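(* Let $K\subset\mathbb{R}^n$ be a convex body in $C^2_+$ such that $0\in\operatorname{int}(K)$. Then $$\lim_{\delta\to0}\ c_n\,\frac{|(K_\delta)^\circ|-|K^\circ|}{\delta^{\frac{2}{n+1}}}=as_{-\frac{n}{n+2}}(K^\circ),$$ where $c_n=2\left(\frac{|B_2^{n-1}|}{n+1}\right)^{\frac{2}{n+1}}$.
   Context: Here $n\ge 2$. A convex body is a compact convex subset of $\mathbb{R}^n$ with nonempty interior. $|\cdot|$ denotes volume (of the appropriate dimension), $\langle\cdot,\cdot\rangle$ the standard inner product, and $B_2^m$ the Euclidean unit ball of $\mathbb{R}^m$. $K\in C^2_+$ means that $\partial K$ is $C^2$ with everywhere strictly positive Gaussian curvature. For a convex body $L$, $N_L(x)$ is the outer unit normal to $\partial L$ at $x$, $\kappa_L(x)$ the Gaussian curvature of $\partial L$ at $x$, and $\mu_L$ the usual surface area measure on $\partial L$. The polar body is $K^\circ=\{y\in\mathbb{R}^n:\langle x,y\rangle\le 1\ \text{for all } x\in K\}$. Convex floating body: $K_\delta$ is the intersection of all half-spaces $H^+$ whose bounding hyperplanes $H$ cut off a set of volume $\delta$ from $K$, i.e. $|K\cap H^-|=\delta$, where $H^+,H^-$ are the two closed half-spaces bounded by $H$. The limit is as $\delta\to0$, $\delta>0$. $L_p$ affine surface area: for a convex body $L$ containing the origin in its interior and real $p\ne-n$, $$as_p(L)=\int_{\partial L}\frac{\kappa_L(x)^{\frac{p}{n+p}}}{\langle x,N_L(x)\rangle^{\frac{n(p-1)}{n+p}}}\,d\mu_L(x),$$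 provided the integral exists. *)

theory Defs
  imports "HOL-Analysis.Analysis"
begin

definition convex_body :: "'a::euclidean_space set \<Rightarrow> bool" where
  "convex_body K \<longleftrightarrow> compact K \<and> convex K \<and> interior K \<noteq> {}"

definition polar_body :: "'a::euclidean_space set \<Rightarrow> 'a set" where
  "polar_body K = {y. \<forall>x\<in>K. x \<bullet> y \<le> 1}"

text \<open>The half-space kept is \<open>{x. u \<bullet> x \<le> a}\<close>; the one cut off is \<open>{x. a \<le> u \<bullet> x}\<close>.
  Since \<open>u\<close> and \<open>- u\<close> both occur, each hyperplane is considered with both choices of the
  side to be cut off.\<close>

definition floating_body :: "'a::euclidean_space set \<Rightarrow> real \<Rightarrow> 'a set" where
  "floating_body K \<delta> =
     \<Inter> {{x. u \<bullet> x \<le> a} | u a. u \<noteq> 0 \<and> measure lebesgue (K \<inter> {x. a \<le> u \<bullet> x}) = \<delta>}"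

text \<open>Some outer unit normal of the convex set \<open>L\<close> at the boundary point \<open>x\<close>; it is unique
  where the boundary is differentiable.\<close>

definition outer_normal :: "'a::euclidean_space set \<Rightarrow> 'a \<Rightarrow> 'a" where
  "outer_normal L x = (SOME u. norm u = 1 \<and> (\<forall>y\<in>L. u \<bullet> (y - x) \<le> 0))"

text \<open>The Gaussian curvature is the determinant of the differential \<open>W\<close> of the Gauss map
  \<open>outer_normal L : frontier L \<rightarrow> S\<^sup>n\<^sup>-\<^sup>1\<close>, as an endomorphism of the tangent space, i.e. of the
  orthogonal complement of the normal \<open>N\<close>. The derivative within the boundary determines \<open>W\<close>
  on tangent vectors only. Hence \<open>W\<close> is precomposed with the tangential projection and the map is
  extended by the identity on the span of \<open>N\<close>, which does not change the determinant. With the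
  outer normal, a sphere of radius \<open>r\<close> has curvature \<open>1 / r ^ (n - 1)\<close>.\<close>

definition gaussian_curvature :: "(real ^ 'n) set \<Rightarrow> real ^ 'n \<Rightarrow> real" where
  "gaussian_curvature L x =
     (let N = outer_normal L x;
          W = frechet_derivative (outer_normal L) (at x within frontier L)
      in det (matrix (\<lambda>v. W (v - (v \<bullet> N) *\<^sub>R N) + (v \<bullet> N) *\<^sub>R N)))"

text \<open>\<open>g\<close> is the gradient and \<open>h\<close> the Hessian of \<open>f\<close>.\<close>

definition C2_on :: "(real ^ 'n) set \<Rightarrow> (real ^ 'n \<Rightarrow> real) \<Rightarrow>
    (real ^ 'n \<Rightarrow> real ^ 'n) \<Rightarrow> (real ^ 'n \<Rightarrow> real ^ 'n ^ 'n) \<Rightarrow> bool" where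
  "C2_on U f g h \<longleftrightarrow>
     (\<forall>y\<in>U. (f has_derivative (\<lambda>v. g y \<bullet> v)) (at y)) \<and>
     (\<forall>y\<in>U. (g has_derivative (\<lambda>v. h y *v v)) (at y)) \<and>
     continuous_on U h"

text \<open>The boundary is a \<open>C\<^sup>2\<close> hypersurface: locally the zero set of a \<open>C\<^sup>2\<close> function with
  nonvanishing gradient.\<close>

definition C2_boundary :: "(real ^ 'n) set \<Rightarrow> bool" where
  "C2_boundary K \<longleftrightarrow>
     (\<forall>x\<in>frontier K. \<exists>U f g h. open U \<and> x \<in> U \<and> C2_on U f g h \<and>
        (\<forall>y\<in>U. g y \<noteq> 0) \<and> frontier K \<inter> U = {y\<in>U. f y = 0})"

definition C2_plus :: "(real ^ 'n) set \<Rightarrow> bool" where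
  "C2_plus K \<longleftrightarrow> C2_boundary K \<and> (\<forall>x\<in>frontier K. 0 < gaussian_curvature K x)"

text \<open>Hausdorff measure of dimension \<open>m \<ge> 1\<close>, normalised so as to agree with Lebesgue measure
  on \<open>m\<close>-dimensional subspaces: \<open>unit_ball_vol m\<close> is the volume of the Euclidean unit ball in
  dimension \<open>m\<close>. The requirement \<open>bounded (C i)\<close> matters because \<open>diameter\<close> is unspecified
  on unbounded sets.\<close>

definition hausdorff_content :: "nat \<Rightarrow> real \<Rightarrow> 'a::metric_space set \<Rightarrow> ennreal" where
  "hausdorff_content m \<epsilon> A =
     (INF C \<in> {C :: nat \<Rightarrow> 'a set. A \<subseteq> (\<Union>i. C i) \<and> (\<forall>i. bounded (C i) \<and> diameter (C i) \<le> \<epsilon>)}.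
        \<Sum>i. ennreal (unit_ball_vol (real m) * (diameter (C i) / 2) ^ m))"

definition hausdorff_outer :: "nat \<Rightarrow> 'a::metric_space set \<Rightarrow> ennreal" where
  "hausdorff_outer m A = (SUP \<epsilon> \<in> {0<..}. hausdorff_content m \<epsilon> A)"

definition hausdorff_measure :: "nat \<Rightarrow> 'a::metric_space measure" where
  "hausdorff_measure m = measure_of UNIV (sets borel) (hausdorff_outer m)"

definition surface_measure :: "'a::euclidean_space set \<Rightarrow> 'a measure" where
  "surface_measure L = restrict_space (hausdorff_measure (DIM('a) - 1)) (frontier L)"

definition Lp_affine_integrand :: "real \<Rightarrow> (real ^ 'n) set \<Rightarrow> real ^ 'n \<Rightarrow> real" where
  "Lp_affine_integrand p L x =
     (let n = real CARD('n)
      in gaussian_curvature L x powr (p / (n + p)) /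
         (x \<bullet> outer_normal L x) powr (n * (p - 1) / (n + p)))"

definition Lp_affine_surface_area :: "real \<Rightarrow> (real ^ 'n) set \<Rightarrow> real" where
  "Lp_affine_surface_area p L = (LINT x|surface_measure L. Lp_affine_integrand p L x)"

definition Lp_affine_surface_area_exists :: "real \<Rightarrow> (real ^ 'n) set \<Rightarrow> bool" where
  "Lp_affine_surface_area_exists p L \<longleftrightarrow>
     integrable (surface_measure L) (Lp_affine_integrand p L)"

definition floating_const :: "nat \<Rightarrow> real" where
  "floating_const n = 2 * (unit_ball_vol (real (n - 1)) / (real n + 1)) powr (2 / (real n + 1))"

end

(* Let K be a convex body with the origin inside, h its support function and h_d that of the floating
   body K_d. The polar of a body is the unit ball of its support function, so homogeneity gives

     |polar (K_d)| - |polar K| = int_{polar K} ((h / h_d)^n - 1)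

   and everything depends on the size of 1 - h_d / h. At a boundary point y of polar K it is governed
   by the volume of the caps of K near the boundary point x with normal y. In coordinates that turn the
   Hessian Q of half the squared gauge at x into the identity, K is squeezed between two balls touching
   at x, hence a cap of relative height s has volume ~ const * det(Q)^(-1/2) * s^((n+1)/2), and
   (1 - h_d(y)) / d^(2/(n+1)) tends to det(Q)^(1/(n+1)) / c_n. A rolling ball gives a uniform bound,
   so dominated convergence applies.

   The limit is an integral against the cone measure of polar K, i.e. against <y, N> times the surface
   measure. By Legendre duality Q is inverse to the corresponding Hessian of polar K, which expresses
   det(Q) by the Gauss curvature of polar K and yields the affine surface area integrand.

   Surface measure is Hausdorff measure. To compare it with Lebesgue measure on tangent hyperplanes one
   needs that in full dimension both agree; that rests on the isodiametric inequality, which follows by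
   Steiner symmetrisation. *)
theory Submission
  imports Defs
begin

text \<open>The two bounds on the floating body are not symmetric. One cap of volume less than
  \<delta> in direction \<open>y\<close> bounds its support function at \<open>y\<close> from above,
  but a point belongs to it only if the caps cut off through that point in all directions have
  volume at least \<delta>. Hence cap volumes are bounded above in a single direction and below in
  every direction at once.

  The curvature is defined by a chosen normal and a chosen derivative within the boundary, so
  neither its value nor its measurability can be read off directly. Everything is therefore
  expressed by \<open>dual_point\<close>, the gradient of the gauge. It is homogeneous of degree 0;
  its uniqueness means smoothness of \<open>K\<close> and, for the polar body, strict convexity of
  \<open>K\<close>. The C2 hypothesis is used only through this uniqueness, the differentiability of
  \<open>dual_point\<close> at boundary points and its Lipschitz continuity along the boundary;
  positive curvature makes the Hessian Q positive definite. Since no second derivatives are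
  available off the boundary point, Taylor expansion and symmetry of the Hessian are proved from
  differentiability of the gradient at one point.\<close>

section \<open>Hausdorff measure\<close>

text \<open>Caratheodory's criterion. To split \<open>X\<close> along a closed set \<open>F\<close>,
  the part outside \<open>F\<close> is exhausted by the layers \<open>Y n\<close> of points at
  distance at least 1/(n+1) from \<open>F\<close>, which are separated from \<open>F\<close>. The
  remainder lies in the shells \<open>R k\<close>. Shells of equal parity are separated from each
  other, so if \<open>S\<close> is finite their measures are summable and the tails vanish.\<close>

lemma metric_outer_measure_borel:
  fixes \<mu> :: "'a::metric_space set \<Rightarrow> ennreal"
  assumes outer: "outer_measure_space (Pow UNIV) \<mu>"
    and sep: "\<And>A B d. 0 < d \<Longrightarrow> (\<And>a b. a \<in> A \<Longrightarrow> b \<in> B \<Longrightarrow> d \<le> dist a b) \<Longrightarrow> \<mu> A + \<mu> B \<le> \<mu> (A \<union> B)"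
  shows "measure_space UNIV (sets borel) \<mu>"
proof -
  have mono: "\<mu> A \<le> \<mu> B" if "A \<subseteq> B" for A B
    using outer that by (auto simp: outer_measure_space_def increasing_def)
  have empty: "\<mu> {} = 0"
    using outer by (auto simp: outer_measure_space_def positive_def)
  have dsub: "\<mu> (\<Union>i. A i) \<le> (\<Sum>i. \<mu> (A i))" if "disjoint_family A" for A :: "nat \<Rightarrow> 'a set"
    using outer that by (auto simp: outer_measure_space_def countably_subadditive_def image_subset_iff)
  \<comment> \<open>Subadditivity of an outer measure is given for disjoint families only;
    \<open>disjointed\<close> removes the restriction.\<close>
  have csub: "\<mu> (\<Union>i. A i) \<le> (\<Sum>i. \<mu> (A i))" for A :: "nat \<Rightarrow> 'a set"
  proof -
    have "\<mu> (\<Union>i. A i) = \<mu> (\<Union>i. disjointed A i)" by (simp add: UN_disjointed_eq)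
    also have "\<dots> \<le> (\<Sum>i. \<mu> (disjointed A i))" by (rule dsub) (rule disjoint_family_disjointed)
    also have "\<dots> \<le> (\<Sum>i. \<mu> (A i))" by (intro suminf_le mono disjointed_subset) auto
    finally show ?thesis .
  qed
  have sub2: "\<mu> (A \<union> B) \<le> \<mu> A + \<mu> B" for A B
  proof -
    have "\<mu> (\<Union>i. binaryset A B i) \<le> (\<Sum>i. \<mu> (binaryset A B i))" by (rule csub)
    also have "\<dots> = \<mu> A + \<mu> B"
      by (rule suminf_binaryset_eq) (rule empty)
    finally show ?thesis by (simp add: UN_binaryset_eq)
  qed
  have closed_in: "F \<in> lambda_system UNIV (Pow UNIV) \<mu>" if F: "closed F" for F
  proof (cases "F = {}")
    case True
    then show ?thesis by (auto simp: lambda_system_def empty)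
  next
    case False
    have "\<mu> (F \<inter> X) + \<mu> ((UNIV - F) \<inter> X) \<le> \<mu> X" for X
    proof -
      define Y where "Y n = {x \<in> X - F. 1 / (real n + 1) \<le> infdist x F}" for n
      define R where "R n = Y (Suc n) - Y n" for n
      define S where "S = (SUP n. \<mu> (Y n))"
      have SX: "\<mu> (F \<inter> X) + S \<le> \<mu> X"
      proof -
        have "\<mu> (F \<inter> X) + \<mu> (Y n) \<le> \<mu> X" for n
        proof -
          have "\<mu> (F \<inter> X) + \<mu> (Y n) \<le> \<mu> ((F \<inter> X) \<union> Y n)"
          proof (rule sep[of "1 / (real n + 1)"])
            fix a b assume "a \<in> F \<inter> X" "b \<in> Y n"
            then show "1 / (real n + 1) \<le> dist a b"
              using infdist_le[of a F b] by (auto simp: Y_def dist_commute)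
          qed auto
          also have "\<dots> \<le> \<mu> X" by (rule mono) (auto simp: Y_def)
          finally show ?thesis .
        qed
        then have "(SUP n. \<mu> (F \<inter> X) + \<mu> (Y n)) \<le> \<mu> X" by (intro SUP_least)
        then show ?thesis unfolding S_def by (simp add: ennreal_SUP_add_right)
      qed
      have YS: "\<mu> (Y n) \<le> S" for n unfolding S_def by (rule SUP_upper) auto
      have Ymono: "Y n \<subseteq> Y k" if "n \<le> k" for n k
      proof -
        have "1 / (real k + 1) \<le> 1 / (real n + 1)" using that by (intro divide_left_mono) auto
        then show ?thesis unfolding Y_def by fastforce
      qed
      \<comment> \<open>For k < N the points of shell 2k+b have distance at least 1/(2N+b) from
        \<open>F\<close>, those of shell 2N+b less than 1/(2N+b+1). The gap \<open>d\<close>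
        separates them.\<close>
      have alt: "(\<Sum>k<N. \<mu> (R (2*k+b))) \<le> \<mu> (\<Union>k<N. R (2*k+b))" for N b
      proof (induction N)
        case 0 then show ?case by (simp add: empty)
      next
        case (Suc N)
        have "(\<Sum>k<Suc N. \<mu> (R (2*k+b))) \<le> \<mu> (\<Union>k<N. R (2*k+b)) + \<mu> (R (2*N+b))"
          using Suc by (simp add: add_mono)
        also have "\<dots> \<le> \<mu> ((\<Union>k<N. R (2*k+b)) \<union> R (2*N+b))"
        proof (cases "N = 0")
          case False
          define d where "d = 1 / real (2*N+b) - 1 / (real (2*N+b) + 1)"
          have "0 < d" using False unfolding d_def
            by (simp add: divide_strict_left_mono)
          then show ?thesis
          proof (rule sep)
            fix a c assume a: "a \<in> (\<Union>k<N. R (2*k+b))" and c: "c \<in> R (2*N+b)"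
            then obtain k where k: "k < N" "a \<in> R (2*k+b)" by auto
            have "1 / real (2*N+b) \<le> 1 / (real (Suc (2*k+b)) + 1)"
              using k by (intro divide_left_mono) auto
            also have "\<dots> \<le> infdist a F" using k by (auto simp: R_def Y_def)
            finally have 1: "1 / real (2*N+b) \<le> infdist a F" .
            have 2: "infdist c F < 1 / (real (2*N+b) + 1)"
              using c unfolding R_def Y_def by auto
            have "infdist a F \<le> infdist c F + dist a c" by (rule infdist_triangle)
            with 1 2 show "d \<le> dist a c" unfolding d_def by linarith
          qed
        qed (simp add: empty)
        also have "\<dots> = \<mu> (\<Union>k<Suc N. R (2*k+b))"
          by (simp add: lessThan_Suc Un_commute)
        finally show ?case .
      qed
      have half: "(\<Sum>k. \<mu> (R (2*k+b))) \<le> S" for b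
      proof (rule suminf_le_const)
        fix N
        have "(\<Sum>k<N. \<mu> (R (2*k+b))) \<le> \<mu> (\<Union>k<N. R (2*k+b))" by (rule alt)
        also have "\<dots> \<le> \<mu> (Y (2*N+b))"
        proof (rule mono, safe)
          fix x k assume "k < N" "x \<in> R (2*k+b)"
          then show "x \<in> Y (2*N+b)" using Ymono[of "Suc (2*k+b)" "2*N+b"] by (auto simp: R_def)
        qed
        also have "\<dots> \<le> S" by (rule YS)
        finally show "(\<Sum>k<N. \<mu> (R (2*k+b))) \<le> S" .
      qed auto
      \<comment> \<open>A point outside the closed set has positive distance, so it lies in some
        layer. The least such layer is either at most \<open>n\<close> or is entered through a
        shell.\<close>
      have YU: "X - F \<subseteq> Y n \<union> (\<Union>k. R (k + n))" for n
      proof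
        fix x assume x: "x \<in> X - F"
        then have "0 < infdist x F"
          using F False in_closed_iff_infdist_zero[of F x] infdist_nonneg[of x F] by (simp add: less_le)
        then obtain j where "1 / (real (Suc j)) < infdist x F" using nat_approx_posE by blast
        then have xj: "x \<in> Y j" using x by (auto simp: Y_def add.commute)
        define i where "i = (LEAST i. x \<in> Y i)"
        have i: "x \<in> Y i" unfolding i_def using xj by (rule LeastI)
        show "x \<in> Y n \<union> (\<Union>k. R (k + n))"
        proof (cases "i \<le> n")
          case True then show ?thesis using Ymono i by auto
        next
          case False
          then obtain k where k: "i = Suc (k + n)" by (metis add.commute less_imp_Suc_add not_le)
          have "x \<notin> Y (k + n)" using not_less_Least[of "k+n" "\<lambda>i. x \<in> Y i"] k unfolding i_def by auto
          then show ?thesis using i k by (auto simp: R_def)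
        qed
      qed
      have "\<mu> (X - F) \<le> S"
      proof (cases "S = top")
        case False
        have fin: "(\<Sum>k. \<mu> (R (2*k+b))) \<noteq> top" for b using half[of b] False by (metis top.extremum_unique)
        have Rfin: "\<mu> (R k) \<noteq> top" for k
        proof -
          have "\<mu> (R k) \<le> S" using mono[of "R k" "Y (Suc k)"] YS[of "Suc k"] by (auto simp: R_def)
          then show ?thesis using False by (metis top.extremum_unique)
        qed
        define r where "r k = enn2real (\<mu> (R k))" for k
        have Rr: "\<mu> (R k) = ennreal (r k)" for k
          using Rfin[of k] by (simp add: r_def ennreal_enn2real_if)
        have rn: "0 \<le> r k" for k by (simp add: r_def)
        have sumb: "summable (\<lambda>k. r (2*k+b))" for b
          by (rule summable_suminf_not_top) (use rn fin[of b] in \<open>auto simp: Rr\<close>)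
        have sumr: "summable r"
        proof (rule bounded_imp_summable[where B="(\<Sum>k. r (2*k+0)) + (\<Sum>k. r (2*k+1))"])
          fix n
          have "sum r {..n} \<le> sum r {..<2*Suc n}" by (rule sum_mono2) (auto simp: rn)
          also have "sum r {..<2*Suc n} = (\<Sum>k<Suc n. r (2*k+0)) + (\<Sum>k<Suc n. r (2*k+1))"
            by (induction n) (auto simp: ac_simps)
          also have "\<dots> \<le> (\<Sum>k. r (2*k+0)) + (\<Sum>k. r (2*k+1))"
            by (intro add_mono sum_le_suminf sumb) (auto simp: rn)
          finally show "sum r {..n} \<le> (\<Sum>k. r (2*k+0)) + (\<Sum>k. r (2*k+1))" .
        qed (rule rn)
        show ?thesis
        proof (rule ennreal_le_epsilon)
          fix e :: real assume e: "0 < e"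
          obtain N where N: "\<And>n. N \<le> n \<Longrightarrow> norm (\<Sum>i. r (i + n)) < e"
            using suminf_exist_split[OF e sumr] by auto
          have "\<mu> (X - F) \<le> \<mu> (Y N \<union> (\<Union>k. R (k + N)))" by (rule mono) (rule YU)
          also have "\<dots> \<le> \<mu> (Y N) + \<mu> (\<Union>k. R (k + N))" by (rule sub2)
          also have "\<dots> \<le> S + (\<Sum>k. \<mu> (R (k + N)))" by (intro add_mono YS csub)
          also have "(\<Sum>k. \<mu> (R (k + N))) = ennreal (\<Sum>k. r (k + N))"
            unfolding Rr by (rule suminf_ennreal2) (use rn sumr in \<open>auto simp: summable_iff_shift\<close>)
          also have "\<dots> \<le> ennreal e" using N[of N] by (intro ennreal_leI) auto
          finally show "\<mu> (X - F) \<le> S + ennreal e" by (simp add: add_mono)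
        qed
      qed auto
      then show ?thesis
        using SX order_trans[OF add_left_mono[of "\<mu> (X - F)" S "\<mu> (F \<inter> X)"]]
        by (metis Diff_Int_distrib2 Int_UNIV_left Int_commute Diff_Int Diff_cancel Un_empty_right)
    qed
    moreover have "\<mu> X \<le> \<mu> (F \<inter> X) + \<mu> ((UNIV - F) \<inter> X)" for X
    proof -
      have "\<mu> X \<le> \<mu> ((F \<inter> X) \<union> ((UNIV - F) \<inter> X))" by (rule mono) auto
      also note sub2
      finally show ?thesis .
    qed
    ultimately show ?thesis unfolding lambda_system_def by (auto intro!: antisym)
  qed
  interpret sigma_algebra "UNIV :: 'a set" "Pow UNIV" by (rule sigma_algebra_Pow)
  have ms: "measure_space UNIV (lambda_system UNIV (Pow UNIV) \<mu>) \<mu>"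
    by (rule caratheodory_lemma[OF outer])
  then have sa: "sigma_algebra UNIV (lambda_system UNIV (Pow UNIV) \<mu>)"
    by (simp add: measure_space_def)
  have "sets (borel :: 'a measure) = sigma_sets UNIV (Collect closed)"
    by (metis borel_eq_closed sets_measure_of top_greatest Pow_UNIV)
  also have "\<dots> \<subseteq> lambda_system UNIV (Pow UNIV) \<mu>"
    by (rule sigma_algebra.sigma_sets_subset[OF sa]) (use closed_in in auto)
  finally show ?thesis
    using measure_down[OF ms] sets.sigma_algebra_axioms[of borel] by auto
qed

lemma hausdorff_content_mono: "A \<subseteq> B \<Longrightarrow> hausdorff_content m e A \<le> hausdorff_content m e B"
  unfolding hausdorff_content_def by (rule INF_superset_mono) auto

lemma hausdorff_content_antimono: "e \<le> e' \<Longrightarrow> hausdorff_content m e' A \<le> hausdorff_content m e A"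
  unfolding hausdorff_content_def by (rule INF_superset_mono) (auto intro: order_trans)

lemma hausdorff_content_le_outer: "0 < e \<Longrightarrow> hausdorff_content m e A \<le> hausdorff_outer m A"
  unfolding hausdorff_outer_def by (rule SUP_upper) auto

lemma hausdorff_content_le:
  assumes "A \<subseteq> (\<Union>i. C i)" "\<And>i. bounded (C i)" "\<And>i. diameter (C i) \<le> e"
  shows "hausdorff_content m e A \<le> (\<Sum>i. ennreal (unit_ball_vol (real m) * (diameter (C i) / 2) ^ m))"
  unfolding hausdorff_content_def by (rule INF_lower) (use assms in auto)

text \<open>Positivity of \<open>m\<close> enters here: since x ^ 0 = 1, for m = 0 even a cover by
  empty sets would have infinite cost.\<close>

lemma hausdorff_content_empty:
  assumes "0 < m" "0 < e"
  shows "hausdorff_content m e ({} :: 'a::metric_space set) = 0"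
proof -
  have "hausdorff_content m e ({} :: 'a set)
      \<le> (\<Sum>i::nat. ennreal (unit_ball_vol (real m) * (diameter ((\<lambda>_. {} :: 'a set) i) / 2) ^ m))"
    by (rule hausdorff_content_le[where C="\<lambda>_. {}"]) (use assms in auto)
  also have "\<dots> = 0" using assms(1) by (simp add: zero_power)
  finally show ?thesis by simp
qed

text \<open>Covers of the \<open>A i\<close> that are optimal up to \<delta> / 2^(i+1) are merged
  into one sequence along \<open>prod_decode\<close>.\<close>

lemma hausdorff_content_subadditive:
  "hausdorff_content m e (\<Union>i. A i) \<le> (\<Sum>i::nat. hausdorff_content m e (A i))"
proof (cases "(\<Sum>i. hausdorff_content m e (A i)) = top")
  case False
  let ?v = "\<lambda>S. ennreal (unit_ball_vol (real m) * (diameter S / 2) ^ m)"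
  show ?thesis
  proof (rule ennreal_le_epsilon)
    fix \<delta> :: real assume d: "0 < \<delta>"
    have "\<exists>C. A i \<subseteq> (\<Union>k. C k) \<and> (\<forall>k. bounded (C k) \<and> diameter (C k) \<le> e) \<and>
        (\<Sum>k. ?v (C k)) \<le> hausdorff_content m e (A i) + ennreal (\<delta> * (1/2)^Suc i)" for i
    proof -
      have "hausdorff_content m e (A i) \<noteq> top"
        using False ennreal_suminf_lessD[of "\<lambda>i. hausdorff_content m e (A i)" top i] by (auto simp: less_top)
      then have "hausdorff_content m e (A i) < hausdorff_content m e (A i) + ennreal (\<delta> * (1/2)^Suc i)"
        using d by (simp add: ennreal_add_left_cancel_less less_top)
      then show ?thesis unfolding hausdorff_content_def INF_less_iff by (auto intro: less_imp_le)
    qed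
    then obtain C where C: "\<And>i. A i \<subseteq> (\<Union>k. C i k)" "\<And>i k. bounded (C i k)" "\<And>i k. diameter (C i k) \<le> e"
        and Cs: "\<And>i. (\<Sum>k. ?v (C i k)) \<le> hausdorff_content m e (A i) + ennreal (\<delta> * (1/2)^Suc i)" by metis
    define D where "D p = (case prod_decode p of (i, k) \<Rightarrow> C i k)" for p
    have "hausdorff_content m e (\<Union>i. A i) \<le> (\<Sum>p. ?v (D p))"
    proof (rule hausdorff_content_le)
      show "(\<Union>i. A i) \<subseteq> (\<Union>p. D p)"
      proof safe
        fix x i assume "x \<in> A i"
        then obtain k where "x \<in> C i k" using C by blast
        then have "x \<in> D (prod_encode (i, k))" by (simp add: D_def)
        then show "x \<in> (\<Union>p. D p)" by blast
      qed
    qed (auto simp: D_def C split: prod.split)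
    also have "(\<Sum>p. ?v (D p)) = (\<Sum>p. (\<lambda>(i,k). ?v (C i k)) (prod_decode p))"
      by (simp add: D_def split_beta)
    also have "\<dots> = (\<Sum>i. \<Sum>k. ?v (C i k))"
      by (rule suminf_ennreal_2dimen) simp
    also have "\<dots> \<le> (\<Sum>i. hausdorff_content m e (A i) + ennreal (\<delta> * (1/2)^Suc i))"
      by (intro suminf_le Cs) auto
    also have "\<dots> = (\<Sum>i. hausdorff_content m e (A i)) + (\<Sum>i. ennreal (\<delta> * (1/2)^Suc i))"
      by (rule suminf_add[symmetric]) auto
    also have "(\<Sum>i. ennreal (\<delta> * (1/2)^Suc i)) = ennreal \<delta>"
      using sums_mult[OF power_half_series, of \<delta>] d by (intro suminf_ennreal_eq) auto
    finally show "hausdorff_content m e (\<Union>i. A i) \<le> (\<Sum>i. hausdorff_content m e (A i)) + ennreal \<delta>" .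
  qed
qed auto

text \<open>A covering set of diameter at most \<open>e\<close> cannot meet both \<open>A\<close>
  and \<open>B\<close>. Hence every cover of the union splits into a cover of \<open>A\<close> and
  one of \<open>B\<close>, with the empty set, which costs nothing for positive \<open>m\<close>, in
  place of the sets that miss the part in question.\<close>

lemma hausdorff_content_separated:
  assumes m: "0 < m" and sep: "\<And>a b. a \<in> A \<Longrightarrow> b \<in> B \<Longrightarrow> e < dist a b"
  shows "hausdorff_content m e A + hausdorff_content m e B \<le> hausdorff_content m e (A \<union> B)"
proof -
  let ?v = "\<lambda>S. ennreal (unit_ball_vol (real m) * (diameter S / 2) ^ m)"
  have "hausdorff_content m e A + hausdorff_content m e B \<le> (\<Sum>i. ?v (C i))"
    if C: "A \<union> B \<subseteq> (\<Union>i. C i)" "\<And>i. bounded (C i)" "\<And>i. diameter (C i) \<le> e" for C :: "nat \<Rightarrow> 'a set"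
  proof -
    define P where "P S i = (if C i \<inter> S \<noteq> {} then C i else {})" for S i
    have e: "0 \<le> e" using C(2,3)[of 0] diameter_ge_0[of "C 0"] by linarith
    have le: "hausdorff_content m e S \<le> (\<Sum>i. ?v (P S i))" if "S \<subseteq> (\<Union>i. C i)" for S
      by (rule hausdorff_content_le) (use that C e in \<open>auto simp: P_def, blast\<close>)
    have "hausdorff_content m e A + hausdorff_content m e B \<le> (\<Sum>i. ?v (P A i)) + (\<Sum>i. ?v (P B i))"
      by (intro add_mono le) (use C in auto)
    also have "\<dots> = (\<Sum>i. ?v (P A i) + ?v (P B i))" by (rule suminf_add) auto
    also have "\<dots> \<le> (\<Sum>i. ?v (C i))"
    proof (intro suminf_le)
      fix i
      have "\<not> (C i \<inter> A \<noteq> {} \<and> C i \<inter> B \<noteq> {})"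
      proof
        assume "C i \<inter> A \<noteq> {} \<and> C i \<inter> B \<noteq> {}"
        then obtain a b where "a \<in> C i" "a \<in> A" "b \<in> C i" "b \<in> B" by blast
        then show False using sep[of a b] diameter_bounded_bound[OF C(2), of a i b] C(3)[of i] by auto
      qed
      then show "?v (P A i) + ?v (P B i) \<le> ?v (C i)" using m by (auto simp: P_def zero_power)
    qed auto
    finally show ?thesis .
  qed
  then show ?thesis unfolding hausdorff_content_def[of m e "A \<union> B"] by (intro INF_greatest) auto
qed

lemma hausdorff_outer_le:
  assumes "\<And>e. 0 < e \<Longrightarrow> hausdorff_content m e A \<le> c"
  shows "hausdorff_outer m A \<le> c"
  unfolding hausdorff_outer_def by (rule SUP_least) (use assms in auto)

lemma hausdorff_outer_mono:
  assumes "A \<subseteq> B"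
  shows "hausdorff_outer m A \<le> hausdorff_outer m B"
proof (rule hausdorff_outer_le)
  fix e :: real assume e: "0 < e"
  have "hausdorff_content m e A \<le> hausdorff_content m e B" by (rule hausdorff_content_mono[OF assms])
  also have "\<dots> \<le> hausdorff_outer m B" by (rule hausdorff_content_le_outer[OF e])
  finally show "hausdorff_content m e A \<le> hausdorff_outer m B" .
qed

lemma outer_measure_space_hausdorff:
  assumes "0 < m" shows "outer_measure_space (Pow UNIV) (hausdorff_outer m :: 'a::metric_space set \<Rightarrow> ennreal)"
proof -
  have "hausdorff_outer m ({}::'a set) = 0"
  proof -
    have "hausdorff_outer m ({}::'a set) \<le> 0"
      by (rule hausdorff_outer_le) (simp add: hausdorff_content_empty[OF assms])
    then show ?thesis by simp
  qed
  moreover have "hausdorff_outer m (\<Union>i. A i) \<le> (\<Sum>i. hausdorff_outer m (A i))" for A :: "nat \<Rightarrow> 'a set"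
  proof (rule hausdorff_outer_le)
    fix e :: real assume "0 < e"
    have "hausdorff_content m e (\<Union>i. A i) \<le> (\<Sum>i. hausdorff_content m e (A i))" by (rule hausdorff_content_subadditive)
    also have "\<dots> \<le> (\<Sum>i. hausdorff_outer m (A i))" by (intro suminf_le hausdorff_content_le_outer \<open>0 < e\<close>) auto
    finally show "hausdorff_content m e (\<Union>i. A i) \<le> (\<Sum>i. hausdorff_outer m (A i))" .
  qed
  ultimately show ?thesis
    by (auto simp: outer_measure_space_def positive_def increasing_def countably_subadditive_def
        intro: hausdorff_outer_mono)
qed

text \<open>Contents at two scales only grow when both are passed to a common scale below
  \<open>d\<close>, where they add up. The suprema over the two scales are then taken one after the
  other.\<close>

lemma hausdorff_outer_separated:
  assumes m: "0 < m" and d: "0 < d" and sep: "\<And>a b. a \<in> A \<Longrightarrow> b \<in> B \<Longrightarrow> d \<le> dist a b"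
  shows "hausdorff_outer m A + hausdorff_outer m B \<le> hausdorff_outer m (A \<union> B)"
proof -
  have *: "hausdorff_content m e1 A + hausdorff_content m e2 B \<le> hausdorff_outer m (A \<union> B)"
    if "0 < e1" "0 < e2" for e1 e2
  proof -
    define e where "e = min (min e1 e2) (d/2)"
    have "hausdorff_content m e1 A + hausdorff_content m e2 B \<le> hausdorff_content m e A + hausdorff_content m e B"
      by (intro add_mono hausdorff_content_antimono) (auto simp: e_def)
    also have "\<dots> \<le> hausdorff_content m e (A \<union> B)"
      by (rule hausdorff_content_separated[OF m]) (use sep d in \<open>force simp: e_def min_def\<close>)
    also have "\<dots> \<le> hausdorff_outer m (A \<union> B)"
      by (rule hausdorff_content_le_outer) (use that d in \<open>auto simp: e_def\<close>)
    finally show ?thesis .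
  qed
  have "hausdorff_outer m A + hausdorff_content m e2 B \<le> hausdorff_outer m (A \<union> B)" if "0 < e2" for e2
  proof -
    have "hausdorff_outer m A + hausdorff_content m e2 B = (SUP e1\<in>{0<..}. hausdorff_content m e1 A + hausdorff_content m e2 B)"
      unfolding hausdorff_outer_def by (rule ennreal_SUP_add_left[symmetric]) auto
    also have "\<dots> \<le> hausdorff_outer m (A \<union> B)" by (rule SUP_least) (use * that in auto)
    finally show ?thesis .
  qed
  note ** = this
  have "hausdorff_outer m A + hausdorff_outer m B = (SUP e2\<in>{0<..}. hausdorff_outer m A + hausdorff_content m e2 B)"
    unfolding hausdorff_outer_def[of m B] by (subst ennreal_SUP_add_right) auto
  also have "\<dots> \<le> hausdorff_outer m (A \<union> B)" by (rule SUP_least) (use ** in auto)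
  finally show ?thesis .
qed

lemma emeasure_hausdorff_measure:
  assumes "0 < m" "A \<in> sets borel"
  shows "emeasure (hausdorff_measure m) A = hausdorff_outer m A"
proof -
  have "measure_space UNIV (sets borel) (hausdorff_outer m :: 'a set \<Rightarrow> ennreal)"
    using outer_measure_space_hausdorff[OF assms(1)] hausdorff_outer_separated[OF assms(1)]
    by (rule metric_outer_measure_borel)
  then show ?thesis
    unfolding hausdorff_measure_def using assms
    by (intro emeasure_measure_of_sigma) (auto simp: measure_space_def)
qed

lemma sets_hausdorff_measure [simp, measurable_cong]: "sets (hausdorff_measure m) = sets borel"
  unfolding hausdorff_measure_def using sets.sigma_sets_eq[of borel] by (simp add: sets_measure_of)

lemma space_hausdorff_measure [simp]: "space (hausdorff_measure m) = UNIV"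
  unfolding hausdorff_measure_def by (simp add: space_measure_of)

text \<open>Covering sets are intersected with \<open>A\<close> before they are mapped, because
  \<open>f\<close> is Lipschitz on \<open>A\<close> only. Covers at scale e / L turn into covers at
  scale e.\<close>

lemma hausdorff_outer_lipschitz_image:
  assumes m: "0 < m" and L: "0 < L"
    and lip: "\<And>x y. x \<in> A \<Longrightarrow> y \<in> A \<Longrightarrow> dist (f x) (f y) \<le> L * dist x y"
  shows "hausdorff_outer m (f ` A) \<le> ennreal (L ^ m) * hausdorff_outer m A"
proof (rule hausdorff_outer_le)
  fix e :: real assume e: "0 < e"
  let ?v = "\<lambda>S. ennreal (unit_ball_vol (real m) * (diameter S / 2) ^ m)"
  have "hausdorff_content m e (f ` A) \<le> ennreal (L ^ m) * (\<Sum>i. ?v (C i))"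
    if C: "A \<subseteq> (\<Union>i. C i)" "\<And>i. bounded (C i)" "\<And>i. diameter (C i) \<le> e / L" for C :: "nat \<Rightarrow> _ set"
  proof -
    define D where "D i = f ` (C i \<inter> A)" for i
    have dist: "dist u v \<le> L * diameter (C i)" if uv: "u \<in> D i" "v \<in> D i" for i u v
    proof -
      obtain x where x: "x \<in> C i \<inter> A" "u = f x" using uv unfolding D_def by blast
      obtain y where "y \<in> C i \<inter> A" "v = f y" using uv unfolding D_def by blast
      note xy = x this
      have "dist (f x) (f y) \<le> L * dist x y" using lip xy by auto
      also have "\<dots> \<le> L * diameter (C i)" using L xy C(2) by (intro mult_left_mono diameter_bounded_bound) auto
      finally show ?thesis using xy by simp
    qed
    have bd: "bounded (D i)" for i
      unfolding bounded_def using dist[of _ i] by (cases "D i = {}") blast+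
    have diam: "diameter (D i) \<le> L * diameter (C i)" for i
      unfolding diameter_def[of "D i"] using dist L diameter_ge_0[OF C(2)[of i]]
      by (auto intro!: cSUP_least)
    have "hausdorff_content m e (f ` A) \<le> (\<Sum>i. ?v (D i))"
    proof (rule hausdorff_content_le)
      show "f ` A \<subseteq> (\<Union>i. D i)" using C(1) by (fastforce simp: D_def)
      show "diameter (D i) \<le> e" for i
        using diam[of i] C(3)[of i] L by (auto simp: field_simps intro: order_trans)
    qed (rule bd)
    also have "\<dots> \<le> (\<Sum>i. ennreal (L ^ m) * ?v (C i))"
    proof (intro suminf_le)
      fix i
      have "(diameter (D i) / 2) ^ m \<le> (L * (diameter (C i) / 2)) ^ m"
        using diam[of i] diameter_ge_0[OF bd[of i]] by (intro power_mono) auto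
      also have "\<dots> = L ^ m * (diameter (C i) / 2) ^ m" by (rule power_mult_distrib)
      finally have "unit_ball_vol (real m) * (diameter (D i) / 2) ^ m
         \<le> unit_ball_vol (real m) * (L ^ m * (diameter (C i) / 2) ^ m)" by (intro mult_left_mono) auto
      then show "?v (D i) \<le> ennreal (L ^ m) * ?v (C i)"
        using L by (subst ennreal_mult[symmetric]) (auto simp: mult_ac diameter_ge_0[OF C(2)[of i]] intro!: ennreal_leI)
    qed auto
    also have "\<dots> = ennreal (L ^ m) * (\<Sum>i. ?v (C i))" by simp
    finally show ?thesis .
  qed
  note step = this
  \<comment> \<open>The constant is carried across the infimum over covers by multiplying with its
    inverse first.\<close>
  have inv: "ennreal (1 / L ^ m) * (ennreal (L ^ m) * z) = z" "ennreal (L ^ m) * (ennreal (1 / L ^ m) * z) = z" for z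
    using L by (simp_all add: mult.assoc[symmetric] ennreal_mult[symmetric])
  have "ennreal (1 / L ^ m) * hausdorff_content m e (f ` A) \<le> hausdorff_content m (e / L) A"
    unfolding hausdorff_content_def[of m "e / L"]
  proof (rule INF_greatest)
    fix C :: "nat \<Rightarrow> _ set" assume "C \<in> {C. A \<subseteq> (\<Union>i. C i) \<and> (\<forall>i. bounded (C i) \<and> diameter (C i) \<le> e / L)}"
    then have "hausdorff_content m e (f ` A) \<le> ennreal (L ^ m) * (\<Sum>i. ?v (C i))"
      by (intro step) auto
    from mult_left_mono[OF this, of "ennreal (1 / L ^ m)"]
    show "ennreal (1 / L ^ m) * hausdorff_content m e (f ` A) \<le> (\<Sum>i. ?v (C i))"
      by (simp add: inv)
  qed
  from mult_left_mono[OF this, of "ennreal (L ^ m)"]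
  have "hausdorff_content m e (f ` A) \<le> ennreal (L ^ m) * hausdorff_content m (e / L) A"
    by (simp add: inv)
  also have "\<dots> \<le> ennreal (L ^ m) * hausdorff_outer m A"
    using e L by (intro mult_left_mono hausdorff_content_le_outer) auto
  finally show "hausdorff_content m e (f ` A) \<le> ennreal (L ^ m) * hausdorff_outer m A" .
qed

subsection \<open>Steiner symmetrisation and the isodiametric inequality\<close>

text \<open>Length of the part of \<open>A\<close> on the line through \<open>x\<close> in direction
  \<open>i\<close> (for a unit vector). It is defined at every point and constant along these lines,
  so no separate space for the orthogonal hyperplane is needed.\<close>

definition line_measure :: "'a::euclidean_space \<Rightarrow> 'a set \<Rightarrow> 'a \<Rightarrow> ennreal" where
  "line_measure i A x = emeasure lborel {s::real. x - s *\<^sub>R i \<in> A}"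

text \<open>For a basis vector \<open>i\<close>, a slice of finite length is replaced by the open
  segment of the same length centred on the hyperplane orthogonal to \<open>i\<close>.\<close>

definition steiner :: "'a::euclidean_space \<Rightarrow> 'a set \<Rightarrow> 'a set" where
  "steiner i A = {x. ennreal (2 * \<bar>x \<bullet> i\<bar>) < line_measure i A x}"

definition coord_reflect :: "'a::euclidean_space \<Rightarrow> 'a \<Rightarrow> 'a" where
  "coord_reflect j x = x - (2 * (x \<bullet> j)) *\<^sub>R j"

lemma line_measure_nn_integral:
  assumes "A \<in> sets borel"
  shows "line_measure i A x = (\<integral>\<^sup>+s. indicator A (x - s *\<^sub>R i) \<partial>lborel)"
proof -
  have "{s::real. x - s *\<^sub>R i \<in> A} = (\<lambda>s. x - s *\<^sub>R i) -` A \<inter> space borel" by auto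
  also have "\<dots> \<in> sets borel" by (rule measurable_sets[OF _ assms]) measurable
  finally have "{s::real. x - s *\<^sub>R i \<in> A} \<in> sets lborel" by simp
  then have "line_measure i A x = (\<integral>\<^sup>+s. indicator {s::real. x - s *\<^sub>R i \<in> A} s \<partial>lborel)"
    unfolding line_measure_def by simp
  also have "\<dots> = (\<integral>\<^sup>+s. indicator A (x - s *\<^sub>R i) \<partial>lborel)"
    by (intro nn_integral_cong) (auto simp: indicator_def)
  finally show ?thesis .
qed

lemma measurable_line_measure [measurable]:
  assumes [measurable]: "A \<in> sets borel"
  shows "line_measure i A \<in> borel_measurable borel"
proof -
  have "(\<lambda>x. \<integral>\<^sup>+s. indicator A (x - s *\<^sub>R i) \<partial>lborel) \<in> borel_measurable borel" by measurable
  then show ?thesis by (simp add: line_measure_nn_integral[OF assms] fun_eq_iff[symmetric] cong: measurable_cong)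
qed

lemma nn_integral_lborel_translate:
  fixes f :: "'a::euclidean_space \<Rightarrow> ennreal"
  assumes [measurable]: "f \<in> borel_measurable borel"
  shows "(\<integral>\<^sup>+x. f (c + x) \<partial>lborel) = (\<integral>\<^sup>+x. f x \<partial>lborel)"
proof -
  have "(\<integral>\<^sup>+x. f x \<partial>lborel) = (\<integral>\<^sup>+x. f x \<partial>distr lborel borel ((+) c))" by (simp add: lborel_distr_plus)
  also have "\<dots> = (\<integral>\<^sup>+x. f (c + x) \<partial>lborel)" by (subst nn_integral_distr) auto
  finally show ?thesis by simp
qed

text \<open>Fubini without splitting off a coordinate. Each point of \<open>A\<close> is weighted by
  the set of shifts \<open>s\<close> that bring its coordinate into the unit interval; this set has
  length 1. Exchanging the integrals and translating by \<open>s\<close> produces the slice lengths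
  over a slab of width 1.\<close>

lemma emeasure_eq_integral_line_measure:
  fixes i :: "'a::euclidean_space"
  assumes i: "i \<in> Basis" and [measurable]: "A \<in> sets borel"
  shows "emeasure lborel A = (\<integral>\<^sup>+x. indicator {0..1} (x \<bullet> i) * line_measure i A x \<partial>lborel)"
proof -
  have unit: "(\<integral>\<^sup>+s. indicator {0..1} (c + s) \<partial>lborel) = 1" for c :: real
    by (subst nn_integral_lborel_translate) auto
  have "emeasure lborel A = (\<integral>\<^sup>+x. indicator A x \<partial>lborel)" by simp
  also have "\<dots> = (\<integral>\<^sup>+x. (\<integral>\<^sup>+s. indicator A x * indicator {0..1} (x \<bullet> i + s) \<partial>lborel) \<partial>lborel)"
    by (simp add: nn_integral_cmult unit)
  also have "\<dots> = (\<integral>\<^sup>+s. (\<integral>\<^sup>+x. indicator A x * indicator {0..1} (x \<bullet> i + s) \<partial>lborel) \<partial>lborel)"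
    by (rule lborel_pair.Fubini'[symmetric]) measurable
  also have "\<dots> = (\<integral>\<^sup>+s. (\<integral>\<^sup>+x. indicator A (x - s *\<^sub>R i) * indicator {0..1} (x \<bullet> i) \<partial>lborel) \<partial>lborel)"
  proof (rule nn_integral_cong)
    fix s :: real
    have "(\<integral>\<^sup>+x. indicator A x * indicator {0..1} (x \<bullet> i + s) \<partial>lborel) =
      (\<integral>\<^sup>+x. indicator A ((-s *\<^sub>R i) + x) * indicator {0..1} (((-s *\<^sub>R i) + x) \<bullet> i + s) \<partial>lborel)"
      by (rule nn_integral_lborel_translate[symmetric]) measurable
    also have "\<dots> = (\<integral>\<^sup>+x. indicator A (x - s *\<^sub>R i) * indicator {0..1} (x \<bullet> i) \<partial>lborel)"
      using i by (simp add: inner_diff_left)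
    finally show "(\<integral>\<^sup>+x. indicator A x * indicator {0..1} (x \<bullet> i + s) \<partial>lborel) =
       (\<integral>\<^sup>+x. indicator A (x - s *\<^sub>R i) * indicator {0..1} (x \<bullet> i) \<partial>lborel)" .
  qed
  also have "\<dots> = (\<integral>\<^sup>+x. (\<integral>\<^sup>+s. indicator A (x - s *\<^sub>R i) * indicator {0..1} (x \<bullet> i) \<partial>lborel) \<partial>lborel)"
    by (rule lborel_pair.Fubini') measurable
  also have "\<dots> = (\<integral>\<^sup>+x. indicator {0..1} (x \<bullet> i) * line_measure i A x \<partial>lborel)"
    by (simp add: nn_integral_multc line_measure_nn_integral mult.commute)
  finally show ?thesis .
qed

lemma line_measure_shift:
  fixes i :: "'a::euclidean_space"
  assumes [measurable]: "A \<in> sets borel"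
  shows "line_measure i A (x - s *\<^sub>R i) = line_measure i A x"
proof -
  have "line_measure i A (x - s *\<^sub>R i) = (\<integral>\<^sup>+r. indicator A (x - (s + r) *\<^sub>R i) \<partial>lborel)"
    by (subst line_measure_nn_integral) (auto simp: algebra_simps)
  also have "\<dots> = (\<integral>\<^sup>+r. indicator A (x - r *\<^sub>R i) \<partial>lborel)"
    by (rule nn_integral_lborel_translate) measurable
  finally show ?thesis by (simp add: line_measure_nn_integral)
qed

lemma steiner_measurable [measurable]:
  assumes A: "A \<in> sets borel"
  shows "steiner i A \<in> sets borel"
proof -
  have "(\<lambda>x. ennreal (2 * \<bar>x \<bullet> i\<bar>)) \<in> borel_measurable borel" by measurable
  from borel_measurable_less[OF this measurable_line_measure[OF A, of i]]
  show ?thesis by (simp add: steiner_def)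
qed

context
  fixes A :: "'a::euclidean_space set" and i :: 'a and d :: real
  assumes A [measurable]: "A \<in> sets borel" and i: "i \<in> Basis"
    and d: "\<And>x y. x \<in> A \<Longrightarrow> y \<in> A \<Longrightarrow> dist x y \<le> d"
begin

lemma line_bounded:
  assumes "s \<in> {s. x - s *\<^sub>R i \<in> A}" "t \<in> {s. x - s *\<^sub>R i \<in> A}" shows "\<bar>s - t\<bar> \<le> d"
proof -
  have "dist (x - s *\<^sub>R i) (x - t *\<^sub>R i) = \<bar>t - s\<bar>"
    using i by (simp add: dist_norm flip: scaleR_diff_left)
  then show ?thesis using d[of "x - s *\<^sub>R i" "x - t *\<^sub>R i"] assms by auto
qed

lemma line_measure_le_width:
  assumes "{s. x - s *\<^sub>R i \<in> A} \<noteq> {}"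
  shows "bdd_below {s. x - s *\<^sub>R i \<in> A}" "bdd_above {s. x - s *\<^sub>R i \<in> A}"
    "line_measure i A x \<le> ennreal (Sup {s. x - s *\<^sub>R i \<in> A} - Inf {s. x - s *\<^sub>R i \<in> A})"
proof -
  let ?X = "{s. x - s *\<^sub>R i \<in> A}"
  obtain s0 where s0: "s0 \<in> ?X" using assms by auto
  show bd: "bdd_below ?X" "bdd_above ?X"
    using line_bounded[OF _ s0] by (auto intro!: bdd_belowI[of _ "s0 - d"] bdd_aboveI[of _ "s0 + d"] simp: abs_le_iff)
      (smt (verit, best))+
  have "line_measure i A x \<le> emeasure lborel {Inf ?X..Sup ?X}"
    unfolding line_measure_def
    by (intro emeasure_mono) (auto intro!: cInf_lower cSup_upper bd)
  also have "\<dots> = ennreal (Sup ?X - Inf ?X)"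
    using cInf_le_cSup[OF assms bd(2,1)] by simp
  finally show "line_measure i A x \<le> ennreal (Sup ?X - Inf ?X)" .
qed

lemma line_measure_steiner: "line_measure i (steiner i A) x = line_measure i A x"
proof -
  have fin: "line_measure i A x \<noteq> top"
  proof (cases "{s. x - s *\<^sub>R i \<in> A} = {}")
    case True then show ?thesis by (simp add: line_measure_def)
  next
    case False
    then show ?thesis using line_measure_le_width(3)[OF False] by (auto simp: top_unique)
  qed
  then obtain F where F: "line_measure i A x = ennreal F" "0 \<le> F" by (cases "line_measure i A x") auto
  have "{s. x - s *\<^sub>R i \<in> steiner i A} = {s. 2 * \<bar>x \<bullet> i - s\<bar> < F}"
    unfolding steiner_def using i F by (auto simp: line_measure_shift inner_diff_left ennreal_less_iff)
  also have "\<dots> = ball (x \<bullet> i) (F / 2)" by (auto simp: dist_real_def)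
  finally have "line_measure i (steiner i A) x = emeasure lborel (ball (x \<bullet> i) (F / 2))"
    by (simp add: line_measure_def)
  also have "\<dots> = ennreal F" using F by (simp add: ball_eq_greaterThanLessThan)
  finally show ?thesis using F by simp
qed

lemma emeasure_steiner: "emeasure lborel (steiner i A) = emeasure lborel A"
  using emeasure_eq_integral_line_measure[OF i A] emeasure_eq_integral_line_measure[OF i steiner_measurable[OF A]]
  by (simp add: line_measure_steiner)

text \<open>The length of a slice is at most its width Sup - Inf. If all pairs of points from the
  two original slices were closer along \<open>i\<close> than \<open>c\<close>, the two widths
  together would be at most 2c, whereas the symmetrised points force them to exceed 2c. So some pair
  of original points is at least as far apart along \<open>i\<close> as \<open>x\<close> and
  \<open>y\<close> are.\<close>

lemma dist_steiner:
  assumes x: "x \<in> steiner i A" and y: "y \<in> steiner i A" shows "dist x y \<le> d"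
proof -
  let ?X = "{s. x - s *\<^sub>R i \<in> A}" and ?Y = "{s. y - s *\<^sub>R i \<in> A}"
  define c where "c = \<bar>x \<bullet> i\<bar> + \<bar>y \<bullet> i\<bar>"
  have ne': "{s. z - s *\<^sub>R i \<in> A} \<noteq> {}" if z: "z \<in> steiner i A" for z
  proof
    assume "{s. z - s *\<^sub>R i \<in> A} = {}"
    then have "line_measure i A z = 0" unfolding line_measure_def by (simp only: emeasure_empty)
    then show False using z by (simp add: steiner_def)
  qed
  note ne = ne'[OF x] ne'[OF y]
  have wx: "2 * \<bar>x \<bullet> i\<bar> < Sup ?X - Inf ?X" and wy: "2 * \<bar>y \<bullet> i\<bar> < Sup ?Y - Inf ?Y"
    using order_less_le_trans[OF _ line_measure_le_width(3)[OF ne(1)], of "ennreal (2 * \<bar>x \<bullet> i\<bar>)"]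
      order_less_le_trans[OF _ line_measure_le_width(3)[OF ne(2)], of "ennreal (2 * \<bar>y \<bullet> i\<bar>)"] x y
    by (auto simp: steiner_def ennreal_less_iff)
  have "\<exists>s\<in>?X. \<exists>r\<in>?Y. c \<le> \<bar>(x \<bullet> i - s) - (y \<bullet> i - r)\<bar>"
  proof (rule ccontr)
    assume neg: "\<not> ?thesis"
    have lt: "\<bar>(x \<bullet> i - s) - (y \<bullet> i - r)\<bar> < c" if "s \<in> ?X" "r \<in> ?Y" for s r
      using neg that by fastforce
    have "Sup ?Y \<le> Inf ?X + (c - x \<bullet> i + y \<bullet> i)"
    proof (rule cSup_least[OF ne(2)])
      fix r assume r: "r \<in> ?Y"
      have "r - (c - x \<bullet> i + y \<bullet> i) \<le> Inf ?X"
      proof (rule cInf_greatest[OF ne(1)])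
        fix s assume "s \<in> ?X"
        from lt[OF this r] show "r - (c - x \<bullet> i + y \<bullet> i) \<le> s" by linarith
      qed
      then show "r \<le> Inf ?X + (c - x \<bullet> i + y \<bullet> i)" by linarith
    qed
    moreover have "Sup ?X \<le> Inf ?Y + (c + x \<bullet> i - y \<bullet> i)"
    proof (rule cSup_least[OF ne(1)])
      fix r assume r: "r \<in> ?X"
      have "r - (c + x \<bullet> i - y \<bullet> i) \<le> Inf ?Y"
      proof (rule cInf_greatest[OF ne(2)])
        fix s assume "s \<in> ?Y"
        from lt[OF r this] show "r - (c + x \<bullet> i - y \<bullet> i) \<le> s" by linarith
      qed
      then show "r \<le> Inf ?Y + (c + x \<bullet> i - y \<bullet> i)" by linarith
    qed
    ultimately show False using wx wy unfolding c_def by linarith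
  qed
  then obtain s r where s: "x - s *\<^sub>R i \<in> A" and r: "y - r *\<^sub>R i \<in> A"
    and c: "c \<le> \<bar>(x \<bullet> i - s) - (y \<bullet> i - r)\<bar>" by auto
  have ii: "i \<bullet> i = 1" using i by simp
  have pyth: "(norm (z - t *\<^sub>R i))\<^sup>2 = (norm z)\<^sup>2 - (z \<bullet> i)\<^sup>2 + (z \<bullet> i - t)\<^sup>2" for z t
    unfolding power2_norm_eq_inner using ii
    by (simp add: inner_diff_left inner_diff_right inner_commute power2_eq_square algebra_simps)
  \<comment> \<open>Returning to the original points changes only the component of x - y along
    \<open>i\<close> and does not shrink it, so by Pythagoras the distance does not shrink.\<close>
  have "\<bar>(x - y) \<bullet> i\<bar> \<le> \<bar>(x - y) \<bullet> i - (s - r)\<bar>"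
    using c unfolding c_def inner_diff_left by linarith
  then have "((x - y) \<bullet> i)\<^sup>2 \<le> ((x - y) \<bullet> i - (s - r))\<^sup>2" by (simp add: abs_le_square_iff)
  then have "(norm (x - y))\<^sup>2 \<le> (norm ((x - y) - (s - r) *\<^sub>R i))\<^sup>2" unfolding pyth by linarith
  then have "norm (x - y) \<le> norm ((x - y) - (s - r) *\<^sub>R i)" by simp
  also have "\<dots> = dist (x - s *\<^sub>R i) (y - r *\<^sub>R i)" by (simp add: dist_norm algebra_simps)
  also have "\<dots> \<le> d" by (rule d[OF s r])
  finally show ?thesis by (simp add: dist_norm)
qed

lemma coord_reflect_steiner_same: "x \<in> steiner i A \<Longrightarrow> coord_reflect i x \<in> steiner i A"
  using i by (simp add: steiner_def coord_reflect_def line_measure_shift inner_diff_left)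

text \<open>Reflection in another basis vector carries lines in direction \<open>i\<close> to such
  lines and preserves the centring, so symmetries obtained by earlier symmetrisations
  survive.\<close>

lemma coord_reflect_steiner:
  assumes j: "j \<in> Basis" and inv: "\<And>x. x \<in> A \<Longrightarrow> coord_reflect j x \<in> A" and x: "x \<in> steiner i A"
  shows "coord_reflect j x \<in> steiner i A"
proof (cases "j = i")
  case True then show ?thesis using coord_reflect_steiner_same x by simp
next
  case False
  then have ij: "i \<bullet> j = 0" "j \<bullet> i = 0" using i j by (auto simp: inner_Basis)
  have invol: "coord_reflect j (coord_reflect j z) = z" for z
    using j by (simp add: coord_reflect_def inner_diff_left algebra_simps)
  have iff: "coord_reflect j z \<in> A \<longleftrightarrow> z \<in> A" for z
    using inv[of z] inv[of "coord_reflect j z"] invol by auto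
  have "coord_reflect j x - s *\<^sub>R i = coord_reflect j (x - s *\<^sub>R i)" for s
    using ij by (simp add: coord_reflect_def inner_diff_left)
  then have "line_measure i A (coord_reflect j x) = line_measure i A x"
    by (simp add: line_measure_def iff)
  moreover have "coord_reflect j x \<bullet> i = x \<bullet> i" using ij by (simp add: coord_reflect_def inner_diff_left)
  ultimately show ?thesis using x by (simp add: steiner_def)
qed

end

text \<open>After symmetrisation in every basis direction the set is invariant under all coordinate
  reflections, hence under negation. A point and its negative are then at distance at most
  \<open>d\<close>, so the set lies in the ball of radius d / 2. A bound on distances takes the
  place of the diameter because that is what symmetrisation preserves.\<close>

lemma isodiametric_dist:
  fixes A :: "'a::euclidean_space set"
  assumes A: "A \<in> sets borel" and d: "\<And>x y. x \<in> A \<Longrightarrow> y \<in> A \<Longrightarrow> dist x y \<le> d" and d0: "0 \<le> d"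
  shows "emeasure lborel A \<le> ennreal (unit_ball_vol (DIM('a)) * (d / 2) ^ DIM('a))"
proof -
  have "\<exists>B::'a set\<in>sets borel. emeasure lborel B = emeasure lborel A \<and> (\<forall>x\<in>B. \<forall>y\<in>B. dist x y \<le> d) \<and>
      (\<forall>j\<in>I. \<forall>x\<in>B. coord_reflect j x \<in> B)" if "finite I" "I \<subseteq> Basis" for I
    using that
  proof (induction I)
    case empty then show ?case using A d by blast
  next
    case (insert i I)
    then obtain B where B12: "B \<in> sets borel" "emeasure lborel B = emeasure lborel A"
      and B34: "\<forall>x\<in>B. \<forall>y\<in>B. dist x y \<le> d" "\<forall>j\<in>I. \<forall>x\<in>B. coord_reflect j x \<in> B" by auto
    have B3: "\<And>x y. x \<in> B \<Longrightarrow> y \<in> B \<Longrightarrow> dist x y \<le> d"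
      and B4: "\<And>j x. j \<in> I \<Longrightarrow> x \<in> B \<Longrightarrow> coord_reflect j x \<in> B" using B34 by blast+
    note B = B12 B3 B4
    have i: "i \<in> Basis" using insert by auto
    show ?case
    proof (intro bexI conjI ballI)
      show "steiner i B \<in> sets borel" using B by simp
      show "emeasure lborel (steiner i B) = emeasure lborel A" using emeasure_steiner[OF B(1) i B(3)] B(2) by simp
      show "dist x y \<le> d" if "x \<in> steiner i B" "y \<in> steiner i B" for x y
        using dist_steiner[OF B(1) i B(3)] that by blast
      show "coord_reflect j x \<in> steiner i B" if "j \<in> insert i I" "x \<in> steiner i B" for j x
        using coord_reflect_steiner[OF B(1) i B(3), of j x] coord_reflect_steiner_same[OF B(1) i B(3), of x] B(4) that insert.prems
        by blast
    qed
  qed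
  from this[OF finite_Basis order_refl] obtain B :: "'a set" where B12: "B \<in> sets borel" "emeasure lborel B = emeasure lborel A"
      and B34: "\<forall>x\<in>B. \<forall>y\<in>B. dist x y \<le> d" "\<forall>j\<in>Basis. \<forall>x\<in>B. coord_reflect j x \<in> B" by auto
  have B3: "\<And>x y. x \<in> B \<Longrightarrow> y \<in> B \<Longrightarrow> dist x y \<le> d"
    and B4: "\<And>j x. j \<in> Basis \<Longrightarrow> x \<in> B \<Longrightarrow> coord_reflect j x \<in> B" using B34 by blast+
  note B = B12 B3 B4
  have neg: "- x \<in> B" if x: "x \<in> B" for x
  proof -
    \<comment> \<open>The partial sum over \<open>J\<close> is the result of the reflections in the
      vectors of \<open>J\<close>; over the whole basis it yields the negative of
      \<open>x\<close>.\<close>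
    have "x - (\<Sum>j\<in>J. (2 * (x \<bullet> j)) *\<^sub>R j) \<in> B" if "finite J" "J \<subseteq> Basis" for J
      using that
    proof (induction J)
      case (insert j J)
      let ?z = "x - (\<Sum>j\<in>J. (2 * (x \<bullet> j)) *\<^sub>R j)"
      have "coord_reflect j ?z \<in> B" using insert B(4) by auto
      moreover have "?z \<bullet> j = x \<bullet> j"
        using insert.prems insert.hyps
        by (auto simp: inner_diff_left inner_sum_left inner_Basis intro!: sum.neutral)
      ultimately show ?case using insert by (simp add: coord_reflect_def algebra_simps)
    qed (use x in simp)
    from this[of Basis] have "x - (2::real) *\<^sub>R (\<Sum>j\<in>Basis. (x \<bullet> j) *\<^sub>R j) \<in> B"
      by (simp add: scaleR_sum_right)
    then show ?thesis by (simp add: euclidean_representation scaleR_2)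
  qed
  have "B \<subseteq> cball 0 (d / 2)"
  proof
    fix x assume "x \<in> B"
    then have "dist x (- x) \<le> d" using B(3) neg by auto
    then show "x \<in> cball 0 (d / 2)" by (simp add: dist_norm flip: scaleR_2)
  qed
  then have "emeasure lborel B \<le> emeasure lborel (cball 0 (d / 2) :: 'a set)"
    by (rule emeasure_mono) simp
  also have "\<dots> = ennreal (unit_ball_vol (DIM('a)) * (d / 2) ^ DIM('a))"
    using d0 by (intro emeasure_cball) auto
  finally show ?thesis using B(2) by simp
qed

lemma isodiametric_inequality:
  fixes A :: "'a::euclidean_space set"
  assumes "A \<in> sets borel" "bounded A"
  shows "emeasure lborel A \<le> ennreal (unit_ball_vol (DIM('a)) * (diameter A / 2) ^ DIM('a))"
  using assms by (intro isodiametric_dist diameter_bounded_bound diameter_ge_0)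

subsection \<open>Hausdorff measure of full dimension\<close>

text \<open>Covering sets need not be measurable; their closures are, with the same diameter, and
  the isodiametric inequality bounds the volume of each. The scale of the cover is irrelevant for
  this bound, so scale 1 is taken.\<close>

lemma emeasure_lborel_le_hausdorff_outer:
  fixes A :: "'a::euclidean_space set"
  assumes A: "A \<in> sets borel"
  shows "emeasure lborel A \<le> hausdorff_outer DIM('a) A"
proof -
  have "emeasure lborel A \<le> hausdorff_content DIM('a) 1 A"
    unfolding hausdorff_content_def
  proof (rule INF_greatest)
    fix C :: "nat \<Rightarrow> 'a set" assume "C \<in> {C. A \<subseteq> (\<Union>i. C i) \<and> (\<forall>i. bounded (C i) \<and> diameter (C i) \<le> 1)}"
    then have C: "A \<subseteq> (\<Union>i. C i)" "\<And>i. bounded (C i)" by auto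
    have "emeasure lborel A \<le> emeasure lborel (\<Union>i. closure (C i))"
    proof (rule emeasure_mono)
      show "A \<subseteq> (\<Union>i. closure (C i))" using C(1) closure_subset by blast
    qed simp
    also have "\<dots> \<le> (\<Sum>i. emeasure lborel (closure (C i)))"
      by (intro emeasure_subadditive_countably) auto
    also have "\<dots> \<le> (\<Sum>i. ennreal (unit_ball_vol (DIM('a)) * (diameter (C i) / 2) ^ DIM('a)))"
    proof (intro suminf_le)
      fix i
      show "emeasure lborel (closure (C i)) \<le> ennreal (unit_ball_vol (DIM('a)) * (diameter (C i) / 2) ^ DIM('a))"
        using isodiametric_inequality[of "closure (C i)"] C(2)[of i]
        by (simp add: diameter_closure bounded_closure)
    qed auto
    finally show "emeasure lborel A \<le> (\<Sum>i. ennreal (unit_ball_vol (DIM('a)) * (diameter (C i) / 2) ^ DIM('a)))" .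
  qed
  also have "\<dots> \<le> hausdorff_outer DIM('a) A" by (rule hausdorff_content_le_outer) simp
  finally show ?thesis .
qed

lemma hausdorff_content_Un:
  assumes "0 < m" "0 < e"
  shows "hausdorff_content m e (A \<union> B) \<le> hausdorff_content m e A + hausdorff_content m e B"
proof -
  have 0: "hausdorff_content m e ({}::'a set) = 0"
    by (rule hausdorff_content_empty) (use assms in auto)
  have "hausdorff_content m e (\<Union>i. binaryset A B i) \<le> (\<Sum>i. hausdorff_content m e (binaryset A B i))"
    by (rule hausdorff_content_subadditive)
  then show ?thesis
    unfolding UN_binaryset_eq suminf_binaryset_eq[where f="hausdorff_content m e", OF 0] .
qed

text \<open>For a ball the summand of the content equals its volume, so disjointness of the original
  balls inside \<open>U\<close> bounds the whole sum. The factor \<open>k\<close> is 5 when the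
  enlarged balls of the Vitali covering lemma are used and 1 when the balls themselves fill a set up
  to a null set.\<close>

lemma hausdorff_content_disjoint_balls:
  fixes a :: "'b \<Rightarrow> 'a::euclidean_space"
  assumes C: "countable C" "pairwise (\<lambda>i j. disjnt (cball (a i) (r i)) (cball (a j) (r j))) C"
    and r: "\<And>i. i \<in> C \<Longrightarrow> 0 < r i" "\<And>i. i \<in> C \<Longrightarrow> 2 * (k * r i) \<le> e"
    and k: "0 < k" and e: "0 < e"
    and U: "\<And>i. i \<in> C \<Longrightarrow> cball (a i) (r i) \<subseteq> U" and Ub: "U \<in> sets borel"
  shows "hausdorff_content DIM('a) e (\<Union>i\<in>C. cball (a i) (k * r i)) \<le> ennreal (k ^ DIM('a)) * emeasure lborel U"
proof -
  let ?N = "to_nat_on C ` C"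
  define D where "D n = (if n \<in> ?N then cball (a (from_nat_into C n)) (k * r (from_nat_into C n)) else {})" for n
  define E where "E n = (if n \<in> ?N then cball (a (from_nat_into C n)) (r (from_nat_into C n)) else {})" for n
  have fC: "from_nat_into C n \<in> C" if "n \<in> ?N" for n using that C(1) by auto
  have bd: "bounded (D n)" for n by (auto simp: D_def)
  have dD: "diameter (D n) = (if n \<in> ?N then 2 * (k * r (from_nat_into C n)) else 0)" for n
  proof (cases "n \<in> ?N")
    case True
    then show ?thesis using mult_pos_pos[OF k r(1)[OF fC[OF True]]] by (simp add: D_def)
  qed (auto simp: D_def)
  have disj: "disjoint_family E"
  proof (unfold disjoint_family_on_def, intro ballI impI)
    fix n m :: nat assume "n \<noteq> m"
    show "E n \<inter> E m = {}"
    proof (cases "n \<in> ?N \<and> m \<in> ?N")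
      case True
      then have "from_nat_into C n \<noteq> from_nat_into C m"
        using \<open>n \<noteq> m\<close> C(1) by auto
      then show ?thesis using True fC C(2) by (auto simp: E_def pairwise_def disjnt_def)
    qed (auto simp: E_def)
  qed
  have "hausdorff_content DIM('a) e (\<Union>i\<in>C. cball (a i) (k * r i))
      \<le> (\<Sum>n. ennreal (unit_ball_vol (real DIM('a)) * (diameter (D n) / 2) ^ DIM('a)))"
  proof (rule hausdorff_content_le)
    show "(\<Union>i\<in>C. cball (a i) (k * r i)) \<subseteq> (\<Union>n. D n)"
    proof safe
      fix x i assume i: "i \<in> C" "x \<in> cball (a i) (k * r i)"
      then have "x \<in> D (to_nat_on C i)" using C(1) by (auto simp: D_def)
      then show "x \<in> (\<Union>n. D n)" by blast
    qed
    show "diameter (D n) \<le> e" for n unfolding dD using r(2) fC e by auto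
  qed (rule bd)
  also have "\<dots> = (\<Sum>n. ennreal (k ^ DIM('a)) * emeasure lborel (E n))"
  proof (intro suminf_cong)
    fix n
    show "ennreal (unit_ball_vol (real DIM('a)) * (diameter (D n) / 2) ^ DIM('a)) = ennreal (k ^ DIM('a)) * emeasure lborel (E n)"
    proof (cases "n \<in> ?N")
      case True
      then show ?thesis using r(1)[OF fC[OF True]] k
        by (simp add: dD E_def emeasure_cball ennreal_mult[symmetric] power_mult_distrib mult_ac)
    next
      case False
      then show ?thesis by (simp add: dD E_def)
    qed
  qed
  also have "\<dots> = ennreal (k ^ DIM('a)) * emeasure lborel (\<Union>n. E n)"
    using disj by (subst suminf_emeasure[symmetric]) (auto simp: E_def)
  also have "\<dots> \<le> ennreal (k ^ DIM('a)) * emeasure lborel U"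
  proof -
    have "E n \<subseteq> U" for n using U[OF fC[of n]] by (auto simp: E_def)
    then have "emeasure lborel (\<Union>n. E n) \<le> emeasure lborel U" using Ub by (intro emeasure_mono) auto
    then show ?thesis by (intro mult_left_mono) auto
  qed
  finally show ?thesis .
qed

text \<open>A null set has an open neighbourhood of measure below \<eta> / 5^n. Disjoint small balls
  in it, enlarged five times, cover the null set at total cost at most \<eta>. The bound 10 r <= e
  keeps the enlarged diameters below the scale.\<close>

lemma hausdorff_content_negligible:
  fixes N :: "'a::euclidean_space set"
  assumes N: "negligible N" and e: "0 < e"
  shows "hausdorff_content DIM('a) e N = 0"
proof -
  have "hausdorff_content DIM('a) e N \<le> 0 + ennreal \<eta>" if \<eta>: "0 < \<eta>" for \<eta>
  proof -
    obtain U where U: "open U" "N \<subseteq> U" "emeasure lebesgue (U - N) < ennreal (\<eta> / 5 ^ DIM('a))"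
    proof (rule sets_lebesgue_outer_open[OF negligible_imp_sets[OF N], of "\<eta> / 5 ^ DIM('a)"])
      show "0 < \<eta> / 5 ^ DIM('a)" using \<eta> by simp
    qed
    have sets: "U \<in> sets lebesgue" "N \<in> sets lebesgue"
      using U(1) negligible_imp_sets[OF N] by (auto intro: sets_completionI_sets)
    have "emeasure lborel U = emeasure lebesgue U" using U(1) by simp
    also have "\<dots> \<le> emeasure lebesgue ((U - N) \<union> N)"
      by (intro emeasure_mono) (use sets in auto)
    also have "\<dots> \<le> emeasure lebesgue (U - N) + emeasure lebesgue N"
      by (intro emeasure_subadditive) (use sets in auto)
    also have "\<dots> = emeasure lebesgue (U - N)" using N by (simp add: negligible_iff_null_sets null_setsD1)
    finally have Ule: "emeasure lborel U \<le> ennreal (\<eta> / 5 ^ DIM('a))" using U(3) by simp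
    have "\<exists>r>0. 10 * r \<le> e \<and> cball x r \<subseteq> U" if x: "x \<in> N" for x
    proof -
      obtain r where "0 < r" "cball x r \<subseteq> U" using U x by (meson open_contains_cball subsetD)
      then show ?thesis using e by (intro exI[of _ "min r (e/10)"]) (auto simp: subset_iff)
    qed
    then obtain r where r: "\<And>x. x \<in> N \<Longrightarrow> 0 < r x" "\<And>x. x \<in> N \<Longrightarrow> 10 * r x \<le> e" "\<And>x. x \<in> N \<Longrightarrow> cball x (r x) \<subseteq> U"
      by metis
    obtain C where C: "countable C" "C \<subseteq> N" "pairwise (\<lambda>i j. disjnt (cball i (r i)) (cball j (r j))) C"
      "N \<subseteq> (\<Union>i\<in>C. cball i (5 * r i))"
    proof (rule Vitali_covering_lemma_cballs[where S=N and K=N and a="\<lambda>x. x" and r=r and B="e/10"])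
      show "N \<subseteq> (\<Union>i\<in>N. cball i (r i))" using r(1) by (force intro: less_imp_le)
      show "0 < r i \<and> r i \<le> e / 10" if "i \<in> N" for i using r that by force
    qed auto
    have "hausdorff_content DIM('a) e N \<le> hausdorff_content DIM('a) e (\<Union>i\<in>C. cball i (5 * r i))"
      by (rule hausdorff_content_mono) (rule C)
    also have "\<dots> \<le> ennreal (5 ^ DIM('a)) * emeasure lborel U"
    proof (rule hausdorff_content_disjoint_balls[where a="\<lambda>x. x", OF C(1,3)])
      show "0 < r i" "2 * (5 * r i) \<le> e" "cball i (r i) \<subseteq> U" if "i \<in> C" for i
        using r[of i] that C(2) by auto
      show "0 < (5::real)" "0 < e" "U \<in> sets borel" using U(1) e by simp_all
    qed
    also have "\<dots> \<le> ennreal (5 ^ DIM('a)) * ennreal (\<eta> / 5 ^ DIM('a))" by (intro mult_left_mono Ule) auto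
    also have "\<dots> = ennreal \<eta>" using \<eta> by (simp add: ennreal_mult[symmetric])
    finally show ?thesis by simp
  qed
  then have "hausdorff_content DIM('a) e N \<le> 0" by (rule ennreal_le_epsilon)
  then show ?thesis by simp
qed

text \<open>For the upper bound, the Vitali covering theorem fills \<open>A\<close> up to a null set
  with disjoint balls of diameter at most \<open>e\<close> inside an open set of hardly larger
  measure. These balls cost exactly their volume and the null set costs nothing.\<close>

lemma hausdorff_outer_eq_lborel:
  fixes A :: "'a::euclidean_space set"
  assumes A: "A \<in> sets borel"
  shows "hausdorff_outer DIM('a) A = emeasure lborel A"
proof (rule antisym)
  show "hausdorff_outer DIM('a) A \<le> emeasure lborel A"
  proof (rule hausdorff_outer_le, rule ennreal_le_epsilon)
    fix e \<eta> :: real assume e: "0 < e" and \<eta>: "0 < \<eta>"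
    obtain U where U: "open U" "A \<subseteq> U" "emeasure lborel (U - A) < ennreal \<eta>"
      using outer_regular_lborel[OF A, of \<eta>] \<eta> by auto
    define K where "K = {(x, r). 0 < r \<and> 2 * r \<le> e \<and> cball x r \<subseteq> U}"
    obtain C where C: "countable C" "C \<subseteq> K"
      "pairwise (\<lambda>i j. disjnt (cball (fst i) (snd i)) (cball (fst j) (snd j))) C"
      "negligible (A - (\<Union>i\<in>C. cball (fst i) (snd i)))"
    proof (rule Vitali_covering_theorem_cballs[of K snd A fst])
      show "0 < snd i" if "i \<in> K" for i using that by (auto simp: K_def)
      fix x d assume x: "x \<in> A" and d: "0 < (d::real)"
      obtain r where r: "0 < r" "cball x r \<subseteq> U" using U x by (meson open_contains_cball subsetD)
      then have "(x, min r (min (e/2) (d/2))) \<in> K" using e d by (auto simp: K_def subset_iff)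
      then show "\<exists>i. i \<in> K \<and> x \<in> cball (fst i) (snd i) \<and> snd i < d"
        using r e d by (intro exI[of _ "(x, min r (min (e/2) (d/2)))"]) auto
    qed
    let ?V = "\<Union>i\<in>C. cball (fst i) (1 * snd i)"
    have "hausdorff_content DIM('a) e A \<le> hausdorff_content DIM('a) e (?V \<union> (A - ?V))"
      by (rule hausdorff_content_mono) auto
    also have "\<dots> \<le> hausdorff_content DIM('a) e ?V + hausdorff_content DIM('a) e (A - ?V)"
      by (rule hausdorff_content_Un) (use e in auto)
    also have "hausdorff_content DIM('a) e (A - ?V) = 0"
      by (rule hausdorff_content_negligible) (use C e in auto)
    also have "hausdorff_content DIM('a) e ?V \<le> ennreal (1 ^ DIM('a)) * emeasure lborel U"
    proof (rule hausdorff_content_disjoint_balls[OF C(1,3)])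
      have "i \<in> K" if "i \<in> C" for i using that C(2) by auto
      then show "0 < snd i" "2 * (1 * snd i) \<le> e" "cball (fst i) (snd i) \<subseteq> U" if "i \<in> C" for i
        using that by (simp_all add: K_def case_prod_unfold)
    qed (use U e in auto)
    also have "emeasure lborel U \<le> emeasure lborel A + emeasure lborel (U - A)"
      using U A emeasure_subadditive[of A lborel "U - A"] by (simp add: Un_absorb1)
    also have "\<dots> \<le> emeasure lborel A + ennreal \<eta>" using U(3) by (intro add_left_mono) auto
    finally show "hausdorff_content DIM('a) e A \<le> emeasure lborel A + ennreal \<eta>"
      by (simp add: mult_left_mono add_mono)
  qed
qed (rule emeasure_lborel_le_hausdorff_outer[OF A])

subsection \<open>Isometric coordinates\<close>

text \<open>Coordinates of hyperplanes in \<open>real ^ 'n\<close>; \<open>max 1\<close> only serves to make the type nonempty.\<close>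

typedef 'n hyper = "{i::nat. i < max 1 (CARD('n::finite) - 1)}"
  by (intro exI[of _ 0]) auto

instance hyper :: (finite) finite
proof
  show "finite (UNIV :: 'a hyper set)"
    unfolding type_definition.univ[OF type_definition_hyper] by simp
qed

lemma card_hyper: "CARD('n::finite hyper) = max 1 (CARD('n) - 1)"
  unfolding type_definition.card[OF type_definition_hyper] by simp

lemma hausdorff_outer_isometry:
  assumes m: "0 < m" and iso: "\<And>x y. x \<in> A \<Longrightarrow> y \<in> A \<Longrightarrow> dist (f x) (f y) = dist x y"
  shows "hausdorff_outer m (f ` A) = hausdorff_outer m A"
proof (rule antisym)
  have "hausdorff_outer m (f ` A) \<le> ennreal (1 ^ m) * hausdorff_outer m A"
    by (rule hausdorff_outer_lipschitz_image[OF m]) (use iso in auto)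
  then show "hausdorff_outer m (f ` A) \<le> hausdorff_outer m A" by simp
  have inj: "inj_on f A" by (rule inj_onI) (metis iso dist_eq_0_iff)
  have "hausdorff_outer m (inv_into A f ` (f ` A)) \<le> ennreal (1 ^ m) * hausdorff_outer m (f ` A)"
    by (rule hausdorff_outer_lipschitz_image[OF m]) (use iso inj in auto)
  then show "hausdorff_outer m A \<le> hausdorff_outer m (f ` A)" using inj by simp
qed

text \<open>Hausdorff measure depends on distances alone and coincides with Lebesgue measure in full
  dimension. So Lebesgue measure is transported by isometries even between different Euclidean
  types.\<close>

lemma distr_lborel_isometry:
  fixes f :: "'a::euclidean_space \<Rightarrow> 'b::euclidean_space"
  assumes f: "linear f" "\<And>x. norm (f x) = norm x" "surj f" and dim: "DIM('a) = DIM('b)"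
  shows "distr lborel borel f = lborel"
proof (rule measure_eqI)
  have [measurable]: "f \<in> borel_measurable borel"
    using f(1) by (intro borel_measurable_continuous_onI linear_continuous_on linear_conv_bounded_linear[THEN iffD1])
  fix B assume "B \<in> sets (distr lborel borel f)"
  then have B [measurable]: "B \<in> sets borel" by simp
  have fB: "f -` B \<in> sets borel"
    using measurable_sets[of f borel borel B] by simp
  have "emeasure (distr lborel borel f) B = emeasure lborel (f -` B)"
    by (subst emeasure_distr) auto
  also have "\<dots> = hausdorff_outer DIM('a) (f -` B)" by (rule hausdorff_outer_eq_lborel[OF fB, symmetric])
  also have "\<dots> = hausdorff_outer DIM('a) (f ` (f -` B))"
    by (rule hausdorff_outer_isometry[symmetric]) (use f in \<open>auto simp: dist_norm simp flip: linear_diff\<close>)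
  also have "f ` (f -` B) = B" using f(3) by (rule surj_image_vimage_eq)
  also have "hausdorff_outer DIM('a) B = emeasure lborel B"
    unfolding dim by (rule hausdorff_outer_eq_lborel[OF B])
  finally show "emeasure (distr lborel borel f) B = emeasure lborel B" .
qed simp

section \<open>Slicing by height over a hyperplane: cones, slabs and caps of balls\<close>

lemma emeasure_lborel_scale:
  fixes B :: "'a::euclidean_space set"
  assumes B: "B \<in> sets borel" and c: "0 < c"
  shows "emeasure lborel {w. (1 / c) *\<^sub>R w \<in> B} = ennreal (c ^ DIM('a)) * emeasure lborel B"
proof -
  have eq: "{w. (1 / c) *\<^sub>R w \<in> B} = (\<lambda>x. c *\<^sub>R x + 0) ` B"
  proof (rule set_eqI)
    fix w :: 'a
    have "w = c *\<^sub>R ((1 / c) *\<^sub>R w) + 0" using c by simp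
    then show "w \<in> {w. (1 / c) *\<^sub>R w \<in> B} \<longleftrightarrow> w \<in> (\<lambda>x. c *\<^sub>R x + 0) ` B" using c by force
  qed
  have "{w. (1 / c) *\<^sub>R w \<in> B} = (\<lambda>w. (1 / c) *\<^sub>R w) -` B \<inter> space borel" by auto
  also have "\<dots> \<in> sets borel" by (rule measurable_sets[OF _ B]) measurable
  finally have s: "{w. (1 / c) *\<^sub>R w \<in> B} \<in> sets borel" .
  have "emeasure lborel {w. (1 / c) *\<^sub>R w \<in> B} = emeasure lebesgue {w. (1 / c) *\<^sub>R w \<in> B}" using s by simp
  also have "\<dots> = ennreal (c ^ DIM('a)) * emeasure lebesgue B"
    unfolding eq emeasure_lebesgue_affine using c by (simp add: ennreal_power)
  also have "emeasure lebesgue B = emeasure lborel B" using B by simp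
  finally show ?thesis .
qed

lemma indicator_mult_eq_if:
  fixes f :: "real \<Rightarrow> real"
  shows "(\<lambda>x. indicator A x * f x) = (\<lambda>x. if x \<in> A then f x else 0)"
  by (auto simp: fun_eq_iff)

lemma nn_integral_powr_Icc:
  assumes "0 \<le> (p::real)" "0 \<le> t" "0 \<le> c"
  shows "(\<integral>\<^sup>+x. ennreal (indicator {0..t} x * (c * x powr p)) \<partial>lborel) = ennreal (c * (t powr (p + 1) / (p + 1)))"
proof -
  have "((\<lambda>x. c * x powr p) has_integral (c * (t powr (p+1) / (p+1)))) {0..t}"
    using assms by (intro has_integral_mult_right has_integral_powr_from_0) auto
  then have "((\<lambda>x. indicator {0..t} x * (c * x powr p)) has_integral (c * (t powr (p+1) / (p+1)))) UNIV"
    by (subst (asm) has_integral_restrict_UNIV[symmetric]) (simp add: indicator_mult_eq_if)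
  from nn_integral_has_integral_lborel[OF _ _ this] show ?thesis using assms by auto
qed

text \<open>The first coordinate is the height in direction \<open>N\<close>, the second runs
  through the orthogonal hyperplane. The product type turns slicing by height into an instance of
  Fubini.\<close>

definition normal_coordinates :: "real ^ 'n \<Rightarrow> (real \<times> (real ^ 'n hyper) \<Rightarrow> real ^ 'n) \<Rightarrow> bool" where
  "normal_coordinates N \<Psi> \<longleftrightarrow> linear \<Psi> \<and> (\<forall>z. norm (\<Psi> z) = norm z) \<and> surj \<Psi> \<and> \<Psi> (1, 0) = N"

lemma normal_coordinates_exist:
  fixes N :: "real ^ 'n"
  assumes "2 \<le> CARD('n)" "norm N = 1"
  obtains \<Psi> where "normal_coordinates N \<Psi>"
proof -
  have "dim (UNIV :: (real \<times> (real ^ 'n hyper)) set) = dim (UNIV :: (real ^ 'n) set)"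
    using assms(1) by (simp add: card_hyper)
  then obtain f :: "real \<times> (real ^ 'n hyper) \<Rightarrow> real ^ 'n"
    where f: "linear f" "f ` UNIV = UNIV" "\<And>x. norm (f x) = norm x"
    using isometry_subspaces[of "UNIV :: (real \<times> (real ^ 'n hyper)) set" "UNIV :: (real ^ 'n) set"] by auto
  have "norm (f (1, 0)) = norm N" using f(3) assms(2) by (simp add: norm_Pair)
  then obtain g where g: "orthogonal_transformation g" "g (f (1, 0)) = N"
    by (rule orthogonal_transformation_exists)
  have "surj (g \<circ> f)" using f(2) orthogonal_transformation_surj[OF g(1)] by (intro comp_surj) auto
  then have "normal_coordinates N (g \<circ> f)"
    using f g linear_compose[OF f(1) orthogonal_transformation_linear[OF g(1)]]
    unfolding normal_coordinates_def by (simp add: orthogonal_transformation_norm del: split_paired_All)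
  then show thesis by (rule that)
qed

context
  fixes N :: "real ^ 'n" and \<Psi>
  assumes card: "2 \<le> CARD('n)" and \<Psi>: "normal_coordinates N \<Psi>"
begin

lemma normal_coordinates_linear: "linear \<Psi>" and normal_coordinates_norm: "norm (\<Psi> z) = norm z"
  and normal_coordinates_surj: "surj \<Psi>" and normal_coordinates_axis: "\<Psi> (1, 0) = N"
  using \<Psi> unfolding normal_coordinates_def by blast+

lemma normal_coordinates_dist: "dist (\<Psi> z) (\<Psi> w) = dist z w"
  by (simp add: dist_norm normal_coordinates_norm flip: linear_diff[OF normal_coordinates_linear])

lemma normal_coordinates_inner: "\<Psi> z \<bullet> \<Psi> w = z \<bullet> w"
  unfolding dot_norm normal_coordinates_norm
  by (simp add: normal_coordinates_norm dot_norm flip: linear_add[OF normal_coordinates_linear])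

lemma normal_coordinates_inner_axis: "N \<bullet> \<Psi> (t, w) = t"
  using normal_coordinates_inner[of "(1, 0)" "(t, w)"] by (simp add: normal_coordinates_axis)

lemma measurable_normal_coordinates [measurable]: "\<Psi> \<in> borel_measurable borel"
  using normal_coordinates_linear
  by (intro borel_measurable_continuous_onI linear_continuous_on linear_conv_bounded_linear[THEN iffD1])

lemma card_hyper_eq: "CARD('n hyper) = CARD('n) - 1" using card by (simp add: card_hyper)

lemma nn_integral_normal_coordinates:
  assumes [measurable]: "F \<in> borel_measurable borel"
  shows "(\<integral>\<^sup>+x. F x \<partial>lborel) = (\<integral>\<^sup>+t. (\<integral>\<^sup>+w. F (\<Psi> (t, w)) \<partial>lborel) \<partial>lborel)"
proof -
  have "distr lborel borel \<Psi> = lborel"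
    using card by (intro distr_lborel_isometry normal_coordinates_linear normal_coordinates_norm normal_coordinates_surj)
      (simp add: card_hyper)
  then have "(\<integral>\<^sup>+x. F x \<partial>lborel) = (\<integral>\<^sup>+x. F x \<partial>distr lborel borel \<Psi>)" by simp
  also have "\<dots> = (\<integral>\<^sup>+z. F (\<Psi> z) \<partial>lborel)"
    by (subst nn_integral_distr) auto
  also have "\<dots> = (\<integral>\<^sup>+z. F (\<Psi> z) \<partial>(lborel \<Otimes>\<^sub>M lborel))" by (simp add: lborel_prod)
  also have "\<dots> = (\<integral>\<^sup>+t. (\<integral>\<^sup>+w. F (\<Psi> (t, w)) \<partial>lborel) \<partial>lborel)"
    by (rule lborel.nn_integral_fst[symmetric]) (simp add: lborel_prod)
  finally show ?thesis .
qed

lemma emeasure_normal_coordinates: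
  assumes [measurable]: "A \<in> sets borel"
  shows "emeasure lborel A = (\<integral>\<^sup>+t. emeasure lborel {w. \<Psi> (t, w) \<in> A} \<partial>lborel)"
proof -
  have "emeasure lborel A = (\<integral>\<^sup>+t. (\<integral>\<^sup>+w. indicator A (\<Psi> (t, w)) \<partial>lborel) \<partial>lborel)"
    using nn_integral_normal_coordinates[of "indicator A"] by simp
  also have "\<dots> = (\<integral>\<^sup>+t. emeasure lborel {w. \<Psi> (t, w) \<in> A} \<partial>lborel)"
  proof (rule nn_integral_cong)
    fix t :: real
    have "{w. \<Psi> (t, w) \<in> A} = (\<lambda>w. \<Psi> (t, w)) -` A \<inter> space borel" by auto
    also have "\<dots> \<in> sets borel" by (rule measurable_sets[OF _ assms]) measurable
    finally have s: "{w. \<Psi> (t, w) \<in> A} \<in> sets lborel" by simp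
    have "(\<integral>\<^sup>+w. indicator A (\<Psi> (t, w)) \<partial>lborel) = (\<integral>\<^sup>+w. indicator {w. \<Psi> (t, w) \<in> A} w \<partial>lborel)"
      by (intro nn_integral_cong) (auto simp: indicator_def)
    then show "(\<integral>\<^sup>+w. indicator A (\<Psi> (t, w)) \<partial>lborel) = emeasure lborel {w. \<Psi> (t, w) \<in> A}"
      using s by simp
  qed
  finally show ?thesis .
qed

lemma hausdorff_outer_slice:
  assumes "B \<in> sets borel"
  shows "hausdorff_outer (CARD('n) - 1) ((\<lambda>w. \<Psi> (t, w)) ` B) = emeasure lborel B"
proof -
  have "hausdorff_outer (CARD('n) - 1) ((\<lambda>w. \<Psi> (t, w)) ` B) = hausdorff_outer (CARD('n) - 1) B"
    by (rule hausdorff_outer_isometry) (use card in \<open>auto simp: normal_coordinates_dist dist_Pair_Pair\<close>)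
  also have "\<dots> = emeasure lborel B"
    using hausdorff_outer_eq_lborel[OF assms] by (simp add: card_hyper_eq)
  finally show ?thesis .
qed

text \<open>Cavalieri: the slice of the cone at height \<open>t\<close> is the base scaled by t / d.
  The factor n is kept on the left, since the cone measure is n times volume.\<close>

lemma emeasure_cone:
  assumes B [measurable]: "B \<in> sets borel" and d: "0 < d"
    and C: "C \<in> sets borel" "\<And>t w. \<Psi> (t, w) \<in> C \<longleftrightarrow> 0 < t \<and> t \<le> d \<and> (d / t) *\<^sub>R w \<in> B"
  shows "ennreal (real CARD('n)) * emeasure lborel C = ennreal d * emeasure lborel B"
proof -
  let ?m = "CARD('n hyper)"
  have slice: "emeasure lborel {w. \<Psi> (t, w) \<in> C} = ennreal (indicator {0..d} t * (t / d) ^ ?m) * emeasure lborel B" for t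
  proof (cases "0 < t \<and> t \<le> d")
    case True
    then have "{w. \<Psi> (t, w) \<in> C} = {w. (1 / (t / d)) *\<^sub>R w \<in> B}" by (simp add: C)
    then show ?thesis using True d emeasure_lborel_scale[OF B, of "t / d"] by simp
  next
    case False
    then have "{w. \<Psi> (t, w) \<in> C} = {}" unfolding C by auto
    moreover have "indicator {0..d} t * (t / d) ^ ?m = 0"
      using False by (auto simp: indicator_def zero_power)
    ultimately show ?thesis by (simp only: emeasure_empty ennreal_0 mult_zero_left)
  qed
  have int: "(\<integral>\<^sup>+t. ennreal (indicator {0..d} t * (t / d) ^ ?m) \<partial>lborel) = ennreal (d / real CARD('n))"
  proof -
    have "((\<lambda>t. (t / d) ^ ?m) has_integral (d / real (Suc ?m) * (d / d) ^ Suc ?m - d / real (Suc ?m) * (0 / d) ^ Suc ?m)) {0..d}"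
    proof (rule fundamental_theorem_of_calculus)
      fix t assume "t \<in> {0..d}"
      show "((\<lambda>t. d / real (Suc ?m) * (t / d) ^ Suc ?m) has_vector_derivative (t / d) ^ ?m) (at t within {0..d})"
        unfolding has_real_derivative_iff_has_vector_derivative[symmetric]
        by (rule derivative_eq_intros refl | use d in \<open>simp del: of_nat_Suc power_Suc\<close>)+
    qed (use d in simp)
    then have "((\<lambda>t. (t / d) ^ ?m) has_integral (d / real CARD('n))) {0..d}"
      using d card by (simp add: card_hyper_eq zero_power)
    then have "((\<lambda>t. indicator {0..d} t * (t / d) ^ ?m) has_integral (d / real CARD('n))) UNIV"
      by (subst (asm) has_integral_restrict_UNIV[symmetric]) (simp add: indicator_mult_eq_if)
    from nn_integral_has_integral_lborel[OF _ _ this] show ?thesis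
      using d by (auto simp: indicator_def)
  qed
  have "emeasure lborel C = ennreal (d / real CARD('n)) * emeasure lborel B"
    unfolding emeasure_normal_coordinates[OF C(1)] slice using int
    by (subst nn_integral_multc) auto
  then show ?thesis
    using d by (simp add: mult.assoc[symmetric] ennreal_mult[symmetric])
qed

text \<open>Serves to show that the volume of a cap depends continuously on the position of the
  cutting hyperplane.\<close>

lemma emeasure_slab_le:
  assumes A [measurable]: "A \<in> sets borel" "A \<subseteq> cball 0 R" and "0 \<le> R" "a \<le> b"
    and ab: "\<And>x. x \<in> A \<Longrightarrow> a \<le> N \<bullet> x \<and> N \<bullet> x \<le> b"
  shows "emeasure lborel A \<le> ennreal ((b - a) * (unit_ball_vol (CARD('n hyper)) * R ^ CARD('n hyper)))"
proof -
  let ?V = "unit_ball_vol (CARD('n hyper)) * R ^ CARD('n hyper)"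
  have slice: "emeasure lborel {w. \<Psi> (t, w) \<in> A} \<le> ennreal ?V * indicator {a..b} t" for t
  proof (cases "t \<in> {a..b}")
    case True
    have "norm w \<le> R" if "\<Psi> (t, w) \<in> A" for w
    proof -
      have "norm w \<le> norm (t, w)" by (metis norm_snd_le snd_conv)
      also have "\<dots> = norm (\<Psi> (t, w))" by (simp add: normal_coordinates_norm)
      also have "\<dots> \<le> R" using that A(2) by auto
      finally show ?thesis .
    qed
    then have "emeasure lborel {w. \<Psi> (t, w) \<in> A} \<le> emeasure lborel (cball 0 R :: (real ^ 'n hyper) set)"
      by (intro emeasure_mono) auto
    also have "\<dots> = ennreal ?V" using assms(3) by (subst emeasure_cball) auto
    finally show ?thesis using True by simp
  next
    case False
    then have "{w. \<Psi> (t, w) \<in> A} = {}" using ab normal_coordinates_inner_axis by force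
    then show ?thesis by simp
  qed
  have "emeasure lborel A \<le> (\<integral>\<^sup>+t. ennreal ?V * indicator {a..b} t \<partial>lborel)"
    unfolding emeasure_normal_coordinates[OF A(1)] by (intro nn_integral_mono slice)
  also have "\<dots> = ennreal ((b - a) * ?V)"
    using assms(3,4) by (subst nn_integral_cmult_indicator) (auto simp: ennreal_mult[symmetric] mult.commute)
  finally show ?thesis .
qed

lemma emeasure_cball_sqrt:
  assumes "0 \<le> s"
  shows "emeasure lborel (cball 0 (sqrt s) :: (real ^ 'n hyper) set)
    = ennreal (unit_ball_vol (real (CARD('n) - 1)) * s powr (real (CARD('n) - 1) / 2))"
proof -
  have "sqrt s ^ CARD('n hyper) = s powr (real (CARD('n) - 1) / 2)"
  proof (cases "s = 0")
    case False
    then have "sqrt s ^ CARD('n hyper) = (s powr (1/2)) powr real (CARD('n hyper))"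
      using assms by (simp add: powr_half_sqrt powr_realpow)
    then show ?thesis by (simp add: powr_powr card_hyper_eq)
  qed (use card in \<open>simp add: card_hyper_eq zero_power\<close>)
  then show ?thesis using assms by (subst emeasure_cball) (auto simp: card_hyper_eq)
qed

text \<open>The ball touches the hyperplane of height 0 at the origin, so its slice at height
  \<open>s\<close> is a ball of squared radius s (2\<rho> - s). For heights up to \<open>t\<close>
  the second factor lies between 2\<rho> - t and 2\<rho>, and what remains is the integral of a
  power of \<open>s\<close>.\<close>

lemma emeasure_cap_bounds:
  fixes \<rho> t :: real
  defines "C \<equiv> {x \<in> cball (\<rho> *\<^sub>R N) \<rho>. N \<bullet> x \<le> t}"
    and "m \<equiv> real (CARD('n) - 1)"
  assumes t: "0 \<le> t" "t \<le> 2 * \<rho>"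
  shows "emeasure lborel C \<le> ennreal (unit_ball_vol m * (2 * \<rho>) powr (m / 2) * (t powr (m / 2 + 1) / (m / 2 + 1)))"
    and "ennreal (unit_ball_vol m * (2 * \<rho> - t) powr (m / 2) * (t powr (m / 2 + 1) / (m / 2 + 1))) \<le> emeasure lborel C"
proof -
  have "C = cball (\<rho> *\<^sub>R N) \<rho> \<inter> {x. N \<bullet> x \<le> t}" by (auto simp: C_def)
  then have C: "C \<in> sets borel" by (simp add: closed_halfspace_le)
  have m0: "0 \<le> m" by (simp add: m_def)
  have iff: "\<Psi> (s, w) \<in> C \<longleftrightarrow> s \<le> t \<and> (norm w)\<^sup>2 \<le> s * (2 * \<rho> - s)" for s w
  proof -
    have "\<Psi> (s, w) - \<rho> *\<^sub>R N = \<Psi> (s - \<rho>, w)"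
      using linear_diff[OF normal_coordinates_linear, of "(s, w)" "\<rho> *\<^sub>R (1, 0)"]
      by (simp add: linear_cmul[OF normal_coordinates_linear, of \<rho> "(1,0)"] normal_coordinates_axis del: scaleR_Pair)
         (simp)
    then have "dist (\<rho> *\<^sub>R N) (\<Psi> (s, w)) = norm (s - \<rho>, w)"
      by (metis dist_commute dist_norm normal_coordinates_norm)
    then have "dist (\<rho> *\<^sub>R N) (\<Psi> (s, w)) \<le> \<rho> \<longleftrightarrow> (s - \<rho>)\<^sup>2 + (norm w)\<^sup>2 \<le> \<rho>\<^sup>2"
      using t real_sqrt_le_iff[of "(s - \<rho>)\<^sup>2 + (norm w)\<^sup>2" "\<rho>\<^sup>2"] by (simp add: norm_Pair)
    then show ?thesis unfolding C_def
      by (auto simp: normal_coordinates_inner_axis power2_eq_square algebra_simps)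
  qed
  have slice: "emeasure lborel {w. \<Psi> (s, w) \<in> C}
      = ennreal (indicator {0..t} s * (unit_ball_vol m * (s * (2 * \<rho> - s)) powr (m / 2)))" for s
  proof (cases "s \<in> {0..t}")
    case True
    then have nn: "0 \<le> s * (2 * \<rho> - s)" using t by auto
    have "{w. \<Psi> (s, w) \<in> C} = cball 0 (sqrt (s * (2 * \<rho> - s)))"
      using True nn real_le_rsqrt sqrt_ge_absD by (fastforce simp: iff)
    then show ?thesis using True emeasure_cball_sqrt[OF nn] by (simp add: m_def)
  next
    case False
    have "\<not> (s \<le> t \<and> (norm w)\<^sup>2 \<le> s * (2 * \<rho> - s))" for w :: "real ^ 'n hyper"
    proof
      assume a: "s \<le> t \<and> (norm w)\<^sup>2 \<le> s * (2 * \<rho> - s)"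
      then have "s < 0" using False by auto
      then have "s * (2 * \<rho> - s) < 0" using t by (intro mult_neg_pos) auto
      then show False using a zero_le_power2[of "norm w"] by linarith
    qed
    then have "{w. \<Psi> (s, w) \<in> C} = {}" unfolding iff by auto
    then show ?thesis using False by simp
  qed
  have eq: "emeasure lborel C = (\<integral>\<^sup>+s. ennreal (indicator {0..t} s * (unit_ball_vol m * (s * (2 * \<rho> - s)) powr (m / 2))) \<partial>lborel)"
    unfolding emeasure_normal_coordinates[OF C] slice ..
  show "emeasure lborel C \<le> ennreal (unit_ball_vol m * (2 * \<rho>) powr (m / 2) * (t powr (m / 2 + 1) / (m / 2 + 1)))"
  proof -
    have "emeasure lborel C \<le> (\<integral>\<^sup>+s. ennreal (indicator {0..t} s * ((unit_ball_vol m * (2 * \<rho>) powr (m / 2)) * s powr (m / 2))) \<partial>lborel)"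
      unfolding eq
    proof (intro nn_integral_mono ennreal_leI)
      fix s
      show "indicator {0..t} s * (unit_ball_vol m * (s * (2 * \<rho> - s)) powr (m / 2))
         \<le> indicator {0..t} s * ((unit_ball_vol m * (2 * \<rho>) powr (m / 2)) * s powr (m / 2))"
      proof (cases "s \<in> {0..t}")
        case True
        have "(s * (2 * \<rho> - s)) powr (m / 2) = s powr (m / 2) * (2 * \<rho> - s) powr (m / 2)"
          using True t by (simp add: powr_mult)
        also have "\<dots> \<le> s powr (m / 2) * (2 * \<rho>) powr (m / 2)"
          using True t m0 by (intro mult_left_mono powr_mono2) auto
        finally show ?thesis using True m0 by (simp add: mult_left_mono mult_ac)
      qed auto
    qed
    also have "\<dots> = ennreal (unit_ball_vol m * (2 * \<rho>) powr (m / 2) * (t powr (m / 2 + 1) / (m / 2 + 1)))"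
      using t m0 by (intro nn_integral_powr_Icc) auto
    finally show ?thesis .
  qed
  show "ennreal (unit_ball_vol m * (2 * \<rho> - t) powr (m / 2) * (t powr (m / 2 + 1) / (m / 2 + 1))) \<le> emeasure lborel C"
  proof -
    have "ennreal (unit_ball_vol m * (2 * \<rho> - t) powr (m / 2) * (t powr (m / 2 + 1) / (m / 2 + 1)))
      = (\<integral>\<^sup>+s. ennreal (indicator {0..t} s * ((unit_ball_vol m * (2 * \<rho> - t) powr (m / 2)) * s powr (m / 2))) \<partial>lborel)"
      using t m0 by (intro nn_integral_powr_Icc[symmetric]) auto
    also have "\<dots> \<le> emeasure lborel C"
      unfolding eq
    proof (intro nn_integral_mono ennreal_leI)
      fix s
      show "indicator {0..t} s * ((unit_ball_vol m * (2 * \<rho> - t) powr (m / 2)) * s powr (m / 2))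
        \<le> indicator {0..t} s * (unit_ball_vol m * (s * (2 * \<rho> - s)) powr (m / 2))"
      proof (cases "s \<in> {0..t}")
        case True
        have "s powr (m / 2) * (2 * \<rho> - t) powr (m / 2) \<le> s powr (m / 2) * (2 * \<rho> - s) powr (m / 2)"
          using True t m0 by (intro mult_left_mono powr_mono2) auto
        also have "\<dots> = (s * (2 * \<rho> - s)) powr (m / 2)"
          using True t by (simp add: powr_mult)
        finally show ?thesis using True m0 by (simp add: mult_left_mono mult_ac)
      qed auto
    qed
    finally show ?thesis .
  qed
qed

end

section \<open>Convex bodies with the origin in the interior\<close>

definition supp :: "'a::euclidean_space set \<Rightarrow> 'a \<Rightarrow> real" where
  "supp L u = (SUP x\<in>L. x \<bullet> u)"

text \<open>For smooth \<open>K\<close> this is the gradient at \<open>x\<close> of the gauge \<open>supp (polar_body K)\<close> of \<open>K\<close>.\<close>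

definition dual_point :: "'a::euclidean_space set \<Rightarrow> 'a \<Rightarrow> 'a" where
  "dual_point K x = (SOME y. y \<in> polar_body K \<and> x \<bullet> y = supp (polar_body K) x)"

locale origin_body =
  fixes K :: "'a::euclidean_space set"
  assumes compact: "compact K" and convex: "convex K" and zero_interior: "0 \<in> interior K"
begin

lemma zero_in: "0 \<in> K" using zero_interior interior_subset by auto

lemma bound: obtains R where "0 < R" "\<And>x. x \<in> K \<Longrightarrow> norm x \<le> R"
  using compact_imp_bounded[OF compact] unfolding bounded_pos by auto

lemma inner_ball: obtains r where "0 < r" "cball 0 r \<subseteq> K"
  using zero_interior by (auto simp: mem_interior_cball)

lemma supp_attained: obtains x where "x \<in> K" "x \<bullet> u = supp K u" "\<And>z. z \<in> K \<Longrightarrow> z \<bullet> u \<le> supp K u"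
proof -
  have "continuous_on K (\<lambda>x. x \<bullet> u)" by (intro continuous_intros)
  then obtain x where x: "x \<in> K" "\<And>z. z \<in> K \<Longrightarrow> z \<bullet> u \<le> x \<bullet> u"
    using continuous_attains_sup[OF compact] zero_in by blast
  then have "supp K u = x \<bullet> u"
    unfolding supp_def by (intro cSup_eq_maximum) auto
  then show thesis using x that by auto
qed

lemma supp_upper: "z \<in> K \<Longrightarrow> z \<bullet> u \<le> supp K u"
  by (rule supp_attained[of u]) auto

lemma supp_le: "(\<And>z. z \<in> K \<Longrightarrow> z \<bullet> u \<le> c) \<Longrightarrow> supp K u \<le> c"
  by (rule supp_attained[of u]) metis

lemma supp_zero [simp]: "supp K 0 = 0"
  by (rule supp_attained[of 0]) auto

lemma supp_scale: assumes "0 \<le> c" shows "supp K (c *\<^sub>R u) = c * supp K u"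
proof (rule antisym)
  show "supp K (c *\<^sub>R u) \<le> c * supp K u"
    by (rule supp_le) (use assms supp_upper in \<open>auto intro: mult_left_mono\<close>)
  obtain x where "x \<in> K" "x \<bullet> u = supp K u" using supp_attained[of u] by metis
  then show "c * supp K u \<le> supp K (c *\<^sub>R u)" using supp_upper[of x "c *\<^sub>R u"] by auto
qed

lemma supp_pos: assumes "u \<noteq> 0" shows "0 < supp K u"
proof -
  obtain r where r: "0 < r" "cball 0 r \<subseteq> K" by (rule inner_ball)
  have "(r / norm u) *\<^sub>R u \<in> K" using r assms by (intro subsetD[OF r(2)]) simp
  then have "(r / norm u) *\<^sub>R u \<bullet> u \<le> supp K u" by (rule supp_upper)
  moreover have "0 < (r / norm u) *\<^sub>R u \<bullet> u" using r assms by simp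
  ultimately show ?thesis by linarith
qed

lemma supp_nonneg: "0 \<le> supp K u"
  using supp_upper[OF zero_in, of u] by simp

lemma supp_diff_le: assumes R: "\<And>x. x \<in> K \<Longrightarrow> norm x \<le> R" shows "\<bar>supp K u - supp K v\<bar> \<le> R * norm (u - v)"
proof -
  have le: "supp K u \<le> supp K v + R * norm (u - v)" for u v
  proof (rule supp_le)
    fix z assume z: "z \<in> K"
    have "z \<bullet> u = z \<bullet> v + z \<bullet> (u - v)" by (simp add: inner_diff_right)
    also have "\<dots> \<le> supp K v + norm z * norm (u - v)"
      by (intro add_mono supp_upper[OF z] norm_cauchy_schwarz)
    also have "\<dots> \<le> supp K v + R * norm (u - v)" using R[OF z] by (simp add: mult_right_mono)
    finally show "z \<bullet> u \<le> supp K v + R * norm (u - v)" .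
  qed
  show ?thesis using le[of u v] le[of v u] by (simp add: norm_minus_commute abs_le_iff)
qed

lemma continuous_on_supp: "continuous_on S (supp K)"
proof -
  obtain R where R: "0 < R" "\<And>x. x \<in> K \<Longrightarrow> norm x \<le> R" by (rule bound) blast
  have "R-lipschitz_on S (supp K)"
    using supp_diff_le[OF R(2)] R(1) by (intro lipschitz_onI) (auto simp: dist_norm)
  then show ?thesis by (rule lipschitz_on_continuous_on)
qed

lemma mem_polar_iff: "y \<in> polar_body K \<longleftrightarrow> supp K y \<le> 1"
  unfolding polar_body_def using supp_upper[of _ y] supp_le[of y 1] by force

lemma origin_body_polar: "origin_body (polar_body K)"
proof
  obtain r where r: "0 < r" "cball 0 r \<subseteq> K" by (rule inner_ball)
  obtain R where R: "0 < R" "\<And>x. x \<in> K \<Longrightarrow> norm x \<le> R" by (rule bound) blast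
  have "polar_body K = {y. supp K y \<le> 1}" using mem_polar_iff by auto
  then have "closed (polar_body K)" by (simp add: closed_Collect_le continuous_on_supp)
  moreover have "norm y \<le> 1 / r" if "y \<in> polar_body K" for y
  proof (cases "y = 0")
    case False
    have "(r / norm y) *\<^sub>R y \<in> K" using r False by (intro subsetD[OF r(2)]) simp
    then have "(r / norm y) *\<^sub>R y \<bullet> y \<le> 1" using that by (auto simp: polar_body_def)
    moreover have "(r / norm y) *\<^sub>R y \<bullet> y = r * norm y"
      using False by (simp add: power2_norm_eq_inner[symmetric] power2_eq_square)
    ultimately show ?thesis using r by (simp add: field_simps)
  qed (use r in auto)
  then have "bounded (polar_body K)" by (auto simp: bounded_iff)
  ultimately show "compact (polar_body K)" by (simp add: compact_eq_bounded_closed)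
  have "polar_body K = (\<Inter>x\<in>K. {y. x \<bullet> y \<le> 1})" by (auto simp: polar_body_def)
  then show "convex (polar_body K)" by (auto intro: convex_INT convex_halfspace_le)
  have "ball 0 (1 / R) \<subseteq> polar_body K"
  proof
    fix y assume "y \<in> ball (0::'a) (1 / R)"
    then have y: "R * norm y \<le> 1" using R(1) by (simp add: field_simps)
    have "x \<bullet> y \<le> 1" if "x \<in> K" for x
    proof -
      have "x \<bullet> y \<le> norm x * norm y" by (rule norm_cauchy_schwarz)
      also have "\<dots> \<le> R * norm y" using R(2)[OF that] by (simp add: mult_right_mono)
      finally show ?thesis using y by simp
    qed
    then show "y \<in> polar_body K" by (simp add: polar_body_def)
  qed
  then show "0 \<in> interior (polar_body K)"
    unfolding mem_interior using R(1) by (intro exI[of _ "1 / R"]) simp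
qed

text \<open>A point outside \<open>K\<close> is strictly separated from it by a functional
  \<open>a\<close> with level \<open>b\<close>. As the origin lies in \<open>K\<close>, the level is
  negative, so a / b belongs to the polar body and exceeds 1 at the point.\<close>

lemma bipolar: "polar_body (polar_body K) = K"
proof
  show "K \<subseteq> polar_body (polar_body K)" by (auto simp: polar_body_def inner_commute)
  show "polar_body (polar_body K) \<subseteq> K"
  proof (rule ccontr)
    assume "\<not> polar_body (polar_body K) \<subseteq> K"
    then obtain x where x: "x \<in> polar_body (polar_body K)" "x \<notin> K" by auto
    obtain a b where ab: "a \<bullet> x < b" "\<And>z. z \<in> K \<Longrightarrow> b < a \<bullet> z"
      using separating_hyperplane_closed_point[OF convex compact_imp_closed[OF compact] x(2)] by auto
    have b: "b < 0" using ab(2)[OF zero_in] by simp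
    have "z \<bullet> ((1 / b) *\<^sub>R a) \<le> 1" if "z \<in> K" for z
      using ab(2)[OF that] b by (simp add: inner_commute divide_le_eq)
    then have "(1 / b) *\<^sub>R a \<in> polar_body K" by (simp add: polar_body_def)
    with x(1) have "(1 / b) *\<^sub>R a \<bullet> x \<le> 1" unfolding polar_body_def[of "polar_body K"] by blast
    then show False using ab(1) b by (simp add: divide_le_eq)
  qed
qed

end

context origin_body begin

interpretation polar: origin_body "polar_body K" by (rule origin_body_polar)

lemma mem_iff: "x \<in> K \<longleftrightarrow> supp (polar_body K) x \<le> 1"
  using polar.mem_polar_iff[of x] by (simp add: bipolar)

text \<open>The support function of the polar body is the gauge of \<open>K\<close>. Interior points
  have gauge less than 1 because they can be stretched slightly without leaving
  \<open>K\<close>.\<close>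

lemma frontier_iff: "x \<in> frontier K \<longleftrightarrow> supp (polar_body K) x = 1"
proof -
  have "x \<in> interior K \<longleftrightarrow> supp (polar_body K) x < 1"
  proof
    assume "supp (polar_body K) x < 1"
    moreover have "open {x. supp (polar_body K) x < 1}"
      by (intro open_Collect_less polar.continuous_on_supp continuous_on_const)
    moreover have "{x. supp (polar_body K) x < 1} \<subseteq> K" by (auto simp: mem_iff)
    ultimately show "x \<in> interior K" by (intro interiorI[of "{x. supp (polar_body K) x < 1}"]) auto
  next
    assume x: "x \<in> interior K"
    show "supp (polar_body K) x < 1"
    proof (cases "x = 0")
      case False
      obtain e where e: "0 < e" "cball x e \<subseteq> K" using x by (auto simp: mem_interior_cball)
      have "(1 + e / norm x) *\<^sub>R x \<in> cball x e"
        using e False by (simp add: dist_norm scaleR_left_distrib)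
      then have "supp (polar_body K) ((1 + e / norm x) *\<^sub>R x) \<le> 1" using e mem_iff by blast
      then have "(1 + e / norm x) * supp (polar_body K) x \<le> 1"
        using e(1) by (subst (asm) polar.supp_scale) auto
      moreover have "supp (polar_body K) x < (1 + e / norm x) * supp (polar_body K) x"
        using mult_pos_pos[OF divide_pos_pos[OF e(1)] polar.supp_pos[OF False], of "norm x"]
          zero_less_norm_iff[THEN iffD2, OF False]
        unfolding distrib_right by linarith
      ultimately show ?thesis by linarith
    qed simp
  qed
  then have "x \<in> frontier K \<longleftrightarrow> supp (polar_body K) x \<le> 1 \<and> \<not> supp (polar_body K) x < 1"
    unfolding frontier_def closure_closed[OF compact_imp_closed[OF compact]] Diff_iff mem_iff[of x] by simp
  then show ?thesis by auto
qed

lemma frontier_scale: "x \<noteq> 0 \<Longrightarrow> (1 / supp (polar_body K) x) *\<^sub>R x \<in> frontier K"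
  unfolding frontier_iff using polar.supp_pos[of x] by (subst polar.supp_scale) auto

lemma frontier_nonzero: "x \<in> frontier K \<Longrightarrow> x \<noteq> 0"
  by (auto simp: frontier_iff)

lemma frontier_subset: "frontier K \<subseteq> K"
  using compact_imp_closed[OF compact] by (simp add: frontier_subset_eq)

lemma compact_frontier: "compact (frontier K)"
  using compact compact_frontier by blast

lemma dual_point: "dual_point K x \<in> polar_body K" "x \<bullet> dual_point K x = supp (polar_body K) x"
proof -
  obtain y where "y \<in> polar_body K" "y \<bullet> x = supp (polar_body K) x" using polar.supp_attained[of x] by metis
  then have "\<exists>y. y \<in> polar_body K \<and> x \<bullet> y = supp (polar_body K) x" by (auto simp: inner_commute)
  from someI_ex[OF this] show "dual_point K x \<in> polar_body K" "x \<bullet> dual_point K x = supp (polar_body K) x"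
    unfolding dual_point_def by auto
qed

text \<open>The subgradient inequalities of the gauge at \<open>x\<close> and at \<open>z\<close>.
  Together they confine the remainder of the linear expansion by the variation of
  \<open>dual_point\<close>, so continuity of \<open>dual_point\<close> gives differentiability of
  the gauge, and Lipschitz continuity gives a quadratic bound.\<close>

lemma gauge_increment: "0 \<le> supp (polar_body K) z - supp (polar_body K) x - dual_point K x \<bullet> (z - x)"
  "supp (polar_body K) z - supp (polar_body K) x - dual_point K x \<bullet> (z - x) \<le> (dual_point K z - dual_point K x) \<bullet> (z - x)"
  using dual_point[of x] dual_point[of z] polar.supp_upper[OF dual_point(1)[of x], of z]
    polar.supp_upper[OF dual_point(1)[of z], of x]
  by (auto simp: inner_diff_left inner_diff_right inner_commute)

lemma dual_point_monotone: "0 \<le> (dual_point K z - dual_point K x) \<bullet> (z - x)"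
  using gauge_increment[of z x] by linarith

end

text \<open>Functionals are normalised to value 1 at the boundary point, so uniqueness means a
  unique supporting hyperplane. Applied to \<open>polar_body K\<close>, the condition says that
  every supporting hyperplane of \<open>K\<close> touches it in a single point.\<close>

locale smooth_body = origin_body +
  assumes unique: "\<And>x y y'. x \<in> frontier K \<Longrightarrow> y \<in> polar_body K \<Longrightarrow> y' \<in> polar_body K \<Longrightarrow>
    x \<bullet> y = 1 \<Longrightarrow> x \<bullet> y' = 1 \<Longrightarrow> y = y'"
begin

interpretation polar: origin_body "polar_body K" by (rule origin_body_polar)

lemma dual_point_eqI:
  assumes "x \<noteq> 0" "y \<in> polar_body K" "x \<bullet> y = supp (polar_body K) x"
  shows "dual_point K x = y"
proof (rule unique[OF frontier_scale[OF assms(1)]])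
  show "(1 / supp (polar_body K) x) *\<^sub>R x \<bullet> dual_point K x = 1" "(1 / supp (polar_body K) x) *\<^sub>R x \<bullet> y = 1"
    using dual_point[of x] assms polar.supp_pos[OF assms(1)] by auto
qed (use dual_point assms in auto)

lemma dual_point_scale:
  assumes "0 < c" shows "dual_point K (c *\<^sub>R x) = dual_point K x"
proof (cases "x = 0")
  case False
  then show ?thesis
    using assms dual_point[of x] by (intro dual_point_eqI) (auto simp: polar.supp_scale)
qed simp

text \<open>By compactness, functionals of the polar body at distance at least \<open>e\<close> from
  \<open>dual_point K x\<close> miss the maximum at \<open>x\<close> by a fixed gap \<gamma>. Both
  the gauge and the pairing change by at most R |z - x|, so such a functional cannot be maximal at a
  point \<open>z\<close> close to \<open>x\<close>.\<close>

lemma isCont_dual_point: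
  assumes x: "x \<noteq> 0" shows "isCont (dual_point K) x"
proof -
  obtain R where R: "0 < R" "\<And>y. y \<in> polar_body K \<Longrightarrow> norm y \<le> R" by (rule polar.bound) blast
  have "\<exists>d>0. \<forall>z. norm (z - x) < d \<longrightarrow> norm (dual_point K z - dual_point K x) < e" if e: "0 < e" for e
  proof -
    let ?F = "{y \<in> polar_body K. e \<le> norm (y - dual_point K x)}"
    have "compact (polar_body K \<inter> {y. e \<le> norm (y - dual_point K x)})"
      using polar.compact
      by (rule compact_Int_closed) (intro closed_Collect_le continuous_on_const continuous_on_norm
          continuous_on_diff continuous_on_id)
    moreover have "?F = polar_body K \<inter> {y. e \<le> norm (y - dual_point K x)}" by auto
    ultimately have cF: "compact ?F" by simp
    show ?thesis
    proof (cases "?F = {}")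
      case True
      then have "norm (dual_point K z - dual_point K x) < e" for z
        using dual_point(1)[of z] unfolding empty_Collect_eq not_le[symmetric] by blast
      then show ?thesis by (intro exI[of _ 1]) simp
    next
      case False
      have "continuous_on ?F (\<lambda>y. x \<bullet> y)" by (intro continuous_intros)
      then obtain y0 where y0: "y0 \<in> ?F" "\<And>y. y \<in> ?F \<Longrightarrow> x \<bullet> y \<le> x \<bullet> y0"
        using continuous_attains_sup[OF cF False] by blast
      define \<gamma> where "\<gamma> = supp (polar_body K) x - x \<bullet> y0"
      have "\<gamma> \<noteq> 0" using dual_point_eqI[OF x, of y0] y0(1) e by (auto simp: \<gamma>_def)
      moreover have "0 \<le> \<gamma>" using polar.supp_upper[of y0 x] y0(1) by (auto simp: \<gamma>_def inner_commute)
      ultimately have g: "0 < \<gamma>" by simp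
      show ?thesis
      proof (intro exI[of _ "\<gamma> / (3 * R)"] conjI allI impI)
        show "0 < \<gamma> / (3 * R)" using g R by simp
        fix z assume z: "norm (z - x) < \<gamma> / (3 * R)"
        then have zR: "3 * (R * norm (z - x)) < \<gamma>" using R(1) by (simp add: field_simps)
        show "norm (dual_point K z - dual_point K x) < e"
        proof (rule ccontr)
          assume "\<not> norm (dual_point K z - dual_point K x) < e"
          then have "dual_point K z \<in> ?F" using dual_point(1) by auto
          then have 1: "x \<bullet> dual_point K z \<le> supp (polar_body K) x - \<gamma>" using y0(2) by (auto simp: \<gamma>_def)
          have "(z - x) \<bullet> dual_point K z \<le> norm (z - x) * norm (dual_point K z)" by (rule norm_cauchy_schwarz)
          also have "\<dots> \<le> R * norm (z - x)"
            using mult_right_mono[OF R(2)[OF dual_point(1)[of z]], of "norm (z - x)"] by (simp add: mult.commute)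
          finally have 2: "supp (polar_body K) z - x \<bullet> dual_point K z \<le> R * norm (z - x)"
            by (simp add: inner_diff_left dual_point(2))
          have "\<bar>supp (polar_body K) z - supp (polar_body K) x\<bar> \<le> R * norm (z - x)"
            by (rule polar.supp_diff_le[OF R(2)])
          then show False using 1 2 zR g by linarith
        qed
      qed
    qed
  qed
  then show ?thesis unfolding continuous_at_eps_delta dist_norm by blast
qed

lemma continuous_on_dual_point: "0 \<notin> S \<Longrightarrow> continuous_on S (dual_point K)"
  by (rule continuous_at_imp_continuous_on) (metis isCont_dual_point)

lemma gauge_has_derivative:
  assumes x: "x \<noteq> 0"
  shows "(supp (polar_body K) has_derivative (\<lambda>v. dual_point K x \<bullet> v)) (at x)"
  unfolding has_derivative_at_alt
proof (intro conjI allI impI)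
  show "bounded_linear (\<lambda>v. dual_point K x \<bullet> v)" by (rule bounded_linear_inner_right)
  fix e :: real assume "0 < e"
  then obtain d where d: "0 < d" "\<And>z. norm (z - x) < d \<Longrightarrow> norm (dual_point K z - dual_point K x) < e"
    using isCont_dual_point[OF x] unfolding continuous_at_eps_delta dist_norm by metis
  show "\<exists>d>0. \<forall>y. norm (y - x) < d \<longrightarrow>
    norm (supp (polar_body K) y - supp (polar_body K) x - dual_point K x \<bullet> (y - x)) \<le> e * norm (y - x)"
  proof (intro exI[of _ d] conjI allI impI)
    fix y assume y: "norm (y - x) < d"
    have "norm (supp (polar_body K) y - supp (polar_body K) x - dual_point K x \<bullet> (y - x))
        \<le> (dual_point K y - dual_point K x) \<bullet> (y - x)"
      using gauge_increment[where x=x and z=y] by auto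
    also have "\<dots> \<le> norm (dual_point K y - dual_point K x) * norm (y - x)" by (rule norm_cauchy_schwarz)
    also have "\<dots> \<le> e * norm (y - x)" using d(2)[OF y] by (simp add: mult_right_mono)
    finally show "norm (supp (polar_body K) y - supp (polar_body K) x - dual_point K x \<bullet> (y - x)) \<le> e * norm (y - x)" .
  qed (rule d)
qed

lemma dual_point_nonzero: "x \<noteq> 0 \<Longrightarrow> dual_point K x \<noteq> 0"
  using dual_point(2)[of x] polar.supp_pos[of x] by auto

lemma inner_dual_point: "x \<in> frontier K \<Longrightarrow> x \<bullet> dual_point K x = 1"
  using dual_point(2)[of x] by (simp add: frontier_iff)

lemma dual_point_frontier: assumes "x \<noteq> 0" shows "dual_point K x \<in> frontier (polar_body K)"
proof -
  let ?x = "(1 / supp (polar_body K) x) *\<^sub>R x"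
  have "?x \<in> K" using frontier_scale[OF assms] frontier_subset by blast
  moreover have "?x \<bullet> dual_point K x = 1" using dual_point(2)[of x] polar.supp_pos[OF assms] by simp
  ultimately have "1 \<le> supp K (dual_point K x)" by (metis supp_upper)
  moreover have "supp K (dual_point K x) \<le> 1" using dual_point(1)[of x] by (simp add: mem_polar_iff)
  ultimately show ?thesis using polar.frontier_iff[of "dual_point K x"] by (simp add: bipolar)
qed

text \<open>\<open>outer_normal\<close> is a choice, but any admissible unit normal, rescaled to
  have value 1 at \<open>x\<close>, lies in the polar body; uniqueness then determines it.\<close>

lemma outer_normal_eq:
  assumes x: "x \<in> frontier K"
  shows "outer_normal K x = (1 / norm (dual_point K x)) *\<^sub>R dual_point K x"
proof -
  let ?G = "dual_point K x"
  have G0: "?G \<noteq> 0" using dual_point_nonzero frontier_nonzero x by blast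
  have ex: "norm ((1 / norm ?G) *\<^sub>R ?G) = 1 \<and> (\<forall>y\<in>K. (1 / norm ?G) *\<^sub>R ?G \<bullet> (y - x) \<le> 0)"
  proof (intro conjI ballI)
    fix y assume "y \<in> K"
    then have "y \<bullet> ?G \<le> 1" using dual_point(1) by (auto simp: polar_body_def)
    then have "?G \<bullet> (y - x) \<le> 0" using inner_dual_point[OF x] by (simp add: inner_diff_left inner_commute[of ?G])
    then show "(1 / norm ?G) *\<^sub>R ?G \<bullet> (y - x) \<le> 0" using G0 by (simp add: divide_le_0_iff)
  qed (use G0 in simp)
  let ?u = "outer_normal K x"
  have u: "norm ?u = 1" "\<And>y. y \<in> K \<Longrightarrow> ?u \<bullet> (y - x) \<le> 0"
    using someI[of "\<lambda>u. norm u = 1 \<and> (\<forall>y\<in>K. u \<bullet> (y - x) \<le> 0)", OF ex] unfolding outer_normal_def by auto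
  have le: "y \<bullet> ?u \<le> x \<bullet> ?u" if "y \<in> K" for y
    using u(2)[OF that] by (simp add: inner_diff_right inner_commute)
  have "supp K ?u \<le> x \<bullet> ?u" by (rule supp_le) (rule le)
  then have pos: "0 < x \<bullet> ?u" using supp_pos[of ?u] u(1) by force
  have "dual_point K x = (1 / (x \<bullet> ?u)) *\<^sub>R ?u"
  proof (rule dual_point_eqI[OF frontier_nonzero[OF x]])
    show "(1 / (x \<bullet> ?u)) *\<^sub>R ?u \<in> polar_body K"
      unfolding polar_body_def using le pos by (auto simp: divide_le_eq)
    show "x \<bullet> (1 / (x \<bullet> ?u)) *\<^sub>R ?u = supp (polar_body K) x"
      using pos x by (simp add: frontier_iff)
  qed
  then show ?thesis using pos u(1) by simp
qed

end

section \<open>Curvature\<close>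

text \<open>Symmetry of the second derivative when the gradient is differentiable at the point
  \<open>x\<close> alone. The mixed second difference of \<open>f\<close> with steps s u and s v
  equals s^2 (A u \<bullet> v) up to an error s^2 e for small s, and it is symmetric in u and
  v.\<close>

lemma gradient_derivative_symmetric:
  fixes f :: "'a::euclidean_space \<Rightarrow> real"
  assumes S: "open S" "x \<in> S"
    and f: "\<And>y. y \<in> S \<Longrightarrow> (f has_derivative (\<lambda>v. g y \<bullet> v)) (at y)"
    and g: "(g has_derivative A) (at x)"
  shows "A u \<bullet> v = A v \<bullet> u"
proof -
  interpret A: bounded_linear A by (rule has_derivative_bounded_linear[OF g])
  have key: "\<exists>d>0. \<forall>s. 0 < s \<and> s < d \<longrightarrow>
      \<bar>f (x + s *\<^sub>R u + s *\<^sub>R v) - f (x + s *\<^sub>R u) - f (x + s *\<^sub>R v) + f x - s\<^sup>2 * (A u \<bullet> v)\<bar> \<le> s\<^sup>2 * e"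
    if e: "0 < e" for e u v
  proof -
    \<comment> \<open>B - 1 is the factor that the error estimate below produces; dividing
      \<open>e\<close> by B makes the total error at most s^2 e, and the summand 1 keeps B
      positive.\<close>
    define B where "B = (norm u + 2 * norm v) * norm v + 1"
    have B: "0 < B" by (simp add: B_def add_nonneg_pos)
    obtain d1 where d1: "0 < d1" "\<And>w. norm w < d1 \<Longrightarrow> norm (g (x + w) - g x - A w) \<le> (e / B) * norm w"
    proof -
      obtain d where d: "d > 0" "\<And>y. norm (y - x) < d \<Longrightarrow> norm (g y - g x - A (y - x)) \<le> (e / B) * norm (y - x)"
        using g e B unfolding has_derivative_at_alt by (metis divide_pos_pos)
      show thesis
      proof (rule that[OF d(1)])
        fix w :: 'a assume "norm w < d"
        then show "norm (g (x + w) - g x - A w) \<le> (e / B) * norm w" using d(2)[of "x + w"] by simp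
      qed
    qed
    obtain d2 where d2: "0 < d2" "ball x d2 \<subseteq> S" using S open_contains_ball by blast
    define d where "d = min d1 d2 / (norm u + norm v + 1)"
    have uv: "0 < norm u + norm v + 1" by (simp add: add_nonneg_pos)
    have d: "0 < d" using d1(1) d2(1) uv by (simp add: d_def)
    show ?thesis
    proof (intro exI[of _ d] conjI allI impI d)
      fix s :: real assume s: "0 < s \<and> s < d"
      then have "s * (norm u + norm v + 1) < min d1 d2" using uv by (simp add: d_def pos_less_divide_eq)
      then have small: "s * (norm u + norm v) < min d1 d2" using s by (simp add: algebra_simps)
      have nb: "norm (a *\<^sub>R u + b *\<^sub>R v) < min d1 d2" if "\<bar>a\<bar> \<le> s" "\<bar>b\<bar> \<le> s" for a b
      proof -
        have "norm (a *\<^sub>R u + b *\<^sub>R v) \<le> \<bar>a\<bar> * norm u + \<bar>b\<bar> * norm v"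
          by (metis norm_triangle_ineq norm_scaleR)
        also have "\<dots> \<le> s * norm u + s * norm v" using that by (intro add_mono mult_right_mono) auto
        finally show ?thesis using small by (simp add: distrib_left)
      qed
      have inS: "x + (a *\<^sub>R u + b *\<^sub>R v) \<in> S" if "\<bar>a\<bar> \<le> s" "\<bar>b\<bar> \<le> s" for a b
        using nb[OF that] d2(2) by (auto simp: dist_norm subset_iff norm_minus_commute)
      \<comment> \<open>The mean value theorem is applied in direction v to the difference of
        \<open>f\<close> in direction u. This expresses the second difference by two values of the
        gradient, both compared with its value at \<open>x\<close>.\<close>
      define \<theta> where "\<theta> t = f (x + s *\<^sub>R u + t *\<^sub>R (s *\<^sub>R v)) - f (x + t *\<^sub>R (s *\<^sub>R v))" for t
      have "\<exists>\<xi>. 0 < \<xi> \<and> \<xi> < 1 \<and> \<theta> 1 - \<theta> 0 = (1 - 0) * ((g (x + s *\<^sub>R u + \<xi> *\<^sub>R (s *\<^sub>R v)) - g (x + \<xi> *\<^sub>R (s *\<^sub>R v))) \<bullet> (s *\<^sub>R v))"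
      proof (rule MVT2)
        fix t :: real assume t: "0 \<le> t" "t \<le> 1"
        then have ts: "\<bar>t * s\<bar> \<le> s" using s by (simp add: mult_le_cancel_right1)
        have 1: "x + s *\<^sub>R u + t *\<^sub>R (s *\<^sub>R v) \<in> S" using inS[of s "t * s"] s ts by (simp add: add.assoc)
        have 2: "x + t *\<^sub>R (s *\<^sub>R v) \<in> S" using inS[of 0 "t * s"] s ts by simp
        have c1: "((\<lambda>t. x + s *\<^sub>R u + t *\<^sub>R (s *\<^sub>R v)) has_derivative (\<lambda>r. r *\<^sub>R (s *\<^sub>R v))) (at t)"
          and c2: "((\<lambda>t. x + t *\<^sub>R (s *\<^sub>R v)) has_derivative (\<lambda>r. r *\<^sub>R (s *\<^sub>R v))) (at t)"
          by (auto intro!: derivative_eq_intros)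
        have "(\<theta> has_derivative (\<lambda>r. g (x + s *\<^sub>R u + t *\<^sub>R (s *\<^sub>R v)) \<bullet> (r *\<^sub>R (s *\<^sub>R v)) - g (x + t *\<^sub>R (s *\<^sub>R v)) \<bullet> (r *\<^sub>R (s *\<^sub>R v)))) (at t)"
          unfolding \<theta>_def
          by (rule has_derivative_diff[OF has_derivative_compose[OF c1 f[OF 1]] has_derivative_compose[OF c2 f[OF 2]]])
        then show "(\<theta> has_real_derivative ((g (x + s *\<^sub>R u + t *\<^sub>R (s *\<^sub>R v)) - g (x + t *\<^sub>R (s *\<^sub>R v))) \<bullet> (s *\<^sub>R v))) (at t)"
          unfolding has_field_derivative_def
          by (rule has_derivative_eq_rhs) (auto simp: fun_eq_iff inner_diff_left algebra_simps)
      qed simp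
      then obtain \<xi> where \<xi>: "0 < \<xi>" "\<xi> < 1"
        and eq: "\<theta> 1 - \<theta> 0 = (g (x + s *\<^sub>R u + \<xi> *\<^sub>R (s *\<^sub>R v)) - g (x + \<xi> *\<^sub>R (s *\<^sub>R v))) \<bullet> (s *\<^sub>R v)" by auto
      define w1 where "w1 = s *\<^sub>R u + (\<xi> * s) *\<^sub>R v"
      define w2 where "w2 = (\<xi> * s) *\<^sub>R v"
      have xs: "\<bar>\<xi> * s\<bar> \<le> s" using \<xi> s by (simp add: mult_le_cancel_right1)
      have n1: "norm w1 < d1" using nb[of s "\<xi> * s"] xs s by (simp add: w1_def)
      have n2: "norm w2 < d1" using nb[of 0 "\<xi> * s"] xs s by (simp add: w2_def)
      have b2: "norm w2 \<le> s * norm v" using xs by (simp add: w2_def mult_right_mono)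
      have b1: "norm w1 \<le> s * norm u + s * norm v"
        unfolding w1_def using xs s by (intro norm_triangle_mono) (auto simp: mult_right_mono)
      define r where "r = (g (x + w1) - g x - A w1) - (g (x + w2) - g x - A w2)"
      have "norm r \<le> (e / B) * norm w1 + (e / B) * norm w2"
        unfolding r_def by (rule order_trans[OF norm_triangle_ineq4]) (intro add_mono d1(2) n1 n2)
      also have "\<dots> \<le> (e / B) * (s * norm u + s * norm v) + (e / B) * (s * norm v)"
        using e B b1 b2 by (intro add_mono mult_left_mono) auto
      also have "\<dots> = (e / B) * s * (norm u + 2 * norm v)" by (simp add: algebra_simps)
      finally have nr: "norm r \<le> (e / B) * s * (norm u + 2 * norm v)" .
      have "w1 - w2 = s *\<^sub>R u" by (simp add: w1_def w2_def)
      then have "A w1 - A w2 = s *\<^sub>R A u" by (metis A.diff A.scaleR)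
      then have "g (x + w1) - g (x + w2) = s *\<^sub>R A u + r" unfolding r_def by (simp add: algebra_simps)
      moreover have "\<theta> 1 - \<theta> 0 = (g (x + w1) - g (x + w2)) \<bullet> (s *\<^sub>R v)"
        unfolding eq w1_def w2_def by (simp add: add.assoc)
      ultimately have "\<theta> 1 - \<theta> 0 - s\<^sup>2 * (A u \<bullet> v) = s * (r \<bullet> v)"
        by (simp add: inner_add_left power2_eq_square algebra_simps)
      then have "\<bar>\<theta> 1 - \<theta> 0 - s\<^sup>2 * (A u \<bullet> v)\<bar> = s * \<bar>r \<bullet> v\<bar>" using s by (simp add: abs_mult)
      also have "\<dots> \<le> s * (norm r * norm v)" using s by (intro mult_left_mono Cauchy_Schwarz_ineq2) auto
      also have "\<dots> \<le> s * (((e / B) * s * (norm u + 2 * norm v)) * norm v)"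
        using s nr by (intro mult_left_mono mult_right_mono) auto
      also have "\<dots> = s\<^sup>2 * (e * ((B - 1) / B))" by (simp add: B_def power2_eq_square)
      also have "\<dots> \<le> s\<^sup>2 * (e * 1)" using B e by (intro mult_left_mono) (auto simp: divide_le_eq)
      finally show "\<bar>f (x + s *\<^sub>R u + s *\<^sub>R v) - f (x + s *\<^sub>R u) - f (x + s *\<^sub>R v) + f x - s\<^sup>2 * (A u \<bullet> v)\<bar> \<le> s\<^sup>2 * e"
        unfolding \<theta>_def by (simp add: algebra_simps)
    qed
  qed
  have "\<bar>A u \<bullet> v - A v \<bullet> u\<bar> \<le> e" if e: "0 < e" for e
  proof -
    obtain d where d: "0 < d" "\<And>s. 0 < s \<Longrightarrow> s < d \<Longrightarrow>
       \<bar>f (x + s *\<^sub>R u + s *\<^sub>R v) - f (x + s *\<^sub>R u) - f (x + s *\<^sub>R v) + f x - s\<^sup>2 * (A u \<bullet> v)\<bar> \<le> s\<^sup>2 * (e/2)"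
      using key[of "e/2" u v] e by auto
    obtain d' where d': "0 < d'" "\<And>s. 0 < s \<Longrightarrow> s < d' \<Longrightarrow>
       \<bar>f (x + s *\<^sub>R v + s *\<^sub>R u) - f (x + s *\<^sub>R v) - f (x + s *\<^sub>R u) + f x - s\<^sup>2 * (A v \<bullet> u)\<bar> \<le> s\<^sup>2 * (e/2)"
      using key[of "e/2" v u] e by auto
    define s where "s = min d d' / 2"
    have s: "0 < s" "s < d" "s < d'" using d(1) d'(1) by (auto simp: s_def)
    have "x + s *\<^sub>R v + s *\<^sub>R u = x + s *\<^sub>R u + s *\<^sub>R v" by (simp add: algebra_simps)
    then have "\<bar>s\<^sup>2 * (A u \<bullet> v) - s\<^sup>2 * (A v \<bullet> u)\<bar> \<le> s\<^sup>2 * (e/2) + s\<^sup>2 * (e/2)"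
      using d(2)[OF s(1,2)] d'(2)[OF s(1,3)] by (simp only:; linarith)
    moreover have "\<bar>s\<^sup>2 * (A u \<bullet> v) - s\<^sup>2 * (A v \<bullet> u)\<bar> = s\<^sup>2 * \<bar>A u \<bullet> v - A v \<bullet> u\<bar>"
      by (simp add: abs_mult flip: right_diff_distrib)
    moreover have "s\<^sup>2 * (e/2) + s\<^sup>2 * (e/2) = s\<^sup>2 * e" by simp
    ultimately have "s\<^sup>2 * \<bar>A u \<bullet> v - A v \<bullet> u\<bar> \<le> s\<^sup>2 * e" by linarith
    then show ?thesis using s(1) by simp
  qed
  then have "\<bar>A u \<bullet> v - A v \<bullet> u\<bar> \<le> 0" by (rule dense_ge)
  then show ?thesis by simp
qed

text \<open>A rotation takes an axis to the direction of v. In these coordinates the rank-one term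
  alters a single column of the identity matrix, and Cramer's formula evaluates the
  determinant.\<close>

lemma det_id_plus_rank_one:
  fixes u v :: "real ^ 'n"
  shows "det (matrix (\<lambda>x. x + (v \<bullet> x) *\<^sub>R u)) = 1 + u \<bullet> v"
proof (cases "v = 0")
  case True
  have "matrix (\<lambda>x::real^'n. x) = mat 1" by (simp add: matrix_id_mat_1[unfolded id_def])
  then show ?thesis using True by simp
next
  case False
  fix k :: 'n
  have axis: "det (matrix (\<lambda>x::real^'n. x + (c * (x $ k)) *\<^sub>R w)) = 1 + c * (w $ k)" for w c
  proof -
    have "matrix (\<lambda>x::real^'n. x + (c * (x $ k)) *\<^sub>R w)
      = (\<chi> i j. if j = k then (axis k 1 + c *\<^sub>R w) $ i else mat 1 $ i $ j)"
      by (simp add: matrix_def vec_eq_iff axis_def mat_def)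
    also have "\<dots> = (\<chi> i j. if j = k then (mat 1 *v (axis k 1 + c *\<^sub>R w)) $ i else mat 1 $ i $ j)"
      by (simp only: matrix_vector_mul_lid)
    finally show ?thesis by (simp only: cramer_lemma det_I) (simp add: axis_def)
  qed
  have "norm (axis k 1 :: real^'n) = norm ((1 / norm v) *\<^sub>R v)" using False by simp
  then obtain R :: "real^'n \<Rightarrow> real^'n" where R: "orthogonal_transformation R" "R (axis k 1) = (1 / norm v) *\<^sub>R v"
    by (rule orthogonal_transformation_exists)
  have lin: "linear R" using R(1) by (rule orthogonal_transformation_linear)
  obtain u' where u': "R u' = u" using orthogonal_transformation_surj[OF R(1)] by (metis surjD)
  define T where "T x = x + (v \<bullet> x) *\<^sub>R u" for x
  define T' where "T' x = x + (norm v * (x $ k)) *\<^sub>R u'" for x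
  have inner: "R x \<bullet> R y = x \<bullet> y" for x y using R(1) by (simp add: orthogonal_transformation_def)
  have vR: "v \<bullet> R x = norm v * (x $ k)" for x
  proof -
    have "v = norm v *\<^sub>R R (axis k 1)" using R(2) False by simp
    then have "v \<bullet> R x = norm v * (R (axis k 1) \<bullet> R x)" by (metis inner_scaleR_left)
    then show ?thesis by (simp add: inner inner_axis')
  qed
  have linT: "linear T" unfolding T_def by (rule linearI) (auto simp: algebra_simps inner_add_right)
  have linT': "linear T'" unfolding T'_def by (rule linearI) (auto simp: algebra_simps)
  have "T \<circ> R = R \<circ> T'"
    unfolding T_def T'_def using u' by (auto simp: fun_eq_iff vR linear_add[OF lin] linear_cmul[OF lin])
  then have "matrix T ** matrix R = matrix R ** matrix T'"
    using matrix_compose[OF lin linT] matrix_compose[OF linT' lin] by simp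
  then have "det (matrix T) * det (matrix R) = det (matrix R) * det (matrix T')" by (metis det_mul)
  moreover have "det (matrix R) \<noteq> 0"
    using det_nz_iff_inj[OF lin] orthogonal_transformation_inj[OF R(1)] by simp
  ultimately have "det (matrix T) = det (matrix T')" by simp
  also have "\<dots> = 1 + norm v * (u' $ k)" unfolding T'_def by (rule axis)
  also have "norm v * (u' $ k) = u \<bullet> v" using vR[of u'] u' by (simp add: inner_commute)
  finally show ?thesis by (simp add: T_def[abs_def])
qed

definition tangential :: "'a::real_inner \<Rightarrow> 'a \<Rightarrow> 'a" where
  "tangential N v = v - (v \<bullet> N) *\<^sub>R N"

lemma (in smooth_body) outer_normal_has_derivative_frontier:
  assumes x0: "x0 \<in> frontier K" and A: "(dual_point K has_derivative A) (at x0)"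
  defines "G \<equiv> dual_point K x0" and "N \<equiv> outer_normal K x0"
  shows "(outer_normal K has_derivative (\<lambda>v. (1 / norm G) *\<^sub>R tangential N (A v))) (at x0 within frontier K)"
proof -
  have G0: "G \<noteq> 0" unfolding G_def by (rule dual_point_nonzero[OF frontier_nonzero[OF x0]])
  have N: "N = (1 / norm G) *\<^sub>R G" unfolding N_def G_def by (rule outer_normal_eq[OF x0])
  have "((\<lambda>x. (1 / norm (dual_point K x)) *\<^sub>R dual_point K x) has_derivative
      (\<lambda>v. (1 / norm G) *\<^sub>R A v + (- ((1 / norm G) * (sgn G \<bullet> A v) * (1 / norm G))) *\<^sub>R G)) (at x0)"
    unfolding inverse_eq_divide[symmetric]
    by (rule has_derivative_eq_rhs[OF has_derivative_scaleR[OF Deriv.has_derivative_inverse[OF _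
        has_derivative_compose[OF A has_derivative_norm]] A]])
      (use G0 in \<open>auto simp: G_def fun_eq_iff inner_commute\<close>)
  then have "((\<lambda>x. (1 / norm (dual_point K x)) *\<^sub>R dual_point K x) has_derivative
      (\<lambda>v. (1 / norm G) *\<^sub>R tangential N (A v))) (at x0)"
    by (rule has_derivative_eq_rhs)
      (auto simp: fun_eq_iff tangential_def N sgn_div_norm algebra_simps inner_commute divide_inverse)
  then have "((\<lambda>x. (1 / norm (dual_point K x)) *\<^sub>R dual_point K x) has_derivative
      (\<lambda>v. (1 / norm G) *\<^sub>R tangential N (A v))) (at x0 within frontier K)"
    by (rule has_derivative_at_withinI)
  then show ?thesis
    by (rule has_derivative_transform[OF x0, rotated]) (simp add: outer_normal_eq)
qed

text \<open>A derivative within the frontier is not determined in normal directions. For a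
  tangential v the radial projection of the line x0 + t v is a curve in the frontier with velocity
  v, because the gauge is stationary along v; along this curve both derivatives must agree.\<close>

lemma (in origin_body) has_derivative_frontier_unique:
  fixes f :: "'a \<Rightarrow> 'b::real_normed_vector"
  assumes smooth: "smooth_body K"
    and x0: "x0 \<in> frontier K" and v: "dual_point K x0 \<bullet> v = 0"
    and D: "(f has_derivative D) (at x0 within frontier K)"
    and D': "(f has_derivative D') (at x0 within frontier K)"
  shows "D v = D' v"
proof -
  interpret smooth_body K by (rule smooth)
  interpret polar: origin_body "polar_body K" by (rule origin_body_polar)
  let ?g = "supp (polar_body K)"
  define \<gamma> where "\<gamma> t = (1 / ?g (x0 + t *\<^sub>R v)) *\<^sub>R (x0 + t *\<^sub>R v)" for t :: real
  define S where "S = {t. x0 + t *\<^sub>R v \<noteq> 0}"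
  have "open S" unfolding S_def by (intro open_Collect_neq continuous_intros)
  have x00: "x0 \<noteq> 0" by (rule frontier_nonzero[OF x0])
  then have 0: "0 \<in> S" by (simp add: S_def)
  have g1: "?g x0 = 1" using x0 by (simp add: frontier_iff)
  have \<gamma>0: "\<gamma> 0 = x0" by (simp add: \<gamma>_def g1)
  have \<gamma>S: "\<gamma> ` S \<subseteq> frontier K" unfolding \<gamma>_def S_def using frontier_scale by auto
  have line: "((\<lambda>t. x0 + t *\<^sub>R v) has_derivative (\<lambda>t. t *\<^sub>R v)) (at 0)"
    by (auto intro!: derivative_eq_intros)
  have "((\<lambda>t. ?g (x0 + t *\<^sub>R v)) has_derivative (\<lambda>t. dual_point K x0 \<bullet> (t *\<^sub>R v))) (at 0)"
    by (rule has_derivative_compose[OF line]) (use gauge_has_derivative[OF x00] in simp)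
  then have gd: "((\<lambda>t. ?g (x0 + t *\<^sub>R v)) has_derivative (\<lambda>t. 0)) (at 0)" using v by simp
  have "(\<gamma> has_derivative (\<lambda>t. inverse (?g (x0 + 0 *\<^sub>R v)) *\<^sub>R (t *\<^sub>R v) + (- (inverse (?g (x0 + 0 *\<^sub>R v)) * 0 * inverse (?g (x0 + 0 *\<^sub>R v)))) *\<^sub>R (x0 + 0 *\<^sub>R v))) (at 0)"
    unfolding \<gamma>_def inverse_eq_divide[symmetric]
    by (intro has_derivative_scaleR line Deriv.has_derivative_inverse gd) (simp add: g1)
  then have "(\<gamma> has_derivative (\<lambda>t. t *\<^sub>R v)) (at 0)" by (simp add: g1)
  then have \<gamma>d: "(\<gamma> has_derivative (\<lambda>t. t *\<^sub>R v)) (at 0 within S)" by (rule has_derivative_at_withinI)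
  have chain: "((f \<circ> \<gamma>) has_derivative (E \<circ> (\<lambda>t. t *\<^sub>R v))) (at 0)"
    if E: "(f has_derivative E) (at x0 within frontier K)" for E
  proof -
    have "(f has_derivative E) (at (\<gamma> 0) within \<gamma> ` S)"
      using has_derivative_subset[OF E \<gamma>S] by (simp add: \<gamma>0)
    from diff_chain_within[OF \<gamma>d this] show ?thesis unfolding at_within_open[OF 0 \<open>open S\<close>] .
  qed
  have "D \<circ> (\<lambda>t. t *\<^sub>R v) = D' \<circ> (\<lambda>t::real. t *\<^sub>R v)"
    by (rule has_derivative_unique[OF chain[OF D] chain[OF D']])
  from fun_cong[OF this, of 1] show ?thesis by simp
qed

text \<open>The curvature is defined with an unspecified derivative of the normal. It is applied to
  tangential vectors only, where it must coincide with the one computed from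
  \<open>A\<close>.\<close>

lemma gaussian_curvature_eq:
  fixes K :: "(real ^ 'n) set"
  assumes K: "smooth_body K" and x0: "x0 \<in> frontier K" and A: "(dual_point K has_derivative A) (at x0)"
  defines "N \<equiv> outer_normal K x0"
  shows "gaussian_curvature K x0
    = det (matrix (\<lambda>v. (1 / norm (dual_point K x0)) *\<^sub>R tangential N (A (tangential N v)) + (v \<bullet> N) *\<^sub>R N))"
proof -
  interpret smooth_body K by (rule K)
  let ?G = "dual_point K x0"
  let ?W = "frechet_derivative (outer_normal K) (at x0 within frontier K)"
  have N: "N = (1 / norm ?G) *\<^sub>R ?G" unfolding N_def by (rule outer_normal_eq[OF x0])
  have G0: "?G \<noteq> 0" by (rule dual_point_nonzero[OF frontier_nonzero[OF x0]])
  note d = outer_normal_has_derivative_frontier[OF x0 A, folded N_def]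
  then have W: "(outer_normal K has_derivative ?W) (at x0 within frontier K)"
    using frechet_derivative_works differentiable_def by blast
  have "?W (tangential N v) = (1 / norm ?G) *\<^sub>R tangential N (A (tangential N v))" for v
  proof (rule has_derivative_frontier_unique[OF K x0 _ W d])
    have "N \<bullet> N = 1" using G0 by (simp add: N power2_norm_eq_inner[symmetric] power2_eq_square)
    then have "N \<bullet> tangential N v = 0" by (simp add: tangential_def inner_diff_right inner_commute)
    then show "?G \<bullet> tangential N v = 0" using G0 by (simp add: N)
  qed
  then show ?thesis
    by (simp add: gaussian_curvature_def Let_def N_def[symmetric] flip: tangential_def)
qed

text \<open>The operator on the left is the Hessian of half the squared gauge. The shear
  \<open>S\<close> sends N to |G| x0, the direction annihilated by \<open>A\<close>, and
  \<open>S'\<close> is its transpose; both have determinant 1. They bring the Hessian to the block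
  form |G| (B E), where B is the operator defining the curvature and E stretches N by |G|. Scaling
  by |G| contributes the power n, and E one more.\<close>

lemma det_hessian_eq_curvature:
  fixes K :: "(real ^ 'n) set"
  assumes K: "smooth_body K" and x0: "x0 \<in> frontier K" and A: "(dual_point K has_derivative A) (at x0)"
    and sym: "\<And>u v. A u \<bullet> v = A v \<bullet> u" and Ax0: "A x0 = 0"
  defines "G \<equiv> dual_point K x0"
  shows "det (matrix (\<lambda>v. A v + (G \<bullet> v) *\<^sub>R G)) = norm G ^ (CARD('n) + 1) * gaussian_curvature K x0"
proof -
  interpret smooth_body K by (rule K)
  interpret A: bounded_linear A by (rule has_derivative_bounded_linear[OF A])
  define N where "N = outer_normal K x0"
  have G0: "G \<noteq> 0" unfolding G_def by (rule dual_point_nonzero[OF frontier_nonzero[OF x0]])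
  have N: "N = (1 / norm G) *\<^sub>R G" unfolding N_def G_def by (rule outer_normal_eq[OF x0])
  have GN: "G = norm G *\<^sub>R N" using G0 by (simp add: N)
  have NN: "N \<bullet> N = 1" using G0 by (simp add: N power2_norm_eq_inner[symmetric] power2_eq_square)
  have xG: "x0 \<bullet> G = 1" unfolding G_def by (rule inner_dual_point[OF x0])
  have xN: "norm G * (x0 \<bullet> N) = 1" using xG G0 by (simp add: N)
  define z where "z = norm G *\<^sub>R x0 - N"
  have zN: "z \<bullet> N = 0" using xN NN by (simp add: z_def inner_diff_left)
  define Q where "Q v = A v + (G \<bullet> v) *\<^sub>R G" for v
  define S where "S v = v + (N \<bullet> v) *\<^sub>R z" for v
  define S' where "S' v = v + (z \<bullet> v) *\<^sub>R N" for v
  define B where "B v = (1 / norm G) *\<^sub>R tangential N (A (tangential N v)) + (v \<bullet> N) *\<^sub>R N" for v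
  define E where "E v = v + (N \<bullet> v) *\<^sub>R ((norm G - 1) *\<^sub>R N)" for v
  have linP: "linear (tangential N)"
    by (rule linearI) (auto simp: tangential_def algebra_simps inner_add_left)
  have lin: "linear Q" "linear S" "linear S'" "linear E"
    unfolding Q_def S_def S'_def E_def
    by (auto intro!: linearI simp: A.add A.scaleR inner_add_right algebra_simps)
  have linB: "linear B"
    unfolding B_def by (rule linearI)
     (auto simp: linear_add[OF linP] linear_cmul[OF linP] A.add A.scaleR inner_add_left algebra_simps)
  have detS: "det (matrix S) = 1" unfolding S_def det_id_plus_rank_one by (simp add: zN)
  have detS': "det (matrix S') = 1" unfolding S'_def det_id_plus_rank_one using zN by (simp add: inner_commute)
  have detE: "det (matrix E) = norm G" unfolding E_def det_id_plus_rank_one by (simp add: NN)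
  have "S' (Q (S v)) = norm G *\<^sub>R B (E v)" for v
  proof -
    let ?t = "tangential N v"
    have Nt: "N \<bullet> ?t = 0" using NN by (simp add: tangential_def inner_diff_right inner_commute)
    have Sv: "S v = ?t + (v \<bullet> N) *\<^sub>R (norm G *\<^sub>R x0)"
      by (simp add: S_def tangential_def z_def algebra_simps inner_commute)
    have "G \<bullet> S v = norm G * (v \<bullet> N)"
      unfolding Sv using Nt xG by (subst GN) (simp add: inner_add_right inner_commute[of N] xN)
    then have QS: "Q (S v) = A ?t + (norm G * norm G * (v \<bullet> N)) *\<^sub>R N"
      unfolding Q_def Sv using Ax0 by (subst (2) GN) (simp add: A.add A.scaleR mult_ac)
    have "z \<bullet> A ?t = - (N \<bullet> A ?t)"
      using sym[of ?t x0] Ax0 unfolding z_def inner_diff_left inner_scaleR_left inner_commute[of x0] by simp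
    then have "z \<bullet> Q (S v) = - (N \<bullet> A ?t)" unfolding QS using zN by (simp add: inner_add_right)
    then have 1: "S' (Q (S v)) = tangential N (A ?t) + (norm G * norm G * (v \<bullet> N)) *\<^sub>R N"
      unfolding S'_def QS by (simp add: tangential_def inner_commute)
    have EN: "E v \<bullet> N = norm G * (v \<bullet> N)"
      using NN by (simp add: E_def inner_add_left inner_commute algebra_simps)
    have "tangential N (E v) = ?t"
      unfolding tangential_def EN by (simp add: E_def inner_commute algebra_simps)
    then have 2: "norm G *\<^sub>R B (E v) = tangential N (A ?t) + (norm G * norm G * (v \<bullet> N)) *\<^sub>R N"
      unfolding B_def EN using G0 by (simp add: scaleR_add_right)
    show ?thesis using 1 2 by simp
  qed
  then have comp: "S' \<circ> (Q \<circ> S) = (*\<^sub>R) (norm G) \<circ> (B \<circ> E)" by (auto simp: fun_eq_iff)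
  have "det (matrix (S' \<circ> (Q \<circ> S))) = det (matrix Q)"
    using lin by (simp add: matrix_compose linear_compose det_mul detS detS')
  moreover have "det (matrix ((*\<^sub>R) (norm G) \<circ> (B \<circ> E))) = norm G ^ CARD('n) * (det (matrix B) * norm G)"
    using lin linB by (simp add: matrix_compose linear_compose det_mul detE)
  moreover have "det (matrix B) = gaussian_curvature K x0"
    unfolding B_def using gaussian_curvature_eq[OF K x0 A] by (simp add: G_def N_def)
  ultimately show ?thesis unfolding Q_def comp by (simp add: mult_ac)
qed

section \<open>Bodies with twice differentiable boundary and positive curvature\<close>

lemma line_has_derivative:
  fixes f :: "'a::real_normed_vector \<Rightarrow> 'b::real_normed_vector"
  assumes "(f has_derivative D) (at x)"
  shows "((\<lambda>t. f (x + t *\<^sub>R v)) has_derivative (\<lambda>t. t *\<^sub>R D v)) (at 0)"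
proof -
  have "((\<lambda>t. x + t *\<^sub>R v) has_derivative (\<lambda>t. t *\<^sub>R v)) (at 0)" by (auto intro!: derivative_eq_intros)
  then have "((\<lambda>t. f (x + t *\<^sub>R v)) has_derivative (\<lambda>t. D (t *\<^sub>R v))) (at 0)"
    by (rule has_derivative_compose) (use assms in simp)
  then show ?thesis
    using linear_cmul[OF has_derivative_linear[OF assms]] by simp
qed

lemma line_inner_has_real_derivative:
  fixes f :: "'a::real_normed_vector \<Rightarrow> 'b::real_inner"
  assumes "(f has_derivative D) (at x)"
  shows "((\<lambda>t. f (x + t *\<^sub>R v) \<bullet> w) has_real_derivative (D v \<bullet> w)) (at 0)"
  unfolding has_field_derivative_def
  by (rule has_derivative_eq_rhs[OF has_derivative_inner_left[OF line_has_derivative[OF assms]]])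
    (auto simp: fun_eq_iff)

text \<open>If \<open>y\<close> were not parallel to the gradient, moving from \<open>x\<close> in a direction where \<open>y\<close> increases
  one could reach both signs of \<open>f\<close> and hence a boundary point strictly beyond the supporting
  hyperplane.\<close>

lemma (in origin_body) supporting_functional_parallel_gradient:
  fixes f :: "'a \<Rightarrow> real"
  assumes x: "x \<in> frontier K" and U: "open U" "x \<in> U"
    and f: "\<And>z. z \<in> U \<Longrightarrow> (f has_derivative (\<lambda>v. g z \<bullet> v)) (at z)"
    and g: "g x \<noteq> 0" and fr: "frontier K \<inter> U = {z \<in> U. f z = 0}"
    and y: "y \<in> polar_body K" "x \<bullet> y = 1"
  shows "x \<bullet> g x \<noteq> 0" "y = (1 / (x \<bullet> g x)) *\<^sub>R g x"
proof -
  define w where "w = g x"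
  have w0: "w \<noteq> 0" using g by (simp add: w_def)
  define v where "v = y - ((y \<bullet> w) / (w \<bullet> w)) *\<^sub>R w"
  have vw: "v \<bullet> w = 0" using w0 by (simp add: v_def inner_diff_left)
  have vy: "v \<bullet> y = v \<bullet> v" using vw by (simp add: v_def inner_diff_right inner_commute)
  have "v = 0"
  proof (rule ccontr)
    assume v0: "v \<noteq> 0"
    \<comment> \<open>Small enough that adding \<theta> w to v with |\<theta>| <= \<epsilon> does
      not destroy the gain v \<bullet> v of the functional y along v.\<close>
    define \<epsilon> where "\<epsilon> = (v \<bullet> v) / (2 * (\<bar>w \<bullet> y\<bar> + 1))"
    have \<epsilon>: "0 < \<epsilon>" using v0 by (simp add: \<epsilon>_def add_nonneg_pos)
    have "\<epsilon> * (2 * (\<bar>w \<bullet> y\<bar> + 1)) = v \<bullet> v" unfolding \<epsilon>_def by (simp add: add_nonneg_pos)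
    moreover have "\<epsilon> * (2 * (\<bar>w \<bullet> y\<bar> + 1)) = 2 * (\<epsilon> * \<bar>w \<bullet> y\<bar>) + 2 * \<epsilon>" by (simp add: algebra_simps)
    ultimately have \<epsilon>w: "\<epsilon> * \<bar>w \<bullet> y\<bar> < v \<bullet> v" using \<epsilon> mult_nonneg_nonneg[of \<epsilon> "\<bar>w \<bullet> y\<bar>"] by linarith
    have fx: "f x = 0" using x U fr by blast
    have der: "((\<lambda>t. f (x + t *\<^sub>R z)) has_real_derivative (w \<bullet> z)) (at 0)" for z
      unfolding has_field_derivative_def
      by (rule has_derivative_eq_rhs[OF line_has_derivative[OF f[OF U(2)]]]) (auto simp: fun_eq_iff w_def)
    have ww: "0 < \<epsilon> * (w \<bullet> w)" using \<epsilon> w0 by simp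
    obtain d1 where d1: "0 < d1" "\<And>t. 0 < t \<Longrightarrow> t < d1 \<Longrightarrow> 0 < f (x + t *\<^sub>R (v + \<epsilon> *\<^sub>R w))"
      using DERIV_pos_inc_right[OF der, of "v + \<epsilon> *\<^sub>R w"] vw ww fx by (auto simp: inner_add_right inner_commute)
    obtain d2 where d2: "0 < d2" "\<And>t. 0 < t \<Longrightarrow> t < d2 \<Longrightarrow> f (x + t *\<^sub>R (v + (-\<epsilon>) *\<^sub>R w)) < 0"
      using DERIV_neg_dec_right[OF der, of "v + (-\<epsilon>) *\<^sub>R w"] vw ww fx
      by (auto simp: inner_diff_right inner_commute)
    obtain r where r: "0 < r" "ball x r \<subseteq> U" using U open_contains_ball by blast
    define L where "L = norm v + \<epsilon> * norm w + 1"
    have L: "0 < L" using \<epsilon> by (simp add: L_def add_nonneg_pos)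
    define q where "q = r / L"
    define t where "t = min (min d1 d2) q / 2"
    have t: "0 < t" "t < d1" "t < d2" "t < r / L"
      using d1(1) d2(1) divide_pos_pos[OF r(1) L] unfolding t_def q_def[symmetric] by auto
    have inU: "x + t *\<^sub>R (v + \<theta> *\<^sub>R w) \<in> U" if "\<bar>\<theta>\<bar> \<le> \<epsilon>" for \<theta>
    proof -
      have "norm (v + \<theta> *\<^sub>R w) \<le> norm v + \<bar>\<theta>\<bar> * norm w" by (metis norm_triangle_ineq norm_scaleR)
      also have "\<dots> \<le> L" using that by (simp add: L_def add_mono mult_right_mono add_increasing2)
      finally have "t * norm (v + \<theta> *\<^sub>R w) \<le> t * L" using t by (intro mult_left_mono) auto
      also have "\<dots> < r" using t L by (simp add: pos_less_divide_eq)
      finally show ?thesis using r(2) t by (auto simp: dist_norm subset_iff)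
    qed
    \<comment> \<open>The directional derivatives of \<open>f\<close> along v + \<epsilon> w and v -
      \<epsilon> w have opposite signs, so on the segment between the two displaced points
      \<open>f\<close> vanishes, and this zero is a boundary point.\<close>
    have "\<exists>\<theta>\<ge>-\<epsilon>. \<theta> \<le> \<epsilon> \<and> f (x + t *\<^sub>R (v + \<theta> *\<^sub>R w)) = 0"
    proof (rule IVT')
      show "f (x + t *\<^sub>R (v + (-\<epsilon>) *\<^sub>R w)) \<le> 0" using d2(2)[OF t(1,3)] by simp
      show "0 \<le> f (x + t *\<^sub>R (v + \<epsilon> *\<^sub>R w))" using d1(2)[OF t(1,2)] by simp
      have "continuous_on U f"
        by (rule has_derivative_continuous_on) (use f has_derivative_at_withinI in blast)
      then show "continuous_on {-\<epsilon>..\<epsilon>} (\<lambda>\<theta>. f (x + t *\<^sub>R (v + \<theta> *\<^sub>R w)))"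
        by (rule continuous_on_compose2) (use inU in \<open>auto intro!: continuous_intros\<close>)
    qed (use \<epsilon> in simp)
    then obtain \<theta> where "- \<epsilon> \<le> \<theta>" "\<theta> \<le> \<epsilon>" and f\<theta>: "f (x + t *\<^sub>R (v + \<theta> *\<^sub>R w)) = 0" by blast
    then have "\<bar>\<theta>\<bar> \<le> \<epsilon>" by (intro abs_leI) linarith+
    note \<theta> = this f\<theta>
    then have "x + t *\<^sub>R (v + \<theta> *\<^sub>R w) \<in> K" using fr inU[OF \<theta>(1)] frontier_subset by blast
    then have "(x + t *\<^sub>R (v + \<theta> *\<^sub>R w)) \<bullet> y \<le> 1" using y(1) by (auto simp: polar_body_def)
    then have "t * (v \<bullet> v + \<theta> * (w \<bullet> y)) \<le> 0" using y(2) vy by (simp add: inner_add_left)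
    moreover have "\<bar>\<theta> * (w \<bullet> y)\<bar> \<le> \<epsilon> * \<bar>w \<bullet> y\<bar>" using \<theta>(1) by (simp add: abs_mult mult_right_mono)
    then have "0 < v \<bullet> v + \<theta> * (w \<bullet> y)" using \<epsilon>w by linarith
    ultimately show False using t(1) by (simp add: mult_le_0_iff)
  qed
  then have yw: "y = ((y \<bullet> w) / (w \<bullet> w)) *\<^sub>R w" by (simp add: v_def)
  define c where "c = (y \<bullet> w) / (w \<bullet> w)"
  have yc: "y = c *\<^sub>R w" using yw by (simp add: c_def)
  then have "c * (x \<bullet> w) = 1" using y(2) by simp
  then show "x \<bullet> g x \<noteq> 0" "y = (1 / (x \<bullet> g x)) *\<^sub>R g x"
    using yc by (auto simp: w_def[symmetric] eq_divide_eq)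
qed

lemma C2_boundary_smooth_body:
  fixes K :: "(real ^ 'n) set"
  assumes "origin_body K" and C2: "C2_boundary K"
  shows "smooth_body K"
proof -
  interpret origin_body K by fact
  show ?thesis
  proof
    fix x y y' assume x: "x \<in> frontier K" and y: "y \<in> polar_body K" "y' \<in> polar_body K" "x \<bullet> y = 1" "x \<bullet> y' = 1"
    obtain U f g h where U: "open U" "x \<in> U" "C2_on U f g h" "\<forall>y\<in>U. g y \<noteq> 0" "frontier K \<inter> U = {y\<in>U. f y = 0}"
      using bspec[OF C2[unfolded C2_boundary_def] x] by (elim exE conjE) (rule that)
    have f: "(f has_derivative (\<lambda>v. g z \<bullet> v)) (at z)" if "z \<in> U" for z using U(3) that by (simp add: C2_on_def)
    have g: "g x \<noteq> 0" using U by blast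
    note par = supporting_functional_parallel_gradient(2)[OF x U(1,2) f g U(5)]
    show "y = y'" using par[OF _ y(1,3)] par[OF _ y(2,4)] by simp
  qed
qed

text \<open>All that is kept of a local equation of the boundary: its gradient, divided by its
  pairing with the point, is \<open>dual_point\<close>.\<close>

lemma C2_boundary_local:
  fixes K :: "(real ^ 'n) set"
  assumes K: "origin_body K" and C2: "C2_boundary K" and x0: "x0 \<in> frontier K"
  obtains U g h where "open U" "x0 \<in> U" "\<And>z. z \<in> U \<Longrightarrow> (g has_derivative (\<lambda>v. h z *v v)) (at z)"
    "continuous_on U h" "\<And>z. z \<in> frontier K \<inter> U \<Longrightarrow> z \<bullet> g z \<noteq> 0 \<and> dual_point K z = (1 / (z \<bullet> g z)) *\<^sub>R g z"
proof -
  interpret smooth_body K by (rule C2_boundary_smooth_body[OF K C2])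
  obtain U f g h where U: "open U" "x0 \<in> U" "C2_on U f g h" "\<forall>y\<in>U. g y \<noteq> 0" "frontier K \<inter> U = {y\<in>U. f y = 0}"
    using bspec[OF C2[unfolded C2_boundary_def] x0] by (elim exE conjE) (rule that)
  have f: "(f has_derivative (\<lambda>v. g z \<bullet> v)) (at z)" if "z \<in> U" for z using U(3) that by (simp add: C2_on_def)
  show thesis
  proof (rule that[of U g h])
    show "z \<bullet> g z \<noteq> 0 \<and> dual_point K z = (1 / (z \<bullet> g z)) *\<^sub>R g z" if "z \<in> frontier K \<inter> U" for z
    proof -
      have z: "z \<in> frontier K" "z \<in> U" "g z \<noteq> 0" using that U(4) by auto
      note par = supporting_functional_parallel_gradient[OF z(1) U(1) z(2) f z(3) U(5) dual_point(1)[of z] inner_dual_point[OF z(1)]]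
      show ?thesis using par by simp
    qed
    show "open U" "x0 \<in> U" "continuous_on U h" using U by (simp_all add: C2_on_def)
    show "(g has_derivative (\<lambda>v. h z *v v)) (at z)" if "z \<in> U" for z using U(3) that by (simp add: C2_on_def)
  qed
qed

text \<open>The local formula holds on the frontier only. Since \<open>dual_point\<close> is
  homogeneous of degree 0, composing the formula with the radial projection \<open>p\<close> extends
  it to a neighbourhood of \<open>x0\<close>.\<close>

lemma C2_boundary_dual_point_differentiable:
  fixes K :: "(real ^ 'n) set"
  assumes K: "origin_body K" and C2: "C2_boundary K" and x0: "x0 \<in> frontier K"
  obtains A where "(dual_point K has_derivative A) (at x0)"
proof -
  interpret smooth_body K by (rule C2_boundary_smooth_body[OF K C2])
  interpret polar: origin_body "polar_body K" by (rule origin_body_polar)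
  let ?g = "supp (polar_body K)"
  obtain U g h where U: "open U" "x0 \<in> U" "\<And>z. z \<in> U \<Longrightarrow> (g has_derivative (\<lambda>v. h z *v v)) (at z)"
    and G: "\<And>z. z \<in> frontier K \<inter> U \<Longrightarrow> z \<bullet> g z \<noteq> 0 \<and> dual_point K z = (1 / (z \<bullet> g z)) *\<^sub>R g z"
    by (rule C2_boundary_local[OF K C2 x0]) blast
  have x00: "x0 \<noteq> 0" by (rule frontier_nonzero[OF x0])
  have g1: "?g x0 = 1" using x0 by (simp add: frontier_iff)
  define p where "p z = (1 / ?g z) *\<^sub>R z" for z
  have p0: "p x0 = x0" by (simp add: p_def g1)
  have cp: "continuous_on (-{0}) p"
    unfolding p_def using polar.supp_pos by (intro continuous_intros polar.continuous_on_supp) force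
  define V where "V = -{0} \<inter> p -` U"
  have V: "open V" unfolding V_def by (rule continuous_open_preimage[OF cp]) (use U in auto)
  have x0V: "x0 \<in> V" using x00 U(2) p0 by (simp add: V_def)
  have pd: "p differentiable (at x0)"
    unfolding p_def inverse_eq_divide[symmetric]
    by (intro differentiable_scaleR differentiable_inverse differentiableI[OF gauge_has_derivative[OF x00]]
        differentiable_ident) (simp add: g1)
  define R where "R z = (1 / (z \<bullet> g z)) *\<^sub>R g z" for z
  have gd: "g differentiable (at x0)" using U differentiableI by blast
  have "x0 \<bullet> g x0 \<noteq> 0" using G x0 U(2) by blast
  then have "R differentiable (at x0)"
    unfolding R_def inverse_eq_divide[symmetric]
    by (intro differentiable_scaleR differentiable_inverse differentiable_inner gd differentiable_ident) simp
  then have "(R \<circ> p) differentiable (at x0)"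
    using pd p0 by (intro differentiable_chain_at) auto
  then obtain A where A: "((R \<circ> p) has_derivative A) (at x0)" by (auto simp: differentiable_def)
  have "(dual_point K has_derivative A) (at x0)"
  proof (rule has_derivative_transform_within_open[OF A V x0V])
    fix z assume z: "z \<in> V"
    then have z0: "z \<noteq> 0" and pU: "p z \<in> U" by (auto simp: V_def)
    have "p z \<in> frontier K" unfolding p_def by (rule frontier_scale[OF z0])
    then have "dual_point K (p z) = R (p z)" using G pU by (simp add: R_def)
    moreover have "dual_point K (p z) = dual_point K z"
      unfolding p_def using polar.supp_pos[OF z0] by (intro dual_point_scale) simp
    ultimately show "(R \<circ> p) z = dual_point K z" by simp
  qed
  then show thesis by (rule that)
qed

text \<open>On a small closed ball the Hessian is bounded, which makes the gradient Lipschitz by the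
  mean value inequality, and the pairing \<open>D\<close> stays away from 0. The quotient is then
  Lipschitz.\<close>

lemma C2_boundary_dual_point_locally_lipschitz:
  fixes K :: "(real ^ 'n) set"
  assumes K: "origin_body K" and C2: "C2_boundary K" and x0: "x0 \<in> frontier K"
  shows "\<exists>r>0. \<exists>M\<ge>0. \<forall>p\<in>frontier K \<inter> ball x0 r. \<forall>q\<in>frontier K \<inter> ball x0 r.
    norm (dual_point K p - dual_point K q) \<le> M * norm (p - q)"
proof -
  interpret smooth_body K by (rule C2_boundary_smooth_body[OF K C2])
  obtain U g h where U: "open U" "x0 \<in> U" "\<And>z. z \<in> U \<Longrightarrow> (g has_derivative (\<lambda>v. h z *v v)) (at z)"
    "continuous_on U h"
    and G: "\<And>z. z \<in> frontier K \<inter> U \<Longrightarrow> z \<bullet> g z \<noteq> 0 \<and> dual_point K z = (1 / (z \<bullet> g z)) *\<^sub>R g z"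
    by (rule C2_boundary_local[OF K C2 x0]) blast
  have gcont: "continuous_on U g"
    by (rule has_derivative_continuous_on) (use U(3) has_derivative_at_withinI in blast)
  define D where "D z = z \<bullet> g z" for z
  have Dcont: "continuous_on U D" unfolding D_def by (intro continuous_intros gcont)
  define c where "c = \<bar>D x0\<bar> / 2"
  have c: "0 < c" using G x0 U(2) by (auto simp: c_def D_def)
  have "open (U \<inter> D -` {s. c < \<bar>s\<bar>})"
    by (rule continuous_open_preimage[OF Dcont U(1)]) (intro open_Collect_less continuous_intros)
  moreover have "x0 \<in> U \<inter> D -` {s. c < \<bar>s\<bar>}" using U(2) c by (simp add: c_def)
  ultimately obtain r where r: "0 < r" "cball x0 r \<subseteq> U \<inter> D -` {s. c < \<bar>s\<bar>}" by (meson open_contains_cball)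
  have cU: "cball x0 r \<subseteq> U" using r by auto
  have cD: "c \<le> \<bar>D z\<bar>" if "z \<in> cball x0 r" for z using r(2) that by force
  have "bounded (h ` cball x0 r)" "bounded (g ` cball x0 r)"
    using U(4) gcont cU by (auto intro!: compact_imp_bounded compact_continuous_image intro: continuous_on_subset)
  then have "\<exists>B. \<forall>y\<in>h ` cball x0 r. norm y \<le> B" "\<exists>B. \<forall>y\<in>g ` cball x0 r. norm y \<le> B"
    by (simp_all only: bounded_iff)
  then obtain Bh Bg where "\<forall>y\<in>h ` cball x0 r. norm y \<le> Bh" "\<forall>y\<in>g ` cball x0 r. norm y \<le> Bg" by blast
  then have Bh: "\<And>z. z \<in> cball x0 r \<Longrightarrow> norm (h z) \<le> Bh"
    and Bg: "\<And>z. z \<in> cball x0 r \<Longrightarrow> norm (g z) \<le> Bg" by blast+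
  define L where "L = real CARD('n) * real CARD('n) * Bh"
  define Bp where "Bp = norm x0 + r"
  have Bp: "norm z \<le> Bp" if "z \<in> cball x0 r" for z
    using that norm_triangle_ineq[of x0 "z - x0"] by (simp add: Bp_def dist_norm norm_minus_commute)
  have x0c: "x0 \<in> cball x0 r" using r by simp
  have nn: "0 \<le> Bh" "0 \<le> Bg" "0 \<le> Bp"
    using order_trans[OF norm_ge_zero Bh[OF x0c]] order_trans[OF norm_ge_zero Bg[OF x0c]]
      order_trans[OF norm_ge_zero Bp[OF x0c]] by auto
  have L0: "0 \<le> L" using nn by (simp add: L_def)
  have gdz: "(g has_derivative (\<lambda>v. h z *v v)) (at z within cball x0 r)" if "z \<in> cball x0 r" for z
    by (rule has_derivative_at_withinI[OF U(3)[OF subsetD[OF cU that]]])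
  have hz: "onorm (\<lambda>v. h z *v v) \<le> L" if z: "z \<in> cball x0 r" for z
  proof -
    have comp: "\<bar>h z $ i $ j\<bar> \<le> Bh" for i j
      using component_le_norm_cart[of "h z $ i" j] Finite_Cartesian_Product.norm_nth_le[of "h z" i] Bh[OF z] by linarith
    show ?thesis
      unfolding L_def using onorm_le_matrix_component[of "h z", OF comp] .
  qed
  have glip: "norm (g p - g q) \<le> L * norm (p - q)" if "p \<in> cball x0 r" "q \<in> cball x0 r" for p q
    using differentiable_bound[OF convex_cball gdz hz that] .
  define X where "X = Bg + Bp * L"
  have X0: "0 \<le> X" using nn L0 by (simp add: X_def)
  define M where "M = L / c + Bg * X / (c * c)"
  have M0: "0 \<le> M" using nn L0 X0 c by (simp add: M_def)
  have "norm (dual_point K p - dual_point K q) \<le> M * norm (p - q)"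
    if p: "p \<in> frontier K \<inter> ball x0 r" and q: "q \<in> frontier K \<inter> ball x0 r" for p q
  proof -
    have pc: "p \<in> cball x0 r" and qc: "q \<in> cball x0 r" using p q by auto
    have Dp: "D p \<noteq> 0" "D q \<noteq> 0" using cD[OF pc] cD[OF qc] c by auto
    have eq: "dual_point K p - dual_point K q
        = (1 / D p) *\<^sub>R (g p - g q) + ((D q - D p) / (D p * D q)) *\<^sub>R g q"
    proof -
      have "(D q - D p) / (D p * D q) = 1 / D p - 1 / D q" using Dp by (simp add: diff_divide_distrib)
      moreover have "dual_point K p = (1 / D p) *\<^sub>R g p" "dual_point K q = (1 / D q) *\<^sub>R g q"
        using conjunct2[OF G[of p]] conjunct2[OF G[of q]] p q subsetD[OF cU pc] subsetD[OF cU qc]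
        by (simp_all add: D_def)
      ultimately show ?thesis by (simp add: scaleR_diff_right scaleR_diff_left)
    qed
    have "1 / \<bar>D p\<bar> \<le> 1 / c" by (rule frac_le) (use cD[OF pc] c in simp_all)
    then have i1: "\<bar>1 / D p\<bar> \<le> 1 / c" by (simp only: abs_divide abs_one)
    have 1: "norm ((1 / D p) *\<^sub>R (g p - g q)) \<le> (1 / c) * (L * norm (p - q))"
      unfolding norm_scaleR by (rule mult_mono[OF i1 glip[OF pc qc]]) (use c in simp_all)
    have "D q - D p = (q - p) \<bullet> g q + p \<bullet> (g q - g p)" by (simp add: D_def inner_diff_left inner_diff_right)
    then have "\<bar>D q - D p\<bar> \<le> \<bar>(q - p) \<bullet> g q\<bar> + \<bar>p \<bullet> (g q - g p)\<bar>" by (simp only: abs_triangle_ineq)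
    also have "\<dots> \<le> norm (q - p) * norm (g q) + norm p * norm (g q - g p)"
      by (rule add_mono[OF Cauchy_Schwarz_ineq2 Cauchy_Schwarz_ineq2])
    also have "\<dots> \<le> norm (q - p) * Bg + Bp * (L * norm (q - p))"
      by (rule add_mono[OF mult_left_mono[OF Bg[OF qc]] mult_mono[OF Bp[OF pc] glip[OF qc pc]]]) (use nn in simp_all)
    also have "\<dots> = (Bg + Bp * L) * norm (p - q)" 
      unfolding norm_minus_commute[of q p] by (simp add: algebra_simps)
    finally have Dd: "\<bar>D q - D p\<bar> \<le> X * norm (p - q)" unfolding X_def .
    have cc: "c * c \<le> \<bar>D p\<bar> * \<bar>D q\<bar>" by (rule mult_mono[OF cD[OF pc] cD[OF qc]]) (use c in simp_all)
    have i2: "\<bar>(D q - D p) / (D p * D q)\<bar> \<le> (X * norm (p - q)) / (c * c)"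
      unfolding abs_divide abs_mult by (rule frac_le[OF _ Dd _ cc]) (use c X0 in simp_all)
    have 2: "norm (((D q - D p) / (D p * D q)) *\<^sub>R g q) \<le> ((X * norm (p - q)) / (c * c)) * Bg"
      unfolding norm_scaleR by (rule mult_mono[OF i2 Bg[OF qc]]) (use nn X0 c in simp_all)
    have "norm (dual_point K p - dual_point K q) \<le> (1 / c) * (L * norm (p - q)) + ((X * norm (p - q)) / (c * c)) * Bg"
      unfolding eq by (rule norm_triangle_mono[OF 1 2])
    also have "\<dots> = M * norm (p - q)" unfolding M_def by (simp add: ring_distribs mult_ac)
    finally show ?thesis .
  qed
  then show ?thesis using r(1) M0 by blast
qed

text \<open>A Lebesgue number \<open>e\<close> of a finite cover puts any two points closer than
  \<open>e\<close> into one ball with a local Lipschitz constant. For points further apart the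
  boundedness of the polar body gives the constant 2 R / e.\<close>

lemma C2_boundary_dual_point_lipschitz:
  fixes K :: "(real ^ 'n) set"
  assumes K: "origin_body K" and C2: "C2_boundary K"
  obtains M where "0 < M" "\<And>p q. p \<in> frontier K \<Longrightarrow> q \<in> frontier K \<Longrightarrow> norm (dual_point K p - dual_point K q) \<le> M * norm (p - q)"
proof -
  interpret smooth_body K by (rule C2_boundary_smooth_body[OF K C2])
  interpret polar: origin_body "polar_body K" by (rule origin_body_polar)
  obtain r M where r: "\<And>x. x \<in> frontier K \<Longrightarrow> 0 < r x" and M0: "\<And>x. x \<in> frontier K \<Longrightarrow> 0 \<le> M x"
    and M: "\<And>x p q. x \<in> frontier K \<Longrightarrow> p \<in> frontier K \<inter> ball x (r x) \<Longrightarrow> q \<in> frontier K \<inter> ball x (r x) \<Longrightarrow>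
      norm (dual_point K p - dual_point K q) \<le> M x * norm (p - q)"
    using C2_boundary_dual_point_locally_lipschitz[OF K C2] by metis
  obtain F where F: "F \<subseteq> frontier K" "finite F" "frontier K \<subseteq> (\<Union>x\<in>F. ball x (r x))"
    by (rule compactE_image[OF compact_frontier, of "frontier K" "\<lambda>x. ball x (r x)"]) (use r in auto)
  obtain e where e: "0 < e" "\<And>x. x \<in> frontier K \<Longrightarrow> \<exists>B\<in>(\<lambda>x. ball x (r x)) ` F. ball x e \<subseteq> B"
    by (rule Heine_Borel_lemma[OF compact_frontier F(3)]) auto
  obtain R where R: "0 < R" "\<And>y. y \<in> polar_body K \<Longrightarrow> norm y \<le> R" by (rule polar.bound) blast
  define C where "C = sum M F + 2 * R / e"
  have MF: "M x \<le> sum M F" if "x \<in> F" for x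
    by (rule member_le_sum[OF that _ F(2)]) (use M0 F(1) in auto)
  have sM: "0 \<le> sum M F" by (intro sum_nonneg) (use M0 F(1) in auto)
  have "norm (dual_point K p - dual_point K q) \<le> C * norm (p - q)" if p: "p \<in> frontier K" and q: "q \<in> frontier K" for p q
  proof (cases "norm (p - q) < e")
    case True
    obtain x where x: "x \<in> F" "ball p e \<subseteq> ball x (r x)" using e(2)[OF p] by auto
    have "p \<in> ball p e" "q \<in> ball p e" using True e(1) by (auto simp: dist_norm)
    then have "p \<in> frontier K \<inter> ball x (r x)" "q \<in> frontier K \<inter> ball x (r x)" using p q x(2) by blast+
    then have "norm (dual_point K p - dual_point K q) \<le> M x * norm (p - q)" using M x(1) F(1) by blast
    also have "\<dots> \<le> C * norm (p - q)"
      using MF[OF x(1)] R(1) e(1) by (intro mult_right_mono) (auto simp: C_def add_increasing2)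
    finally show ?thesis .
  next
    case False
    have "norm (dual_point K p - dual_point K q) \<le> R + R"
      by (rule norm_triangle_le_diff) (intro add_mono R(2) dual_point(1))
    also have "\<dots> = (2 * R / e) * e" using e(1) by simp
    also have "\<dots> \<le> C * norm (p - q)"
      using False e(1) R(1) sM by (intro mult_mono) (auto simp: C_def)
    finally show ?thesis .
  qed
  moreover have "0 < C" using sM R(1) e(1) by (simp add: C_def add_nonneg_pos)
  ultimately show thesis by (rule that[rotated])
qed

section \<open>Positivity of the Hessian and smoothness of the polar body\<close>

context smooth_body begin

interpretation polar: origin_body "polar_body K" by (rule origin_body_polar)

lemma dual_point_derivative_symmetric:
  assumes x: "x \<noteq> 0" and A: "(dual_point K has_derivative A) (at x)"
  shows "A u \<bullet> v = A v \<bullet> u"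
  by (rule gradient_derivative_symmetric[OF _ _ gauge_has_derivative A, of "-{0}"]) (use x in auto)

lemma dual_point_derivative_radial:
  assumes x: "x \<noteq> 0" and A: "(dual_point K has_derivative A) (at x)"
  shows "A x = 0"
proof -
  have "((\<lambda>t. dual_point K (x + t *\<^sub>R x)) has_derivative (\<lambda>t. 0)) (at 0)"
  proof (rule has_derivative_transform_within_open[of "\<lambda>t. dual_point K x" _ _ UNIV "{-1<..<1::real}"])
    fix t :: real assume "t \<in> {-1<..<1}"
    then have "dual_point K ((1 + t) *\<^sub>R x) = dual_point K x" by (intro dual_point_scale) auto
    then show "dual_point K x = dual_point K (x + t *\<^sub>R x)" by (simp add: algebra_simps)
  qed auto
  from has_derivative_unique[OF line_has_derivative[OF A, of x] this]
  have "(1::real) *\<^sub>R A x = 0" by metis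
  then show ?thesis by simp
qed

lemma dual_point_derivative_nonneg:
  assumes A: "(dual_point K has_derivative A) (at x)"
  shows "0 \<le> A v \<bullet> v"
proof (rule ccontr)
  assume "\<not> 0 \<le> A v \<bullet> v"
  then obtain d where d: "0 < d" "\<And>h. 0 < h \<Longrightarrow> h < d \<Longrightarrow> dual_point K (x + (0 + h) *\<^sub>R v) \<bullet> v < dual_point K (x + 0 *\<^sub>R v) \<bullet> v"
    using DERIV_neg_dec_right[OF line_inner_has_real_derivative[OF A, of v v]] by auto
  have "0 \<le> (dual_point K (x + (d/2) *\<^sub>R v) - dual_point K x) \<bullet> ((d/2) *\<^sub>R v)"
    using dual_point_monotone[of "x + (d/2) *\<^sub>R v" x] by simp
  then have "0 \<le> (dual_point K (x + (d/2) *\<^sub>R v) - dual_point K x) \<bullet> v" using d(1) by (simp add: zero_le_mult_iff)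
  then show False using d(2)[of "d/2"] d(1) by (simp add: inner_diff_left)
qed

text \<open>A positive semidefinite symmetric form vanishes at v only if v lies in its kernel:
  otherwise the form would be negative at v - t (A v) for the small \<open>t\<close> chosen
  below.\<close>

lemma dual_point_derivative_pos:
  assumes x: "x \<noteq> 0" and A: "(dual_point K has_derivative A) (at x)" and v: "A v \<noteq> 0"
  shows "0 < A v \<bullet> v"
proof (rule ccontr)
  interpret A: bounded_linear A by (rule has_derivative_bounded_linear[OF A])
  assume "\<not> 0 < A v \<bullet> v"
  then have 0: "A v \<bullet> v = 0" using dual_point_derivative_nonneg[OF A, of v] by simp
  define c where "c = A (A v) \<bullet> A v"
  have c: "0 \<le> c" unfolding c_def by (rule dual_point_derivative_nonneg[OF A])
  define t where "t = (A v \<bullet> A v) / (c + 1)"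
  have t: "0 < t" using v c by (simp add: t_def)
  have "0 \<le> A (v - t *\<^sub>R A v) \<bullet> (v - t *\<^sub>R A v)" by (rule dual_point_derivative_nonneg[OF A])
  also have "\<dots> = t * (t * c - 2 * (A v \<bullet> A v))"
    using 0 dual_point_derivative_symmetric[OF x A, of "A v" v]
    by (simp add: A.diff A.scaleR inner_diff_left inner_diff_right c_def algebra_simps power2_eq_square)
  finally have "2 * (A v \<bullet> A v) \<le> t * c" using t by (simp add: zero_le_mult_iff)
  moreover have "t * c \<le> A v \<bullet> A v"
  proof -
    have "t * c \<le> t * (c + 1)" using t by simp
    also have "\<dots> = A v \<bullet> A v" using c by (simp add: t_def)
    finally show ?thesis .
  qed
  moreover have "0 < A v \<bullet> A v" using v by simp
  ultimately show False by linarith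
qed

end

text \<open>Both summands are nonnegative. If both vanish, v is a tangential vector killed by
  \<open>A\<close>, hence in the kernel of the operator whose determinant is the curvature.
  Subtracting a multiple of x0, which \<open>A\<close> also kills, reduces to the tangential
  case.\<close>

lemma positive_curvature_hessian_pos:
  fixes K :: "(real ^ 'n) set"
  assumes K: "smooth_body K" and x0: "x0 \<in> frontier K" and A: "(dual_point K has_derivative A) (at x0)"
    and pos: "0 < gaussian_curvature K x0" and v: "v \<noteq> 0"
  shows "0 < A v \<bullet> v + (dual_point K x0 \<bullet> v)\<^sup>2"
proof -
  interpret smooth_body K by (rule K)
  interpret A: bounded_linear A by (rule has_derivative_bounded_linear[OF A])
  let ?G = "dual_point K x0"
  have x00: "x0 \<noteq> 0" by (rule frontier_nonzero[OF x0])
  have Ax0: "A x0 = 0" by (rule dual_point_derivative_radial[OF x00 A])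
  show ?thesis
  proof (cases "A v = 0")
    case False
    then show ?thesis using dual_point_derivative_pos[OF x00 A] by (simp add: add_pos_nonneg)
  next
    case True
    define w where "w = v - (?G \<bullet> v) *\<^sub>R x0"
    have Gw: "?G \<bullet> w = 0" using inner_dual_point[OF x0] by (simp add: w_def inner_diff_right inner_commute)
    have Aw: "A w = 0" using True Ax0 by (simp add: w_def A.diff A.scaleR)
    define N where "N = outer_normal K x0"
    define B where "B v = (1 / norm ?G) *\<^sub>R tangential N (A (tangential N v)) + (v \<bullet> N) *\<^sub>R N" for v
    have linP: "linear (tangential N)"
      by (rule linearI) (auto simp: tangential_def algebra_simps inner_add_left)
    have linB: "linear B"
      unfolding B_def by (rule linearI)
       (auto simp: linear_add[OF linP] linear_cmul[OF linP] A.add A.scaleR inner_add_left algebra_simps)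
    have "det (matrix B) \<noteq> 0" using gaussian_curvature_eq[OF K x0 A] pos by (simp add: B_def[abs_def] N_def)
    then have inj: "inj B" using det_nz_iff_inj[OF linB] by simp
    have wN: "w \<bullet> N = 0" unfolding N_def outer_normal_eq[OF x0] using Gw by (simp add: inner_commute)
    then have "B w = 0" using Aw linear_0[OF linP] by (simp add: B_def tangential_def)
    then have "w = 0" using inj linear_0[OF linB] by (metis injD)
    then have "?G \<bullet> v \<noteq> 0" using v by (auto simp: w_def)
    then show ?thesis using True by simp
  qed
qed

text \<open>Two boundary points with the same supporting functional y span a segment in the boundary
  on which \<open>dual_point\<close> is constantly y. In the direction of the segment both the
  derivative of \<open>dual_point\<close> and y vanish, against positivity of the Hessian.\<close>

lemma positive_curvature_polar_smooth:
  fixes K :: "(real ^ 'n) set"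
  assumes K: "smooth_body K" and diff: "\<And>x. x \<in> frontier K \<Longrightarrow> dual_point K differentiable (at x)"
    and pos: "\<And>x. x \<in> frontier K \<Longrightarrow> 0 < gaussian_curvature K x"
  shows "smooth_body (polar_body K)"
proof -
  interpret smooth_body K by (rule K)
  interpret polar: origin_body "polar_body K" by (rule origin_body_polar)
  show ?thesis
  proof
    fix y x x' assume y: "y \<in> frontier (polar_body K)" and "x \<in> polar_body (polar_body K)" "x' \<in> polar_body (polar_body K)"
      and yx: "y \<bullet> x = 1" "y \<bullet> x' = 1"
    then have x: "x \<in> K" "x' \<in> K" by (auto simp: bipolar)
    have yP: "y \<in> polar_body K" using polar.frontier_subset y by auto
    have fr: "z \<in> frontier K" if z: "z \<in> K" "y \<bullet> z = 1" for z
      using polar.supp_upper[OF yP, of z] z mem_iff[of z] by (simp add: frontier_iff inner_commute)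
    have Gz: "dual_point K z = y" if z: "z \<in> K" "y \<bullet> z = 1" for z
      using fr[OF z] z yP frontier_nonzero[OF fr[OF z]]
      by (intro dual_point_eqI) (auto simp: frontier_iff inner_commute)
    have xf: "x \<in> frontier K" using fr x yx by blast
    obtain A where A: "(dual_point K has_derivative A) (at x)" using diff[OF xf] by (auto simp: differentiable_def)
    show "x = x'"
    proof (rule ccontr)
      assume ne: "x \<noteq> x'"
      define v where "v = x' - x"
      have Gl: "dual_point K (x + t *\<^sub>R v) = y" if "0 \<le> t" "t \<le> 1" for t
      proof (rule Gz)
        have "x + t *\<^sub>R v = (1 - t) *\<^sub>R x + t *\<^sub>R x'" by (simp add: v_def algebra_simps)
        then show "x + t *\<^sub>R v \<in> K" using convexD[OF convex x, of "1 - t" t] that by simp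
        show "y \<bullet> (x + t *\<^sub>R v) = 1" using yx by (simp add: v_def inner_add_right inner_diff_right)
      qed
      have "A v = 0"
      proof (rule ccontr)
        assume "A v \<noteq> 0"
        then have "0 < A v \<bullet> A v" by simp
        from DERIV_pos_inc_right[OF line_inner_has_real_derivative[OF A, of v "A v"] this]
        obtain d where d: "0 < d" "\<And>h. 0 < h \<Longrightarrow> h < d \<Longrightarrow> dual_point K (x + 0 *\<^sub>R v) \<bullet> A v < dual_point K (x + (0 + h) *\<^sub>R v) \<bullet> A v"
          by auto
        define h where "h = min (d/2) 1"
        have "0 < h" "h < d" "h \<le> 1" using d(1) by (auto simp: h_def)
        then show False using d(2)[of h] Gl[of 0] Gl[of h] by simp
      qed
      moreover have "dual_point K x \<bullet> v = 0" using Gl[of 0] yx by (simp add: v_def inner_diff_right)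
      ultimately show False
        using positive_curvature_hessian_pos[OF K xf A pos[OF xf], of v] ne by (simp add: v_def)
    qed
  qed
qed

lemma dual_point_polar:
  assumes K: "smooth_body K" "smooth_body (polar_body K)" and x: "x \<noteq> 0"
  shows "dual_point (polar_body K) (dual_point K x) = (1 / supp (polar_body K) x) *\<^sub>R x"
proof -
  interpret smooth_body K by fact
  interpret polar: smooth_body "polar_body K" by fact
  have g: "0 < supp (polar_body K) x" by (rule polar.supp_pos[OF x])
  show ?thesis
  proof (rule polar.dual_point_eqI[OF dual_point_nonzero[OF x]])
    show "(1 / supp (polar_body K) x) *\<^sub>R x \<in> polar_body (polar_body K)"
      using frontier_scale[OF x] frontier_subset by (auto simp: bipolar)
    show "dual_point K x \<bullet> (1 / supp (polar_body K) x) *\<^sub>R x = supp (polar_body (polar_body K)) (dual_point K x)"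
      using dual_point_frontier[OF x] dual_point(2)[of x] g by (simp add: polar.frontier_iff inner_commute)
  qed
qed

text \<open>The gradients of \<open>\<phi>\<^sup>2 / 2\<close> and \<open>h\<^sup>2 / 2\<close>, for the gauge \<open>\<phi>\<close> and the support function \<open>h\<close>
  of \<open>K\<close>, are inverse to each other (Legendre duality); hence so are their Hessians.\<close>

lemma curvature_polar:
  fixes K :: "(real ^ 'n) set"
  assumes K: "smooth_body K" "smooth_body (polar_body K)"
    and x0: "x0 \<in> frontier K" and A: "(dual_point K has_derivative A) (at x0)"
    and pos: "0 < gaussian_curvature K x0"
  shows "det (matrix (\<lambda>v. A v + (dual_point K x0 \<bullet> v) *\<^sub>R dual_point K x0))
    * (norm x0 ^ (CARD('n) + 1) * gaussian_curvature (polar_body K) (dual_point K x0)) = 1"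
    (is "det (matrix ?Q) * _ = 1")
proof -
  interpret smooth_body K by fact
  interpret polar: smooth_body "polar_body K" by fact
  interpret A: bounded_linear A by (rule has_derivative_bounded_linear[OF A])
  let ?g = "supp (polar_body K)" and ?P = "polar_body K"
  define y where "y = dual_point K x0"
  have x00: "x0 \<noteq> 0" by (rule frontier_nonzero[OF x0])
  have y0: "y \<noteq> 0" unfolding y_def by (rule dual_point_nonzero[OF x00])
  have g1: "?g x0 = 1" using x0 by (simp add: frontier_iff)
  have yf: "y \<in> frontier ?P" unfolding y_def by (rule dual_point_frontier[OF x00])
  have h1: "supp (polar_body ?P) y = 1" using yf by (simp add: polar.frontier_iff)
  have Gy: "dual_point ?P y = x0" unfolding y_def by (subst dual_point_polar[OF K x00]) (simp add: g1)
  define \<Gamma> where "\<Gamma> x = ?g x *\<^sub>R dual_point K x" for x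
  define \<Gamma>' where "\<Gamma>' y = supp (polar_body ?P) y *\<^sub>R dual_point ?P y" for y
  have inv: "\<Gamma> (\<Gamma>' z) = z" if z: "z \<noteq> 0" for z
  proof -
    have hz: "0 < supp K z" by (rule supp_pos[OF z])
    have "dual_point K (dual_point ?P z) = (1 / supp K z) *\<^sub>R z"
      using dual_point_polar[of ?P z] K z by (simp add: bipolar)
    then have "dual_point K (\<Gamma>' z) = (1 / supp K z) *\<^sub>R z"
      unfolding \<Gamma>'_def using hz by (simp add: dual_point_scale bipolar)
    moreover have "?g (\<Gamma>' z) = supp K z"
      using polar.dual_point_frontier[OF z] hz unfolding \<Gamma>'_def
      by (simp add: polar.supp_scale bipolar frontier_iff)
    ultimately show ?thesis using hz by (simp add: \<Gamma>_def)
  qed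
  have \<Gamma>'y: "\<Gamma>' y = x0" by (simp add: \<Gamma>'_def h1 Gy)
  have linQ: "linear ?Q" by (rule linearI) (auto simp: A.add A.scaleR inner_add_right algebra_simps)
  have injQ: "inj ?Q"
  proof -
    have "v = 0" if "?Q v = 0" for v
    proof (rule ccontr)
      assume "v \<noteq> 0"
      then have "0 < A v \<bullet> v + (dual_point K x0 \<bullet> v)\<^sup>2"
        by (rule positive_curvature_hessian_pos[OF K(1) x0 A pos])
      also have "\<dots> = ?Q v \<bullet> v" by (simp add: inner_add_left power2_eq_square)
      finally show False using that by simp
    qed
    then show ?thesis using linear_injective_0[OF linQ] by blast
  qed
  obtain Qi where Qi: "linear Qi" "Qi \<circ> ?Q = id"
    using linear_injective_left_inverse[OF linQ injQ] by auto
  have \<Gamma>d: "(\<Gamma> has_derivative ?Q) (at x0)"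
    unfolding \<Gamma>_def
    by (rule has_derivative_eq_rhs[OF has_derivative_scaleR[OF gauge_has_derivative[OF x00] A]])
      (auto simp: fun_eq_iff g1)
  \<comment> \<open>The inverse function rule needs only that \<Gamma> inverts \<Gamma>' near y and
    that \<Gamma>' is continuous there; no differentiability of the dual map is presupposed.\<close>
  have \<Gamma>'d: "(\<Gamma>' has_derivative Qi) (at y)"
  proof (rule has_derivative_inverse_basic[where f=\<Gamma> and f'="?Q" and T="-{0}"])
    show "(\<Gamma> has_derivative ?Q) (at (\<Gamma>' y))" using \<Gamma>d by (simp add: \<Gamma>'y)
    show "bounded_linear Qi" using Qi(1) by (simp add: linear_conv_bounded_linear)
    have "isCont (supp (polar_body ?P)) y"
      using continuous_on_supp[of UNIV] by (simp add: bipolar continuous_on_eq_continuous_at)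
    then show "continuous (at y) \<Gamma>'" unfolding \<Gamma>'_def
      by (intro continuous_scaleR polar.isCont_dual_point y0)
    show "Qi \<circ> ?Q = id" by (rule Qi(2))
    show "open (-{0::real^'n})" "y \<in> -{0}" using y0 by auto
    show "\<Gamma> (\<Gamma>' z) = z" if "z \<in> -{0}" for z using inv that by simp
  qed
  have hd: "(supp (polar_body ?P) has_derivative (\<lambda>v. x0 \<bullet> v)) (at y)"
    using polar.gauge_has_derivative[OF y0] by (simp add: Gy)
  \<comment> \<open>The product rule for support function times \<open>dual_point\<close>
    contributes a rank-one term, which is removed to isolate the derivative of
    \<open>dual_point\<close> of the polar body.\<close>
  define A' where "A' v = Qi v - (x0 \<bullet> v) *\<^sub>R x0" for v
  have "((\<lambda>z. inverse (supp (polar_body ?P) z) *\<^sub>R \<Gamma>' z) has_derivative A') (at y)"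
    by (rule has_derivative_eq_rhs[OF has_derivative_scaleR[OF Deriv.has_derivative_inverse[OF _ hd] \<Gamma>'d]])
      (auto simp: fun_eq_iff h1 \<Gamma>'y A'_def)
  then have A': "(dual_point ?P has_derivative A') (at y)"
  proof (rule has_derivative_transform_within_open[of _ _ _ _ "-{0}"])
    fix z :: "real ^ 'n" assume "z \<in> -{0}"
    then show "inverse (supp (polar_body ?P) z) *\<^sub>R \<Gamma>' z = dual_point ?P z"
      using supp_pos[of z] by (simp add: \<Gamma>'_def bipolar)
  qed (use y0 in auto)
  have "det (matrix (\<lambda>v. A' v + (dual_point ?P y \<bullet> v) *\<^sub>R dual_point ?P y))
      = norm (dual_point ?P y) ^ (CARD('n) + 1) * gaussian_curvature ?P y"
    by (rule det_hessian_eq_curvature[OF K(2) yf A' polar.dual_point_derivative_symmetric[OF y0 A']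
        polar.dual_point_derivative_radial[OF y0 A']])
  then have "det (matrix Qi) = norm x0 ^ (CARD('n) + 1) * gaussian_curvature ?P y"
    by (simp add: Gy A'_def)
  moreover have "det (matrix Qi) * det (matrix ?Q) = 1"
  proof -
    have "det (matrix Qi) * det (matrix ?Q) = det (matrix (Qi \<circ> ?Q))"
      unfolding matrix_compose[OF linQ Qi(1)] by (rule det_mul[symmetric])
    also have "\<dots> = 1" unfolding Qi(2) by simp
    finally show ?thesis .
  qed
  ultimately show ?thesis by (simp add: y_def mult.commute)
qed

section \<open>Surface measure and cone measure\<close>

definition radial :: "'a::euclidean_space set \<Rightarrow> 'a \<Rightarrow> 'a" where
  "radial K x = (1 / supp (polar_body K) x) *\<^sub>R x"

definition cone_over :: "'a::euclidean_space set \<Rightarrow> 'a set \<Rightarrow> 'a set" where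
  "cone_over K E = {x \<in> K. x \<noteq> 0 \<and> radial K x \<in> E}"

text \<open>The weight is the distance of the tangent hyperplane from the origin: x \<bullet>
  \<open>dual_point K x\<close> = 1 on the frontier, and \<open>dual_point\<close> points in the
  normal direction.\<close>

definition support_measure :: "(real ^ 'n) set \<Rightarrow> (real ^ 'n) measure" where
  "support_measure K = density (hausdorff_measure (CARD('n) - 1))
     (\<lambda>x. indicator (frontier K) x * ennreal (1 / norm (dual_point K x)))"

text \<open>The factor n compensates the 1/n in the volume of a cone, so that this becomes equal to
  \<open>support_measure\<close>.\<close>

definition cone_measure :: "(real ^ 'n) set \<Rightarrow> (real ^ 'n) measure" where
  "cone_measure K = distr (density lborel (\<lambda>x. ennreal (real CARD('n)) * indicator (K - {0}) x)) borel (radial K)"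

context origin_body begin

interpretation polar: origin_body "polar_body K" by (rule origin_body_polar)

lemma radial_scale: "0 < c \<Longrightarrow> radial K (c *\<^sub>R x) = radial K x"
  by (simp add: radial_def polar.supp_scale)

lemma radial_frontier: "x \<in> frontier K \<Longrightarrow> radial K x = x"
  by (simp add: radial_def frontier_iff)

lemma radial_in_frontier: "x \<noteq> 0 \<Longrightarrow> radial K x \<in> frontier K"
  unfolding radial_def by (rule frontier_scale)

lemma measurable_radial: "radial K \<in> borel_measurable borel"
proof (rule borel_measurable_continuous_countable_exceptions[of "{0}"])
  show "continuous_on (- {0}) (radial K)"
    unfolding radial_def using polar.supp_pos by (intro continuous_intros polar.continuous_on_supp) force
qed simp

lemma sets_cone_over: "E \<in> sets borel \<Longrightarrow> cone_over K E \<in> sets borel"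
proof -
  assume "E \<in> sets borel"
  then have "radial K -` E \<in> sets borel" using measurable_sets[OF measurable_radial] by force
  moreover have "cone_over K E = K \<inter> -{0} \<inter> (radial K -` E)" by (auto simp: cone_over_def)
  ultimately show ?thesis using compact_imp_closed[OF compact] by auto
qed

end

lemma (in smooth_body) measurable_dual_point: "dual_point K \<in> borel_measurable borel"
  by (rule borel_measurable_continuous_countable_exceptions[of "{0}"])
    (auto intro: continuous_on_dual_point)

lemma emeasure_lborel_le_scaled:
  fixes A B :: "'a::euclidean_space set"
  assumes "B \<in> sets borel" "0 < c" "\<And>x. x \<in> A \<Longrightarrow> (1 / c) *\<^sub>R x \<in> B"
  shows "emeasure lborel A \<le> ennreal (c ^ DIM('a)) * emeasure lborel B"
proof -
  have "{x. (1 / c) *\<^sub>R x \<in> B} = (\<lambda>x. (1 / c) *\<^sub>R x) -` B \<inter> space borel" by auto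
  also have "\<dots> \<in> sets borel" by (rule measurable_sets[OF _ assms(1)]) measurable
  finally have "{x. (1 / c) *\<^sub>R x \<in> B} \<in> sets lborel" by simp
  then have "emeasure lborel A \<le> emeasure lborel {x. (1 / c) *\<^sub>R x \<in> B}"
    by (intro emeasure_mono) (use assms(3) in auto)
  also have "\<dots> = ennreal (c ^ DIM('a)) * emeasure lborel B"
    by (rule emeasure_lborel_scale[OF assms(1,2)])
  finally show ?thesis .
qed

context
  fixes K :: "(real ^ 'n) set"
  assumes K: "smooth_body K" and card: "2 \<le> CARD('n)"
begin

interpretation smooth_body K by (rule K)
interpretation polar: origin_body "polar_body K" by (rule origin_body_polar)

lemma frontier_borel: "frontier K \<in> sets borel"
  using compact_imp_closed[OF compact_frontier] by simp

lemma sets_support_measure [simp]: "sets (support_measure K) = sets borel"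
  by (simp add: support_measure_def)

lemma sets_cone_measure [simp]: "sets (cone_measure K) = sets borel"
  by (simp add: cone_measure_def)

lemma measurable_support_density:
  "(\<lambda>x. indicator (frontier K) x * ennreal (1 / norm (dual_point K x))) \<in> borel_measurable borel"
  using measurable_dual_point frontier_borel by measurable

lemma emeasure_cone_measure:
  assumes E: "E \<in> sets borel"
  shows "emeasure (cone_measure K) E = ennreal (real CARD('n)) * emeasure lborel (cone_over K E)"
proof -
  have K0: "K - {0} \<in> sets borel" using compact_imp_closed[OF compact] by auto
  have rE: "radial K -` E \<in> sets borel" using measurable_sets[OF measurable_radial E] by simp
  have "emeasure (cone_measure K) E
      = emeasure (density lborel (\<lambda>x. ennreal (real CARD('n)) * indicator (K - {0}) x)) (radial K -` E)"
    unfolding cone_measure_def using measurable_radial E by (subst emeasure_distr) auto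
  also have "\<dots> = (\<integral>\<^sup>+x. ennreal (real CARD('n)) * indicator (K - {0}) x * indicator (radial K -` E) x \<partial>lborel)"
    using rE K0 by (subst emeasure_density) auto
  also have "\<dots> = (\<integral>\<^sup>+x. ennreal (real CARD('n)) * indicator (cone_over K E) x \<partial>lborel)"
    by (intro nn_integral_cong) (auto simp: cone_over_def indicator_def)
  also have "\<dots> = ennreal (real CARD('n)) * emeasure lborel (cone_over K E)"
    using sets_cone_over[OF E] by (subst nn_integral_cmult_indicator) auto
  finally show ?thesis .
qed

lemma emeasure_support_measure_bounds:
  assumes E: "E \<in> sets borel" "E \<subseteq> frontier K" and ab: "0 \<le> a"
    and le: "\<And>x. x \<in> E \<Longrightarrow> a \<le> 1 / norm (dual_point K x) \<and> 1 / norm (dual_point K x) \<le> b"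
  shows "emeasure (support_measure K) E \<le> ennreal b * hausdorff_outer (CARD('n) - 1) E"
    and "ennreal a * hausdorff_outer (CARD('n) - 1) E \<le> emeasure (support_measure K) E"
proof -
  have eq: "emeasure (support_measure K) E = (\<integral>\<^sup>+x. indicator (frontier K) x * ennreal (1 / norm (dual_point K x)) * indicator E x
      \<partial>hausdorff_measure (CARD('n) - 1))"
    unfolding support_measure_def
    by (rule emeasure_density) (use E measurable_support_density in \<open>auto cong: measurable_cong_sets\<close>)
  have H: "emeasure (hausdorff_measure (CARD('n) - 1)) E = hausdorff_outer (CARD('n) - 1) E"
    by (rule emeasure_hausdorff_measure) (use card E in auto)
  have cst: "(\<integral>\<^sup>+x. ennreal c * indicator E x \<partial>hausdorff_measure (CARD('n) - 1)) = ennreal c * hausdorff_outer (CARD('n) - 1) E" for c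
    using E(1) by (subst nn_integral_cmult_indicator) (simp_all only: H sets_hausdorff_measure)
  show "emeasure (support_measure K) E \<le> ennreal b * hausdorff_outer (CARD('n) - 1) E"
    unfolding eq cst[symmetric]
    by (intro nn_integral_mono) (use le E in \<open>auto simp: indicator_def intro!: ennreal_leI\<close>)
  show "ennreal a * hausdorff_outer (CARD('n) - 1) E \<le> emeasure (support_measure K) E"
    unfolding eq cst[symmetric]
    by (intro nn_integral_mono) (use le E in \<open>auto simp: indicator_def intro!: ennreal_leI\<close>)
qed

text \<open>Near \<open>x0\<close> the radial projection of the boundary onto the tangent hyperplane at \<open>x0\<close> is almost
  isometric, and it maps cones over boundary pieces to cones over flat pieces.\<close>

lemma support_cone_measure_flat:
  assumes x0: "x0 \<in> frontier K" and \<eta>: "0 < \<eta>" "\<eta> \<le> 1/4"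
    and R: "0 < R" "\<And>x. x \<in> K \<Longrightarrow> norm x \<le> R"
    and E: "E \<in> sets borel" "E \<subseteq> frontier K"
    and near: "\<And>x. x \<in> E \<Longrightarrow> \<bar>x \<bullet> dual_point K x0 - 1\<bar> \<le> \<eta>"
      "\<And>x. x \<in> E \<Longrightarrow> R * norm (dual_point K x - dual_point K x0) \<le> \<eta>"
      "\<And>x. x \<in> E \<Longrightarrow> norm (dual_point K x0) \<le> (1 + \<eta>) * norm (dual_point K x)"
      "\<And>x. x \<in> E \<Longrightarrow> norm (dual_point K x) \<le> (1 + \<eta>) * norm (dual_point K x0)"
  defines "\<theta> \<equiv> (1 + 6 * \<eta>) ^ (2 * CARD('n))"
  shows "emeasure (support_measure K) E \<le> ennreal \<theta> * emeasure (cone_measure K) E"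
    and "emeasure (cone_measure K) E \<le> ennreal \<theta> * emeasure (support_measure K) E"
proof -
  let ?m = "CARD('n) - 1"
  define G0 where "G0 = dual_point K x0"
  have G00: "G0 \<noteq> 0" unfolding G0_def by (rule dual_point_nonzero[OF frontier_nonzero[OF x0]])
  define d where "d = 1 / norm G0"
  have d: "0 < d" using G00 by (simp add: d_def)
  \<comment> \<open>\<open>N\<close> is the normal at \<open>x0\<close> and \<open>d\<close> the
    distance of the tangent hyperplane from the origin; this hyperplane is the slice of height
    \<open>d\<close>.\<close>
  define N where "N = d *\<^sub>R G0"
  have N1: "norm N = 1" using G00 by (simp add: N_def d_def)
  have Nx: "N \<bullet> x = d * (x \<bullet> G0)" for x by (simp add: N_def inner_commute)
  obtain \<Psi> where \<Psi>: "normal_coordinates N \<Psi>" by (rule normal_coordinates_exist[OF card N1])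
  note P = normal_coordinates_linear[OF card \<Psi>] normal_coordinates_surj[OF card \<Psi>]
    normal_coordinates_inner_axis[OF card \<Psi>] measurable_normal_coordinates[OF card \<Psi>]
  define B where "B = {w. radial K (\<Psi> (d, w)) \<in> E}"
  have B: "B \<in> sets borel"
  proof -
    have "(\<lambda>w. radial K (\<Psi> (d, w))) \<in> borel_measurable borel"
      by (rule measurable_compose[OF _ measurable_radial], rule measurable_compose[OF _ P(4)]) measurable
    from measurable_sets[OF this E(1)] show ?thesis by (simp add: B_def vimage_def)
  qed
  \<comment> \<open>The cone with apex 0 over the flat piece \<open>B\<close>, which replaces the
    cone over the curved piece \<open>E\<close>.\<close>
  define C where "C = {z. 0 < N \<bullet> z \<and> N \<bullet> z \<le> d \<and> radial K z \<in> E}"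
  have C: "C \<in> sets borel"
  proof -
    have "radial K -` E \<in> sets borel" using measurable_sets[OF measurable_radial E(1)] by simp
    moreover have "{z. 0 < N \<bullet> z} \<in> sets borel" by (simp add: open_halfspace_gt)
    moreover have "{z. N \<bullet> z \<le> d} \<in> sets borel" by (simp add: closed_halfspace_le)
    moreover have "C = {z. 0 < N \<bullet> z} \<inter> {z. N \<bullet> z \<le> d} \<inter> radial K -` E" by (auto simp: C_def)
    ultimately show ?thesis by auto
  qed
  have coneC: "ennreal (real CARD('n)) * emeasure lborel C = ennreal d * emeasure lborel B"
  proof (rule emeasure_cone[OF card \<Psi> B d C])
    fix t w
    show "\<Psi> (t, w) \<in> C \<longleftrightarrow> 0 < t \<and> t \<le> d \<and> (d / t) *\<^sub>R w \<in> B"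
    proof (cases "0 < t")
      case True
      have "\<Psi> (d, (d / t) *\<^sub>R w) = (d / t) *\<^sub>R \<Psi> (t, w)"
        using linear_cmul[OF P(1), of "d / t" "(t, w)"] True by simp
      then have "radial K (\<Psi> (d, (d / t) *\<^sub>R w)) = radial K (\<Psi> (t, w))"
        using True d by (simp add: radial_scale)
      then show ?thesis using True by (simp add: C_def B_def P(3))
    qed (simp add: C_def P(3))
  qed
  define \<pi> where "\<pi> x = (1 / (x \<bullet> G0)) *\<^sub>R x" for x
  have a: "1 - \<eta> \<le> x \<bullet> G0" "x \<bullet> G0 \<le> 1 + \<eta>" "0 < x \<bullet> G0" if "x \<in> E" for x
    using near(1)[OF that] \<eta> by (auto simp: G0_def abs_le_iff)
  have piE: "\<pi> ` E = (\<lambda>w. \<Psi> (d, w)) ` B"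
  proof
    show "\<pi> ` E \<subseteq> (\<lambda>w. \<Psi> (d, w)) ` B"
    proof
      fix z assume "z \<in> \<pi> ` E"
      then obtain x where x: "x \<in> E" "z = \<pi> x" by auto
      obtain t w where tw: "z = \<Psi> (t, w)" using P(2) by (metis surjD surj_pair)
      have "N \<bullet> z = d" using a(3)[OF x(1)] by (simp add: Nx x(2) \<pi>_def)
      then have "t = d" using tw P(3) by simp
      moreover have "radial K z = x"
        using a(3)[OF x(1)] E(2) x(1) by (simp add: x(2) \<pi>_def radial_scale radial_frontier subset_iff)
      ultimately show "z \<in> (\<lambda>w. \<Psi> (d, w)) ` B" using tw x(1) by (auto simp: B_def)
    qed
    show "(\<lambda>w. \<Psi> (d, w)) ` B \<subseteq> \<pi> ` E"
    proof
      fix z assume "z \<in> (\<lambda>w. \<Psi> (d, w)) ` B"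
      then obtain w where w: "z = \<Psi> (d, w)" "radial K z \<in> E" by (auto simp: B_def)
      have "d * (z \<bullet> G0) = d" using Nx[of z] P(3) w(1) by simp
      then have zG: "z \<bullet> G0 = 1" using d by simp
      then have "z \<noteq> 0" by auto
      then have "0 < supp (polar_body K) z" by (rule polar.supp_pos)
      then have "\<pi> (radial K z) = z" using zG by (simp add: \<pi>_def radial_def)
      then show "z \<in> \<pi> ` E" using w(2) by (metis imageI)
    qed
  qed
  \<comment> \<open>Why the height hardly varies along the boundary: the supporting inequalities at
    x and x' bound (x - x') \<bullet> G0 by |x - x'| times the deviation of
    \<open>dual_point\<close> from G0. Hence only continuity of \<open>dual_point\<close> is
    required.\<close>
  have Gdiff: "\<bar>(x - x') \<bullet> G0\<bar> * R \<le> \<eta> * norm (x - x')" if x: "x \<in> E" "x' \<in> E" for x x'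
  proof -
    have fr: "supp (polar_body K) x = 1" "supp (polar_body K) x' = 1" using E(2) x by (auto simp: frontier_iff[symmetric])
    have 1: "dual_point K x \<bullet> (x' - x) \<le> 0" using gauge_increment(1)[of x' x] fr by simp
    have 2: "dual_point K x' \<bullet> (x - x') \<le> 0" using gauge_increment(1)[of x x'] fr by simp
    have "(x' - x) \<bullet> G0 \<le> (x' - x) \<bullet> (G0 - dual_point K x)"
      using 1 by (simp add: inner_diff_right inner_commute)
    also have "\<dots> \<le> norm (x' - x) * norm (G0 - dual_point K x)" by (rule norm_cauchy_schwarz)
    finally have "(x' - x) \<bullet> G0 * R \<le> norm (x' - x) * norm (G0 - dual_point K x) * R"
      using R(1) by (simp add: mult_right_mono)
    also have "\<dots> = norm (x' - x) * (R * norm (dual_point K x - dual_point K x0))"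
      by (simp add: G0_def norm_minus_commute mult_ac)
    also have "\<dots> \<le> norm (x' - x) * \<eta>"
      by (rule mult_left_mono[OF near(2)[OF x(1)]]) simp
    finally have 3: "(x' - x) \<bullet> G0 * R \<le> norm (x' - x) * \<eta>" .
    have "(x - x') \<bullet> G0 \<le> (x - x') \<bullet> (G0 - dual_point K x')"
      using 2 by (simp add: inner_diff_right inner_commute)
    also have "\<dots> \<le> norm (x - x') * norm (G0 - dual_point K x')" by (rule norm_cauchy_schwarz)
    finally have "(x - x') \<bullet> G0 * R \<le> norm (x - x') * norm (G0 - dual_point K x') * R"
      using R(1) by (simp add: mult_right_mono)
    also have "\<dots> = norm (x - x') * (R * norm (dual_point K x' - dual_point K x0))"
      by (simp add: G0_def norm_minus_commute mult_ac)
    also have "\<dots> \<le> norm (x - x') * \<eta>"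
      by (rule mult_left_mono[OF near(2)[OF x(2)]]) simp
    finally have 4: "(x - x') \<bullet> G0 * R \<le> norm (x - x') * \<eta>" .
    show ?thesis
    proof (cases "0 \<le> (x - x') \<bullet> G0")
      case True then show ?thesis using 4 by (simp add: mult.commute)
    next
      case False
      then have "\<bar>(x - x') \<bullet> G0\<bar> = (x' - x) \<bullet> G0" by (simp add: inner_diff_left)
      then show ?thesis using 3 by (simp add: mult.commute norm_minus_commute)
    qed
  qed
  have inv1: "1 / (1 - \<eta>) \<le> 1 + 2 * \<eta>"
  proof -
    have "\<eta> * \<eta> \<le> \<eta> * (1/4)" using \<eta> by (intro mult_left_mono) auto
    then have "1 \<le> (1 + 2 * \<eta>) * (1 - \<eta>)" using \<eta> by (simp add: algebra_simps)
    then show ?thesis using \<eta> by (simp add: pos_divide_le_eq)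
  qed
  have xR: "norm x \<le> R" if "x \<in> E" for x using R(2) that E(2) frontier_subset by blast
  have lip1: "dist (\<pi> x) (\<pi> x') \<le> (1 + 6 * \<eta>) * dist x x'" if x: "x \<in> E" "x' \<in> E" for x x'
  proof -
    define p where "p = x \<bullet> G0"
    define q where "q = x' \<bullet> G0"
    have p: "1 - \<eta> \<le> p" "0 < p" and q: "1 - \<eta> \<le> q" "0 < q" using a x by (auto simp: p_def q_def)
    have "\<pi> x - \<pi> x' = (1 / p) *\<^sub>R (x - x') + (1 / p - 1 / q) *\<^sub>R x'"
      by (simp add: \<pi>_def p_def q_def algebra_simps)
    also have "1 / p - 1 / q = (q - p) / (p * q)" using p q by (simp add: field_simps)
    finally have "norm (\<pi> x - \<pi> x') \<le> norm ((1 / p) *\<^sub>R (x - x')) + norm (((q - p) / (p * q)) *\<^sub>R x')"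
      by (simp only: norm_triangle_ineq)
    also have "\<dots> = (1 / p) * norm (x - x') + (\<bar>q - p\<bar> / (p * q)) * norm x'"
      using p q by (simp add: abs_mult)
    also have "(\<bar>q - p\<bar> / (p * q)) * norm x' \<le> (\<bar>q - p\<bar> * R) / (p * q)"
      using xR[OF x(2)] p q by (simp add: mult_left_mono divide_right_mono)
    also have "\<dots> \<le> (\<eta> * norm (x - x')) / (p * q)"
    proof -
      have "\<bar>q - p\<bar> = \<bar>(x - x') \<bullet> G0\<bar>" by (simp add: p_def q_def inner_diff_left)
      then show ?thesis using Gdiff[OF x] p q by (simp add: divide_right_mono)
    qed
    also have "\<dots> = \<eta> * (1 / p) * (1 / q) * norm (x - x')" by simp
    finally have *: "norm (\<pi> x - \<pi> x') \<le> ((1 / p) + \<eta> * ((1 / p) * (1 / q))) * norm (x - x')"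
      by (simp add: algebra_simps)
    have "1 / p \<le> 1 / (1 - \<eta>)" "1 / q \<le> 1 / (1 - \<eta>)" using p q \<eta> by (auto intro: divide_left_mono)
    then have ip: "1 / p \<le> 1 + 2 * \<eta>" "1 / q \<le> 1 + 2 * \<eta>" using inv1 by auto
    have "(1 / p) * (1 / q) \<le> (3/2) * (3/2)" using ip p q \<eta> by (intro mult_mono) auto
    then have "\<eta> * ((1 / p) * (1 / q)) \<le> \<eta> * 4" using \<eta> by (intro mult_left_mono) auto
    then have "(1 / p) + \<eta> * ((1 / p) * (1 / q)) \<le> 1 + 6 * \<eta>" using ip by linarith
    then show ?thesis using * unfolding dist_norm by (meson mult_right_mono norm_ge_zero order_trans)
  qed
  have lip2: "dist x x' \<le> (1 + 6 * \<eta>) * dist (\<pi> x) (\<pi> x')" if x: "x \<in> E" "x' \<in> E" for x x'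
  proof -
    define p where "p = x \<bullet> G0"
    define q where "q = x' \<bullet> G0"
    have p: "p \<le> 1 + \<eta>" "0 < p" and q: "1 - \<eta> \<le> q" "0 < q" using a x by (auto simp: p_def q_def)
    have pq: "(p - q) * (1 / q) = p / q - 1" using q by (simp add: diff_divide_distrib)
    have "x - x' = p *\<^sub>R (\<pi> x - \<pi> x') + ((p - q) * (1 / q)) *\<^sub>R x'"
      unfolding pq using p q by (simp add: \<pi>_def p_def[symmetric] q_def[symmetric] algebra_simps)
    then have "norm (x - x') \<le> norm (p *\<^sub>R (\<pi> x - \<pi> x')) + norm (((p - q) * (1 / q)) *\<^sub>R x')"
      by (simp only: norm_triangle_ineq)
    also have "\<dots> = p * norm (\<pi> x - \<pi> x') + \<bar>p - q\<bar> * (1 / q) * norm x'"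
      using p q by (simp add: abs_mult)
    also have "\<bar>p - q\<bar> * (1 / q) * norm x' \<le> \<bar>p - q\<bar> * (1 / q) * R"
      using xR[OF x(2)] q by (intro mult_left_mono) auto
    also have "\<dots> = (\<bar>(x - x') \<bullet> G0\<bar> * R) * (1 / q)" by (simp add: p_def q_def inner_diff_left)
    also have "\<dots> \<le> (\<eta> * norm (x - x')) * (1 / q)" using Gdiff[OF x] q by (intro mult_right_mono) auto
    also have "\<dots> \<le> (\<eta> * norm (x - x')) * 2"
    proof -
      have "1 / q \<le> 1 / (1 - \<eta>)" using q \<eta> by (auto intro: divide_left_mono)
      then have "1 / q \<le> 2" using inv1 \<eta> by linarith
      then show ?thesis using \<eta> by (intro mult_left_mono) auto
    qed
    also have "p * norm (\<pi> x - \<pi> x') \<le> (1 + \<eta>) * norm (\<pi> x - \<pi> x')" using p by (intro mult_right_mono) auto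
    finally have *: "(1 - 2 * \<eta>) * norm (x - x') \<le> (1 + \<eta>) * norm (\<pi> x - \<pi> x')" by (simp add: algebra_simps)
    have "norm (x - x') \<le> ((1 + 4 * \<eta>) * (1 - 2 * \<eta>)) * norm (x - x')"
    proof -
      have "\<eta> * \<eta> \<le> \<eta> * (1/4)" using \<eta> by (intro mult_left_mono) auto
      then have "1 \<le> (1 + 4 * \<eta>) * (1 - 2 * \<eta>)" by (simp add: algebra_simps)
      from mult_right_mono[OF this norm_ge_zero[of "x - x'"]] show ?thesis by simp
    qed
    also have "\<dots> \<le> (1 + 4 * \<eta>) * ((1 + \<eta>) * norm (\<pi> x - \<pi> x'))"
      using * \<eta> by (simp add: mult.assoc mult_left_mono)
    also have "\<dots> \<le> (1 + 6 * \<eta>) * norm (\<pi> x - \<pi> x')"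
    proof -
      have "\<eta> * \<eta> \<le> \<eta> * (1/4)" using \<eta> by (intro mult_left_mono) auto
      then have "(1 + 4 * \<eta>) * (1 + \<eta>) \<le> 1 + 6 * \<eta>" by (simp add: algebra_simps)
      from mult_right_mono[OF this norm_ge_zero[of "\<pi> x - \<pi> x'"]] show ?thesis by (simp add: mult.assoc)
    qed
    finally show ?thesis unfolding dist_norm .
  qed
  let ?L = "1 + 6 * \<eta>"
  have L: "1 \<le> ?L" "0 < ?L" using \<eta> by auto
  have m0: "0 < ?m" using card by simp
  have HB: "hausdorff_outer ?m (\<pi> ` E) = emeasure lborel B"
    unfolding piE by (rule hausdorff_outer_slice[OF card \<Psi> B])
  have H1: "emeasure lborel B \<le> ennreal (?L ^ ?m) * hausdorff_outer ?m E"
    unfolding HB[symmetric] by (rule hausdorff_outer_lipschitz_image[OF m0 L(2) lip1])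
  have H2: "hausdorff_outer ?m E \<le> ennreal (?L ^ ?m) * emeasure lborel B"
  proof -
    have inj: "inj_on \<pi> E"
    proof (rule inj_onI)
      fix x x' assume "x \<in> E" "x' \<in> E" "\<pi> x = \<pi> x'"
      then show "x = x'" using lip2[of x x'] by simp
    qed
    have "hausdorff_outer ?m (inv_into E \<pi> ` (\<pi> ` E)) \<le> ennreal (?L ^ ?m) * hausdorff_outer ?m (\<pi> ` E)"
      by (rule hausdorff_outer_lipschitz_image[OF m0 L(2)]) (use lip2 inj in auto)
    then show ?thesis by (simp only: HB inv_into_image_cancel[OF inj order_refl])
  qed
  let ?D = "cone_over K E"
  have D1: "emeasure lborel ?D \<le> ennreal (?L ^ CARD('n)) * emeasure lborel C"
    and D2: "emeasure lborel C \<le> ennreal (?L ^ CARD('n)) * emeasure lborel ?D"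
  proof -
    have ray: "N \<bullet> x = d * supp (polar_body K) x * (radial K x \<bullet> G0)" if "x \<noteq> 0" for x
      using polar.supp_pos[OF that] by (simp add: Nx radial_def)
    have "emeasure lborel ?D \<le> ennreal (?L ^ DIM(real ^ 'n)) * emeasure lborel C"
    proof (rule emeasure_lborel_le_scaled[OF C L(2)])
      fix x assume x: "x \<in> ?D"
      then have x': "x \<in> K" "x \<noteq> 0" "radial K x \<in> E" by (auto simp: cone_over_def)
      have s: "0 < supp (polar_body K) x" "supp (polar_body K) x \<le> 1"
        using polar.supp_pos x' by (auto simp: mem_iff[symmetric])
      have pos: "0 < N \<bullet> x" unfolding ray[OF x'(2)] using s d a(3)[OF x'(3)] by simp
      have "supp (polar_body K) x * (radial K x \<bullet> G0) \<le> 1 * (1 + 6 * \<eta>)"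
        using s a[OF x'(3)] \<eta> by (intro mult_mono) auto
      then have "d * (supp (polar_body K) x * (radial K x \<bullet> G0)) \<le> d * (1 * (1 + 6 * \<eta>))" using d by (intro mult_left_mono) auto
      then have "N \<bullet> x \<le> d * ?L" unfolding ray[OF x'(2)] by (simp add: mult.assoc)
      then show "(1 / ?L) *\<^sub>R x \<in> C"
        using pos L x'(3) by (simp add: C_def radial_scale pos_divide_le_eq)
    qed
    then show "emeasure lborel ?D \<le> ennreal (?L ^ CARD('n)) * emeasure lborel C" by simp
    have "emeasure lborel C \<le> ennreal (?L ^ DIM(real ^ 'n)) * emeasure lborel ?D"
    proof (rule emeasure_lborel_le_scaled[OF sets_cone_over[OF E(1)] L(2)])
      fix x assume x: "x \<in> C"
      then have x': "0 < N \<bullet> x" "N \<bullet> x \<le> d" "radial K x \<in> E" by (auto simp: C_def)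
      then have x0: "x \<noteq> 0" by auto
      have s: "0 < supp (polar_body K) x" by (rule polar.supp_pos[OF x0])
      have "d * (supp (polar_body K) x * (radial K x \<bullet> G0)) \<le> d * 1" using x'(2) unfolding ray[OF x0] by (simp add: mult.assoc)
      then have "supp (polar_body K) x * (radial K x \<bullet> G0) \<le> 1" using d by (simp only: mult_le_cancel_left_pos)
      moreover have "supp (polar_body K) x * (1 - \<eta>) \<le> supp (polar_body K) x * (radial K x \<bullet> G0)"
        using s a(1)[OF x'(3)] by (intro mult_left_mono) auto
      ultimately have "supp (polar_body K) x * (1 - \<eta>) \<le> 1" by linarith
      then have "supp (polar_body K) x \<le> 1 / (1 - \<eta>)" using \<eta> by (simp add: pos_le_divide_eq)
      also have "\<dots> \<le> ?L" using inv1 \<eta> by linarith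
      finally have "supp (polar_body K) ((1 / ?L) *\<^sub>R x) \<le> 1"
        using L by (simp add: polar.supp_scale pos_divide_le_eq)
      then show "(1 / ?L) *\<^sub>R x \<in> ?D"
        using x0 L x'(3) by (simp add: cone_over_def mem_iff radial_scale)
    qed
    then show "emeasure lborel C \<le> ennreal (?L ^ CARD('n)) * emeasure lborel ?D" by simp
  qed
  have Gx: "0 < norm (dual_point K x)" if "x \<in> E" for x
    using dual_point_nonzero[OF frontier_nonzero] E(2) that by auto
  have bnd: "d / ?L \<le> 1 / norm (dual_point K x) \<and> 1 / norm (dual_point K x) \<le> d * ?L" if x: "x \<in> E" for x
  proof
    have n0: "0 < norm G0" using G00 by simp
    have "norm (dual_point K x) \<le> (1 + \<eta>) * norm G0" using near(4)[OF x] by (simp add: G0_def)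
    also have "\<dots> \<le> ?L * norm G0" using \<eta> n0 by (intro mult_right_mono) auto
    finally have "1 / (?L * norm G0) \<le> 1 / norm (dual_point K x)"
      using Gx[OF x] n0 L by (intro divide_left_mono mult_pos_pos) auto
    then show "d / ?L \<le> 1 / norm (dual_point K x)" by (simp add: d_def mult.commute)
    have "norm G0 \<le> (1 + \<eta>) * norm (dual_point K x)" using near(3)[OF x] by (simp add: G0_def)
    also have "\<dots> \<le> ?L * norm (dual_point K x)" using \<eta> Gx[OF x] by (intro mult_right_mono) auto
    finally have "?L / (?L * norm (dual_point K x)) \<le> ?L / norm G0"
      using Gx[OF x] n0 L by (intro divide_left_mono mult_pos_pos) auto
    then show "1 / norm (dual_point K x) \<le> d * ?L" using L by (simp add: d_def)
  qed
  have dL: "0 \<le> d / ?L" using d L by simp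
  have SB1: "emeasure (support_measure K) E \<le> ennreal (d * ?L) * hausdorff_outer ?m E"
    by (rule emeasure_support_measure_bounds(1)[OF E dL bnd])
  have SB2: "ennreal (d / ?L) * hausdorff_outer ?m E \<le> emeasure (support_measure K) E"
    by (rule emeasure_support_measure_bounds(2)[OF E dL bnd])
  note SB = SB1 SB2
  \<comment> \<open>One factor comes from the density, n - 1 from the Lipschitz comparison of the
    surface pieces, and n from the scaling between the two cones; this is the exponent 2n in
    \<theta>.\<close>
  have pw: "?L * ?L ^ ?m * ?L ^ CARD('n) = \<theta>"
    using card by (simp add: \<theta>_def mult_2 power_add flip: power_Suc)
  have "emeasure (support_measure K) E \<le> ennreal (d * ?L) * (ennreal (?L ^ ?m) * emeasure lborel B)"
    by (rule order_trans[OF SB(1)]) (intro mult_left_mono H2, simp)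
  also have "\<dots> = ennreal (?L * ?L ^ ?m) * (ennreal d * emeasure lborel B)"
    using d L by (simp add: ennreal_mult mult_ac)
  also have "\<dots> \<le> ennreal (?L * ?L ^ ?m) * (ennreal (real CARD('n)) * (ennreal (?L ^ CARD('n)) * emeasure lborel ?D))"
    unfolding coneC[symmetric] by (intro mult_left_mono D2) auto
  also have "\<dots> = ennreal (?L * ?L ^ ?m * ?L ^ CARD('n)) * emeasure (cone_measure K) E"
    unfolding emeasure_cone_measure[OF E(1)] using L by (simp add: ennreal_mult mult_ac)
  finally show "emeasure (support_measure K) E \<le> ennreal \<theta> * emeasure (cone_measure K) E" unfolding pw .
  have "emeasure (cone_measure K) E \<le> ennreal (?L ^ CARD('n)) * (ennreal (real CARD('n)) * emeasure lborel C)"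
    unfolding emeasure_cone_measure[OF E(1)] using mult_left_mono[OF D1, of "ennreal (real CARD('n))"]
    by (simp add: mult_ac)
  also have "\<dots> \<le> ennreal (?L ^ CARD('n)) * (ennreal d * (ennreal (?L ^ ?m) * hausdorff_outer ?m E))"
    unfolding coneC by (intro mult_left_mono H1) auto
  also have "\<dots> = ennreal (?L * ?L ^ ?m * ?L ^ CARD('n)) * (ennreal (d / ?L) * hausdorff_outer ?m E)"
  proof -
    have "ennreal d = ennreal (?L * (d / ?L))" using L by simp
    also have "\<dots> = ennreal ?L * ennreal (d / ?L)" by (rule ennreal_mult) (use L d in auto)
    finally have "ennreal d = ennreal ?L * ennreal (d / ?L)" .
    then show ?thesis using L by (simp add: ennreal_mult mult_ac)
  qed
  also have "\<dots> \<le> ennreal (?L * ?L ^ ?m * ?L ^ CARD('n)) * emeasure (support_measure K) E"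
    by (intro mult_left_mono SB(2)) auto
  finally show "emeasure (cone_measure K) E \<le> ennreal \<theta> * emeasure (support_measure K) E" unfolding pw .
qed

text \<open>The sets of the finite cover are cut off one after the other; both measures are additive
  over the pieces, so the constant does not grow with the number of sets.\<close>

lemma emeasure_le_local:
  assumes M: "sets M = sets borel" "sets M' = sets borel" and fin: "finite \<U>"
    and op: "\<And>U. U \<in> \<U> \<Longrightarrow> U \<in> sets borel"
    and loc: "\<And>U E. U \<in> \<U> \<Longrightarrow> E \<in> sets borel \<Longrightarrow> E \<subseteq> U \<inter> S \<Longrightarrow> emeasure M E \<le> c * emeasure M' E"
    and E: "E \<in> sets borel" "E \<subseteq> \<Union>\<U>" "E \<subseteq> S"
  shows "emeasure M E \<le> c * emeasure M' E"
  using fin op loc E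
proof (induction \<U> arbitrary: E)
  case (insert U \<U>)
  have U: "U \<in> sets borel" using insert.prems(1) by simp
  have split: "emeasure X E = emeasure X (E \<inter> U) + emeasure X (E - U)" if "sets X = sets borel" for X
  proof -
    have "emeasure X ((E \<inter> U) \<union> (E - U)) = emeasure X (E \<inter> U) + emeasure X (E - U)"
      using U insert.prems(3) that by (intro plus_emeasure[symmetric]) auto
    then show ?thesis by (simp add: Int_Diff_Un)
  qed
  have "emeasure M (E \<inter> U) \<le> c * emeasure M' (E \<inter> U)"
    by (rule insert.prems(2)[of U]) (use U insert.prems in auto)
  moreover have "emeasure M (E - U) \<le> c * emeasure M' (E - U)"
  proof (rule insert.IH)
    show "emeasure M E \<le> c * emeasure M' E" if "V \<in> \<U>" "E \<in> sets borel" "E \<subseteq> V \<inter> S" for V E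
      using insert.prems(2)[of V E] that by auto
  qed (use U insert.prems in auto)
  ultimately show ?case
    unfolding split[OF M(1)] split[OF M(2)] by (simp add: distrib_left add_mono)
qed simp

text \<open>For each \<theta> > 1 compactness covers the frontier by finitely many neighbourhoods on
  which the flat comparison holds with factor at most \<theta>. Letting \<theta> tend to 1 gives
  equality, without charts or an area formula.\<close>

lemma support_measure_eq_cone_measure: "support_measure K = cone_measure K"
proof (rule measure_eqI)
  fix E0 assume "E0 \<in> sets (support_measure K)"
  then have E0: "E0 \<in> sets borel" by simp
  define E where "E = E0 \<inter> frontier K"
  have E: "E \<in> sets borel" "E \<subseteq> frontier K" using E0 frontier_borel by (auto simp: E_def)
  obtain R where R: "0 < R" "\<And>x. x \<in> K \<Longrightarrow> norm x \<le> R" by (rule bound) blast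
  have key: "emeasure (support_measure K) E \<le> ennreal \<theta> * emeasure (cone_measure K) E \<and>
      emeasure (cone_measure K) E \<le> ennreal \<theta> * emeasure (support_measure K) E" if \<theta>: "1 < \<theta>" for \<theta>
  proof -
    have "((\<lambda>\<eta>::real. (1 + 6 * \<eta>) ^ (2 * CARD('n))) \<longlongrightarrow> (1 + 6 * 0) ^ (2 * CARD('n))) (at_right 0)"
      by (intro tendsto_intros)
    then have "\<forall>\<^sub>F \<eta> in at_right 0. (1 + 6 * \<eta>) ^ (2 * CARD('n)) < \<theta>"
      using \<theta> by (intro order_tendstoD) auto
    moreover have "\<forall>\<^sub>F \<eta> in at_right 0. 0 < \<eta> \<and> \<eta> < (1/4::real)"
      by (rule eventually_at_rightI[of 0 "1/4"]) auto
    ultimately have "\<exists>\<eta>. (1 + 6 * \<eta>) ^ (2 * CARD('n)) < \<theta> \<and> 0 < \<eta> \<and> \<eta> < (1/4::real)"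
      using eventually_happens[OF eventually_conj] by fastforce
    then obtain \<eta> :: real where \<eta>: "(1 + 6 * \<eta>) ^ (2 * CARD('n)) < \<theta>" "0 < \<eta>" "\<eta> < 1/4" by blast
    \<comment> \<open>Strict versions of the proximity conditions, so that the neighbourhoods are
      open.\<close>
    define nb where "nb x0 = {x \<in> -{0}. \<bar>x \<bullet> dual_point K x0 - 1\<bar> < \<eta> \<and>
      R * norm (dual_point K x - dual_point K x0) < \<eta> \<and>
      norm (dual_point K x0) < (1 + \<eta>) * norm (dual_point K x) \<and>
      norm (dual_point K x) < (1 + \<eta>) * norm (dual_point K x0)}" for x0
    have Gc: "continuous_on (-{0}) (dual_point K)" by (rule continuous_on_dual_point) simp
    have open_nb: "open (nb x0)" for x0
    proof -
      have op: "open {x \<in> -{0}. f x < g x}" if "continuous_on (-{0}) f" "continuous_on (-{0}) g"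
        for f g :: "real ^ 'n \<Rightarrow> real"
      proof -
        have "open (-{0} \<inter> (\<lambda>x. g x - f x) -` {0<..})"
          by (rule continuous_open_preimage) (use that in \<open>auto intro: continuous_on_diff\<close>)
        moreover have "-{0} \<inter> (\<lambda>x. g x - f x) -` {0<..} = {x \<in> -{0}. f x < g x}" by auto
        ultimately show ?thesis by simp
      qed
      have 1: "open {x \<in> -{0}. \<bar>x \<bullet> dual_point K x0 - 1\<bar> < \<eta>}"
        and 2: "open {x \<in> -{0}. R * norm (dual_point K x - dual_point K x0) < \<eta>}"
        and 3: "open {x \<in> -{0}. norm (dual_point K x0) < (1 + \<eta>) * norm (dual_point K x)}"
        and 4: "open {x \<in> -{0}. norm (dual_point K x) < (1 + \<eta>) * norm (dual_point K x0)}"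
        by (rule op; intro continuous_intros Gc)+
      have "nb x0 = {x \<in> -{0}. \<bar>x \<bullet> dual_point K x0 - 1\<bar> < \<eta>} \<inter>
        {x \<in> -{0}. R * norm (dual_point K x - dual_point K x0) < \<eta>} \<inter>
        {x \<in> -{0}. norm (dual_point K x0) < (1 + \<eta>) * norm (dual_point K x)} \<inter>
        {x \<in> -{0}. norm (dual_point K x) < (1 + \<eta>) * norm (dual_point K x0)}"
        by (auto simp: nb_def)
      then show ?thesis using 1 2 3 4 by auto
    qed
    have mem_nb: "x0 \<in> nb x0" if "x0 \<in> frontier K" for x0
      using \<eta> frontier_nonzero[OF that] dual_point_nonzero[OF frontier_nonzero[OF that]] inner_dual_point[OF that]
      by (simp add: nb_def)
    obtain F where F: "F \<subseteq> frontier K" "finite F" "frontier K \<subseteq> (\<Union>x\<in>F. nb x)"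
      by (rule compactE_image[OF compact_frontier, of "frontier K" nb]) (use open_nb mem_nb in auto)
    let ?\<theta>' = "(1 + 6 * \<eta>) ^ (2 * CARD('n))"
    have flat: "emeasure (support_measure K) E \<le> ennreal ?\<theta>' * emeasure (cone_measure K) E"
      "emeasure (cone_measure K) E \<le> ennreal ?\<theta>' * emeasure (support_measure K) E"
      if x0: "x0 \<in> F" and E: "E \<in> sets borel" "E \<subseteq> nb x0 \<inter> frontier K" for x0 E
    proof -
      have x0f: "x0 \<in> frontier K" and EK: "E \<subseteq> frontier K" using x0 F(1) E by auto
      have n: "\<bar>x \<bullet> dual_point K x0 - 1\<bar> \<le> \<eta>"
        "R * norm (dual_point K x - dual_point K x0) \<le> \<eta>"
        "norm (dual_point K x0) \<le> (1 + \<eta>) * norm (dual_point K x)"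
        "norm (dual_point K x) \<le> (1 + \<eta>) * norm (dual_point K x0)" if "x \<in> E" for x
        using subsetD[OF E(2) that] by (simp_all add: nb_def less_imp_le)
      show "emeasure (support_measure K) E \<le> ennreal ?\<theta>' * emeasure (cone_measure K) E"
        "emeasure (cone_measure K) E \<le> ennreal ?\<theta>' * emeasure (support_measure K) E"
        using support_cone_measure_flat[OF x0f \<eta>(2) less_imp_le[OF \<eta>(3)] R E(1) EK n] by auto
    qed
    have flat': "emeasure (support_measure K) E \<le> ennreal ?\<theta>' * emeasure (cone_measure K) E"
      "emeasure (cone_measure K) E \<le> ennreal ?\<theta>' * emeasure (support_measure K) E"
      if U: "U \<in> nb ` F" and E: "E \<in> sets borel" "E \<subseteq> U \<inter> frontier K" for U E
    proof -
      obtain x0 where "x0 \<in> F" "U = nb x0" using U by blast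
      then show "emeasure (support_measure K) E \<le> ennreal ?\<theta>' * emeasure (cone_measure K) E"
        "emeasure (cone_measure K) E \<le> ennreal ?\<theta>' * emeasure (support_measure K) E"
        using flat[of x0 E] E by auto
    qed
    have nbb: "U \<in> sets borel" if "U \<in> nb ` F" for U using that open_nb by auto
    have EU: "E \<subseteq> \<Union>(nb ` F)" using E(2) F(3) by blast
    have fin: "finite (nb ` F)" using F(2) by simp
    have "emeasure (support_measure K) E \<le> ennreal ?\<theta>' * emeasure (cone_measure K) E"
    proof (rule emeasure_le_local[OF sets_support_measure sets_cone_measure fin _ _ E(1) EU E(2)])
      show "U \<in> sets borel" if "U \<in> nb ` F" for U by (rule nbb[OF that])
    qed (rule flat'(1))
    moreover have "emeasure (cone_measure K) E \<le> ennreal ?\<theta>' * emeasure (support_measure K) E"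
    proof (rule emeasure_le_local[OF sets_cone_measure sets_support_measure fin _ _ E(1) EU E(2)])
      show "U \<in> sets borel" if "U \<in> nb ` F" for U by (rule nbb[OF that])
    qed (rule flat'(2))
    moreover have "ennreal ?\<theta>' * c \<le> ennreal \<theta> * c" for c
      using \<eta>(1) by (intro mult_right_mono ennreal_leI) auto
    ultimately show ?thesis by (meson order_trans)
  qed
  have lim: "a \<le> b" if "\<And>\<theta>. 1 < \<theta> \<Longrightarrow> a \<le> ennreal \<theta> * b" for a b
  proof (cases "b = top \<or> b = 0")
    case True
    then show ?thesis using that[of 2] by auto
  next
    case False
    then obtain b' where b': "b = ennreal b'" "0 < b'" by (cases b) auto
    show ?thesis
    proof (rule ennreal_le_epsilon)
      fix e :: real assume e: "0 < e"
      have "a \<le> ennreal (1 + e / b') * b" using e b' by (intro that) simp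
      also have "\<dots> = b + ennreal e" using e b' by (simp add: ennreal_mult[symmetric] ennreal_plus[symmetric] distrib_right del: ennreal_plus)
      finally show "a \<le> b + ennreal e" .
    qed
  qed
  have "emeasure (support_measure K) E = emeasure (cone_measure K) E"
    using lim[of "emeasure (support_measure K) E" "emeasure (cone_measure K) E"]
      lim[of "emeasure (cone_measure K) E" "emeasure (support_measure K) E"] key by (meson antisym)
  moreover have "emeasure (support_measure K) E0 = emeasure (support_measure K) E"
    unfolding support_measure_def
    using E0 E measurable_support_density
    by (subst (1 2) emeasure_density) (auto intro!: nn_integral_cong simp: E_def indicator_def cong: measurable_cong_sets)
  moreover have "cone_over K E0 = cone_over K E"
    unfolding cone_over_def E_def using radial_in_frontier by auto
  then have "emeasure (cone_measure K) E0 = emeasure (cone_measure K) E"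
    using E0 E by (simp add: emeasure_cone_measure)
  ultimately show "emeasure (support_measure K) E0 = emeasure (cone_measure K) E0" by simp
qed (simp add: sets_support_measure)

end

section \<open>Volumes of caps\<close>

definition ball_cap :: "'a::euclidean_space \<Rightarrow> real \<Rightarrow> 'a \<Rightarrow> real \<Rightarrow> 'a set" where
  "ball_cap c \<rho> v t = {x \<in> cball c \<rho>. \<rho> - t \<le> v \<bullet> (x - c)}"

text \<open>A cap of small height t of a ball of radius \<rho> has volume close to
  \<open>cap_const n\<close> (2\<rho>)^p t^(p+1) with p = (n-1)/2. The denominator p + 1 comes from
  integrating s^p over the heights.\<close>

definition cap_const :: "nat \<Rightarrow> real" where
  "cap_const n = unit_ball_vol (real (n - 1)) / (real (n - 1) / 2 + 1)"

lemma cap_const_pos: "0 < cap_const n"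
  by (simp add: cap_const_def add_nonneg_pos)

lemma ball_cap_eq: "ball_cap c \<rho> v t = cball c \<rho> \<inter> {x. \<rho> - t + v \<bullet> c \<le> v \<bullet> x}"
  by (auto simp: ball_cap_def inner_diff_right)

lemma compact_ball_cap: "compact (ball_cap c \<rho> v t)"
  unfolding ball_cap_eq by (intro compact_Int_closed compact_cball closed_halfspace_ge)

lemma ball_cap_lmeasurable: "ball_cap c \<rho> v t \<in> lmeasurable"
  by (intro lmeasurable_compact compact_ball_cap)

text \<open>Translating the pole c + \<rho> v of the cap to the origin and measuring heights in
  direction -v leads to the caps treated in normal coordinates.\<close>

lemma measure_ball_cap_bounds:
  fixes c v :: "real ^ 'n"
  assumes card: "2 \<le> CARD('n)" and v: "norm v = 1" and t: "0 \<le> t" "t \<le> 2 * \<rho>"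
  defines "p \<equiv> real (CARD('n) - 1) / 2"
  shows "measure lebesgue (ball_cap c \<rho> v t) \<le> cap_const CARD('n) * (2 * \<rho>) powr p * t powr (p + 1)"
    and "cap_const CARD('n) * (2 * \<rho> - t) powr p * t powr (p + 1) \<le> measure lebesgue (ball_cap c \<rho> v t)"
proof -
  let ?N = "- v"
  obtain \<Psi> where \<Psi>: "normal_coordinates ?N \<Psi>" by (rule normal_coordinates_exist[OF card, of ?N]) (use v in auto)
  define C where "C = {x \<in> cball (\<rho> *\<^sub>R ?N) \<rho>. ?N \<bullet> x \<le> t}"
  have "C = cball (\<rho> *\<^sub>R ?N) \<rho> \<inter> {x. ?N \<bullet> x \<le> t}" by (auto simp: C_def)
  then have C: "C \<in> sets borel" using closed_halfspace_le[of ?N t] by auto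
  let ?a = "c + \<rho> *\<^sub>R v"
  have vv: "v \<bullet> v = 1" using v by (simp add: norm_eq_1)
  have iff: "x \<in> ball_cap c \<rho> v t \<longleftrightarrow> - ?a + x \<in> C" for x
  proof -
    have "dist (\<rho> *\<^sub>R ?N) (- ?a + x) = dist c x" by (simp add: dist_norm algebra_simps)
    moreover have "?N \<bullet> (- ?a + x) = \<rho> - v \<bullet> (x - c)" using vv by (simp add: inner_add_right inner_diff_right)
    ultimately show ?thesis by (auto simp: ball_cap_def C_def)
  qed
  have "ball_cap c \<rho> v t \<in> sets borel" by (rule borel_closed[OF compact_imp_closed[OF compact_ball_cap]])
  then have "emeasure lborel (ball_cap c \<rho> v t) = (\<integral>\<^sup>+x. indicator (ball_cap c \<rho> v t) x \<partial>lborel)" by simp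
  also have "\<dots> = (\<integral>\<^sup>+x. indicator C (- ?a + x) \<partial>lborel)"
    by (intro nn_integral_cong) (simp add: iff indicator_def)
  also have "\<dots> = (\<integral>\<^sup>+x. indicator C x \<partial>lborel)" using C by (intro nn_integral_lborel_translate) simp
  also have "\<dots> = emeasure lborel C" using C by simp
  finally have eq: "emeasure lborel (ball_cap c \<rho> v t) = emeasure lborel C" .
  have "emeasure lborel (ball_cap c \<rho> v t) = emeasure lebesgue (ball_cap c \<rho> v t)"
    using compact_imp_closed[OF compact_ball_cap, of c \<rho> v t] by simp
  also have "\<dots> = ennreal (measure lebesgue (ball_cap c \<rho> v t))"
    using ball_cap_lmeasurable emeasure_eq_measure2 by (metis fmeasurableD2 emeasure_eq_ennreal_measure)
  finally have m: "emeasure lborel C = ennreal (measure lebesgue (ball_cap c \<rho> v t))" using eq by simp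
  have cc: "unit_ball_vol (real (CARD('n) - 1)) * a powr p * (t powr (p + 1) / (p + 1))
      = cap_const CARD('n) * a powr p * t powr (p + 1)" for a
    by (simp add: cap_const_def p_def)
  note b = emeasure_cap_bounds[OF card \<Psi> t, folded C_def p_def, unfolded m cc]
  have nn: "0 \<le> cap_const CARD('n) * a powr p * t powr (p + 1)" for a
    using cap_const_pos[of "CARD('n)"] by simp
  show "measure lebesgue (ball_cap c \<rho> v t) \<le> cap_const CARD('n) * (2 * \<rho>) powr p * t powr (p + 1)"
    using b(1) nn by (simp add: ennreal_le_iff)
  show "cap_const CARD('n) * (2 * \<rho> - t) powr p * t powr (p + 1) \<le> measure lebesgue (ball_cap c \<rho> v t)"
    using b(2) by (simp add: ennreal_le_iff)
qed

lemma ball_cap_subset_halfspace: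
  assumes "u \<noteq> 0" "((1 / norm u) *\<^sub>R u) \<bullet> (p - c) \<le> \<rho> - t"
  shows "ball_cap c \<rho> ((1 / norm u) *\<^sub>R u) t \<subseteq> {x. u \<bullet> p \<le> u \<bullet> x}"
proof
  fix x assume "x \<in> ball_cap c \<rho> ((1 / norm u) *\<^sub>R u) t"
  then have "((1 / norm u) *\<^sub>R u) \<bullet> (p - c) \<le> ((1 / norm u) *\<^sub>R u) \<bullet> (x - c)"
    using assms(2) by (auto simp: ball_cap_def)
  then have "(1 / norm u) * (u \<bullet> p) \<le> (1 / norm u) * (u \<bullet> x)" by (simp add: inner_diff_right right_diff_distrib diff_divide_distrib)
  then have "u \<bullet> p \<le> u \<bullet> x" using assms(1) by (simp add: divide_le_cancel)
  then show "x \<in> {x. u \<bullet> p \<le> u \<bullet> x}" by simp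
qed

section \<open>Frames adapted to a positive definite quadratic form\<close>

text \<open>A maximiser of the quadratic form on the unit sphere of the orthogonal complement of known
  eigenvectors is a further eigenvector.\<close>

lemma orthonormal_eigenvectors_exist:
  fixes Q :: "'a::euclidean_space \<Rightarrow> 'a"
  assumes lin: "linear Q" and sym: "\<And>u v. Q u \<bullet> v = Q v \<bullet> u"
  shows "k \<le> DIM('a) \<Longrightarrow> \<exists>(f :: nat \<Rightarrow> 'a) (\<mu> :: nat \<Rightarrow> real). (\<forall>i<k. Q (f i) = \<mu> i *\<^sub>R f i) \<and>
    (\<forall>i<k. \<forall>j<k. f i \<bullet> f j = (if i = j then 1 else 0))"
proof (induction k)
  case (Suc k)
  then obtain f :: "nat \<Rightarrow> 'a" and \<mu> where f: "\<And>i. i < k \<Longrightarrow> Q (f i) = \<mu> i *\<^sub>R f i"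
    "\<And>i j. i < k \<Longrightarrow> j < k \<Longrightarrow> f i \<bullet> f j = (if i = j then 1 else 0)" by (auto simp: Suc_le_eq)
  define V where "V = {v. \<forall>i<k. f i \<bullet> v = 0}"
  have Vadd: "u + t *\<^sub>R v \<in> V" if "u \<in> V" "v \<in> V" for u v t using that by (simp add: V_def inner_add_right)
  have Vs: "t *\<^sub>R v \<in> V" if "v \<in> V" for v t using that by (simp add: V_def)
  let ?S = "f ` {..<k}"
  have "dim ?S \<le> card ?S" by (rule dim_le_card') simp
  also have "\<dots> \<le> k" using card_image_le[of "{..<k}" f] by simp
  finally have "dim ?S < DIM('a)" using Suc.prems by simp
  then obtain x where x: "x \<noteq> 0" "\<And>z. z \<in> span ?S \<Longrightarrow> orthogonal x z"
    by (rule orthogonal_to_subspace_exists) blast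
  have "f i \<bullet> x = 0" if "i < k" for i
    using x(2)[OF span_base, of "f i"] that by (simp add: orthogonal_def inner_commute)
  then have xV: "x \<in> V" by (simp add: V_def)
  have "closed {v. f i \<bullet> v = 0}" for i by (rule closed_hyperplane)
  then have "closed (\<Inter>i\<in>{..<k}. {v. f i \<bullet> v = 0})" by (intro closed_INT) auto
  moreover have "V = (\<Inter>i\<in>{..<k}. {v. f i \<bullet> v = 0})" by (auto simp: V_def)
  ultimately have "compact (sphere 0 1 \<inter> V)" by (intro compact_Int_closed compact_sphere) auto
  moreover have "(1 / norm x) *\<^sub>R x \<in> sphere 0 1 \<inter> V" using x(1) Vs[OF xV] by simp
  moreover have "continuous_on (sphere 0 1 \<inter> V) (\<lambda>v. Q v \<bullet> v)"
    using lin by (intro continuous_intros linear_continuous_on linear_conv_bounded_linear[THEN iffD1])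
  ultimately obtain v where v: "v \<in> sphere 0 1 \<inter> V" "\<And>u. u \<in> sphere 0 1 \<inter> V \<Longrightarrow> Q u \<bullet> u \<le> Q v \<bullet> v"
    using continuous_attains_sup[of "sphere 0 1 \<inter> V" "\<lambda>v. Q v \<bullet> v"] by blast
  have vV: "v \<in> V" and v1: "v \<bullet> v = 1" using v(1) by (auto simp: norm_eq_1)
  define m where "m = Q v \<bullet> v"
  define P where "P u = m * (u \<bullet> u) - Q u \<bullet> u" for u
  have P0: "0 \<le> P u" if u: "u \<in> V" for u
  proof (cases "u = 0")
    case False
    have "Q ((1 / norm u) *\<^sub>R u) \<bullet> ((1 / norm u) *\<^sub>R u) \<le> m"
      unfolding m_def by (rule v(2)) (use False Vs[OF u] in simp)
    then have "Q u \<bullet> u / (u \<bullet> u) \<le> m"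
      by (simp add: linear_cmul[OF lin] dot_square_norm power2_eq_square)
    then show ?thesis using False by (simp add: P_def pos_divide_le_eq)
  qed (simp add: P_def linear_0[OF lin])
  have b0: "m * (v \<bullet> w) - Q v \<bullet> w = 0" if w: "w \<in> V" for w
  proof (rule ccontr)
    define b where "b = m * (v \<bullet> w) - Q v \<bullet> w"
    define c where "c = P w"
    assume "m * (v \<bullet> w) - Q v \<bullet> w \<noteq> 0"
    then have b: "0 < b * b" by (simp add: b_def[symmetric] less_le)
    have c: "0 \<le> c" unfolding c_def by (rule P0[OF w])
    \<comment> \<open>With this \<open>t\<close> the linear term 2 t b dominates t^2 c, so the
      nonnegative form P would be negative at v + t w.\<close>
    define t where "t = - b / (c + 1)"
    have tc: "t * (c + 1) = - b" using c by (simp add: t_def)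
    have "P (v + t *\<^sub>R w) = P v + 2 * t * b + t * t * c"
      using sym[of w v] by (simp add: P_def b_def c_def linear_add[OF lin] linear_cmul[OF lin] inner_add_left inner_add_right
          inner_commute algebra_simps)
    also have "P v = 0" using v1 by (simp add: P_def m_def)
    also have "0 + 2 * t * b + t * t * c = t * b + t * (t * (c + 1) + b) - t * t" by (simp add: algebra_simps)
    also have "\<dots> = t * b - t * t" unfolding tc by simp
    also have "t * b = - (b * b / (c + 1))" by (simp add: t_def)
    finally have Pt: "P (v + t *\<^sub>R w) = - (b * b / (c + 1)) - t * t" .
    have "0 < b * b / (c + 1)" by (rule divide_pos_pos[OF b]) (use c in simp)
    then have "P (v + t *\<^sub>R w) < 0" unfolding Pt using zero_le_square[of t] by linarith
    then show False using P0[OF Vadd[OF vV w, of t]] by simp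
  qed
  define z where "z = Q v - m *\<^sub>R v"
  have "f i \<bullet> z = 0" if "i < k" for i
    using sym[of v "f i"] f(1)[OF that] vV that by (simp add: z_def inner_diff_right V_def inner_commute)
  then have "z \<in> V" by (simp add: V_def)
  from b0[OF this] have "z \<bullet> z = 0" by (simp add: z_def inner_diff_left)
  then have Qv: "Q v = m *\<^sub>R v" by (simp add: z_def)
  have "(\<forall>i<Suc k. Q ((f(k := v)) i) = (\<mu>(k := m)) i *\<^sub>R (f(k := v)) i) \<and>
    (\<forall>i<Suc k. \<forall>j<Suc k. (f(k := v)) i \<bullet> (f(k := v)) j = (if i = j then 1 else 0))"
    using f Qv v1 vV by (auto simp: less_Suc_eq V_def inner_commute)
  then show ?case by blast
qed simp

lemma emeasure_isometry_image:
  fixes f :: "'a::euclidean_space \<Rightarrow> 'a"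
  assumes "linear f" "\<And>x. norm (f x) = norm x" "compact S"
  shows "emeasure lborel (f ` S) = emeasure lborel S"
proof -
  have "compact (f ` S)" by (rule compact_continuous_image[OF linear_continuous_on[OF assms(1)[unfolded linear_conv_bounded_linear]] assms(3)])
  then have b: "f ` S \<in> sets borel" "S \<in> sets borel" using assms(3) by (auto intro!: borel_closed compact_imp_closed)
  have "hausdorff_outer DIM('a) (f ` S) = hausdorff_outer DIM('a) S"
    by (rule hausdorff_outer_isometry) (use assms in \<open>auto simp: dist_norm simp flip: linear_diff\<close>)
  then show ?thesis by (simp only: hausdorff_outer_eq_lborel b)
qed

text \<open>The columns of T are eigenvectors of Q divided by the square roots of their eigenvalues.
  T is a diagonal stretching followed by an orthogonal map; the effect of both on volume is known,
  the second by invariance of Hausdorff measure under isometries.\<close>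

lemma orthonormal_frame_exists:
  fixes Q :: "real ^ 'n \<Rightarrow> real ^ 'n"
  assumes lin: "linear Q" and sym: "\<And>u v. Q u \<bullet> v = Q v \<bullet> u" and pos: "\<And>v. v \<noteq> 0 \<Longrightarrow> 0 < Q v \<bullet> v"
  obtains T where "linear T" "bij T" "\<And>u v. Q (T u) \<bullet> T v = u \<bullet> v" "(det (matrix T))\<^sup>2 * det (matrix Q) = 1"
    "\<And>S. compact S \<Longrightarrow> measure lebesgue (T ` S) = \<bar>det (matrix T)\<bar> * measure lebesgue S"
proof -
  obtain f :: "nat \<Rightarrow> real ^ 'n" and \<mu> where f0: "\<forall>i<CARD('n). Q (f i) = \<mu> i *\<^sub>R f i"
    "\<forall>i<CARD('n). \<forall>j<CARD('n). f i \<bullet> f j = (if i = j then 1 else 0)"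
    using orthonormal_eigenvectors_exist[OF lin sym, of "CARD('n)"] by auto
  obtain e :: "'n \<Rightarrow> nat" where e: "bij_betw e UNIV {0..<CARD('n)}"
    using ex_bij_betw_finite_nat[of "UNIV :: 'n set"] by auto
  have eq: "e i = e j \<longleftrightarrow> i = j" for i j using e by (auto simp: bij_betw_def inj_on_def)
  have el: "e i < CARD('n)" for i using e by (auto simp: bij_betw_def)
  define g where "g i = f (e i)" for i
  define d where "d i = 1 / sqrt (\<mu> (e i))" for i
  define b where "b i = d i *\<^sub>R g i" for i
  have gg: "g i \<bullet> g j = (if i = j then 1 else 0)" for i j using f0(2) el eq by (simp add: g_def)
  have Qg: "Q (g i) = \<mu> (e i) *\<^sub>R g i" for i using f0(1) el by (simp add: g_def)
  have l: "0 < \<mu> (e i)" for i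
  proof -
    have "g i \<noteq> 0" using gg[of i i] by auto
    then have "0 < Q (g i) \<bullet> g i" by (rule pos)
    then show ?thesis using gg[of i i] by (simp add: Qg)
  qed
  have d: "0 < d i" "d i * d i * \<mu> (e i) = 1" for i using l[of i] by (simp_all add: d_def)
  have b: "Q (b i) \<bullet> b j = (if i = j then 1 else 0)" for i j
    using d(2)[of j] by (simp add: b_def linear_cmul[OF lin] Qg gg mult_ac)
  define T where "T x = (\<Sum>i\<in>UNIV. (x $ i) *\<^sub>R b i)" for x :: "real ^ 'n"
  have linT: "linear T" unfolding T_def
    by (rule linearI) (auto simp: algebra_simps sum.distrib scaleR_sum_right)
  have QT: "Q (T u) \<bullet> T v = u \<bullet> v" for u v
  proof -
    have "Q (T u) \<bullet> T v = (\<Sum>i\<in>UNIV. \<Sum>j\<in>UNIV. (u $ i) * ((v $ j) * (Q (b i) \<bullet> b j)))"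
      unfolding T_def by (simp add: linear_sum[OF lin] linear_cmul[OF lin] inner_sum_left inner_sum_right sum_distrib_left)
         (rule trans[OF sum.swap], simp add: mult.left_commute)
    also have "\<dots> = (\<Sum>i\<in>UNIV. (u $ i) * (v $ i))" by (simp add: b if_distrib sum.delta cong: if_cong)
    also have "\<dots> = u \<bullet> v" by (simp add: inner_vec_def)
    finally show ?thesis .
  qed
  have adj: "adjoint T (Q (T u)) = u" for u
  proof (rule vector_eq_ldot[THEN iffD1], rule allI)
    fix z show "z \<bullet> adjoint T (Q (T u)) = z \<bullet> u"
      using QT[of u z] by (simp add: adjoint_works[OF linT] inner_commute)
  qed
  have lin2: "linear (Q \<circ> T)" by (rule linear_compose[OF linT lin])
  have linA: "linear (adjoint T)" by (rule adjoint_linear[OF linT])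
  have "adjoint T \<circ> (Q \<circ> T) = id" using adj by (simp add: fun_eq_iff)
  then have "1 = det (matrix (adjoint T \<circ> (Q \<circ> T)))" by simp
  also have "\<dots> = det (matrix (adjoint T)) * (det (matrix Q) * det (matrix T))"
    by (simp add: matrix_compose[OF lin2 linA] matrix_compose[OF linT lin] det_mul)
  also have "det (matrix (adjoint T)) = det (matrix T)"
    by (simp add: matrix_adjoint[OF linT])
  finally have det: "(det (matrix T))\<^sup>2 * det (matrix Q) = 1" by (simp add: power2_eq_square mult_ac)
  have "inj T" using det det_nz_iff_inj[OF linT] by auto
  then have bij: "bij T" using linear_injective_imp_surjective[OF linT] by (simp add: bij_def)
  define O' where "O' x = (\<Sum>i\<in>UNIV. (x $ i) *\<^sub>R g i)" for x :: "real ^ 'n"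
  define D where "D x = (\<chi> i. d i * x $ i)" for x :: "real ^ 'n"
  have linO: "linear O'" unfolding O'_def
    by (rule linearI) (auto simp: algebra_simps sum.distrib scaleR_sum_right)
  have linD: "linear D" unfolding D_def by (rule linearI) (auto simp: vec_eq_iff algebra_simps)
  have OO: "O' u \<bullet> O' v = u \<bullet> v" for u v
  proof -
    have "O' u \<bullet> O' v = (\<Sum>i\<in>UNIV. \<Sum>j\<in>UNIV. (u $ i) * ((v $ j) * (g i \<bullet> g j)))"
      unfolding O'_def by (simp add: inner_sum_left inner_sum_right sum_distrib_left)
         (rule trans[OF sum.swap], simp add: mult.left_commute)
    also have "\<dots> = (\<Sum>i\<in>UNIV. (u $ i) * (v $ i))" by (simp add: gg if_distrib sum.delta cong: if_cong)
    also have "\<dots> = u \<bullet> v" by (simp add: inner_vec_def)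
    finally show ?thesis .
  qed
  then have orth: "orthogonal_transformation O'" using linO by (simp add: orthogonal_transformation_def)
  then have detO: "\<bar>det (matrix O')\<bar> = 1"
    using det_orthogonal_matrix[of "matrix O'"] by (auto simp: orthogonal_transformation_matrix)
  have TOD: "T = O' \<circ> D" by (simp add: fun_eq_iff T_def O'_def D_def b_def mult.commute)
  have detD: "det (matrix D) = prod d UNIV" by (simp add: D_def matrix_def axis_def det_diagonal)
  have detT: "\<bar>det (matrix T)\<bar> = \<bar>prod d UNIV\<bar>"
    unfolding TOD matrix_compose[OF linD linO] det_mul abs_mult detO detD by simp
  have meas: "measure lebesgue (T ` S) = \<bar>det (matrix T)\<bar> * measure lebesgue S" if S: "compact S" for S
  proof -
    have cD: "compact (D ` S)" by (rule compact_continuous_image[OF linear_continuous_on[OF linD[unfolded linear_conv_bounded_linear]] S])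
    then have cO: "compact (O' ` D ` S)" by (rule compact_continuous_image[OF linear_continuous_on[OF linO[unfolded linear_conv_bounded_linear]]])
    have "measure lborel (O' ` D ` S) = measure lborel (D ` S)"
      unfolding measure_def
      by (subst emeasure_isometry_image[OF linO _ cD]) (use orth in \<open>auto simp: orthogonal_transformation_norm\<close>)
    then have "measure lebesgue (O' ` D ` S) = measure lebesgue (D ` S)"
      using cD cO by (simp add: borel_closed compact_imp_closed)
    also have "\<dots> = \<bar>prod d UNIV\<bar> * measure lebesgue S"
      unfolding D_def by (rule measure_stretch[OF lmeasurable_compact[OF S]])
    finally show ?thesis unfolding detT by (simp add: TOD image_comp)
  qed
  show thesis by (rule that[OF linT bij QT det meas])
qed

section \<open>Rolling balls, uniform cap volumes and second-order expansion\<close>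

context
  fixes K :: "(real ^ 'n) set"
  assumes K: "smooth_body K" and card: "2 \<le> CARD('n)"
begin

interpretation smooth_body K by (rule K)
interpretation polar: origin_body "polar_body K" by (rule origin_body_polar)

lemma cap_lmeasurable: "K \<inter> {x. a \<le> u \<bullet> x} \<in> lmeasurable"
  by (intro lmeasurable_compact compact_Int_closed compact closed_halfspace_ge)

text \<open>Lipschitz continuity of \<open>dual_point\<close> bounds the gauge near every boundary
  point by its linear part plus a quadratic term with one constant for the whole boundary. On the
  displayed ball touching at x the linear part is negative enough to absorb this term.\<close>

lemma inner_rolling_ball:
  assumes M: "0 < M" "\<And>p q. p \<in> frontier K \<Longrightarrow> q \<in> frontier K \<Longrightarrow> norm (dual_point K p - dual_point K q) \<le> M * norm (p - q)"
  obtains L where "0 < L"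
    "\<And>x. x \<in> frontier K \<Longrightarrow> cball (x - (1 / (2 * L)) *\<^sub>R dual_point K x) (norm (dual_point K x) / (2 * L)) \<subseteq> K"
proof -
  let ?g = "supp (polar_body K)"
  obtain R where R: "0 < R" "\<And>x. x \<in> K \<Longrightarrow> norm x \<le> R" by (rule bound) blast
  obtain R' where R': "0 < R'" "\<And>x. x \<in> polar_body K \<Longrightarrow> norm x \<le> R'" by (rule polar.bound) blast
  \<comment> \<open>Lipschitz constant at points x + v off the boundary: the radial projection moves
    x + v to a point within 2 (1 + R R') |v| of x as long as the gauge is at least 1/2.\<close>
  define M' where "M' = M * (2 * (1 + R * R'))"
  \<comment> \<open>The second summand keeps the ball so small that R' |v| <= 1/2 on it, as the
    quadratic bound requires.\<close>
  define L where "L = M' + 2 * R' * R'"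
  have M'0: "0 < M'" using M(1) R(1) R'(1) by (simp add: M'_def add_pos_pos)
  have L: "0 < L" using M'0 R'(1) by (simp add: L_def add_pos_pos)
  have quad: "?g (x + v) \<le> 1 + dual_point K x \<bullet> v + M' * (norm v)\<^sup>2"
    if x: "x \<in> frontier K" and v: "R' * norm v \<le> 1/2" for x v
  proof -
    let ?z = "x + v"
    have gx: "?g x = 1" using x by (simp add: frontier_iff)
    have dg: "\<bar>?g ?z - 1\<bar> \<le> R' * norm v" using polar.supp_diff_le[OF R'(2), of ?z x] gx by simp
    then have gz: "1/2 \<le> ?g ?z" using v by linarith
    then have z0: "?z \<noteq> 0" by auto
    define p where "p = (1 / ?g ?z) *\<^sub>R ?z"
    have p: "p \<in> frontier K" unfolding p_def by (rule frontier_scale[OF z0])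
    have Gp: "dual_point K p = dual_point K ?z" unfolding p_def using gz by (intro dual_point_scale) simp
    have "p - x = (1 / ?g ?z) *\<^sub>R (v + (1 - ?g ?z) *\<^sub>R x)" using gz by (simp add: p_def algebra_simps)
    then have "norm (p - x) = (1 / ?g ?z) * norm (v + (1 - ?g ?z) *\<^sub>R x)" using gz by simp
    also have "\<dots> \<le> 2 * norm (v + (1 - ?g ?z) *\<^sub>R x)"
      using gz by (intro mult_right_mono) (auto simp: divide_le_eq)
    also have "norm (v + (1 - ?g ?z) *\<^sub>R x) \<le> norm v + \<bar>1 - ?g ?z\<bar> * norm x"
      by (metis norm_triangle_ineq norm_scaleR)
    also have "\<bar>1 - ?g ?z\<bar> * norm x \<le> (R' * norm v) * R"
      using dg R(2)[of x] x frontier_subset by (intro mult_mono) (auto simp: abs_minus_commute)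
    finally have px: "norm (p - x) \<le> 2 * (1 + R * R') * norm v" by (simp add: algebra_simps)
    have "norm (dual_point K ?z - dual_point K x) \<le> M * norm (p - x)"
      using M(2)[OF p x] by (simp add: Gp)
    also have "\<dots> \<le> M' * norm v" using px M(1) by (simp add: M'_def mult_left_mono mult.assoc)
    finally have dz: "norm (dual_point K ?z - dual_point K x) \<le> M' * norm v" .
    have "?g ?z - ?g x - dual_point K x \<bullet> (?z - x) \<le> (dual_point K ?z - dual_point K x) \<bullet> (?z - x)"
      by (rule gauge_increment(2))
    also have "\<dots> \<le> norm (dual_point K ?z - dual_point K x) * norm v"
      using norm_cauchy_schwarz[of "dual_point K ?z - dual_point K x" v] by simp
    also have "\<dots> \<le> (M' * norm v) * norm v" using dz by (intro mult_right_mono) auto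
    finally show ?thesis using gx by (simp add: power2_eq_square mult.assoc)
  qed
  show thesis
  proof (rule that[OF L])
    fix x assume x: "x \<in> frontier K"
    let ?y = "dual_point K x"
    show "cball (x - (1 / (2 * L)) *\<^sub>R ?y) (norm ?y / (2 * L)) \<subseteq> K"
    proof
      fix z assume z: "z \<in> cball (x - (1 / (2 * L)) *\<^sub>R ?y) (norm ?y / (2 * L))"
      define v where "v = z - x"
      have zd: "norm (v + (1 / (2 * L)) *\<^sub>R ?y) \<le> norm ?y / (2 * L)"
      proof -
        have "dist (x - (1 / (2 * L)) *\<^sub>R ?y) z = norm (v + (1 / (2 * L)) *\<^sub>R ?y)"
          unfolding dist_commute[of _ z] by (simp add: v_def dist_norm algebra_simps)
        then show ?thesis using z by simp
      qed
      then have "(norm (v + (1 / (2 * L)) *\<^sub>R ?y))\<^sup>2 \<le> (norm ?y / (2 * L))\<^sup>2" by (intro power_mono) auto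
      moreover have "(norm (v + (1 / (2 * L)) *\<^sub>R ?y))\<^sup>2 = (norm v)\<^sup>2 + (1 / L) * (?y \<bullet> v) + (norm ?y / (2 * L))\<^sup>2"
      proof -
        have "(norm (v + (1 / (2 * L)) *\<^sub>R ?y))\<^sup>2 = (norm v)\<^sup>2 + 2 * ((1 / (2 * L)) * (?y \<bullet> v)) + (norm ((1 / (2 * L)) *\<^sub>R ?y))\<^sup>2"
          unfolding power2_norm_eq_inner by (simp add: inner_add_left inner_add_right inner_commute algebra_simps)
        then show ?thesis using L by simp
      qed
      ultimately have "(norm v)\<^sup>2 + (1 / L) * (?y \<bullet> v) \<le> 0" by linarith
      then have "L * ((norm v)\<^sup>2 + (1 / L) * (?y \<bullet> v)) \<le> 0" using L by (simp add: mult_le_0_iff)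
      then have 1: "L * (norm v)\<^sup>2 + ?y \<bullet> v \<le> 0" using L by (simp add: distrib_left)
      have "norm v \<le> norm (v + (1 / (2 * L)) *\<^sub>R ?y) + norm ((1 / (2 * L)) *\<^sub>R ?y)"
        using norm_triangle_ineq4[of "v + (1 / (2 * L)) *\<^sub>R ?y" "(1 / (2 * L)) *\<^sub>R ?y"] by simp
      also have "\<dots> \<le> norm ?y / (2 * L) + norm ?y / (2 * L)" using zd L by simp
      also have "\<dots> \<le> R' / L" using R'(2)[OF dual_point(1)[of x]] L by (simp add: divide_right_mono)
      finally have "R' * norm v \<le> R' * (R' / L)" using R'(1) by (intro mult_left_mono) auto
      also have "\<dots> \<le> 1/2" using L M'0 by (simp add: divide_le_eq L_def)
      finally have "?g (x + v) \<le> 1 + ?y \<bullet> v + M' * (norm v)\<^sup>2" by (rule quad[OF x])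
      also have "\<dots> \<le> 1 + ?y \<bullet> v + L * (norm v)\<^sup>2" using R'(1) by (simp add: L_def mult_right_mono)
      also have "\<dots> \<le> 1" using 1 by linarith
      finally show "z \<in> K" by (simp add: mem_iff v_def)
    qed
  qed
qed

text \<open>The point (1 - s) x lies at depth at least \<open>t\<close> inside the rolling ball at
  x, with \<open>t\<close> of order s. So every half-space through it, whatever its direction,
  contains a cap of that ball of height \<open>t\<close>.\<close>

lemma cap_volume_uniform_lower:
  assumes M: "0 < M" "\<And>p q. p \<in> frontier K \<Longrightarrow> q \<in> frontier K \<Longrightarrow> norm (dual_point K p - dual_point K q) \<le> M * norm (p - q)"
  obtains C s0 where "0 < C" "0 < s0" "s0 < 1"
    "\<And>x s u. x \<in> frontier K \<Longrightarrow> 0 < s \<Longrightarrow> s < s0 \<Longrightarrow> u \<noteq> 0 \<Longrightarrow>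
      C * s powr ((real CARD('n) + 1) / 2) \<le> measure lebesgue (K \<inter> {z. u \<bullet> ((1 - s) *\<^sub>R x) \<le> u \<bullet> z})"
proof -
  obtain L where L: "0 < L"
    "\<And>x. x \<in> frontier K \<Longrightarrow> cball (x - (1 / (2 * L)) *\<^sub>R dual_point K x) (norm (dual_point K x) / (2 * L)) \<subseteq> K"
  proof (rule inner_rolling_ball[OF M(1)])
    show "norm (dual_point K p - dual_point K q) \<le> M * norm (p - q)" if "p \<in> frontier K" "q \<in> frontier K" for p q
      by (rule M(2)[OF that])
  qed (rule that)
  obtain R where R: "0 < R" "\<And>x. x \<in> K \<Longrightarrow> norm x \<le> R" by (rule bound) blast
  obtain R' where R': "0 < R'" "\<And>x. x \<in> polar_body K \<Longrightarrow> norm x \<le> R'" by (rule polar.bound) blast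
  define p where "p = real (CARD('n) - 1) / 2"
  have p1: "p + 1 = (real CARD('n) + 1) / 2" using card by (simp add: p_def of_nat_diff field_simps)
  have p0: "0 \<le> p" by (simp add: p_def)
  define C where "C = cap_const CARD('n) * (1 / (2 * L * R)) powr p * (1 / (4 * R')) powr (p + 1)"
  \<comment> \<open>The second bound makes s |x|^2 at most 1 / (2L), so that the square term uses up
    at most half of the gain s / L.\<close>
  define s0 where "s0 = min (1/2) (1 / (2 * L * (R * R)))"
  have C: "0 < C" unfolding C_def using cap_const_pos[of "CARD('n)"] L(1) R(1) R'(1) by simp
  have s0: "0 < s0" "s0 < 1" using L(1) R(1) by (auto simp: s0_def)
  show thesis
  proof (rule that[OF C s0])
    fix x s u assume x: "x \<in> frontier K" and s: "0 < s" "s < s0" and u: "u \<noteq> (0 :: real ^ 'n)"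
    let ?y = "dual_point K x"
    define \<rho> where "\<rho> = norm ?y / (2 * L)"
    define c where "c = x - (1 / (2 * L)) *\<^sub>R ?y"
    \<comment> \<open>Chosen so that 2 \<rho> t = s / (4L): the squared distance of (1 - s) x from
      the centre is at most \<rho>^2 - s / (2L), hence at most (\<rho> - t)^2.\<close>
    define t where "t = s / (4 * norm ?y)"
    let ?v = "(1 / norm u) *\<^sub>R u"
    have xy: "x \<bullet> ?y = 1" by (rule inner_dual_point[OF x])
    have xR: "norm x \<le> R" using R(2) x frontier_subset by blast
    have "1 \<le> norm x * norm ?y" using norm_cauchy_schwarz[of x ?y] xy by simp
    also have "\<dots> \<le> R * norm ?y" using xR by (rule mult_right_mono) simp
    finally have yR: "1 \<le> R * norm ?y" .
    then have y0: "0 < norm ?y" using R(1) by (metis less_le_not_le mult_zero_right norm_ge_zero not_one_le_zero order_le_less)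
    have yR': "norm ?y \<le> R'" by (rule R'(2)[OF dual_point(1)])
    have sLR: "s * (2 * L * (R * R)) < 1"
      using s(2) L(1) R(1) by (simp add: s0_def pos_less_divide_eq)
    have "0 \<le> R * norm ?y" using yR by linarith
    then have RR: "1 \<le> (R * norm ?y) * (R * norm ?y)" using mult_mono[OF yR yR] by simp
    have t0: "0 < t" using s(1) y0 by (simp add: t_def)
    have t\<rho>: "t \<le> \<rho>"
    proof -
      have "s * (2 * L) * 1 \<le> s * (2 * L) * ((R * norm ?y) * (R * norm ?y))"
        using RR s(1) L(1) by (intro mult_left_mono) auto
      also have "\<dots> = (s * (2 * L * (R * R))) * (norm ?y * norm ?y)" by (simp add: mult_ac)
      also have "\<dots> \<le> 1 * (norm ?y * norm ?y)" using sLR by (intro mult_right_mono) auto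
      finally have "s * (2 * L) \<le> norm ?y * norm ?y" by simp
      moreover have "0 \<le> norm ?y * norm ?y" by simp
      ultimately have "s * (2 * L) \<le> norm ?y * (4 * norm ?y)" by linarith
      then show ?thesis using y0 L(1) unfolding t_def \<rho>_def by (subst frac_le_eq) (auto simp: divide_le_0_iff algebra_simps)
    qed
    have pc: "norm ((1 - s) *\<^sub>R x - c) \<le> \<rho> - t"
    proof (rule power2_le_imp_le)
      have "(1 - s) *\<^sub>R x - c = (1 / (2 * L)) *\<^sub>R ?y - s *\<^sub>R x" by (simp add: c_def algebra_simps)
      moreover have "(norm (a - b))\<^sup>2 = (norm a)\<^sup>2 - 2 * (a \<bullet> b) + (norm b)\<^sup>2" for a b :: "real ^ 'n"
        unfolding power2_norm_eq_inner by (simp add: inner_diff_left inner_diff_right inner_commute)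
      moreover have "((1 / (2 * L)) *\<^sub>R ?y) \<bullet> (s *\<^sub>R x) = (1 / (2 * L)) * (s * (x \<bullet> ?y))" by (simp add: inner_commute)
      ultimately have "(norm ((1 - s) *\<^sub>R x - c))\<^sup>2 = (norm ((1 / (2 * L)) *\<^sub>R ?y))\<^sup>2 - 2 * ((1 / (2 * L)) * (s * (x \<bullet> ?y))) + (norm (s *\<^sub>R x))\<^sup>2"
        by (simp only:)
      also have "\<dots> = \<rho>\<^sup>2 - s / L + s * (s * (norm x * norm x))"
        using L(1) s(1) xy by (simp add: \<rho>_def power_mult_distrib power2_eq_square)
      also have "s * (s * (norm x * norm x)) \<le> s * (1 / (2 * L))"
      proof (intro mult_left_mono)
        have "s * (norm x * norm x) \<le> s * (R * R)" using xR s(1) R(1) by (intro mult_left_mono mult_mono) auto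
        also have "\<dots> \<le> 1 / (2 * L)" using sLR L(1) by (simp add: pos_le_divide_eq mult_ac)
        finally show "s * (norm x * norm x) \<le> 1 / (2 * L)" .
      qed (use s in simp)
      also have "\<rho>\<^sup>2 - s / L + s * (1 / (2 * L)) = \<rho>\<^sup>2 - s / (2 * L)" by (simp add: field_simps)
      also have "\<dots> \<le> \<rho>\<^sup>2 - s / (4 * L)" using s(1) L(1) by (simp add: divide_left_mono)
      also have "s / (4 * L) = 2 * \<rho> * t" using y0 L(1) by (simp add: \<rho>_def t_def)
      also have "\<rho>\<^sup>2 - 2 * \<rho> * t \<le> (\<rho> - t)\<^sup>2" by (simp add: power2_diff)
      finally show "(norm ((1 - s) *\<^sub>R x - c))\<^sup>2 \<le> (\<rho> - t)\<^sup>2" by simp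
    qed (use t\<rho> in simp)
    have v1: "norm ?v = 1" using u by simp
    have "?v \<bullet> ((1 - s) *\<^sub>R x - c) \<le> norm ?v * norm ((1 - s) *\<^sub>R x - c)" by (rule norm_cauchy_schwarz)
    then have "?v \<bullet> ((1 - s) *\<^sub>R x - c) \<le> \<rho> - t" using pc v1 by simp
    then have "ball_cap c \<rho> ?v t \<subseteq> {z. u \<bullet> ((1 - s) *\<^sub>R x) \<le> u \<bullet> z}" by (rule ball_cap_subset_halfspace[OF u])
    moreover have "ball_cap c \<rho> ?v t \<subseteq> K" using L(2)[OF x] unfolding ball_cap_def c_def \<rho>_def by auto
    ultimately have sub: "ball_cap c \<rho> ?v t \<subseteq> K \<inter> {z. u \<bullet> ((1 - s) *\<^sub>R x) \<le> u \<bullet> z}" by blast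
    have "C * s powr (p + 1) \<le> cap_const CARD('n) * (2 * \<rho> - t) powr p * t powr (p + 1)"
    proof -
      have "1 / (2 * L * R) \<le> \<rho>"
        using yR L(1) R(1) by (simp add: \<rho>_def field_simps)
      then have "1 / (2 * L * R) \<le> 2 * \<rho> - t" using t\<rho> by linarith
      then have 1: "(1 / (2 * L * R)) powr p \<le> (2 * \<rho> - t) powr p" using p0 L(1) R(1) by (intro powr_mono2) auto
      have "1 / (4 * R') \<le> 1 / (4 * norm ?y)" using yR' y0 R'(1) by (intro divide_left_mono) auto
      then have "1 / (4 * R') * s \<le> 1 / (4 * norm ?y) * s" using s(1) by (intro mult_right_mono) auto
      then have "1 / (4 * R') * s \<le> t" by (simp add: t_def)
      then have 2: "(1 / (4 * R') * s) powr (p + 1) \<le> t powr (p + 1)" using p0 R'(1) s(1) by (intro powr_mono2) auto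
      have "(1 / (4 * R') * s) powr (p + 1) = (1 / (4 * R')) powr (p + 1) * s powr (p + 1)"
        by (rule powr_mult)
      then have "C * s powr (p + 1) = cap_const CARD('n) * ((1 / (2 * L * R)) powr p * (1 / (4 * R') * s) powr (p + 1))"
        by (simp add: C_def)
      also have "\<dots> \<le> cap_const CARD('n) * ((2 * \<rho> - t) powr p * t powr (p + 1))"
        using 1 2 cap_const_pos[of "CARD('n)"] by (intro mult_left_mono mult_mono) auto
      finally show ?thesis by simp
    qed
    also have "\<dots> \<le> measure lebesgue (ball_cap c \<rho> ?v t)"
      unfolding p_def by (rule measure_ball_cap_bounds(2)[OF card v1]) (use t0 t\<rho> in auto)
    also have "\<dots> \<le> measure lebesgue (K \<inter> {z. u \<bullet> ((1 - s) *\<^sub>R x) \<le> u \<bullet> z})"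
      by (rule measure_mono_fmeasurable[OF sub fmeasurableD[OF ball_cap_lmeasurable] cap_lmeasurable])
    finally show "C * s powr ((real CARD('n) + 1) / 2) \<le> measure lebesgue (K \<inter> {z. u \<bullet> ((1 - s) *\<^sub>R x) \<le> u \<bullet> z})"
      by (simp add: p1)
  qed
qed

text \<open>Second-order expansion from differentiability of the gradient \<Gamma> at the single
  point x, by the mean value theorem along the segment. The square replaces the gauge itself, whose
  Hessian is degenerate in the radial direction.\<close>

lemma squared_gauge_expansion:
  assumes x: "x \<in> frontier K" and A: "(dual_point K has_derivative A) (at x)" and e: "0 < e"
  obtains r where "0 < r" "\<And>v. norm v < r \<Longrightarrow>
    \<bar>(supp (polar_body K) (x + v))\<^sup>2 / 2 - 1/2 - dual_point K x \<bullet> v - (A v \<bullet> v + (dual_point K x \<bullet> v)\<^sup>2) / 2\<bar> \<le> e * (norm v)\<^sup>2"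
proof -
  let ?g = "supp (polar_body K)"
  let ?y = "dual_point K x"
  interpret A: bounded_linear A by (rule has_derivative_bounded_linear[OF A])
  have x0: "x \<noteq> 0" by (rule frontier_nonzero[OF x])
  have g1: "?g x = 1" using x by (simp add: frontier_iff)
  define \<Gamma> where "\<Gamma> z = ?g z *\<^sub>R dual_point K z" for z
  define Q where "Q v = A v + (?y \<bullet> v) *\<^sub>R ?y" for v
  have \<Gamma>d: "(\<Gamma> has_derivative Q) (at x)"
    unfolding \<Gamma>_def Q_def
    by (rule has_derivative_eq_rhs[OF has_derivative_scaleR[OF gauge_has_derivative[OF x0] A]])
      (auto simp: fun_eq_iff g1)
  then obtain r where r: "0 < r" "\<And>z. norm (z - x) < r \<Longrightarrow> norm (\<Gamma> z - \<Gamma> x - Q (z - x)) \<le> e * norm (z - x)"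
    using e unfolding has_derivative_at_alt by metis
  have \<Gamma>x: "\<Gamma> x = ?y" by (simp add: \<Gamma>_def g1)
  have Qs: "Q (t *\<^sub>R v) = t *\<^sub>R Q v" for t v by (simp add: Q_def A.scaleR algebra_simps)
  show thesis
  \<comment> \<open>The bound |v| < |x| keeps the segment from x to x + v away from the origin,
    where the gauge is not differentiable.\<close>
  proof (rule that[of "min r (norm x)"])
    show "0 < min r (norm x)" using r(1) x0 by simp
    fix v :: "real ^ 'n" assume v: "norm v < min r (norm x)"
    define \<theta> where "\<theta> t = (?g (x + t *\<^sub>R v))\<^sup>2 / 2 - t * (?y \<bullet> v) - t\<^sup>2 * (Q v \<bullet> v) / 2" for t :: real
    have "\<exists>\<xi>. 0 < \<xi> \<and> \<xi> < 1 \<and> \<theta> 1 - \<theta> 0 = (1 - 0) * ((\<Gamma> (x + \<xi> *\<^sub>R v) - ?y - \<xi> *\<^sub>R Q v) \<bullet> v)"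
    proof (rule MVT2)
      fix t :: real assume t: "0 \<le> t" "t \<le> 1"
      have "norm (t *\<^sub>R v) \<le> norm v" using t by (simp add: mult_left_le_one_le)
      then have z0: "x + t *\<^sub>R v \<noteq> 0" using v by (metis add_eq_0_iff2 min_less_iff_conj norm_minus_cancel not_less)
      have c1: "((\<lambda>t. x + t *\<^sub>R v) has_derivative (\<lambda>r. r *\<^sub>R v)) (at t)" by (auto intro!: derivative_eq_intros)
      have "((\<lambda>t. ?g (x + t *\<^sub>R v)) has_derivative (\<lambda>r. dual_point K (x + t *\<^sub>R v) \<bullet> (r *\<^sub>R v))) (at t)"
        by (rule has_derivative_compose[OF c1 gauge_has_derivative[OF z0]])
      then have "((\<lambda>t. ?g (x + t *\<^sub>R v)) has_real_derivative (dual_point K (x + t *\<^sub>R v) \<bullet> v)) (at t)"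
        unfolding has_field_derivative_def by (rule has_derivative_eq_rhs) (auto simp: fun_eq_iff)
      then show "(\<theta> has_real_derivative (\<Gamma> (x + t *\<^sub>R v) - ?y - t *\<^sub>R Q v) \<bullet> v) (at t)"
        unfolding \<theta>_def
        by (auto intro!: derivative_eq_intros simp: \<Gamma>_def inner_diff_left)
    qed simp
    then obtain \<xi> where \<xi>: "0 < \<xi>" "\<xi> < 1" "\<theta> 1 - \<theta> 0 = (\<Gamma> (x + \<xi> *\<^sub>R v) - ?y - \<xi> *\<^sub>R Q v) \<bullet> v" by auto
    have xv: "norm (\<xi> *\<^sub>R v) \<le> norm v" using \<xi> by (simp add: mult_left_le_one_le)
    have "norm (\<Gamma> (x + \<xi> *\<^sub>R v) - ?y - \<xi> *\<^sub>R Q v) \<le> e * norm (\<xi> *\<^sub>R v)"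
      using r(2)[of "x + \<xi> *\<^sub>R v"] v xv by (simp add: \<Gamma>x Qs)
    also have "\<dots> \<le> e * norm v" using xv e by (intro mult_left_mono) auto
    finally have n: "norm (\<Gamma> (x + \<xi> *\<^sub>R v) - ?y - \<xi> *\<^sub>R Q v) \<le> e * norm v" .
    have "\<bar>\<theta> 1 - \<theta> 0\<bar> \<le> norm (\<Gamma> (x + \<xi> *\<^sub>R v) - ?y - \<xi> *\<^sub>R Q v) * norm v"
      unfolding \<xi>(3) by (rule Cauchy_Schwarz_ineq2)
    also have "\<dots> \<le> (e * norm v) * norm v" using n by (rule mult_right_mono) simp
    finally have "\<bar>\<theta> 1 - \<theta> 0\<bar> \<le> e * (norm v)\<^sup>2" by (simp add: power2_eq_square mult.assoc)
    moreover have "\<theta> 1 - \<theta> 0 = (?g (x + v))\<^sup>2 / 2 - 1/2 - ?y \<bullet> v - (A v \<bullet> v + (?y \<bullet> v)\<^sup>2) / 2"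
      by (simp add: \<theta>_def g1 Q_def inner_add_left power2_eq_square)
    ultimately show "\<bar>(?g (x + v))\<^sup>2 / 2 - 1/2 - ?y \<bullet> v - (A v \<bullet> v + (?y \<bullet> v)\<^sup>2) / 2\<bar> \<le> e * (norm v)\<^sup>2" by simp
  qed
qed

end

section \<open>Sharp asymptotics of cap volumes at a boundary point\<close>

lemma mem_cball_tangent_iff:
  fixes e v :: "'a::real_inner"
  assumes "norm e = 1" "0 < \<rho>"
  shows "e + v \<in> cball ((1 - \<rho>) *\<^sub>R e) \<rho> \<longleftrightarrow> e \<bullet> v + (norm v)\<^sup>2 / (2 * \<rho>) \<le> 0"
proof -
  have "e \<bullet> e = 1" using assms(1) by (simp add: norm_eq_1)
  then have sq: "(norm (v + \<rho> *\<^sub>R e))\<^sup>2 = (norm v)\<^sup>2 + 2 * \<rho> * (e \<bullet> v) + \<rho>\<^sup>2"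
    unfolding power2_norm_eq_inner
    by (simp add: inner_add_left inner_add_right inner_commute power2_eq_square)
  have "e + v - (1 - \<rho>) *\<^sub>R e = v + \<rho> *\<^sub>R e" by (simp add: algebra_simps)
  then have "dist ((1 - \<rho>) *\<^sub>R e) (e + v) = norm (v + \<rho> *\<^sub>R e)" by (metis dist_commute dist_norm)
  then have "e + v \<in> cball ((1 - \<rho>) *\<^sub>R e) \<rho> \<longleftrightarrow> norm (v + \<rho> *\<^sub>R e) \<le> \<rho>" by simp
  also have "\<dots> \<longleftrightarrow> (norm (v + \<rho> *\<^sub>R e))\<^sup>2 \<le> \<rho>\<^sup>2" using assms(2) by (simp add: power_mono_iff)
  also have "\<dots> \<longleftrightarrow> 2 * \<rho> * (e \<bullet> v + (norm v)\<^sup>2 / (2 * \<rho>)) \<le> 0"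
    unfolding sq using assms(2) by (simp add: algebra_simps)
  also have "\<dots> \<longleftrightarrow> e \<bullet> v + (norm v)\<^sup>2 / (2 * \<rho>) \<le> 0" using assms(2) by (simp add: mult_le_0_iff)
  finally show ?thesis .
qed

context
  fixes K :: "(real ^ 'n) set"
  assumes K: "smooth_body K" and K': "smooth_body (polar_body K)" and card: "2 \<le> CARD('n)"
begin

interpretation smooth_body K by (rule K)
interpretation polar: smooth_body "polar_body K" by (rule K')

text \<open>In the coordinates given by T the boundary point is a unit vector e, its supporting
  functional is e as well, and up to second order \<open>K\<close> looks like the unit ball at e.
  Volumes change by 1 / sqrt q, so cap volumes become those of balls of radius close to 1.\<close>

lemma boundary_frame:
  assumes x: "x \<in> frontier K" and A: "(dual_point K has_derivative A) (at x)"
    and pos: "\<And>v. v \<noteq> 0 \<Longrightarrow> 0 < A v \<bullet> v + (dual_point K x \<bullet> v)\<^sup>2"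
  defines "q \<equiv> det (matrix (\<lambda>v. A v + (dual_point K x \<bullet> v) *\<^sub>R dual_point K x))"
  obtains T :: "real ^ 'n \<Rightarrow> real ^ 'n" and e where "linear T" "bij T" "0 < q" "\<And>S. compact S \<Longrightarrow> measure lebesgue (T ` S) = 1 / sqrt q * measure lebesgue S"
    "T e = x" "norm e = 1" "\<And>v. dual_point K x \<bullet> T v = e \<bullet> v"
    "\<And>\<epsilon>. 0 < \<epsilon> \<Longrightarrow> \<exists>r>0. \<forall>v. norm v < r \<longrightarrow>
      \<bar>(supp (polar_body K) (T (e + v)))\<^sup>2 / 2 - 1/2 - e \<bullet> v - (norm v)\<^sup>2 / 2\<bar> \<le> \<epsilon> * (norm v)\<^sup>2"
proof -
  interpret A: bounded_linear A by (rule has_derivative_bounded_linear[OF A])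
  let ?y = "dual_point K x"
  define Q where "Q v = A v + (?y \<bullet> v) *\<^sub>R ?y" for v
  have x0: "x \<noteq> 0" by (rule frontier_nonzero[OF x])
  have xy: "?y \<bullet> x = 1" using inner_dual_point[OF x] by (simp add: inner_commute)
  have linQ: "linear Q" unfolding Q_def by (rule linearI) (auto simp: A.add A.scaleR inner_add_right algebra_simps)
  have Qvv: "Q v \<bullet> v = A v \<bullet> v + (?y \<bullet> v)\<^sup>2" for v by (simp add: Q_def inner_add_left power2_eq_square)
  have symQ: "Q u \<bullet> v = Q v \<bullet> u" for u v
    using dual_point_derivative_symmetric[OF x0 A, of u v] by (simp add: Q_def inner_add_left)
  obtain T where T: "linear T" "bij T" "\<And>u v. Q (T u) \<bullet> T v = u \<bullet> v" "(det (matrix T))\<^sup>2 * det (matrix Q) = 1"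
      and mT: "\<And>S. compact S \<Longrightarrow> measure lebesgue (T ` S) = \<bar>det (matrix T)\<bar> * measure lebesgue S"
    by (rule orthonormal_frame_exists[OF linQ symQ]) (use pos Qvv in auto)
  have q: "det (matrix Q) = q" by (simp add: q_def Q_def[abs_def])
  have q0: "0 < q" using T(4) unfolding q by (metis zero_less_mult_pos zero_less_one zero_less_power2 mult_zero_left power_zero_numeral zero_neq_one)
  have detT: "\<bar>det (matrix T)\<bar> = 1 / sqrt q"
  proof -
    have "(det (matrix T))\<^sup>2 = 1 / q" using T(4) q0 unfolding q by (simp add: field_simps)
    then have "sqrt ((det (matrix T))\<^sup>2) = sqrt (1 / q)" by simp
    then show ?thesis by (simp add: real_sqrt_divide)
  qed
  obtain e where e: "T e = x" using T(2) by (metis bij_pointE)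
  \<comment> \<open>The radial degeneracy A x = 0 gives Q x = y, and therefore |e| = 1 and the
    identification of y with e.\<close>
  have Qx: "Q x = ?y" using dual_point_derivative_radial[OF x0 A] xy by (simp add: Q_def)
  have "e \<bullet> e = 1" using T(3)[of e e] Qx xy by (simp add: e)
  then have e1: "norm e = 1" by (simp add: norm_eq_1)
  have yT: "?y \<bullet> T v = e \<bullet> v" for v using T(3)[of e v] Qx by (simp add: e)
  obtain B where B: "0 < B" "\<And>v. norm (T v) \<le> B * norm v"
    using linear_bounded_pos[OF T(1)] by blast
  have "\<exists>r>0. \<forall>v. norm v < r \<longrightarrow>
      \<bar>(supp (polar_body K) (T (e + v)))\<^sup>2 / 2 - 1/2 - e \<bullet> v - (norm v)\<^sup>2 / 2\<bar> \<le> \<epsilon> * (norm v)\<^sup>2" if \<epsilon>: "0 < \<epsilon>" for \<epsilon>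
  proof -
    have "0 < \<epsilon> / B\<^sup>2" using \<epsilon> B(1) by simp
    then obtain r where r: "0 < r" "\<And>v. norm v < r \<Longrightarrow>
       \<bar>(supp (polar_body K) (x + v))\<^sup>2 / 2 - 1/2 - ?y \<bullet> v - (A v \<bullet> v + (?y \<bullet> v)\<^sup>2) / 2\<bar> \<le> (\<epsilon> / B\<^sup>2) * (norm v)\<^sup>2"
      by (rule squared_gauge_expansion[OF K card x A]) blast
    show ?thesis
    proof (intro exI[of _ "r / B"] conjI allI impI)
      show "0 < r / B" using r(1) B(1) by simp
      fix v :: "real ^ 'n" assume "norm v < r / B"
      then have "B * norm v < r" using B(1) by (simp add: pos_less_divide_eq mult.commute)
      then have "norm (T v) < r" using B(2)[of v] by linarith
      note b = r(2)[OF this]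
      have "A (T v) \<bullet> T v + (?y \<bullet> T v)\<^sup>2 = (norm v)\<^sup>2"
        using T(3)[of v v] Qvv[of "T v"] by (simp add: power2_norm_eq_inner)
      then have "\<bar>(supp (polar_body K) (T (e + v)))\<^sup>2 / 2 - 1/2 - e \<bullet> v - (norm v)\<^sup>2 / 2\<bar> \<le> (\<epsilon> / B\<^sup>2) * (norm (T v))\<^sup>2"
        using b by (simp add: linear_add[OF T(1)] e yT)
      also have "\<dots> \<le> (\<epsilon> / B\<^sup>2) * (B * norm v)\<^sup>2"
        using B(2)[of v] \<epsilon> by (intro mult_left_mono power_mono) auto
      also have "\<dots> = \<epsilon> * (norm v)\<^sup>2" using B(1) by (simp add: power_mult_distrib)
      finally show "\<bar>(supp (polar_body K) (T (e + v)))\<^sup>2 / 2 - 1/2 - e \<bullet> v - (norm v)\<^sup>2 / 2\<bar> \<le> \<epsilon> * (norm v)\<^sup>2" .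
    qed
  qed
  moreover have "measure lebesgue (T ` S) = 1 / sqrt q * measure lebesgue S" if "compact S" for S
    using mT[OF that] detT by simp
  ultimately show thesis using that[OF T(1,2) q0 _ e e1 yT] by blast
qed

text \<open>Near e the transformed body lies in a ball of radius \<rho> slightly above 1 touching at
  e. By strict convexity and compactness the rest of \<open>K\<close> stays below a level 1 -
  \<gamma>, so caps of relative height less than \<gamma> see only the part inside that
  ball.\<close>

lemma cap_volume_sharp_upper:
  assumes x: "x \<in> frontier K" and A: "(dual_point K has_derivative A) (at x)"
    and pos: "\<And>v. v \<noteq> 0 \<Longrightarrow> 0 < A v \<bullet> v + (dual_point K x \<bullet> v)\<^sup>2" and \<eta>: "0 < \<eta>"
  defines "q \<equiv> det (matrix (\<lambda>v. A v + (dual_point K x \<bullet> v) *\<^sub>R dual_point K x))"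
    and "p \<equiv> real (CARD('n) - 1) / 2"
  shows "\<exists>s0>0. \<forall>s. 0 < s \<and> s < s0 \<longrightarrow>
    measure lebesgue (K \<inter> {z. 1 - s \<le> dual_point K x \<bullet> z})
      \<le> (1 + \<eta>) * (cap_const CARD('n) * 2 powr p / sqrt q) * s powr (p + 1)"
proof -
  let ?y = "dual_point K x"
  let ?g = "supp (polar_body K)"
  obtain T :: "real ^ 'n \<Rightarrow> real ^ 'n" and e where T: "linear T" "bij T" "0 < q" "\<And>S. compact S \<Longrightarrow> measure lebesgue (T ` S) = 1 / sqrt q * measure lebesgue S"
      "T e = x" "norm e = 1"
    and yT: "\<And>v. ?y \<bullet> T v = e \<bullet> v"
    and exp: "\<And>\<epsilon>. 0 < \<epsilon> \<Longrightarrow> \<exists>r>0. \<forall>v. norm v < r \<longrightarrow>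
      \<bar>(?g (T (e + v)))\<^sup>2 / 2 - 1/2 - e \<bullet> v - (norm v)\<^sup>2 / 2\<bar> \<le> \<epsilon> * (norm v)\<^sup>2"
    by (rule boundary_frame[OF x A pos, folded q_def]) blast+
  have ee: "e \<bullet> e = 1" using T(6) by (simp add: norm_eq_1)
  have p0: "0 \<le> p" by (simp add: p_def)
  obtain \<epsilon> where \<epsilon>: "0 < \<epsilon>" "\<epsilon> < 1/4" "(1 / (1 - 2 * \<epsilon>)) powr p < 1 + \<eta>"
  proof -
    have "((\<lambda>\<epsilon>::real. (1 / (1 - 2 * \<epsilon>)) powr p) \<longlongrightarrow> (1 / (1 - 2 * 0)) powr p) (at_right 0)"
      by (intro tendsto_intros) auto
    then have "\<forall>\<^sub>F \<epsilon> in at_right 0. (1 / (1 - 2 * \<epsilon>)) powr p < 1 + \<eta>"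
      using \<eta> by (intro order_tendstoD) auto
    moreover have "\<forall>\<^sub>F \<epsilon> in at_right 0. 0 < \<epsilon> \<and> \<epsilon> < (1/4::real)"
      by (rule eventually_at_rightI[of 0 "1/4"]) auto
    ultimately have "\<exists>\<epsilon>. (1 / (1 - 2 * \<epsilon>)) powr p < 1 + \<eta> \<and> 0 < \<epsilon> \<and> \<epsilon> < (1/4::real)"
      using eventually_happens[OF eventually_conj] by fastforce
    then show thesis using that by blast
  qed
  \<comment> \<open>1 / (2\<rho>) = 1/2 - \<epsilon>: the expansion with error \<epsilon> |v|^2 is
    then exactly the condition for membership in the ball of radius \<rho> touching at e.\<close>
  define \<rho> where "\<rho> = 1 / (1 - 2 * \<epsilon>)"
  have \<rho>: "0 < \<rho>" "1 \<le> \<rho>" "1 / (2 * \<rho>) = 1/2 - \<epsilon>" using \<epsilon> by (auto simp: \<rho>_def field_simps)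
  obtain r where r: "0 < r" "\<And>v. norm v < r \<Longrightarrow>
      \<bar>(?g (T (e + v)))\<^sup>2 / 2 - 1/2 - e \<bullet> v - (norm v)\<^sup>2 / 2\<bar> \<le> \<epsilon> * (norm v)\<^sup>2" using exp[OF \<epsilon>(1)] by blast
  define c where "c = (1 - \<rho>) *\<^sub>R e"
  \<comment> \<open>The part of \<open>K\<close> away from x; its maximal value of y is attained and
    less than 1, since y touches \<open>K\<close> in x only.\<close>
  define W where "W = K - T ` ball e r"
  have "open (T ` ball e r)"
    using open_bijective_linear_image_eq[OF T(1,2)] by simp
  then have cW: "compact W" unfolding W_def using compact by (rule compact_diff[rotated])
  have yle: "?y \<bullet> z \<le> 1" if "z \<in> K" for z
    using dual_point(1)[of x] that by (auto simp: polar_body_def inner_commute)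
  have ylt: "?y \<bullet> z < 1" if "z \<in> W" for z
  proof (rule ccontr)
    assume "\<not> ?y \<bullet> z < 1"
    then have "?y \<bullet> z = 1" using yle[of z] that by (auto simp: W_def)
    moreover have "?y \<bullet> x = 1" using inner_dual_point[OF x] by (simp add: inner_commute)
    moreover have "z \<in> polar_body (polar_body K)" "x \<in> polar_body (polar_body K)"
      using that x frontier_subset by (auto simp: W_def bipolar)
    ultimately have "z = x"
      using polar.unique[OF dual_point_frontier[OF frontier_nonzero[OF x]]] by blast
    then have "z \<in> T ` ball e r" using T(5) r(1) by force
    then show False using that by (simp add: W_def)
  qed
  obtain \<gamma> where \<gamma>: "0 < \<gamma>" "\<And>z. z \<in> W \<Longrightarrow> ?y \<bullet> z \<le> 1 - \<gamma>"
  proof (cases "W = {}")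
    case True
    show thesis by (rule that[of 1]) (use True in auto)
  next
    case False
    have "continuous_on W (\<lambda>z. ?y \<bullet> z)" by (intro continuous_intros)
    then obtain z0 where z0: "z0 \<in> W" "\<And>z. z \<in> W \<Longrightarrow> ?y \<bullet> z \<le> ?y \<bullet> z0"
      using continuous_attains_sup[OF cW False] by blast
    show thesis by (rule that[of "1 - ?y \<bullet> z0"]) (use ylt[OF z0(1)] z0(2) in auto)
  qed
  show ?thesis
  proof (intro exI[of _ "min \<gamma> 1"] conjI allI impI)
    show "0 < min \<gamma> 1" using \<gamma>(1) by simp
    fix s assume s: "0 < s \<and> s < min \<gamma> 1"
    have sub: "K \<inter> {z. 1 - s \<le> ?y \<bullet> z} \<subseteq> T ` ball_cap c \<rho> e s"
    proof
      fix z assume z: "z \<in> K \<inter> {z. 1 - s \<le> ?y \<bullet> z}"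
      have "z \<notin> W" using \<gamma>(2)[of z] z s by auto
      then obtain x' where x': "z = T x'" "x' \<in> ball e r" using z by (auto simp: W_def)
      define v where "v = x' - e"
      have v: "x' = e + v" "norm v < r" using x'(2) by (auto simp: v_def dist_norm norm_minus_commute)
      have "?g z \<le> 1" using z mem_iff by blast
      then have "(?g z)\<^sup>2 \<le> 1" using polar.supp_nonneg[of z] by (simp add: power_le_one)
      then have "e \<bullet> v + (norm v)\<^sup>2 / 2 - \<epsilon> * (norm v)\<^sup>2 \<le> 0"
        using r(2)[OF v(2)] unfolding x'(1) v(1) by linarith
      then have "e \<bullet> v + (norm v)\<^sup>2 * (1/2 - \<epsilon>) \<le> 0" by (simp add: algebra_simps)
      then have "e \<bullet> v + (norm v)\<^sup>2 / (2 * \<rho>) \<le> 0" unfolding \<rho>(3)[symmetric] by simp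
      then have "x' \<in> cball c \<rho>" unfolding v(1) c_def using mem_cball_tangent_iff[OF T(6) \<rho>(1)] by blast
      moreover have "\<rho> - s \<le> e \<bullet> (x' - c)"
        using z ee unfolding x'(1) by (simp add: yT c_def inner_diff_right)
      ultimately show "z \<in> T ` ball_cap c \<rho> e s" using x'(1) by (auto simp: ball_cap_def)
    qed
    have "T ` ball_cap c \<rho> e s \<in> lmeasurable"
      by (intro lmeasurable_compact compact_continuous_image linear_continuous_on compact_ball_cap
          T(1)[unfolded linear_conv_bounded_linear])
    then have "measure lebesgue (K \<inter> {z. 1 - s \<le> ?y \<bullet> z}) \<le> measure lebesgue (T ` ball_cap c \<rho> e s)"
      by (rule measure_mono_fmeasurable[OF sub fmeasurableD[OF cap_lmeasurable[OF K card]]])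
    also have "\<dots> = 1 / sqrt q * measure lebesgue (ball_cap c \<rho> e s)" by (rule T(4)[OF compact_ball_cap])
    also have "\<dots> \<le> 1 / sqrt q * (cap_const CARD('n) * (2 * \<rho>) powr p * s powr (p + 1))"
      using measure_ball_cap_bounds(1)[OF card T(6), of s \<rho> c, folded p_def] s \<rho> T(3)
      by (intro mult_left_mono) auto
    also have "(2 * \<rho>) powr p = 2 powr p * \<rho> powr p" by (rule powr_mult)
    also have "1 / sqrt q * (cap_const CARD('n) * (2 powr p * \<rho> powr p) * s powr (p + 1))
       = \<rho> powr p * ((cap_const CARD('n) * 2 powr p / sqrt q) * s powr (p + 1))" by simp
    also have "\<dots> \<le> (1 + \<eta>) * ((cap_const CARD('n) * 2 powr p / sqrt q) * s powr (p + 1))"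
      using \<epsilon>(3) cap_const_pos[of "CARD('n)"] T(3) by (intro mult_right_mono) (auto simp: \<rho>_def)
    finally show "measure lebesgue (K \<inter> {z. 1 - s \<le> ?y \<bullet> z})
      \<le> (1 + \<eta>) * (cap_const CARD('n) * 2 powr p / sqrt q) * s powr (p + 1)" by (simp add: mult.assoc)
  qed
qed

text \<open>Near e the transformed body contains a ball of radius \<rho> slightly below 1. For
  directions close to e the half-space through (1 - s) e contains a cap of this ball of height s.
  For the other directions a fixed small ball touching at e already contains a cap of volume v0
  independent of s, more than is needed once s is small.\<close>

lemma cap_volume_sharp_lower:
  assumes x: "x \<in> frontier K" and A: "(dual_point K has_derivative A) (at x)"
    and pos: "\<And>v. v \<noteq> 0 \<Longrightarrow> 0 < A v \<bullet> v + (dual_point K x \<bullet> v)\<^sup>2" and \<eta>: "0 < \<eta>" "\<eta> < 1"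
  defines "q \<equiv> det (matrix (\<lambda>v. A v + (dual_point K x \<bullet> v) *\<^sub>R dual_point K x))"
    and "p \<equiv> real (CARD('n) - 1) / 2"
  shows "\<exists>s0>0. \<forall>s u. 0 < s \<and> s < s0 \<and> u \<noteq> 0 \<longrightarrow>
    (1 - \<eta>) * (cap_const CARD('n) * 2 powr p / sqrt q) * s powr (p + 1)
      \<le> measure lebesgue (K \<inter> {z. u \<bullet> ((1 - s) *\<^sub>R x) \<le> u \<bullet> z})"
proof -
  let ?y = "dual_point K x"
  let ?g = "supp (polar_body K)"
  let ?cc = "cap_const CARD('n)"
  obtain T :: "real ^ 'n \<Rightarrow> real ^ 'n" and e where T: "linear T" "bij T" "0 < q" "\<And>S. compact S \<Longrightarrow> measure lebesgue (T ` S) = 1 / sqrt q * measure lebesgue S"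
      "T e = x" "norm e = 1"
    and yT: "\<And>v. ?y \<bullet> T v = e \<bullet> v"
    and exp: "\<And>\<epsilon>. 0 < \<epsilon> \<Longrightarrow> \<exists>r>0. \<forall>v. norm v < r \<longrightarrow>
      \<bar>(?g (T (e + v)))\<^sup>2 / 2 - 1/2 - e \<bullet> v - (norm v)\<^sup>2 / 2\<bar> \<le> \<epsilon> * (norm v)\<^sup>2"
    by (rule boundary_frame[OF x A pos, folded q_def]) blast+
  have ee: "e \<bullet> e = 1" using T(6) by (simp add: norm_eq_1)
  have p0: "0 \<le> p" by (simp add: p_def)
  have cc: "0 < ?cc" by (rule cap_const_pos)
  \<comment> \<open>The extra -\<epsilon> is a reserve for the cap height: once s <= 2 \<epsilon>,
    the factor 2 \<rho> - s is at least 2 (\<rho> - \<epsilon>).\<close>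
  obtain \<epsilon> where \<epsilon>: "0 < \<epsilon>" "\<epsilon> < 1/4" "1 - \<eta> < (1 / (1 + 2 * \<epsilon>) - \<epsilon>) powr p"
  proof -
    have "((\<lambda>\<epsilon>::real. (1 / (1 + 2 * \<epsilon>) - \<epsilon>) powr p) \<longlongrightarrow> (1 / (1 + 2 * 0) - 0) powr p) (at_right 0)"
      by (intro tendsto_intros) auto
    then have "\<forall>\<^sub>F \<epsilon> in at_right 0. 1 - \<eta> < (1 / (1 + 2 * \<epsilon>) - \<epsilon>) powr p"
      using \<eta> by (intro order_tendstoD) auto
    moreover have "\<forall>\<^sub>F \<epsilon> in at_right 0. 0 < \<epsilon> \<and> \<epsilon> < (1/4::real)"
      by (rule eventually_at_rightI[of 0 "1/4"]) auto
    ultimately have "\<exists>\<epsilon>. 1 - \<eta> < (1 / (1 + 2 * \<epsilon>) - \<epsilon>) powr p \<and> 0 < \<epsilon> \<and> \<epsilon> < (1/4::real)"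
      using eventually_happens[OF eventually_conj] by fastforce
    then show thesis using that by blast
  qed
  define \<rho> where "\<rho> = 1 / (1 + 2 * \<epsilon>)"
  have \<rho>: "0 < \<rho>" "\<rho> \<le> 1" "1 / (2 * \<rho>) = 1/2 + \<epsilon>" "1/2 \<le> \<rho>" using \<epsilon> by (auto simp: \<rho>_def field_simps)
  obtain r where r: "0 < r" "\<And>v. norm v < r \<Longrightarrow>
      \<bar>(?g (T (e + v)))\<^sup>2 / 2 - 1/2 - e \<bullet> v - (norm v)\<^sup>2 / 2\<bar> \<le> \<epsilon> * (norm v)\<^sup>2" using exp[OF \<epsilon>(1)] by blast
  define c where "c = (1 - \<rho>) *\<^sub>R e"
  have inK: "T x' \<in> K" if x': "x' \<in> cball c \<rho>" "x' \<in> ball e r" for x'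
  proof -
    define v where "v = x' - e"
    have v: "x' = e + v" "norm v < r" using x'(2) by (auto simp: v_def dist_norm norm_minus_commute)
    have "e \<bullet> v + (norm v)\<^sup>2 / (2 * \<rho>) \<le> 0"
      using x'(1) unfolding v(1) c_def using mem_cball_tangent_iff[OF T(6) \<rho>(1)] by blast
    then have "e \<bullet> v + (norm v)\<^sup>2 * (1 / (2 * \<rho>)) \<le> 0" by simp
    then have "e \<bullet> v + (norm v)\<^sup>2 / 2 + \<epsilon> * (norm v)\<^sup>2 \<le> 0" unfolding \<rho>(3) by (simp add: algebra_simps)
    then have "(?g (T x'))\<^sup>2 \<le> 1" using r(2)[OF v(2)] unfolding v(1) by linarith
    then have "?g (T x') \<le> 1" using power2_le_imp_le[of "?g (T x')" 1] by simp
    then show ?thesis by (simp add: mem_iff)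
  qed
  \<comment> \<open>Data for directions far from e. A ball of radius r2 touching at e stays inside
    the neighbourhood of radius r. A unit vector at distance more than r / 2 from e has inner
    product at most 1 - r^2 / 8, hence at most k, with e, which leaves caps of height t = r2 (1 -
    k).\<close>
  define r2 where "r2 = min \<rho> (r/4)"
  define k where "k = max (1 - r\<^sup>2 / 8) 0"
  define t where "t = r2 * (1 - k)"
  define c2 where "c2 = (1 - r2) *\<^sub>R e"
  define v0 where "v0 = ?cc * (2 * r2 - t) powr p * t powr (p + 1)"
  have r2: "0 < r2" "r2 \<le> \<rho>" "2 * r2 < r" using \<rho>(1) r(1) by (auto simp: r2_def)
  have k: "0 \<le> k" "k < 1" using r(1) by (auto simp: k_def)
  have t: "0 < t" "t \<le> r2" using r2 k by (auto simp: t_def mult_left_le)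
  have v0: "0 < v0" unfolding v0_def using cc t r2(1) by simp
  \<comment> \<open>The bounds serve, in this order: the reserve in the factor 2 \<rho> - s; the cap
    height against the radii; confinement of the cap near its pole; s^(p+1) <= s; and the comparison
    with v0.\<close>
  define s0 where "s0 = min (2 * \<epsilon>) (min r2 (min (r\<^sup>2 / 8) (min 1 (v0 / (?cc * 2 powr p)))))"
  have "0 < v0 / (?cc * 2 powr p)" using v0 cc by simp
  then have s0: "0 < s0" "s0 \<le> 2 * \<epsilon>" "s0 \<le> r2" "s0 \<le> r\<^sup>2 / 8" "s0 \<le> 1" "s0 \<le> v0 / (?cc * 2 powr p)"
    unfolding s0_def using \<epsilon>(1) r2(1) r(1) by (simp, linarith+)
  show ?thesis
  proof (intro exI[of _ s0] conjI allI impI)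
    show "0 < s0" by (rule s0)
    fix s and u :: "real ^ 'n" assume "0 < s \<and> s < s0 \<and> u \<noteq> 0"
    then have s: "0 < s" "s < s0" and u: "u \<noteq> 0" by auto
    \<comment> \<open>The adjoint transports the half-space with normal u to the coordinates in
      which \<open>K\<close> is nearly a ball.\<close>
    define w where "w = adjoint T u"
    have wT: "w \<bullet> z = u \<bullet> T z" for z using adjoint_works[OF T(1), of z u] by (simp add: w_def inner_commute)
    have w: "w \<noteq> 0"
    proof
      assume "w = 0"
      then have "u \<bullet> T z = 0" for z using wT[of z] by simp
      moreover obtain z where "T z = u" using T(2) by (metis bij_pointE)
      ultimately have "u \<bullet> u = 0" by metis
      then show False using u by simp
    qed
    let ?v = "(1 / norm w) *\<^sub>R w"
    have v1: "norm ?v = 1" using w by simp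
    then have vv: "?v \<bullet> ?v = 1" by (simp only: norm_eq_1)
    let ?p = "(1 - s) *\<^sub>R e"
    have Tp: "T ?p = (1 - s) *\<^sub>R x" using linear_cmul[OF T(1)] T(5) by simp
    have main: "1 / sqrt q * measure lebesgue (ball_cap c' \<rho>' ?v t') \<le> measure lebesgue (K \<inter> {z. u \<bullet> ((1 - s) *\<^sub>R x) \<le> u \<bullet> z})"
      if inc: "ball_cap c' \<rho>' ?v t' \<subseteq> cball c \<rho> \<inter> ball e r" and dp: "?v \<bullet> (?p - c') \<le> \<rho>' - t'" for c' \<rho>' t'
    proof -
      have "T ` ball_cap c' \<rho>' ?v t' \<subseteq> K \<inter> {z. u \<bullet> ((1 - s) *\<^sub>R x) \<le> u \<bullet> z}"
      proof
        fix z assume "z \<in> T ` ball_cap c' \<rho>' ?v t'"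
        then obtain x' where x': "z = T x'" "x' \<in> ball_cap c' \<rho>' ?v t'" by auto
        then have "w \<bullet> ?p \<le> w \<bullet> x'" using ball_cap_subset_halfspace[OF w dp] by blast
        then have "u \<bullet> ((1 - s) *\<^sub>R x) \<le> u \<bullet> z" unfolding wT Tp x'(1) .
        moreover have "z \<in> K" using inK[of x'] x' inc by blast
        ultimately show "z \<in> K \<inter> {z. u \<bullet> ((1 - s) *\<^sub>R x) \<le> u \<bullet> z}" by blast
      qed
      then have "measure lebesgue (T ` ball_cap c' \<rho>' ?v t') \<le> measure lebesgue (K \<inter> {z. u \<bullet> ((1 - s) *\<^sub>R x) \<le> u \<bullet> z})"
        by (rule measure_mono_fmeasurable[OF _ fmeasurableD[OF lmeasurable_compact[OF
            compact_continuous_image[OF linear_continuous_on[OF T(1)[unfolded linear_conv_bounded_linear]] compact_ball_cap]]] cap_lmeasurable[OF K card]])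
      then show ?thesis unfolding T(4)[OF compact_ball_cap] .
    qed
    show "(1 - \<eta>) * (?cc * 2 powr p / sqrt q) * s powr (p + 1)
      \<le> measure lebesgue (K \<inter> {z. u \<bullet> ((1 - s) *\<^sub>R x) \<le> u \<bullet> z})"
    proof (cases "norm (?v - e) \<le> r / 2")
      case True
      \<comment> \<open>Every point of a cap of height s is within sqrt (2 \<rho> s) of its pole c +
        \<rho> v, and the pole differs from e by \<rho> (v - e).\<close>
      have inc: "ball_cap c \<rho> ?v s \<subseteq> cball c \<rho> \<inter> ball e r"
      proof
        fix z assume z: "z \<in> ball_cap c \<rho> ?v s"
        then have zc: "norm (z - c) \<le> \<rho>" "\<rho> - s \<le> ?v \<bullet> (z - c)"
          by (auto simp: ball_cap_def dist_norm norm_minus_commute)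
        have "(norm (z - c - \<rho> *\<^sub>R ?v))\<^sup>2 = (norm (z - c))\<^sup>2 - 2 * \<rho> * (?v \<bullet> (z - c)) + \<rho>\<^sup>2"
        proof -
          have "(norm (a - \<rho> *\<^sub>R b))\<^sup>2 = (norm a)\<^sup>2 - 2 * \<rho> * (b \<bullet> a) + \<rho>\<^sup>2 * (b \<bullet> b)" for a b :: "real ^ 'n"
            unfolding power2_norm_eq_inner
            by (simp add: inner_diff_left inner_diff_right inner_commute power2_eq_square)
          from this[of "z - c" ?v] show ?thesis unfolding vv by simp
        qed
        also have "\<dots> \<le> \<rho>\<^sup>2 - 2 * \<rho> * (\<rho> - s) + \<rho>\<^sup>2"
          using zc \<rho>(1) by (intro add_mono diff_mono power_mono mult_left_mono) auto
        also have "\<dots> = 2 * \<rho> * s" by (simp add: power2_eq_square algebra_simps)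
        also have "\<dots> \<le> 2 * 1 * s" using \<rho>(2) s(1) by (intro mult_right_mono mult_left_mono) auto
        also have "\<dots> < (r / 2)\<^sup>2" using s(2) s0(4) by (simp add: power_divide)
        finally have "norm (z - c - \<rho> *\<^sub>R ?v) < r / 2" using r(1) by (intro power2_less_imp_less[of _ "r / 2"]) auto
        moreover have "norm (\<rho> *\<^sub>R (?v - e)) \<le> 1 * (r / 2)"
          unfolding norm_scaleR using True \<rho> by (intro mult_mono) auto
        moreover have "z - e = (z - c - \<rho> *\<^sub>R ?v) + \<rho> *\<^sub>R (?v - e)" by (simp add: c_def algebra_simps)
        then have "norm (z - e) \<le> norm (z - c - \<rho> *\<^sub>R ?v) + norm (\<rho> *\<^sub>R (?v - e))" by (simp only: norm_triangle_ineq)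
        ultimately have "norm (z - e) < r" by linarith
        then show "z \<in> cball c \<rho> \<inter> ball e r" using zc(1) by (simp add: dist_norm norm_minus_commute)
      qed
      have "?p - c = (\<rho> - s) *\<^sub>R e" by (simp add: c_def algebra_simps)
      then have "norm (?p - c) = \<rho> - s" using T(6) s s0(3) r2(2) by simp
      then have dp: "?v \<bullet> (?p - c) \<le> \<rho> - s" using norm_cauchy_schwarz[of ?v "?p - c"] unfolding v1 by simp
      have "(1 - \<eta>) * 2 powr p \<le> (2 * \<rho> - s) powr p"
      proof -
        have "(1 - \<eta>) * 2 powr p \<le> (\<rho> - \<epsilon>) powr p * 2 powr p" using \<epsilon>(3) by (intro mult_right_mono) (auto simp: \<rho>_def)
        also have "\<dots> = ((\<rho> - \<epsilon>) * 2) powr p" by (rule powr_mult[symmetric])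
        also have "\<dots> \<le> (2 * \<rho> - s) powr p" using p0 \<rho>(4) \<epsilon>(2) s s0(2) by (intro powr_mono2) auto
        finally show ?thesis .
      qed
      then have "?cc * ((1 - \<eta>) * 2 powr p) * s powr (p + 1) \<le> ?cc * (2 * \<rho> - s) powr p * s powr (p + 1)"
        using cc by (intro mult_right_mono mult_left_mono) auto
      also have "\<dots> \<le> measure lebesgue (ball_cap c \<rho> ?v s)"
        unfolding p_def by (rule measure_ball_cap_bounds(2)[OF card v1]) (use s s0(3) r2 in auto)
      finally have "1 / sqrt q * (?cc * ((1 - \<eta>) * 2 powr p) * s powr (p + 1)) \<le> 1 / sqrt q * measure lebesgue (ball_cap c \<rho> ?v s)"
        using T(3) by (intro mult_left_mono) auto
      also have "\<dots> \<le> measure lebesgue (K \<inter> {z. u \<bullet> ((1 - s) *\<^sub>R x) \<le> u \<bullet> z})" by (rule main[OF inc dp])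
      finally show ?thesis by (simp add: mult_ac)
    next
      case False
      have inc: "ball_cap c2 r2 ?v t \<subseteq> cball c \<rho> \<inter> ball e r"
      proof
        fix z assume "z \<in> ball_cap c2 r2 ?v t"
        then have zc: "norm (z - c2) \<le> r2" by (auto simp: ball_cap_def dist_norm norm_minus_commute)
        have "norm (z - c) \<le> norm (z - c2) + norm (c2 - c)" using norm_triangle_ineq[of "z - c2" "c2 - c"] by simp
        moreover have "c2 - c = (\<rho> - r2) *\<^sub>R e" by (simp add: c2_def c_def algebra_simps)
        then have "norm (c2 - c) = \<rho> - r2" using T(6) r2(2) by simp
        ultimately have 1: "norm (z - c) \<le> \<rho>" using zc by linarith
        have "norm (z - e) \<le> norm (z - c2) + norm (c2 - e)" using norm_triangle_ineq[of "z - c2" "c2 - e"] by simp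
        moreover have "c2 - e = (- r2) *\<^sub>R e" by (simp add: c2_def algebra_simps)
        then have "norm (c2 - e) = r2" using T(6) r2(1) by simp
        ultimately have 2: "norm (z - e) < r" using zc r2(3) by linarith
        show "z \<in> cball c \<rho> \<inter> ball e r" using 1 2 by (simp add: dist_norm norm_minus_commute)
      qed
      have "(r / 2)\<^sup>2 < (norm (?v - e))\<^sup>2" using False r(1) by (intro power_strict_mono) auto
      also have "(norm (?v - e))\<^sup>2 = 2 - 2 * (?v \<bullet> e)"
      proof -
        have "(norm (a - e))\<^sup>2 = a \<bullet> a - 2 * (a \<bullet> e) + e \<bullet> e" for a
          unfolding power2_norm_eq_inner by (simp add: inner_diff_left inner_diff_right inner_commute)
        from this[of ?v] show ?thesis unfolding vv ee by simp
      qed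
      finally have "?v \<bullet> e \<le> 1 - r\<^sup>2 / 8" by (simp add: power_divide)
      then have ve: "?v \<bullet> e \<le> k" unfolding k_def by linarith
      have "?p - c2 = (r2 - s) *\<^sub>R e" by (simp add: c2_def algebra_simps)
      then have "?v \<bullet> (?p - c2) = (r2 - s) * (?v \<bullet> e)" by (simp only: inner_scaleR_right)
      also have "\<dots> \<le> (r2 - s) * k" using ve s s0(3) by (intro mult_left_mono) auto
      also have "\<dots> \<le> r2 * k" using s k by (intro mult_right_mono) auto
      also have "\<dots> = r2 - t" by (simp add: t_def algebra_simps)
      finally have dp: "?v \<bullet> (?p - c2) \<le> r2 - t" .
      have "s powr (p + 1) \<le> s powr 1" using p0 s s0(5) by (intro powr_mono') auto
      then have "s powr (p + 1) \<le> v0 / (?cc * 2 powr p)" using s s0(6) by simp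
      then have "?cc * 2 powr p * s powr (p + 1) \<le> v0" using cc by (simp add: pos_le_divide_eq mult_ac)
      moreover have "(1 - \<eta>) * (?cc * 2 powr p * s powr (p + 1)) \<le> 1 * (?cc * 2 powr p * s powr (p + 1))"
        using \<eta> cc by (intro mult_right_mono) auto
      ultimately have "(1 - \<eta>) * (?cc * 2 powr p * s powr (p + 1)) \<le> v0" by linarith
      also have "v0 \<le> measure lebesgue (ball_cap c2 r2 ?v t)"
        unfolding v0_def p_def by (rule measure_ball_cap_bounds(2)[OF card v1]) (use t r2 in auto)
      finally have "1 / sqrt q * ((1 - \<eta>) * (?cc * 2 powr p * s powr (p + 1))) \<le> 1 / sqrt q * measure lebesgue (ball_cap c2 r2 ?v t)"
        using T(3) by (intro mult_left_mono) auto
      also have "\<dots> \<le> measure lebesgue (K \<inter> {z. u \<bullet> ((1 - s) *\<^sub>R x) \<le> u \<bullet> z})" by (rule main[OF inc dp])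
      finally show ?thesis by (simp add: mult_ac)
    qed
  qed
qed

end

section \<open>Volumes of gauge balls as integrals of ratios of gauges\<close>

lemma nn_integral_power_Icc:
  assumes "0 < n" "0 \<le> (b::real)"
  shows "(\<integral>\<^sup>+r. ennreal (real n * r ^ (n - 1)) * indicator {0..b} r \<partial>lborel) = ennreal (b ^ n)"
proof -
  have "(\<integral>\<^sup>+r. ennreal (real n * r ^ (n - 1)) * indicator {0..b} r \<partial>lborel) = ennreal (b ^ n - 0 ^ n)"
    by (rule nn_integral_FTC_Icc[where F="\<lambda>r. r ^ n"]) (use assms in \<open>auto intro!: derivative_eq_intros\<close>)
  then show ?thesis using assms by simp
qed

lemma nn_integral_inverse_Icc:
  assumes "0 \<le> c" "0 < a" "a \<le> (b::real)"
  shows "(\<integral>\<^sup>+r. ennreal (c / r) * indicator {a..b} r \<partial>lborel) = ennreal (c * ln (b / a))"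
proof -
  have "(\<integral>\<^sup>+r. ennreal (c / r) * indicator {a..b} r \<partial>lborel) = ennreal (c * ln b - c * ln a)"
    by (rule nn_integral_FTC_Icc[where F="\<lambda>r. c * ln r"]) (use assms in \<open>auto intro!: derivative_eq_intros\<close>)
  then show ?thesis using assms by (simp add: ln_div right_diff_distrib)
qed

text \<open>Both integrations of the double integral in \<open>(r, y)\<close>, after the substitution \<open>w = r y\<close>, are
  elementary; the result does not depend on \<open>h\<close>.\<close>

lemma nn_integral_gauge_ratio:
  fixes g h :: "'a::euclidean_space \<Rightarrow> real"
  assumes [measurable]: "g \<in> borel_measurable borel" "h \<in> borel_measurable borel"
    and g: "\<And>c y. 0 < c \<Longrightarrow> g (c *\<^sub>R y) = c * g y" "\<And>y. y \<noteq> 0 \<Longrightarrow> 0 < g y"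
    and h: "\<And>c y. 0 < c \<Longrightarrow> h (c *\<^sub>R y) = c * h y" "\<And>y. y \<noteq> 0 \<Longrightarrow> 0 < h y"
  shows "(\<integral>\<^sup>+y. ennreal ((h y / g y) ^ DIM('a)) * indicator {y. h y \<le> 1} y \<partial>lborel) =
    (\<integral>\<^sup>+w. ennreal (real DIM('a) * ln (1 / g w)) * indicator {w. w \<noteq> 0 \<and> g w \<le> 1} w \<partial>lborel)"
proof -
  define n where "n = DIM('a)"
  have n: "0 < n" by (simp add: n_def)
  have g0: "g 0 = 0" "h 0 = 0" using g(1)[of 2 0] h(1)[of 2 0] by auto
  have nn: "0 \<le> g y" "0 \<le> h y" for y using g(2)[of y] h(2)[of y] g0 by (cases "y = 0"; auto)+
  \<comment> \<open>\<open>I\<close> writes the n-th power of h / g as an integral over r;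
    \<open>J\<close> is \<open>I\<close> after substituting w = r y, whose Jacobian contributes
    r^(-n) and leaves n / r.\<close>
  define I where "I r y = ennreal (real n * r ^ (n - 1)) * indicator {0<..} r * indicator {y. h y \<le> 1 \<and> r * g y \<le> h y} y" for r :: real and y :: 'a
  define J where "J r w = ennreal (real n / r) * indicator {0<..} r * indicator {w. h w \<le> r \<and> r * g w \<le> h w} w" for r :: real and w :: 'a
  have [measurable]: "(\<lambda>(r, y). I r y) \<in> borel_measurable (lborel \<Otimes>\<^sub>M lborel)"
    "(\<lambda>(r, y). J r y) \<in> borel_measurable (lborel \<Otimes>\<^sub>M lborel)"
    unfolding I_def J_def by measurable
  have "(\<integral>\<^sup>+y. ennreal ((h y / g y) ^ n) * indicator {y. h y \<le> 1} y \<partial>lborel) = (\<integral>\<^sup>+y. (\<integral>\<^sup>+r. I r y \<partial>lborel) \<partial>lborel)"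
  proof (rule nn_integral_cong_AE)
    have "AE r in lborel. r \<noteq> (0::real)" by (rule AE_lborel_singleton)
    have "ennreal ((h y / g y) ^ n) * indicator {y. h y \<le> 1} y = (\<integral>\<^sup>+r. I r y \<partial>lborel)" if y: "y \<noteq> 0" for y
    proof -
      have "(\<integral>\<^sup>+r. I r y \<partial>lborel) = (\<integral>\<^sup>+r. ennreal (real n * r ^ (n - 1)) * indicator {0..h y / g y} r * indicator {y. h y \<le> 1} y \<partial>lborel)"
      proof (rule nn_integral_cong_AE, use \<open>AE r in lborel. r \<noteq> (0::real)\<close> in eventually_elim)
        fix r :: real assume "r \<noteq> 0"
        then show "I r y = ennreal (real n * r ^ (n - 1)) * indicator {0..h y / g y} r * indicator {y. h y \<le> 1} y"
          using g(2)[OF y] by (auto simp: I_def indicator_def pos_le_divide_eq)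
      qed
      also have "\<dots> = ennreal ((h y / g y) ^ n) * indicator {y. h y \<le> 1} y"
        using nn by (subst nn_integral_multc) (simp_all only: nn_integral_power_Icc[OF n divide_nonneg_nonneg], measurable)
      finally show ?thesis by simp
    qed
    then show "AE y in lborel. ennreal ((h y / g y) ^ n) * indicator {y. h y \<le> 1} y = (\<integral>\<^sup>+r. I r y \<partial>lborel)"
      using AE_lborel_singleton[of "0::'a"] by (auto elim!: eventually_mono)
  qed
  also have "\<dots> = (\<integral>\<^sup>+r. (\<integral>\<^sup>+y. I r y \<partial>lborel) \<partial>lborel)" by (rule lborel_pair.Fubini') simp
  also have "\<dots> = (\<integral>\<^sup>+r. (\<integral>\<^sup>+w. J r w \<partial>lborel) \<partial>lborel)"
  proof (rule nn_integral_cong)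
    fix r :: real
    show "(\<integral>\<^sup>+y. I r y \<partial>lborel) = (\<integral>\<^sup>+w. J r w \<partial>lborel)"
    proof (cases "0 < r")
      case True
      define S where "S = {y. h y \<le> 1 \<and> r * g y \<le> h y}"
      have S: "S \<in> sets borel" unfolding S_def by measurable
      have S': "{w. (1 / r) *\<^sub>R w \<in> S} = {w. h w \<le> r \<and> r * g w \<le> h w}"
      proof -
        have *: "g ((1 / r) *\<^sub>R w) = (1 / r) * g w" "h ((1 / r) *\<^sub>R w) = (1 / r) * h w" for w
          by (rule g(1) h(1), use True in simp)+
        show ?thesis unfolding S_def mem_Collect_eq * using True by (simp add: field_simps)
      qed
      have "r ^ n = r * r ^ (n - 1)" using n by (cases n) auto
      then have pw: "real n * r ^ (n - 1) = real n / r * r ^ n" using True by simp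
      have "(\<integral>\<^sup>+y. I r y \<partial>lborel) = ennreal (real n * r ^ (n - 1)) * emeasure lborel S"
        using True S by (simp add: I_def S_def[symmetric] nn_integral_cmult_indicator)
      also have "\<dots> = ennreal (real n / r) * (ennreal (r ^ n) * emeasure lborel S)"
        unfolding pw by (subst ennreal_mult) (use True in \<open>simp_all add: mult.assoc\<close>)
      also have "ennreal (r ^ n) * emeasure lborel S = emeasure lborel {w. h w \<le> r \<and> r * g w \<le> h w}"
        using emeasure_lborel_scale[OF S True] by (simp add: S' n_def)
      also have "ennreal (real n / r) * \<dots> = (\<integral>\<^sup>+w. J r w \<partial>lborel)"
        using True by (simp add: J_def nn_integral_cmult_indicator)
      finally show ?thesis .
    qed (simp add: I_def J_def)
  qed
  also have "\<dots> = (\<integral>\<^sup>+w. (\<integral>\<^sup>+r. J r w \<partial>lborel) \<partial>lborel)" by (rule lborel_pair.Fubini'[symmetric]) (simp add: case_prod_beta')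
  also have "\<dots> = (\<integral>\<^sup>+w. ennreal (real n * ln (1 / g w)) * indicator {w. w \<noteq> 0 \<and> g w \<le> 1} w \<partial>lborel)"
  proof (rule nn_integral_cong_AE)
    have "(\<integral>\<^sup>+r. J r w \<partial>lborel) = ennreal (real n * ln (1 / g w)) * indicator {w. w \<noteq> 0 \<and> g w \<le> 1} w" if w: "w \<noteq> 0" for w
    proof -
      have J: "J r w = ennreal (real n / r) * indicator {h w..h w / g w} r" for r
        using g(2)[OF w] h(2)[OF w] by (auto simp: J_def indicator_def pos_le_divide_eq)
      have le: "h w \<le> h w / g w \<longleftrightarrow> g w \<le> 1"
        using g(2)[OF w] h(2)[OF w] by (simp add: pos_le_divide_eq)
      show ?thesis
      proof (cases "g w \<le> 1")
        case True
        have "(\<integral>\<^sup>+r. J r w \<partial>lborel) = ennreal (real n * ln ((h w / g w) / h w))"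
          unfolding J by (rule nn_integral_inverse_Icc) (use True le h(2)[OF w] in auto)
        then show ?thesis using True w h(2)[OF w] by simp
      next
        case False
        then have "{h w..h w / g w} = {}" using le by simp
        then show ?thesis using False by (simp add: J)
      qed
    qed
    then show "AE w in lborel. (\<integral>\<^sup>+r. J r w \<partial>lborel) = ennreal (real n * ln (1 / g w)) * indicator {w. w \<noteq> 0 \<and> g w \<le> 1} w"
      using AE_lborel_singleton[of "0::'a"] by (auto elim!: eventually_mono)
  qed
  finally show ?thesis unfolding n_def .
qed

text \<open>The logarithmic integral depends on g alone. Evaluating it once with h replaced by g and
  once with h itself equates the volume of the g-ball with an integral over the h-ball, without
  polar coordinates.\<close>

lemma measure_gauge_ball:
  fixes g h :: "'a::euclidean_space \<Rightarrow> real"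
  assumes [measurable]: "g \<in> borel_measurable borel" "h \<in> borel_measurable borel"
    and g: "\<And>c y. 0 < c \<Longrightarrow> g (c *\<^sub>R y) = c * g y" "\<And>y. y \<noteq> 0 \<Longrightarrow> 0 < g y"
    and h: "\<And>c y. 0 < c \<Longrightarrow> h (c *\<^sub>R y) = c * h y" "\<And>y. y \<noteq> 0 \<Longrightarrow> 0 < h y"
  shows "measure lborel {y. g y \<le> 1} = (LINT y|lborel. indicator ({y. h y \<le> 1} - {0}) y * (h y / g y) ^ DIM('a))"
proof -
  have g0: "g 0 = 0" "h 0 = 0" using g(1)[of 2 0] h(1)[of 2 0] by auto
  have "emeasure lborel {y. g y \<le> 1} = (\<integral>\<^sup>+y. indicator {y. g y \<le> 1} y \<partial>lborel)" by simp
  also have "\<dots> = (\<integral>\<^sup>+y. ennreal ((g y / g y) ^ DIM('a)) * indicator {y. g y \<le> 1} y \<partial>lborel)"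
  proof (rule nn_integral_cong_AE, use AE_lborel_singleton[of "0::'a"] in eventually_elim)
    fix y :: 'a assume "y \<noteq> 0"
    then show "indicator {y. g y \<le> 1} y = ennreal ((g y / g y) ^ DIM('a)) * indicator {y. g y \<le> 1} y"
      using g(2)[of y] by simp
  qed
  also have "\<dots> = (\<integral>\<^sup>+y. ennreal ((h y / g y) ^ DIM('a)) * indicator {y. h y \<le> 1} y \<partial>lborel)"
    by (rule trans[OF nn_integral_gauge_ratio[OF assms(1,1) g g] nn_integral_gauge_ratio[OF assms(1,2) g h, symmetric]])
  also have "\<dots> = (\<integral>\<^sup>+y. ennreal (indicator ({y. h y \<le> 1} - {0}) y * (h y / g y) ^ DIM('a)) \<partial>lborel)"
    by (intro nn_integral_cong) (auto simp: indicator_def g0)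
  finally have "measure lborel {y. g y \<le> 1} = enn2real (\<integral>\<^sup>+y. ennreal (indicator ({y. h y \<le> 1} - {0}) y * (h y / g y) ^ DIM('a)) \<partial>lborel)"
    by (simp add: measure_def)
  also have "\<dots> = (LINT y|lborel. indicator ({y. h y \<le> 1} - {0}) y * (h y / g y) ^ DIM('a))"
  proof (rule integral_eq_nn_integral[symmetric])
    have "0 \<le> g y" "0 \<le> h y" for y using g(2)[of y] h(2)[of y] g0 by (cases "y = 0"; auto)+
    then show "AE y in lborel. 0 \<le> indicator ({y. h y \<le> 1} - {0}) y * (h y / g y) ^ DIM('a)" by simp
  qed measurable
  finally show ?thesis .
qed

text \<open>The bounds are arranged for a negative exponent b, where a larger base gives the smaller
  value.\<close>

lemma tendsto_powr_sandwich:
  fixes f :: "'a \<Rightarrow> real"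
  assumes a: "0 < a" and lo: "\<And>c. a < c \<Longrightarrow> \<forall>\<^sub>F x in F. c powr b \<le> f x"
    and up: "\<And>c. 0 < c \<Longrightarrow> c < a \<Longrightarrow> \<forall>\<^sub>F x in F. f x \<le> c powr b"
  shows "(f \<longlongrightarrow> a powr b) F"
proof (rule order_tendstoI)
  have lim: "((\<lambda>c. c powr b) \<longlongrightarrow> a powr b) (at a within S)" for S
    using a by (intro tendsto_intros) auto
  fix z
  show "\<forall>\<^sub>F x in F. z < f x" if "z < a powr b"
  proof -
    have "\<forall>\<^sub>F c in at_right a. z < c powr b \<and> a < c"
      using order_tendstoD(1)[OF lim that] by (intro eventually_conj) (auto simp: eventually_at_right_less)
    then obtain c where "z < c powr b" "a < c" using eventually_happens'[of "at_right a"] by (auto simp: trivial_limit_at_right_real)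
    then show ?thesis using lo[of c] by (auto elim!: eventually_mono)
  qed
  show "\<forall>\<^sub>F x in F. f x < z" if "a powr b < z"
  proof -
    have "\<forall>\<^sub>F c in at_left a. c powr b < z \<and> 0 < c \<and> c < a"
      using order_tendstoD(2)[OF lim that, of "{..<a}"] eventually_at_left_real[OF a] by eventually_elim auto
    then obtain c where "c powr b < z" "0 < c" "c < a" using eventually_happens'[of "at_left a"] by (auto simp: trivial_limit_at_left_real)
    then show ?thesis using up[of c] by (auto elim!: eventually_mono)
  qed
qed

section \<open>The floating body\<close>

lemma closed_floating_body: "closed (floating_body K \<delta>)"
  unfolding floating_body_def by (intro closed_Inter ballI) (auto simp: closed_halfspace_le)

lemma convex_floating_body: "convex (floating_body K \<delta>)"
  unfolding floating_body_def by (intro convex_Inter) (auto simp: convex_halfspace_le)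

context
  fixes K :: "(real ^ 'n) set"
  assumes K: "smooth_body K" and card: "2 \<le> CARD('n)"
begin

interpretation smooth_body K by (rule K)
interpretation polar: origin_body "polar_body K" by (rule origin_body_polar)

lemma cap_volume_antimono: "a \<le> b \<Longrightarrow> measure lebesgue (K \<inter> {x. b \<le> u \<bullet> x}) \<le> measure lebesgue (K \<inter> {x. a \<le> u \<bullet> x})"
  by (rule measure_mono_fmeasurable[OF _ fmeasurableD[OF cap_lmeasurable[OF K card]] cap_lmeasurable[OF K card]]) auto

text \<open>Two caps in the same direction differ by a slab of the bounded body, whose volume is
  proportional to its width at most. This gives the continuity needed to find a cap of prescribed
  volume.\<close>

lemma cap_volume_lipschitz:
  assumes u: "u \<noteq> 0"
  obtains L where "0 \<le> L"
    "\<And>a b. a \<le> b \<Longrightarrow> measure lebesgue (K \<inter> {x. a \<le> u \<bullet> x}) - measure lebesgue (K \<inter> {x. b \<le> u \<bullet> x}) \<le> L * (b - a)"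
proof -
  obtain R where R: "0 < R" "\<And>x. x \<in> K \<Longrightarrow> norm x \<le> R" by (rule bound) blast
  let ?N = "(1 / norm u) *\<^sub>R u"
  obtain \<Psi> where \<Psi>: "normal_coordinates ?N \<Psi>" by (rule normal_coordinates_exist[OF card, of ?N]) (use u in auto)
  define L where "L = unit_ball_vol (CARD('n hyper)) * R ^ CARD('n hyper) / norm u"
  have L: "0 \<le> L" using R(1) by (simp add: L_def)
  show thesis
  proof (rule that[OF L])
    fix a b :: real assume ab: "a \<le> b"
    let ?A = "K \<inter> {x. a \<le> u \<bullet> x} \<inter> {x. u \<bullet> x \<le> b}"
    have cA: "compact ?A" by (intro compact_Int_closed compact closed_halfspace_ge closed_halfspace_le)
    have bA: "?A \<in> sets borel" by (rule borel_closed[OF compact_imp_closed[OF cA]])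
    have "emeasure lborel ?A \<le> ennreal ((b / norm u - a / norm u) * (unit_ball_vol (CARD('n hyper)) * R ^ CARD('n hyper)))"
      by (rule emeasure_slab_le[OF card \<Psi> bA])
         (use R ab u in \<open>auto simp: divide_right_mono dist_norm\<close>)
    also have "(b / norm u - a / norm u) * (unit_ball_vol (CARD('n hyper)) * R ^ CARD('n hyper)) = L * (b - a)"
      by (simp add: L_def diff_divide_distrib[symmetric])
    finally have "measure lborel ?A \<le> L * (b - a)"
      using L ab by (simp add: measure_def enn2real_leI)
    then have mA: "measure lebesgue ?A \<le> L * (b - a)" using bA by simp
    have lA: "?A \<in> lmeasurable" by (rule lmeasurable_compact[OF cA])
    have "measure lebesgue (K \<inter> {x. a \<le> u \<bullet> x}) \<le> measure lebesgue (?A \<union> (K \<inter> {x. b \<le> u \<bullet> x}))"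
      by (rule measure_mono_fmeasurable[OF _ fmeasurableD[OF cap_lmeasurable[OF K card]] fmeasurable.Un[OF lA cap_lmeasurable[OF K card]]]) auto
    also have "\<dots> \<le> measure lebesgue ?A + measure lebesgue (K \<inter> {x. b \<le> u \<bullet> x})"
      by (rule measure_Un_le[OF fmeasurableD[OF lA] fmeasurableD[OF cap_lmeasurable[OF K card]]])
    finally show "measure lebesgue (K \<inter> {x. a \<le> u \<bullet> x}) - measure lebesgue (K \<inter> {x. b \<le> u \<bullet> x}) \<le> L * (b - a)"
      using mA by linarith
  qed
qed

lemma cap_of_volume_exists:
  assumes u: "u \<noteq> 0" and \<delta>: "0 < \<delta>" "\<delta> < measure lebesgue K"
  obtains a where "measure lebesgue (K \<inter> {x. a \<le> u \<bullet> x}) = \<delta>"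
proof -
  define F where "F a = measure lebesgue (K \<inter> {x. a \<le> u \<bullet> x})" for a
  obtain L where L: "0 \<le> L" "\<And>a b. a \<le> b \<Longrightarrow> F a - F b \<le> L * (b - a)"
    unfolding F_def by (rule cap_volume_lipschitz[OF u]) blast
  have "\<bar>F a - F b\<bar> \<le> L * \<bar>a - b\<bar>" for a b
    using L(2)[of a b] L(2)[of b a] cap_volume_antimono[of a b u] cap_volume_antimono[of b a u]
    by (cases "a \<le> b") (auto simp: F_def)
  then have "L-lipschitz_on UNIV F" using L(1) by (intro lipschitz_onI) (auto simp: dist_real_def)
  then have cont: "continuous_on S F" for S
    using lipschitz_on_continuous_on continuous_on_subset by blast
  obtain R where R: "0 < R" "\<And>x. x \<in> K \<Longrightarrow> norm x \<le> R" by (rule bound) blast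
  define T where "T = R * norm u + 1"
  have T: "0 < T" using R(1) by (simp add: T_def add_nonneg_pos)
  have ux: "\<bar>u \<bullet> x\<bar> < T" if "x \<in> K" for x
  proof -
    have "\<bar>u \<bullet> x\<bar> \<le> norm u * norm x" by (rule Cauchy_Schwarz_ineq2)
    also have "\<dots> \<le> norm u * R" using R(2)[OF that] by (intro mult_left_mono) auto
    finally show ?thesis by (simp add: T_def mult.commute)
  qed
  have "K \<inter> {x. T \<le> u \<bullet> x} = {}" "K \<inter> {x. - T \<le> u \<bullet> x} = K" using ux by force+
  then have "F T = 0" "F (- T) = measure lebesgue K" by (simp_all add: F_def)
  then have "\<exists>a. - T \<le> a \<and> a \<le> T \<and> F a = \<delta>"
    using \<delta> T by (intro IVT2' cont) auto
  then show thesis using that by (auto simp: F_def)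
qed

text \<open>The hyperplane with normal u that cuts off exactly \<delta> lies at a level at most
  \<open>a\<close>, because the cap above \<open>a\<close> is still too small.\<close>

lemma floating_body_below:
  assumes "0 < \<delta>" "\<delta> < measure lebesgue K" "u \<noteq> 0" "measure lebesgue (K \<inter> {x. a \<le> u \<bullet> x}) < \<delta>"
    and z: "z \<in> floating_body K \<delta>"
  shows "u \<bullet> z \<le> a"
proof -
  obtain b where b: "measure lebesgue (K \<inter> {x. b \<le> u \<bullet> x}) = \<delta>" by (rule cap_of_volume_exists[OF assms(3,1,2)])
  have "u \<bullet> z \<le> b" using z assms(3) b unfolding floating_body_def by blast
  moreover have "b \<le> a" using cap_volume_antimono[of a b u] assms(4) b by linarith
  ultimately show ?thesis by linarith
qed

lemma floating_body_subset:
  assumes "0 < \<delta>" "\<delta> < measure lebesgue K"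
  shows "floating_body K \<delta> \<subseteq> K"
proof
  fix z assume z: "z \<in> floating_body K \<delta>"
  have "z \<bullet> u \<le> 1" if u: "u \<in> polar_body K" for u
  proof (cases "u = 0")
    case False
    have "z \<bullet> u \<le> 1 + e" if "0 < e" for e
    proof -
      have "x \<bullet> u \<le> 1" if "x \<in> K" for x using u that by (auto simp: polar_body_def)
      then have "K \<inter> {x. 1 + e \<le> u \<bullet> x} = {}" using \<open>0 < e\<close> by (fastforce simp: inner_commute)
      then have "u \<bullet> z \<le> 1 + e" using assms(1) by (intro floating_body_below[OF assms False _ z]) simp
      then show ?thesis by (simp add: inner_commute)
    qed
    then show ?thesis by (rule field_le_epsilon)
  qed simp
  then have "z \<in> polar_body (polar_body K)" by (auto simp: polar_body_def inner_commute)
  then show "z \<in> K" by (simp add: bipolar)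
qed

text \<open>In any direction the hyperplane cutting off exactly \<delta> lies beyond p, because the
  cap through p is already larger. The condition has to be known for all directions.\<close>

lemma mem_floating_body:
  assumes "\<And>u. u \<noteq> 0 \<Longrightarrow> \<delta> < measure lebesgue (K \<inter> {x. u \<bullet> p \<le> u \<bullet> x})"
  shows "p \<in> floating_body K \<delta>"
proof -
  have "u \<bullet> p \<le> a" if "u \<noteq> 0" "measure lebesgue (K \<inter> {x. a \<le> u \<bullet> x}) = \<delta>" for u a
    using assms[OF that(1)] cap_volume_antimono[of a "u \<bullet> p" u] that(2) by linarith
  then show ?thesis unfolding floating_body_def by blast
qed

text \<open>The hypothesis concerns shrunken boundary points only; convexity of the floating body
  supplies the origin and from it the whole body shrunk by 1 - s.\<close>

lemma origin_body_floating_body: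
  assumes \<delta>: "0 < \<delta>" "\<delta> < measure lebesgue K" and s: "0 < s" "s < 1"
    and sub: "\<And>x. x \<in> frontier K \<Longrightarrow> (1 - s) *\<^sub>R x \<in> floating_body K \<delta>"
  shows "origin_body (floating_body K \<delta>)" "\<And>z. z \<in> K \<Longrightarrow> (1 - s) *\<^sub>R z \<in> floating_body K \<delta>"
proof -
  let ?g = "supp (polar_body K)"
  let ?F = "floating_body K \<delta>"
  have zero: "0 \<in> ?F"
  proof -
    obtain i :: 'n where True by simp
    define w :: "real ^ 'n" where "w = axis i 1"
    have w: "w \<noteq> 0" "- w \<noteq> 0" by (auto simp: w_def axis_eq_0_iff)
    have p: "0 < ?g w" "0 < ?g (- w)" using polar.supp_pos w by blast+
    \<comment> \<open>Weights for which the shrunken boundary points in the opposite directions w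
      and -w combine to 0.\<close>
    define t where "t = ?g (- w) / (?g w + ?g (- w))"
    have t: "0 \<le> t" "0 \<le> 1 - t" using p by (simp_all add: t_def field_simps)
    have mem: "(1 - t) *\<^sub>R ((1 - s) *\<^sub>R ((1 / ?g w) *\<^sub>R w)) + t *\<^sub>R ((1 - s) *\<^sub>R ((1 / ?g (- w)) *\<^sub>R (- w))) \<in> ?F"
      by (rule convexD[OF convex_floating_body sub[OF frontier_scale[OF w(1)]] sub[OF frontier_scale[OF w(2)]]]) (use t in auto)
    have "1 - t = ?g w / (?g w + ?g (- w))" using p by (simp add: t_def field_simps)
    then have "(1 - t) * ((1 - s) * (1 / ?g w)) = t * ((1 - s) * (1 / ?g (- w)))" using p by (simp add: t_def)
    then have eq: "(1 - t) *\<^sub>R ((1 - s) *\<^sub>R ((1 / ?g w) *\<^sub>R w)) + t *\<^sub>R ((1 - s) *\<^sub>R ((1 / ?g (- w)) *\<^sub>R (- w))) = 0" by simp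
    show ?thesis using mem unfolding eq .
  qed
  show sub': "(1 - s) *\<^sub>R z \<in> ?F" if z: "z \<in> K" for z
  proof (cases "z = 0")
    case False
    have g: "0 < ?g z" "?g z \<le> 1" using polar.supp_pos[OF False] z mem_iff by auto
    have "(1 - ?g z) *\<^sub>R 0 + ?g z *\<^sub>R ((1 - s) *\<^sub>R ((1 / ?g z) *\<^sub>R z)) \<in> ?F"
      by (rule convexD[OF convex_floating_body zero sub[OF frontier_scale[OF False]]]) (use g in auto)
    then show ?thesis using g(1) by simp
  qed (use zero in simp)
  show "origin_body ?F"
  proof
    show "compact ?F"
      using compact_Int_closed[OF compact closed_floating_body, of K \<delta>] floating_body_subset[OF \<delta>] by (simp add: Int_absorb1)
    show "convex ?F" by (rule convex_floating_body)
    obtain r where r: "0 < r" "cball 0 r \<subseteq> K" by (rule inner_ball)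
    have "cball 0 ((1 - s) * r) \<subseteq> ?F"
    proof
      fix z :: "real ^ 'n" assume z: "z \<in> cball 0 ((1 - s) * r)"
      then have "norm z \<le> (1 - s) * r" by simp
      then have "norm ((1 / (1 - s)) *\<^sub>R z) \<le> r" using s by (simp add: pos_divide_le_eq mult.commute)
      then have "(1 / (1 - s)) *\<^sub>R z \<in> K" using r(2) by (auto simp: dist_norm)
      from sub'[OF this] show "z \<in> ?F" using s by simp
    qed
    moreover have "0 < (1 - s) * r" using s r(1) by simp
    ultimately show "0 \<in> interior ?F" unfolding mem_interior_cball by blast
  qed
qed

text \<open>Bounds valid for all y at once, from which the integrable majorant of the limit argument
  is built. They come from the uniform lower bound on caps: the body shrunk by 1 - s lies in the
  floating body when s is a suitable multiple of \<delta>^(2/(n+1)).\<close>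

lemma floating_body_uniform:
  assumes M: "0 < M" "\<And>p q. p \<in> frontier K \<Longrightarrow> q \<in> frontier K \<Longrightarrow> norm (dual_point K p - dual_point K q) \<le> M * norm (p - q)"
  obtains B \<delta>0 where "0 \<le> B" "0 < \<delta>0" "\<And>\<delta>. 0 < \<delta> \<Longrightarrow> \<delta> < \<delta>0 \<Longrightarrow> \<delta> < measure lebesgue K"
    "\<And>\<delta>. 0 < \<delta> \<Longrightarrow> \<delta> < \<delta>0 \<Longrightarrow> origin_body (floating_body K \<delta>)"
    "\<And>\<delta> y. 0 < \<delta> \<Longrightarrow> \<delta> < \<delta>0 \<Longrightarrow> supp (floating_body K \<delta>) y \<le> supp K y"
    "\<And>\<delta> y. 0 < \<delta> \<Longrightarrow> \<delta> < \<delta>0 \<Longrightarrow> supp K y - supp (floating_body K \<delta>) y \<le> B * \<delta> powr (2 / (real CARD('n) + 1)) * supp K y"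
    "\<And>\<delta> y. 0 < \<delta> \<Longrightarrow> \<delta> < \<delta>0 \<Longrightarrow> supp K y \<le> 2 * supp (floating_body K \<delta>) y"
proof -
  define \<beta> where "\<beta> = 2 / (real CARD('n) + 1)"
  have \<beta>: "0 < \<beta>" "\<beta> * ((real CARD('n) + 1) / 2) = 1" by (simp_all add: \<beta>_def)
  obtain C s0 where C: "0 < C" "0 < s0" "s0 < 1"
    "\<And>x s u. x \<in> frontier K \<Longrightarrow> 0 < s \<Longrightarrow> s < s0 \<Longrightarrow> u \<noteq> 0 \<Longrightarrow>
      C * s powr ((real CARD('n) + 1) / 2) \<le> measure lebesgue (K \<inter> {z. u \<bullet> ((1 - s) *\<^sub>R x) \<le> u \<bullet> z})"
    by (rule cap_volume_uniform_lower[OF K card M]) blast+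
  define B where "B = (2 / C) powr \<beta>"
  define s1 where "s1 = min s0 (1/2)"
  have s1: "0 < s1" "s1 \<le> s0" "s1 \<le> 1/2" using C(2) by (auto simp: s1_def)
  define \<delta>0 where "\<delta>0 = (C / 2) * s1 powr (1 / \<beta>)"
  \<comment> \<open>Solves C s^((n+1)/2) = 2 \<delta>; the factor 2 makes the caps strictly larger
    than \<delta>.\<close>
  define s where "s \<delta> = B * \<delta> powr \<beta>" for \<delta>
  have s_eq: "s \<delta> = (2 * \<delta> / C) powr \<beta>" for \<delta>
    unfolding s_def B_def powr_mult[symmetric] by simp
  have s: "0 < s \<delta>" "s \<delta> < s1" "C * s \<delta> powr ((real CARD('n) + 1) / 2) = 2 * \<delta>" if \<delta>: "0 < \<delta>" "\<delta> < \<delta>0" for \<delta>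
  proof -
    show "0 < s \<delta>" using \<delta> C by (simp add: s_eq)
    have "2 * \<delta> / C < s1 powr (1 / \<beta>)" using \<delta>(2) C(1) by (simp add: \<delta>0_def pos_divide_less_eq mult.commute)
    then have "s \<delta> < (s1 powr (1 / \<beta>)) powr \<beta>"
      unfolding s_eq by (rule powr_less_mono2[OF \<beta>(1), rotated]) (use \<delta> C in auto)
    then show "s \<delta> < s1" using \<beta>(1) s1(1) by (simp add: powr_powr)
    have "s \<delta> powr ((real CARD('n) + 1) / 2) = 2 * \<delta> / C"
      unfolding s_eq powr_powr \<beta>(2) using \<delta>(1) C(1) by simp
    then show "C * s \<delta> powr ((real CARD('n) + 1) / 2) = 2 * \<delta>" using C(1) by simp
  qed
  have cap: "\<delta> < measure lebesgue (K \<inter> {z. u \<bullet> ((1 - s \<delta>) *\<^sub>R x) \<le> u \<bullet> z})"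
    if "0 < \<delta>" "\<delta> < \<delta>0" "x \<in> frontier K" "u \<noteq> 0" for \<delta> x u
    using C(4)[OF that(3) s(1)[OF that(1,2)] _ that(4)] s(2,3)[OF that(1,2)] s1 that(1) by linarith
  have small: "\<delta> < measure lebesgue K" if \<delta>: "0 < \<delta>" "\<delta> < \<delta>0" for \<delta>
  proof -
    obtain i :: 'n where True by simp
    define w :: "real ^ 'n" where "w = axis i 1"
    have w: "w \<noteq> 0" by (auto simp: w_def axis_eq_0_iff)
    have "\<delta> < measure lebesgue (K \<inter> {z. w \<bullet> ((1 - s \<delta>) *\<^sub>R ((1 / supp (polar_body K) w) *\<^sub>R w)) \<le> w \<bullet> z})"
      by (rule cap[OF \<delta> frontier_scale[OF w] w])
    also have "\<dots> \<le> measure lebesgue K"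
      by (rule measure_mono_fmeasurable[OF _ fmeasurableD[OF cap_lmeasurable[OF K card]] lmeasurable_compact[OF compact]]) auto
    finally show ?thesis .
  qed
  have s': "0 < s \<delta>" "s \<delta> < 1" "s \<delta> \<le> 1/2" if "0 < \<delta>" "\<delta> < \<delta>0" for \<delta> using s(1,2)[OF that] s1 by auto
  note o = origin_body_floating_body[OF _ small s'(1,2) mem_floating_body[OF cap]]
  have body: "origin_body (floating_body K \<delta>)" if \<delta>: "0 < \<delta>" "\<delta> < \<delta>0" for \<delta>
    by (rule o(1)) (use \<delta> in auto)
  have low: "(1 - s \<delta>) * supp K y \<le> supp (floating_body K \<delta>) y" if \<delta>: "0 < \<delta>" "\<delta> < \<delta>0" for \<delta> y
  proof -
    obtain z where z: "z \<in> K" "z \<bullet> y = supp K y" by (rule supp_attained) blast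
    have "(1 - s \<delta>) *\<^sub>R z \<in> floating_body K \<delta>" by (rule o(2)) (use \<delta> z in auto)
    then have "((1 - s \<delta>) *\<^sub>R z) \<bullet> y \<le> supp (floating_body K \<delta>) y" by (rule origin_body.supp_upper[OF body[OF \<delta>]])
    then show ?thesis using z(2) by simp
  qed
  show thesis
  proof (rule that[of B \<delta>0])
    show "0 \<le> B" by (simp add: B_def)
    show "0 < \<delta>0" using C(1) s1(1) by (simp add: \<delta>0_def)
    fix \<delta> :: real and y :: "real ^ 'n" assume \<delta>: "0 < \<delta>" "\<delta> < \<delta>0"
    show "\<delta> < measure lebesgue K" by (rule small[OF \<delta>])
    show "origin_body (floating_body K \<delta>)" by (rule body[OF \<delta>])
    show "supp (floating_body K \<delta>) y \<le> supp K y"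
      by (rule origin_body.supp_le[OF body[OF \<delta>]]) (use floating_body_subset[OF \<delta>(1) small[OF \<delta>]] supp_upper in blast)
    show "supp K y - supp (floating_body K \<delta>) y \<le> B * \<delta> powr (2 / (real CARD('n) + 1)) * supp K y"
      using low[OF \<delta>, of y] by (simp add: s_def \<beta>_def algebra_simps)
    have "(1/2) * supp K y \<le> (1 - s \<delta>) * supp K y"
      using s'(3)[OF \<delta>] supp_nonneg[of y] by (intro mult_right_mono) auto
    then show "supp K y \<le> 2 * supp (floating_body K \<delta>) y" using low[OF \<delta>, of y] by linarith
  qed
qed

end

section \<open>Limit of the support functions and of the polar volumes\<close>

lemma powr_less_root:
  assumes "0 < b" "0 \<le> t" "0 < s" "t < s powr (1 / b)"
  shows "t powr b < (s::real)"
proof -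
  have "t powr b < (s powr (1 / b)) powr b" using assms by (intro powr_less_mono2) auto
  then show ?thesis using assms by (simp add: powr_powr)
qed

text \<open>Density of the affine surface area with respect to the cone measure: the integrand
  divided by the weight 1 / norm (\<open>dual_point P y\<close>) of the support measure.\<close>

definition cone_density :: "(real ^ 'n) set \<Rightarrow> real ^ 'n \<Rightarrow> real" where
  "cone_density P y = Lp_affine_integrand (- (real CARD('n) / (real CARD('n) + 2))) P y * norm (dual_point P y)"

context
  fixes K :: "(real ^ 'n) set"
  assumes K: "smooth_body K" and K': "smooth_body (polar_body K)" and card: "2 \<le> CARD('n)"
    and diff: "\<And>x. x \<in> frontier K \<Longrightarrow> \<exists>A. (dual_point K has_derivative A) (at x)"
    and curv: "\<And>x. x \<in> frontier K \<Longrightarrow> 0 < gaussian_curvature K x"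
    and lip: "\<exists>M>0. \<forall>p\<in>frontier K. \<forall>q\<in>frontier K. norm (dual_point K p - dual_point K q) \<le> M * norm (p - q)"
begin

interpretation smooth_body K by (rule K)
interpretation polar: smooth_body "polar_body K" by (rule K')

text \<open>Cap volumes at the touching point x are close to V s^(p+1). Setting this equal to
  \<delta> predicts the relative depth (\<delta> / V)^\<beta>, and the two sharp cap bounds enclose
  the true depth. The rest identifies the constant with the affine integrand of the polar
  body.\<close>

lemma floating_body_supp_limit:
  assumes y: "y \<in> frontier (polar_body K)"
  shows "((\<lambda>\<delta>. floating_const CARD('n) * ((1 - supp (floating_body K \<delta>) y) / \<delta> powr (2 / (real CARD('n) + 1)))) \<longlongrightarrow>
    Lp_affine_integrand (- (real CARD('n) / (real CARD('n) + 2))) (polar_body K) y * norm (dual_point (polar_body K) y)) (at_right 0)"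
proof -
  define n where "n = real CARD('n)"
  define \<beta> where "\<beta> = 2 / (n + 1)"
  define p where "p = real (CARD('n) - 1) / 2"
  have n: "2 \<le> n" using card by (simp add: n_def)
  have p1: "p + 1 = (n + 1) / 2" using card by (simp add: p_def n_def of_nat_diff field_simps)
  have \<beta>: "0 < \<beta>" "\<beta> * (p + 1) = 1" using n by (simp_all add: \<beta>_def p1)
  define x where "x = dual_point (polar_body K) y"
  have y0: "y \<noteq> 0" by (rule polar.frontier_nonzero[OF y])
  have x: "x \<in> frontier K" using polar.dual_point_frontier[OF y0] by (simp add: x_def bipolar)
  have x0: "x \<noteq> 0" by (rule frontier_nonzero[OF x])
  have yx: "y \<bullet> x = 1" using polar.inner_dual_point[OF y] by (simp add: x_def)
  have hy: "supp K y = 1" using y polar.frontier_iff[of y] by (simp add: bipolar)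
  have "smooth_body (polar_body (polar_body K))" using K by (simp add: bipolar)
  from dual_point_polar[OF K' this y0] have Kx: "dual_point K x = y" by (simp add: bipolar x_def hy)
  obtain A where A: "(dual_point K has_derivative A) (at x)" using diff[OF x] by blast
  have pos: "0 < A v \<bullet> v + (dual_point K x \<bullet> v)\<^sup>2" if "v \<noteq> 0" for v
    by (rule positive_curvature_hessian_pos[OF K x A curv[OF x] that])
  define q where "q = det (matrix (\<lambda>v. A v + (dual_point K x \<bullet> v) *\<^sub>R dual_point K x))"
  have q: "0 < q" unfolding q_def by (rule boundary_frame[OF K K' card x A pos])
  define V where "V = cap_const CARD('n) * 2 powr p / sqrt q"
  have V: "0 < V" using q cap_const_pos by (simp add: V_def)
  obtain M where M: "0 < M" "\<And>p q. p \<in> frontier K \<Longrightarrow> q \<in> frontier K \<Longrightarrow> norm (dual_point K p - dual_point K q) \<le> M * norm (p - q)"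
    using lip by blast
  obtain \<delta>0 where U: "0 < \<delta>0" "\<And>\<delta>. 0 < \<delta> \<Longrightarrow> \<delta> < \<delta>0 \<Longrightarrow> \<delta> < measure lebesgue K"
    "\<And>\<delta>. 0 < \<delta> \<Longrightarrow> \<delta> < \<delta>0 \<Longrightarrow> origin_body (floating_body K \<delta>)"
  proof (rule floating_body_uniform[OF K card M])
    fix B \<delta>0 assume "0 < \<delta>0" "\<And>\<delta>. 0 < \<delta> \<Longrightarrow> \<delta> < \<delta>0 \<Longrightarrow> \<delta> < measure lebesgue K"
      "\<And>\<delta>. 0 < \<delta> \<Longrightarrow> \<delta> < \<delta>0 \<Longrightarrow> origin_body (floating_body K \<delta>)"
    then show thesis by (rule that)
  qed
  have lim: "((\<lambda>\<delta>. (1 - supp (floating_body K \<delta>) y) / \<delta> powr \<beta>) \<longlongrightarrow> V powr (- \<beta>)) (at_right 0)"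
  proof (rule tendsto_powr_sandwich[OF V])
    fix c assume c: "V < c"
    then have c0: "0 < c" using V by linarith
    \<comment> \<open>Puts (1 + \<eta>) V halfway between V and c, so the cap of relative height
      (\<delta> / c)^\<beta> has volume below \<delta>.\<close>
    define \<eta> where "\<eta> = (c / V - 1) / 2"
    have e: "(1 + \<eta>) * V = (V + c) / 2" using V by (simp add: \<eta>_def field_simps)
    have "1 < c / V" using c V by (simp add: pos_less_divide_eq)
    then have \<eta>: "0 < \<eta>" "(1 + \<eta>) * V < c" unfolding e using c by (simp_all add: \<eta>_def)
    have "\<exists>s0>0. \<forall>s. 0 < s \<and> s < s0 \<longrightarrow> measure lebesgue (K \<inter> {z. 1 - s \<le> y \<bullet> z}) \<le> (1 + \<eta>) * V * s powr (p + 1)"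
      by (rule cap_volume_sharp_upper[OF K K' card x A pos \<eta>(1), folded q_def p_def, folded V_def, unfolded Kx])
    then obtain s0 where s0: "0 < s0" "\<forall>s. 0 < s \<and> s < s0 \<longrightarrow>
        measure lebesgue (K \<inter> {z. 1 - s \<le> y \<bullet> z}) \<le> (1 + \<eta>) * V * s powr (p + 1)" by (elim exE conjE)
    show "\<forall>\<^sub>F \<delta> in at_right 0. c powr - \<beta> \<le> (1 - supp (floating_body K \<delta>) y) / \<delta> powr \<beta>"
    proof (rule eventually_at_rightI[of 0 "min \<delta>0 (c * s0 powr (1 / \<beta>))"])
      show "0 < min \<delta>0 (c * s0 powr (1 / \<beta>))" using U(1) c0 s0(1) by simp
      fix \<delta> assume "\<delta> \<in> {0<..<min \<delta>0 (c * s0 powr (1 / \<beta>))}"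
      then have \<delta>: "0 < \<delta>" "\<delta> < \<delta>0" "\<delta> / c < s0 powr (1 / \<beta>)" using c0 by (auto simp: pos_divide_less_eq mult.commute)
      define s where "s = (\<delta> / c) powr \<beta>"
      have s: "0 < s" "s < s0" using \<delta> c0 \<beta>(1) s0(1) by (auto simp: s_def intro!: powr_less_root)
      have sp: "s powr (p + 1) = \<delta> / c" unfolding s_def powr_powr \<beta>(2) using \<delta>(1) c0 by simp
      have "(1 + \<eta>) * V * (\<delta> / c) < c * (\<delta> / c)" using \<eta>(2) \<delta>(1) c0 by (intro mult_strict_right_mono) auto
      then have small: "measure lebesgue (K \<inter> {z. 1 - s \<le> y \<bullet> z}) < \<delta>" using s0(2)[rule_format, OF conjI[OF s]] c0 unfolding sp by simp
      have "supp (floating_body K \<delta>) y \<le> 1 - s"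
        using floating_body_below[OF K card \<delta>(1) U(2)[OF \<delta>(1,2)] y0 small]
        by (intro origin_body.supp_le[OF U(3)[OF \<delta>(1,2)]]) (simp add: inner_commute)
      then have "s / \<delta> powr \<beta> \<le> (1 - supp (floating_body K \<delta>) y) / \<delta> powr \<beta>" by (intro divide_right_mono) auto
      moreover have "s / \<delta> powr \<beta> = c powr - \<beta>" using \<delta>(1) c0 by (simp add: s_def powr_divide powr_minus_divide)
      ultimately show "c powr - \<beta> \<le> (1 - supp (floating_body K \<delta>) y) / \<delta> powr \<beta>" by simp
    qed
  next
    fix c assume c: "0 < c" "c < V"
    define \<eta> where "\<eta> = (1 - c / V) / 2"
    have e: "(1 - \<eta>) * V = (V + c) / 2" using V by (simp add: \<eta>_def field_simps)
    have "c / V < 1" "0 < c / V" using c V by simp_all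
    then have "0 < (1 - c / V) / 2 \<and> (1 - c / V) / 2 < 1 \<and> c < (V + c) / 2" using c(2) by simp
    then have \<eta>: "0 < \<eta>" "\<eta> < 1" "c < (1 - \<eta>) * V" unfolding e by (simp_all only: \<eta>_def)
    have "\<exists>s0>0. \<forall>s u. 0 < s \<and> s < s0 \<and> u \<noteq> 0 \<longrightarrow>
        (1 - \<eta>) * V * s powr (p + 1) \<le> measure lebesgue (K \<inter> {z. u \<bullet> ((1 - s) *\<^sub>R x) \<le> u \<bullet> z})"
      by (rule cap_volume_sharp_lower[OF K K' card x A pos \<eta>(1,2), folded q_def p_def, folded V_def])
    then obtain s0 where s0: "0 < s0" "\<forall>s u. 0 < s \<and> s < s0 \<and> u \<noteq> 0 \<longrightarrow>
        (1 - \<eta>) * V * s powr (p + 1) \<le> measure lebesgue (K \<inter> {z. u \<bullet> ((1 - s) *\<^sub>R x) \<le> u \<bullet> z})" by (elim exE conjE)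
    show "\<forall>\<^sub>F \<delta> in at_right 0. (1 - supp (floating_body K \<delta>) y) / \<delta> powr \<beta> \<le> c powr - \<beta>"
    proof (rule eventually_at_rightI[of 0 "min \<delta>0 (c * s0 powr (1 / \<beta>))"])
      show "0 < min \<delta>0 (c * s0 powr (1 / \<beta>))" using U(1) c s0(1) by simp
      fix \<delta> assume "\<delta> \<in> {0<..<min \<delta>0 (c * s0 powr (1 / \<beta>))}"
      then have \<delta>: "0 < \<delta>" "\<delta> < \<delta>0" "\<delta> / c < s0 powr (1 / \<beta>)" using c by (auto simp: pos_divide_less_eq mult.commute)
      define s where "s = (\<delta> / c) powr \<beta>"
      have s: "0 < s" "s < s0" using \<delta> c \<beta>(1) s0(1) by (auto simp: s_def intro!: powr_less_root)
      have sp: "s powr (p + 1) = \<delta> / c" unfolding s_def powr_powr \<beta>(2) using \<delta>(1) c by simp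
      have "c * (\<delta> / c) < (1 - \<eta>) * V * (\<delta> / c)" using \<eta>(3) \<delta>(1) c by (intro mult_strict_right_mono) auto
      then have big: "\<delta> < (1 - \<eta>) * V * s powr (p + 1)" using c unfolding sp by simp
      have "(1 - s) *\<^sub>R x \<in> floating_body K \<delta>"
        by (rule mem_floating_body[OF K card]) (use big s s0(2) in force)
      then have "((1 - s) *\<^sub>R x) \<bullet> y \<le> supp (floating_body K \<delta>) y" by (rule origin_body.supp_upper[OF U(3)[OF \<delta>(1,2)]])
      then have "1 - s \<le> supp (floating_body K \<delta>) y" using yx by (simp add: inner_commute)
      then have "(1 - supp (floating_body K \<delta>) y) / \<delta> powr \<beta> \<le> s / \<delta> powr \<beta>" by (intro divide_right_mono) auto
      moreover have "s / \<delta> powr \<beta> = c powr - \<beta>" using \<delta>(1) c by (simp add: s_def powr_divide powr_minus_divide)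
      ultimately show "(1 - supp (floating_body K \<delta>) y) / \<delta> powr \<beta> \<le> c powr - \<beta>" by simp
    qed
  qed
  \<comment> \<open>The quantity whose power enters \<open>floating_const\<close>; as p + 1 = (n +
    1) / 2, the cap constant is 2 W.\<close>
  define W where "W = unit_ball_vol (real (CARD('n) - 1)) / (n + 1)"
  have W: "0 < W" using n by (simp add: W_def)
  have const: "floating_const CARD('n) = 2 * W powr \<beta>" by (simp add: floating_const_def W_def \<beta>_def n_def)
  have "cap_const CARD('n) = unit_ball_vol (real (CARD('n) - 1)) / (p + 1)" by (simp only: cap_const_def p_def)
  then have "cap_const CARD('n) = 2 * W" unfolding p1 W_def using n by (simp add: field_simps)
  then have Veq: "V = W * (2 powr (p + 1) * q powr (- (1/2)))"
    using q by (simp add: V_def powr_add powr_minus_divide powr_half_sqrt)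
  \<comment> \<open>The exponents cancel: the power of 2 in V becomes 1/2, which the factor 2 of
    \<open>floating_const\<close> compensates, W disappears, and only the root of q is left.\<close>
  have "(p + 1) * - \<beta> = - 1" using \<beta>(2) by (simp add: mult.commute)
  then have "V powr - \<beta> = W powr - \<beta> * (2 powr - 1 * q powr (\<beta> / 2))"
    unfolding Veq powr_mult powr_powr by simp
  moreover have "W powr \<beta> * W powr - \<beta> = 1" using W by (simp add: powr_add[symmetric])
  moreover have "2 * W powr \<beta> * (W powr - \<beta> * (2 powr - 1 * q powr (\<beta> / 2)))
      = (W powr \<beta> * W powr - \<beta>) * (2 * 2 powr - 1) * q powr (\<beta> / 2)" by (simp only: mult_ac)
  moreover have "2 * 2 powr - 1 = (1::real)" by (simp add: powr_minus)
  moreover have "\<beta> / 2 = 1 / (n + 1)" using n by (simp add: \<beta>_def field_simps)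
  ultimately have c1: "floating_const CARD('n) * V powr - \<beta> = q powr (1 / (n + 1))"
    unfolding const by (simp only: mult_1)
  define \<kappa> where "\<kappa> = gaussian_curvature (polar_body K) y"
  have "q * (norm x ^ (CARD('n) + 1) * \<kappa>) = 1"
    using curvature_polar[OF K K' x A curv[OF x]] by (simp add: q_def \<kappa>_def Kx)
  then have "\<kappa> = inverse (q * norm x ^ (CARD('n) + 1))" using q x0 by (simp add: field_simps)
  also have "norm x ^ (CARD('n) + 1) = norm x powr (n + 1)"
    using x0 powr_realpow[of "norm x" "CARD('n) + 1"] by (simp add: n_def add.commute)
  finally have \<kappa>: "\<kappa> = (q * norm x powr (n + 1)) powr - 1" using q x0 by (simp add: powr_minus)
  \<comment> \<open>Duality gives q |x|^(n+1) \<kappa> = 1, where |x| is the inverse of the distance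
    of the tangent hyperplane of the polar body at y from the origin.\<close>
  have "\<kappa> powr (- 1 / (n + 1)) = q powr (1 / (n + 1)) * norm x"
  proof -
    have e: "(n + 1) * (- 1 * (- 1 / (n + 1))) = 1" "(n + 1) * - 1 * (- 1 / (n + 1)) = 1" "- 1 * (- 1 / (n + 1)) = 1 / (n + 1)"
      using n by (simp_all add: field_simps)
    show ?thesis unfolding \<kappa> powr_powr powr_mult unfolding e using x0 by simp
  qed
  moreover have "y \<bullet> outer_normal (polar_body K) y = 1 / norm x"
    using polar.outer_normal_eq[OF y] yx by (simp add: x_def)
  \<comment> \<open>For the parameter -n/(n+2) the curvature exponent is -1/(n+1) and that of y
    \<bullet> N is -2. Multiplying the integrand by |x| therefore leaves the root of q
    alone.\<close>
  moreover have "- (n / (n + 2)) / (n + - (n / (n + 2))) = - 1 / (n + 1)"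
    "n * (- (n / (n + 2)) - 1) / (n + - (n / (n + 2))) = - 2" using n by (simp_all add: divide_simps; simp add: algebra_simps)+
  moreover have "(1 / norm x) powr - 2 = (norm x)\<^sup>2" using x0 by (simp add: powr_minus_divide powr_divide)
  ultimately have "Lp_affine_integrand (- (n / (n + 2))) (polar_body K) y = q powr (1 / (n + 1)) * norm x / (norm x)\<^sup>2"
    by (simp add: Lp_affine_integrand_def Let_def n_def[symmetric] \<kappa>_def[symmetric])
  then have "Lp_affine_integrand (- (n / (n + 2))) (polar_body K) y * norm (dual_point (polar_body K) y) = floating_const CARD('n) * V powr - \<beta>"
    unfolding c1 x_def[symmetric] using x0 by (simp add: power2_eq_square)
  then show ?thesis using tendsto_mult_left[OF lim, of "floating_const CARD('n)"] by (simp add: \<beta>_def n_def)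
qed

text \<open>Dominated convergence is a statement about sequences, hence the form with arbitrary
  sequences below \<delta>0. Measurability of the density is part of the conclusion, because the
  curvature rests on choices: it is obtained from the density being a pointwise limit of continuous
  functions on the frontier. Integrability likewise comes from the majorant.\<close>

lemma floating_volume_limit:
  "\<exists>\<delta>0>0. \<forall>S. (\<forall>i. 0 < S i) \<longrightarrow> (\<forall>i. S i < \<delta>0) \<longrightarrow> S \<longlonglongrightarrow> 0 \<longrightarrow>
      (\<lambda>y. indicator (frontier (polar_body K)) y * cone_density (polar_body K) y) \<in> borel_measurable borel \<and>
      integrable lborel (\<lambda>y. indicator (polar_body K - {0}) y * (real CARD('n) * cone_density (polar_body K) (radial (polar_body K) y))) \<and>
      (\<lambda>i. floating_const CARD('n) * ((measure lebesgue (polar_body (floating_body K (S i))) - measure lebesgue (polar_body K))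
         / S i powr (2 / (real CARD('n) + 1)))) \<longlonglongrightarrow>
      (LINT y|lborel. indicator (polar_body K - {0}) y * (real CARD('n) * cone_density (polar_body K) (radial (polar_body K) y)))"
proof -
  let ?P = "polar_body K"
  let ?n = "CARD('n)"
  let ?c = "floating_const ?n"
  let ?h = "supp K"
  define \<beta> where "\<beta> = 2 / (real ?n + 1)"
  have \<beta>: "0 < \<beta>" by (simp add: \<beta>_def)
  have *: "0 < 2 * (w / (real ?n + 1)) powr b" if "0 < w" for w b :: real using that by simp
  have c0: "0 < ?c" unfolding floating_const_def by (rule *, rule unit_ball_vol_pos) simp
  obtain M where M: "0 < M" "\<And>p q. p \<in> frontier K \<Longrightarrow> q \<in> frontier K \<Longrightarrow> norm (dual_point K p - dual_point K q) \<le> M * norm (p - q)"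
    using lip by blast
  obtain B \<delta>0 where U: "0 \<le> B" "0 < \<delta>0" 
    "\<And>\<delta>. 0 < \<delta> \<Longrightarrow> \<delta> < \<delta>0 \<Longrightarrow> origin_body (floating_body K \<delta>)"
    "\<And>\<delta> y. 0 < \<delta> \<Longrightarrow> \<delta> < \<delta>0 \<Longrightarrow> supp (floating_body K \<delta>) y \<le> ?h y"
    "\<And>\<delta> y. 0 < \<delta> \<Longrightarrow> \<delta> < \<delta>0 \<Longrightarrow> ?h y - supp (floating_body K \<delta>) y \<le> B * \<delta> powr \<beta> * ?h y"
    "\<And>\<delta> y. 0 < \<delta> \<Longrightarrow> \<delta> < \<delta>0 \<Longrightarrow> ?h y \<le> 2 * supp (floating_body K \<delta>) y"
    unfolding \<beta>_def by (rule floating_body_uniform[OF K card M]) blast+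
  have hm [measurable]: "?h \<in> borel_measurable borel" by (rule borel_measurable_continuous_onI[OF continuous_on_supp])
  have P_eq: "?P = {y. ?h y \<le> 1}" using mem_polar_iff by auto
  have cP: "compact ?P" by (rule polar.compact)
  then have Pb [measurable]: "?P \<in> sets borel" by (intro borel_closed compact_imp_closed)
  have fb [measurable]: "frontier ?P \<in> sets borel" by (intro borel_closed compact_imp_closed polar.compact_frontier)
  show ?thesis
  proof (rule exI[of _ \<delta>0], rule conjI[OF U(2)], intro allI impI)
    fix S :: "nat \<Rightarrow> real" assume "\<forall>i. 0 < S i" "\<forall>i. S i < \<delta>0" "S \<longlonglongrightarrow> 0"
    then have S: "\<And>i. 0 < S i" "\<And>i. S i < \<delta>0" "S \<longlonglongrightarrow> 0" by auto
    define g where "g i = supp (floating_body K (S i))" for i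
    define D where "D i y = (1 - g i y / ?h y) / S i powr \<beta>" for i y
    define F where "F y = indicator (?P - {0}) y * (real ?n * cone_density ?P (radial ?P y))" for y
    define G where "G i y = ?c * (indicator (?P - {0}) y * (((?h y / g i y) ^ ?n - 1) / S i powr \<beta>))" for i y
    note body = U(3)[OF S(1,2)]
    have gm [measurable]: "g i \<in> borel_measurable borel" for i
      unfolding g_def by (rule borel_measurable_continuous_onI[OF origin_body.continuous_on_supp[OF body]])
    have Gm [measurable]: "G i \<in> borel_measurable borel" for i unfolding G_def by measurable
    have gscale: "g i (c *\<^sub>R y) = c * g i y" if "0 < c" for i c y
      unfolding g_def using that by (intro origin_body.supp_scale[OF body]) simp
    have gpos: "0 < g i y" if "y \<noteq> 0" for i y unfolding g_def by (rule origin_body.supp_pos[OF body that])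
    have hpos: "0 < ?h y" if "y \<noteq> 0" for y by (rule supp_pos[OF that])
    have Slim: "(\<lambda>i. S i powr \<beta>) \<longlonglongrightarrow> 0"
      using tendsto_powr'[OF S(3) tendsto_const[of \<beta>]] \<beta> S(1) by (simp add: less_imp_le)
    have Spos: "0 < S i powr \<beta>" for i using S(1)[of i] by simp
    have S_at: "filterlim S (at_right 0) sequentially"
      using S by (intro tendsto_imp_filterlim_at_right) auto
    have front: "(\<lambda>i. ?c * D i y) \<longlonglongrightarrow> cone_density ?P y" if y: "y \<in> frontier ?P" for y
    proof -
      have "?h y = 1" using y polar.frontier_iff[of y] by (simp add: bipolar)
      then show ?thesis
        using filterlim_compose[OF floating_body_supp_limit[OF y] S_at]
        by (simp add: D_def g_def \<beta>_def cone_density_def)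
    qed
    have "(\<lambda>y. indicator (frontier ?P) y * cone_density ?P y) \<in> borel_measurable borel"
    proof (rule borel_measurable_LIMSEQ_real)
      show "(\<lambda>y. indicator (frontier ?P) y * (?c * D i y)) \<in> borel_measurable borel" for i unfolding D_def by measurable
      show "(\<lambda>i. indicator (frontier ?P) y * (?c * D i y)) \<longlonglongrightarrow> indicator (frontier ?P) y * cone_density ?P y" for y
        by (cases "y \<in> frontier ?P") (simp_all add: front)
    qed
    \<comment> \<open>\<open>D i\<close> is homogeneous of degree 0, so the limit on the frontier
      carries over to all nonzero points by radial projection.\<close>
    moreover have conv: "(\<lambda>i. ?c * D i y) \<longlonglongrightarrow> cone_density ?P (radial ?P y)" if y: "y \<noteq> 0" for y
    proof -
      have r: "radial ?P y = (1 / ?h y) *\<^sub>R y" by (simp add: radial_def bipolar)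
      have "D i (radial ?P y) = D i y" for i
        unfolding D_def r using hpos[OF y] gpos[OF y, of i] by (simp add: gscale supp_scale)
      then show ?thesis using front[OF polar.radial_in_frontier[OF y]] by simp
    qed
    \<comment> \<open>With u = h / g the geometric sum factors u^n - 1 through u - 1, which is
      \<open>D i y\<close> times the power of \<open>S i\<close> times u.\<close>
    have G_eq: "G i y = indicator (?P - {0}) y * ((?c * D i y) * (?h y / g i y) * (\<Sum>k<?n. (?h y / g i y) ^ k))" for i y
    proof (cases "y = 0")
      case False
      define u where "u = ?h y / g i y"
      have "u - 1 = D i y * S i powr \<beta> * u"
        using hpos[OF False] gpos[OF False, of i] Spos[of i] by (simp add: D_def u_def field_simps)
      then have "(u ^ ?n - 1) / S i powr \<beta> = D i y * u * (\<Sum>k<?n. u ^ k)"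
        using Spos[of i] by (simp add: power_diff_1_eq)
      then show ?thesis by (simp add: G_def u_def)
    qed (simp add: G_def)
    have lim: "(\<lambda>i. G i y) \<longlonglongrightarrow> F y" for y
    proof (cases "y = 0")
      case False
      have "1 - (1 / ?c) * ((?c * D i y) * S i powr \<beta>) = g i y / ?h y" for i using Spos[of i] c0 by (simp add: D_def)
      moreover have "(\<lambda>i. 1 - (1 / ?c) * ((?c * D i y) * S i powr \<beta>)) \<longlonglongrightarrow> 1 - (1 / ?c) * (cone_density ?P (radial ?P y) * 0)"
        by (intro tendsto_intros conv[OF False] Slim)
      ultimately have "(\<lambda>i. g i y / ?h y) \<longlonglongrightarrow> 1" by simp
      from tendsto_inverse[OF this] have u: "(\<lambda>i. ?h y / g i y) \<longlonglongrightarrow> 1" by simp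
      have "(\<lambda>i. indicator (?P - {0}) y * ((?c * D i y) * (?h y / g i y) * (\<Sum>k<?n. (?h y / g i y) ^ k)))
          \<longlonglongrightarrow> indicator (?P - {0}) y * (cone_density ?P (radial ?P y) * 1 * (\<Sum>k<?n. 1 ^ k))"
        by (intro tendsto_intros conv[OF False] u)
      then show ?thesis unfolding G_eq F_def by (simp add: mult.commute)
    qed (simp add: G_def F_def)
    \<comment> \<open>The majorant: the relative depth \<open>D i\<close> is at most B, the ratio h
      / g at most 2, and the polar body has finite volume.\<close>
    define w where "w y = indicator ?P y * (?c * B * 2 * (\<Sum>k<?n. 2 ^ k))" for y :: "real ^ 'n"
    have w: "integrable lborel w"
      unfolding w_def using emeasure_compact_finite[OF cP] by (intro integrable_mult_left integrable_real_indicator) auto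
    have wb: "0 \<le> ?c * B * 2 * (\<Sum>k<?n. 2 ^ k)" using c0 U(1) by (intro mult_nonneg_nonneg sum_nonneg) auto
    have bd: "norm (G i y) \<le> w y" for i y
    proof (cases "y = 0")
      case False
      define u where "u = ?h y / g i y"
      have u: "0 \<le> u" "u \<le> 2"
        using hpos[OF False] gpos[OF False, of i] U(6)[OF S(1)[of i] S(2)[of i], of y] by (auto simp: u_def g_def[symmetric] pos_divide_le_eq)
      have "0 \<le> D i y" using U(4)[OF S(1)[of i] S(2)[of i], of y] hpos[OF False] Spos[of i]
        by (simp add: D_def g_def[symmetric] pos_divide_le_eq)
      moreover have "D i y \<le> B"
      proof -
        have "1 - g i y / ?h y = (?h y - g i y) / ?h y" using hpos[OF False] by (simp add: diff_divide_distrib)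
        also have "\<dots> \<le> B * S i powr \<beta>" using U(5)[OF S(1)[of i] S(2)[of i], of y] hpos[OF False] by (simp add: g_def[symmetric] pos_divide_le_eq)
        finally show ?thesis using Spos[of i] by (simp add: D_def pos_divide_le_eq)
      qed
      ultimately have "\<bar>(?c * D i y) * u * (\<Sum>k<?n. u ^ k)\<bar> \<le> (?c * B) * 2 * (\<Sum>k<?n. 2 ^ k)"
        unfolding abs_mult using c0 u U(1)
        by (intro mult_mono sum_mono power_mono order_trans[OF sum_abs]) (auto intro!: sum_nonneg sum_mono power_mono)
      then show ?thesis unfolding G_eq u_def[symmetric] w_def using False by (cases "y \<in> ?P") simp_all
    next
      case True
      then show ?thesis using mult_nonneg_nonneg[OF _ wb, of "indicator ?P y"] by (simp add: G_def w_def)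
    qed
    have Fm: "F \<in> borel_measurable lborel"
      by (rule borel_measurable_LIMSEQ_real[of lborel G]) (use lim in auto)
    have Gm': "G i \<in> borel_measurable lborel" for i by simp
    have lim': "AE y in lborel. (\<lambda>i. G i y) \<longlonglongrightarrow> F y" and bd': "AE y in lborel. norm (G i y) \<le> w y" for i
      using lim bd by auto
    note dct = integrable_dominated_convergence[OF Fm Gm' w lim' bd'] integral_dominated_convergence[OF Fm Gm' w lim' bd']
    have "integral\<^sup>L lborel (G i) = ?c * ((measure lebesgue (polar_body (floating_body K (S i))) - measure lebesgue ?P) / S i powr \<beta>)" for i
    proof -
      interpret f: origin_body "floating_body K (S i)" by (rule body)
      have Q: "polar_body (floating_body K (S i)) = {y. g i y \<le> 1}" using f.mem_polar_iff by (auto simp: g_def)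
      have "polar_body (floating_body K (S i)) \<in> sets borel"
        using origin_body.compact[OF f.origin_body_polar] by (intro borel_closed compact_imp_closed)
      then have mQ: "measure lebesgue (polar_body (floating_body K (S i))) = measure lborel {y. g i y \<le> 1}" by (simp add: Q)
      have mP: "measure lebesgue ?P = measure lborel {y. ?h y \<le> 1}" using Pb by (simp add: P_eq)
      define a where "a y = (indicator (?P - {0}) y * (?h y / g i y) ^ ?n :: real)" for y
      define b where "b y = (indicator (?P - {0}) y * (?h y / ?h y) ^ ?n :: real)" for y
      have 1: "measure lborel {y. g i y \<le> 1} = integral\<^sup>L lborel a"
        using measure_gauge_ball[of "g i" ?h] gscale gpos hpos supp_scale by (simp add: a_def[abs_def] P_eq[symmetric])
      have 2: "measure lborel {y. ?h y \<le> 1} = integral\<^sup>L lborel b"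
        using measure_gauge_ball[of ?h ?h] hpos supp_scale by (simp add: b_def[abs_def] P_eq[symmetric])
      have [measurable]: "a \<in> borel_measurable lborel" "b \<in> borel_measurable lborel" unfolding a_def b_def by measurable
      have ind: "integrable lborel (indicator ?P :: _ \<Rightarrow> real)"
        using emeasure_compact_finite[OF cP] by (intro integrable_real_indicator) auto
      have int: "integrable lborel a" "integrable lborel b"
      proof -
        have "norm (a y) \<le> norm (indicator ?P y * 2 ^ ?n :: real)" for y
        proof (cases "y = 0")
          case False
          have "?h y / g i y \<le> 2" "0 \<le> ?h y / g i y"
            using hpos[OF False] gpos[OF False, of i] U(6)[OF S(1)[of i] S(2)[of i], of y] by (auto simp: g_def[symmetric] pos_divide_le_eq)
          then show ?thesis using power_mono[of "?h y / g i y" 2 ?n] by (auto simp: a_def indicator_def)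
        qed (simp add: a_def)
        then show "integrable lborel a" using ind
          by (intro Bochner_Integration.integrable_bound[OF integrable_mult_left[OF ind, of "2 ^ ?n"]]) auto
        have "norm (b y) \<le> norm (indicator ?P y :: real)" for y
          using hpos[of y] by (cases "y = 0") (auto simp: b_def indicator_def)
        then show "integrable lborel b" by (intro Bochner_Integration.integrable_bound[OF ind]) auto
      qed
      have "G i y = ?c / S i powr \<beta> * (a y - b y)" for y
        using hpos[of y] by (cases "y \<in> ?P - {0}") (auto simp: G_def a_def b_def)
      then have "G i = (\<lambda>y. ?c / S i powr \<beta> * (a y - b y))" by (rule ext)
      then have "integral\<^sup>L lborel (G i) = ?c / S i powr \<beta> * (integral\<^sup>L lborel a - integral\<^sup>L lborel b)"
        by (simp only: integral_mult_right_zero Bochner_Integration.integral_diff[OF int])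
      then show ?thesis unfolding mQ mP 1 2 by simp
    qed
    then have "(\<lambda>i. ?c * ((measure lebesgue (polar_body (floating_body K (S i))) - measure lebesgue ?P) / S i powr \<beta>)) \<longlonglongrightarrow> integral\<^sup>L lborel F"
      using dct(2) by simp
    ultimately show "(\<lambda>y. indicator (frontier ?P) y * cone_density ?P y) \<in> borel_measurable borel \<and>
      integrable lborel (\<lambda>y. indicator (?P - {0}) y * (real ?n * cone_density ?P (radial ?P y))) \<and>
      (\<lambda>i. ?c * ((measure lebesgue (polar_body (floating_body K (S i))) - measure lebesgue ?P) / S i powr (2 / (real ?n + 1)))) \<longlonglongrightarrow>
      (LINT y|lborel. indicator (?P - {0}) y * (real ?n * cone_density ?P (radial ?P y)))"
      using dct(1) by (simp add: F_def[abs_def] \<beta>_def)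
  qed
qed

text \<open>The weight of the support measure cancels the factor norm (\<open>dual_point\<close>) of
  \<open>cone_density\<close>. Equality with the cone measure then turns the surface integral into a
  volume integral of the density along rays.\<close>

lemma surface_measure_cone_density:
  assumes m: "(\<lambda>y. indicator (frontier (polar_body K)) y * cone_density (polar_body K) y) \<in> borel_measurable borel"
  defines "I \<equiv> Lp_affine_integrand (- (real CARD('n) / (real CARD('n) + 2))) (polar_body K)"
    and "F \<equiv> \<lambda>y. indicator (polar_body K - {0}) y * (real CARD('n) * cone_density (polar_body K) (radial (polar_body K) y))"
  shows "integrable (surface_measure (polar_body K)) I \<longleftrightarrow> integrable lborel F"
    and "integral\<^sup>L (surface_measure (polar_body K)) I = integral\<^sup>L lborel F"
proof -
  let ?P = "polar_body K"
  let ?H = "hausdorff_measure (CARD('n) - 1) :: (real ^ 'n) measure"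
  define f where "f y = indicator (frontier ?P) y * cone_density ?P y" for y
  define \<rho> where "\<rho> y = (indicator (frontier ?P) y * (1 / norm (dual_point ?P y)) :: real)" for y
  define \<tau> where "\<tau> y = (real CARD('n) * indicator (?P - {0}) y :: real)" for y :: "real ^ 'n"
  have fb [measurable]: "frontier ?P \<in> sets borel" by (intro borel_closed compact_imp_closed polar.compact_frontier)
  have Pb [measurable]: "?P \<in> sets borel" by (intro borel_closed compact_imp_closed polar.compact)
  have [measurable]: "dual_point ?P \<in> borel_measurable borel" by (rule polar.measurable_dual_point)
  have rm: "radial ?P \<in> borel_measurable borel" by (rule polar.measurable_radial)
  have fm: "f \<in> borel_measurable borel" using m by (simp add: f_def[abs_def])
  have fH: "f \<in> borel_measurable ?H" using fm by (simp cong: measurable_cong_sets)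
  have \<rho>m: "\<rho> \<in> borel_measurable borel" unfolding \<rho>_def by measurable
  have \<rho>H: "\<rho> \<in> borel_measurable ?H" using \<rho>m by (simp cong: measurable_cong_sets)
  have \<tau>m: "\<tau> \<in> borel_measurable lborel" unfolding \<tau>_def by measurable
  have "ennreal (\<rho> y) = indicator (frontier ?P) y * ennreal (1 / norm (dual_point ?P y))" for y
    by (simp add: \<rho>_def indicator_def)
  then have "density ?H (\<lambda>y. ennreal (\<rho> y)) = support_measure ?P" by (simp add: support_measure_def)
  also have "\<dots> = cone_measure ?P" by (rule support_measure_eq_cone_measure[OF K' card])
  also have "\<dots> = distr (density lborel (\<lambda>y. ennreal (\<tau> y))) borel (radial ?P)"
  proof -
    have "ennreal (\<tau> y) = ennreal (real CARD('n)) * indicator (?P - {0}) y" for y by (simp add: \<tau>_def indicator_def)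
    then show ?thesis by (simp add: cone_measure_def)
  qed
  finally have eq: "density ?H (\<lambda>y. ennreal (\<rho> y)) = distr (density lborel (\<lambda>y. ennreal (\<tau> y))) borel (radial ?P)" .
  have surf: "surface_measure ?P = restrict_space ?H (frontier ?P)" by (simp add: surface_measure_def)
  have 1: "indicator (frontier ?P) y *\<^sub>R I y = \<rho> y *\<^sub>R f y" for y
    using polar.dual_point_nonzero[of y] polar.frontier_nonzero[of y]
    by (auto simp: I_def \<rho>_def f_def cone_density_def indicator_def)
  have 2: "\<tau> y *\<^sub>R f (radial ?P y) = F y" for y
    using polar.radial_in_frontier[of y] by (auto simp: \<tau>_def f_def F_def indicator_def)
  have rd: "radial ?P \<in> measurable (density lborel (\<lambda>y. ennreal (\<tau> y))) borel" using rm by simp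
  have frm: "(\<lambda>y. f (radial ?P y)) \<in> borel_measurable lborel" using measurable_compose[OF rm fm] by simp
  have Om: "frontier ?P \<inter> space ?H \<in> sets ?H" by simp
  have pos: "AE y in ?H. 0 \<le> \<rho> y" "AE y in lborel. 0 \<le> \<tau> y" by (simp_all add: \<rho>_def \<tau>_def)
  have "integrable (surface_measure ?P) I \<longleftrightarrow> integrable ?H (\<lambda>y. \<rho> y *\<^sub>R f y)"
    unfolding surf integrable_restrict_space[OF Om] 1 ..
  also have "\<dots> \<longleftrightarrow> integrable (density ?H (\<lambda>y. ennreal (\<rho> y))) f"
    by (rule integrable_density[OF fH \<rho>H pos(1), symmetric])
  also have "\<dots> \<longleftrightarrow> integrable (density lborel (\<lambda>y. ennreal (\<tau> y))) (\<lambda>y. f (radial ?P y))"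
    unfolding eq by (rule integrable_distr_eq[OF rd fm])
  also have "\<dots> \<longleftrightarrow> integrable lborel F"
    unfolding integrable_density[OF frm \<tau>m pos(2)] 2 ..
  finally show "integrable (surface_measure ?P) I \<longleftrightarrow> integrable lborel F" .
  have "integral\<^sup>L (surface_measure ?P) I = integral\<^sup>L ?H (\<lambda>y. \<rho> y *\<^sub>R f y)"
    unfolding surf integral_restrict_space[OF Om] 1 ..
  also have "\<dots> = integral\<^sup>L (density ?H (\<lambda>y. ennreal (\<rho> y))) f"
    by (rule integral_density[OF fH \<rho>H pos(1), symmetric])
  also have "\<dots> = integral\<^sup>L (density lborel (\<lambda>y. ennreal (\<tau> y))) (\<lambda>y. f (radial ?P y))"
    unfolding eq by (rule integral_distr[OF rd fm])
  also have "\<dots> = integral\<^sup>L lborel F"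
    unfolding integral_density[OF frm \<tau>m pos(2)] 2 ..
  finally show "integral\<^sup>L (surface_measure ?P) I = integral\<^sup>L lborel F" .
qed

end

theorem theorem2p1:
  fixes K :: "(real ^ 'n) set"
  assumes "2 \<le> CARD('n)"
    and "convex_body K"
    and "C2_plus K"
    and "0 \<in> interior K"
  shows "Lp_affine_surface_area_exists
           (- (real CARD('n) / (real CARD('n) + 2))) (polar_body K) \<and>
         ((\<lambda>\<delta>. floating_const CARD('n) *
              ((measure lebesgue (polar_body (floating_body K \<delta>)) -
                measure lebesgue (polar_body K)) /
               \<delta> powr (2 / (real CARD('n) + 1))))
            \<longlongrightarrow> Lp_affine_surface_area
                  (- (real CARD('n) / (real CARD('n) + 2))) (polar_body K)) (at_right 0)"
proof -
  have O: "origin_body K" using assms(2,4) by (simp add: origin_body_def convex_body_def)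
  have C2: "C2_boundary K" and curv: "\<And>x. x \<in> frontier K \<Longrightarrow> 0 < gaussian_curvature K x"
    using assms(3) by (auto simp: C2_plus_def)
  have K: "smooth_body K" by (rule C2_boundary_smooth_body[OF O C2])
  have diff: "\<exists>A. (dual_point K has_derivative A) (at x)" if "x \<in> frontier K" for x
    by (rule C2_boundary_dual_point_differentiable[OF O C2 that]) blast
  have K': "smooth_body (polar_body K)"
    by (rule positive_curvature_polar_smooth[OF K _ curv]) (use diff in \<open>auto simp: differentiable_def\<close>)
  have lip: "\<exists>M>0. \<forall>p\<in>frontier K. \<forall>q\<in>frontier K. norm (dual_point K p - dual_point K q) \<le> M * norm (p - q)"
    by (rule C2_boundary_dual_point_lipschitz[OF O C2]) blast
  note ctx = K K' assms(1) diff curv lip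
  have "\<exists>\<delta>0>0. \<forall>S. (\<forall>i. 0 < S i) \<longrightarrow> (\<forall>i. S i < \<delta>0) \<longrightarrow> S \<longlonglongrightarrow> 0 \<longrightarrow>
      (\<lambda>y. indicator (frontier (polar_body K)) y * cone_density (polar_body K) y) \<in> borel_measurable borel \<and>
      integrable lborel (\<lambda>y. indicator (polar_body K - {0}) y * (real CARD('n) * cone_density (polar_body K) (radial (polar_body K) y))) \<and>
      (\<lambda>i. floating_const CARD('n) * ((measure lebesgue (polar_body (floating_body K (S i))) - measure lebesgue (polar_body K))
         / S i powr (2 / (real CARD('n) + 1)))) \<longlonglongrightarrow>
      (LINT y|lborel. indicator (polar_body K - {0}) y * (real CARD('n) * cone_density (polar_body K) (radial (polar_body K) y)))"
    by (rule floating_volume_limit[OF ctx])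
  then obtain \<delta>0 where \<delta>0: "0 < \<delta>0"
    "\<forall>S. (\<forall>i. 0 < S i) \<longrightarrow> (\<forall>i. S i < \<delta>0) \<longrightarrow> S \<longlonglongrightarrow> 0 \<longrightarrow>
      (\<lambda>y. indicator (frontier (polar_body K)) y * cone_density (polar_body K) y) \<in> borel_measurable borel \<and>
      integrable lborel (\<lambda>y. indicator (polar_body K - {0}) y * (real CARD('n) * cone_density (polar_body K) (radial (polar_body K) y))) \<and>
      (\<lambda>i. floating_const CARD('n) * ((measure lebesgue (polar_body (floating_body K (S i))) - measure lebesgue (polar_body K))
         / S i powr (2 / (real CARD('n) + 1)))) \<longlonglongrightarrow>
      (LINT y|lborel. indicator (polar_body K - {0}) y * (real CARD('n) * cone_density (polar_body K) (radial (polar_body K) y)))" by (elim exE conjE)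
  \<comment> \<open>Measurability and integrability do not depend on the sequence; any admissible
    sequence yields them. Starting with the factor 1/2 keeps it strictly below \<delta>0.\<close>
  have "(\<lambda>i. \<delta>0 * inverse (real (Suc (Suc i)))) \<longlonglongrightarrow> \<delta>0 * 0"
    by (intro tendsto_mult tendsto_const LIMSEQ_Suc[OF LIMSEQ_inverse_real_of_nat])
  then have S: "(\<lambda>i. \<delta>0 * inverse (real (Suc (Suc i)))) \<longlonglongrightarrow> 0" by simp
  have "\<delta>0 * inverse (real (Suc (Suc i))) < \<delta>0 * 1" for i
    using \<delta>0(1) by (intro mult_strict_left_mono) (simp_all add: inverse_less_1_iff)
  then have seq: "(\<lambda>y. indicator (frontier (polar_body K)) y * cone_density (polar_body K) y) \<in> borel_measurable borel"
      "integrable lborel (\<lambda>y. indicator (polar_body K - {0}) y * (real CARD('n) * cone_density (polar_body K) (radial (polar_body K) y)))"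
    using \<delta>0(2)[rule_format, OF _ _ S] \<delta>0(1) by simp_all
  let ?F = "\<lambda>y. indicator (polar_body K - {0}) y * (real CARD('n) * cone_density (polar_body K) (radial (polar_body K) y))"
  let ?I = "Lp_affine_integrand (- (real CARD('n) / (real CARD('n) + 2))) (polar_body K)"
  have int: "integrable (surface_measure (polar_body K)) ?I \<longleftrightarrow> integrable lborel ?F"
    by (rule surface_measure_cone_density(1)[OF ctx seq(1)])
  have eq: "integral\<^sup>L (surface_measure (polar_body K)) ?I = integral\<^sup>L lborel ?F"
    by (rule surface_measure_cone_density(2)[OF ctx seq(1)])
  show ?thesis
    unfolding Lp_affine_surface_area_exists_def Lp_affine_surface_area_def int eq
  proof (rule conjI[OF seq(2)], rule tendsto_at_right_sequentially[OF \<delta>0(1)])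
    fix S :: "nat \<Rightarrow> real" assume S: "\<And>i. 0 < S i" "\<And>i. S i < \<delta>0" "S \<longlonglongrightarrow> 0"
    from \<delta>0(2)[rule_format, OF S] show "(\<lambda>i. floating_const CARD('n) * ((measure lebesgue (polar_body (floating_body K (S i))) -
        measure lebesgue (polar_body K)) / S i powr (2 / (real CARD('n) + 1)))) \<longlonglongrightarrow> integral\<^sup>L lborel ?F"
      by blast
  qed
qed

end
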